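(* Let $n\ge3$ and let $\Omega\subset\mathbb{R}^n$ be a domain with $\partial_*\Omega=\partial\Omega$ and with $(n-1)$-Ahlfors regular boundary with constant $C_A$. Further assume, if $\Omega$ is unbounded, that $\mathbb{R}^n\setminus\partial\Omega$ consists of two nonempty connected components. Then there exists $\delta_n>0$ (depending only on $n$) such that for every $\delta\in(0,\delta_n]$ there exists $\epsilon_\delta$ with $0<\epsilon_\delta<\epsilon_2$ (depending only on $\delta$, $n$ and $C_A$) such that if for every compact set $K\subset\mathbb{R}^n$ there exists $R_K>0$ with $\sup_{x\in\partial\Omega\cap K}\|\nu_\Omega\|_*(x,R_K)<\epsilon_\delta$, then $\Omega$ is a $\delta$-chord-arc domain.
   Context: A domain is an open connected set. $\partial_*\Omega$ is the measure-theoretic (essential) boundary and $\nu_\Omega$ the measure-theoretic outer unit normal. A closed set $F$ is $(n-1)$-Ahlfors regular with constant $C_A$ if $C_A^{-1}r^{n-1}\le\mathcal{H}^{n-1}(F\cap B(x,r))\le C_Ar^{n-1}$ for all $x\in F$, $0<r<\operatorname{diam}F$. With $F=\partial\Omega$, $$\|f\|_*(x,r)=\sup_{0<s<r}\Big(\frac{1}{\mathcal{H}^{n-1}(B(x,s)\cap F)}\int_{B(x,s)\cap F}|f-f_{x,s}|^2\,d\mathcal{H}^{n-1}\Big)^{1/2},$$ with $f_{x,s}$ the average of $f$ over $B(x,s)\cap F$. For a closed set $\Sigma$, $x\in\Sigma$, $r>0$: $\Theta(x,r)=\inf_L\frac1rD[\Sigma\cap\overline{B(x,r)},L\cap\overline{B(x,r)}]$,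 the infimum over all $(n-1)$-planes $L\ni x$, with $D[A,B]=\sup_{a\in A}d(a,B)+\sup_{b\in B}d(b,A)$. The constant $\epsilon_2=\epsilon_2(n,C_A)>0$ is a fixed constant for which there is $C_2=C_2(n,C_A)<\infty$ with the following property: if $E$ is a set of locally finite perimeter with Gauss–Green measure $\mu_E$, $\partial E=\operatorname{spt}\mu_E$, $C_A^{-1}r^{n-1}\le|\mu_E|(B(y,r))\le C_Ar^{n-1}$ for all $y\in\partial E$, $0<r<r_0$, and if for some $x\in\partial E$ the $L^2$ mean oscillation of $\nu_E$ on $B(x,r)\cap\partial^*E$ (with respect to $\mathcal{H}^{n-1}$) is at most $\epsilon_2$ for all $r<r_0$, then $\sup_{\rho<r_0/8}\Theta(x,\rho)\le C_2\epsilon_2^{1/(n-1)}$ (where $\Sigma=\partial E$). $\Sigma$ is a $\delta$-Reifenberg flat set if for each compact $K$ there is $R_K>0$ with $\sup_{r\in(0,R_K]}\sup_{x\in K\cap\Sigma}\Theta(x,r)<\delta$. For $\delta$ smaller than a fixed small dimensional constant (such that $\delta$-Reifenberg flat domains are locally NTA), a domain $\Omega$ is a $\delta$-Reifenberg flat domain if $\partial\Omega$ is a $\delta$-Reifenberg flat set and for every compact $K$ there is $R_K>0$ such that for $y\in\partial\Omega\cap K$, $0<r<R_K$ there is a unit vector $\vec n$ such that, for $x\in B(y,r)$, $\langle x-y,\vec n\rangle>\delta r$ implies $x\in\Omega^c$ and $\langle x-y,\vec n\rangle<-\delta r$ implies $x\in\Omega$; if $\Omega$ is unbounded it is further required that $\mathbb{R}^n\setminus\partial\Omega$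 consists of two connected components. A set of locally finite perimeter $\Omega$ is a $\delta$-chord-arc domain if it is a $\delta$-Reifenberg flat domain, $\partial\Omega$ is $(n-1)$-Ahlfors regular, and for each compact $K$ there is $R>0$ with $\sup_{x\in\partial\Omega\cap K}\|\nu_\Omega\|_*(x,R)<\delta$. *)

theory Defs
  imports "HOL-Analysis.Analysis"
begin

section \<open>Hausdorff measure\<close>

text \<open>The library's \<^const>\<open>diameter\<close> is real-valued and meaningless on unbounded sets.\<close>

definition ediam :: "'a::metric_space set \<Rightarrow> ennreal" where
  "ediam A = (SUP x\<in>A. SUP y\<in>A. ennreal (dist x y))"

text \<open>The normalising factor makes the \<open>k\<close>-dimensional measure agree with the area of
  \<open>k\<close>-planes. The empty set is treated separately because \<open>0 ^ 0 = 1\<close>.\<close>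

definition hausdorff_size :: "nat \<Rightarrow> 'a::metric_space set \<Rightarrow> ennreal" where
  "hausdorff_size k C =
     (if C = {} then 0 else ennreal (unit_ball_vol (real k)) * (ediam C / 2) ^ k)"

definition hausdorff_content :: "nat \<Rightarrow> real \<Rightarrow> 'a::metric_space set \<Rightarrow> ennreal" where
  "hausdorff_content k d A =
     (INF C\<in>{C :: nat \<Rightarrow> 'a set. A \<subseteq> (\<Union>i. C i) \<and> (\<forall>i. ediam (C i) \<le> ennreal d)}.
        \<Sum>i. hausdorff_size k (C i))"

definition hausdorff_outer :: "nat \<Rightarrow> 'a::metric_space set \<Rightarrow> ennreal" where
  "hausdorff_outer k A = (SUP d\<in>{0<..}. hausdorff_content k d A)"

definition hausdorff_measure :: "nat \<Rightarrow> 'a::metric_space measure" where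
  "hausdorff_measure k = measure_of UNIV (sets borel) (hausdorff_outer k)"

text \<open>\<^const>\<open>measure_of\<close> returns the zero measure unless its argument is countably additive.
  The lemmas below establish this by Caratheodory's criterion for metric outer measures, so that
  on Borel sets the measure is the outer measure above.\<close>

lemma ediam_empty [simp]: "ediam {} = 0"
  by (simp add: ediam_def bot_ennreal)

lemma ediam_mono: "A \<subseteq> B \<Longrightarrow> ediam A \<le> ediam B"
  unfolding ediam_def by (intro SUP_mono) (meson SUP_subset_mono order_refl subsetD)

lemma dist_le_ediam: "x \<in> A \<Longrightarrow> y \<in> A \<Longrightarrow> ennreal (dist x y) \<le> ediam A"
  unfolding ediam_def by (meson SUP_upper2 order_refl)

lemma hausdorff_size_mono: "A \<subseteq> B \<Longrightarrow> hausdorff_size k A \<le> hausdorff_size k B"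
  unfolding hausdorff_size_def
  by (auto intro!: mult_left_mono power_mono divide_right_mono_ennreal ediam_mono)

lemma hausdorff_content_empty [simp]: "hausdorff_content k d ({} :: 'a::metric_space set) = 0"
proof -
  have "hausdorff_content k d ({} :: 'a set) \<le> (\<Sum>i::nat. hausdorff_size k ({} :: 'a set))"
    unfolding hausdorff_content_def by (rule INF_lower2[of "\<lambda>_. {}"]) auto
  then show ?thesis by (simp add: hausdorff_size_def)
qed

lemma hausdorff_content_mono: "A \<subseteq> B \<Longrightarrow> hausdorff_content k d A \<le> hausdorff_content k d B"
  unfolding hausdorff_content_def by (intro INF_superset_mono) auto

lemma hausdorff_content_antimono: "d \<le> e \<Longrightarrow> hausdorff_content k e A \<le> hausdorff_content k d A"
  unfolding hausdorff_content_def
  by (intro INF_superset_mono) (auto intro: order_trans ennreal_leI)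

lemma hausdorff_content_UN_le:
  fixes A :: "nat \<Rightarrow> 'a::metric_space set"
  shows "hausdorff_content k d (\<Union>i. A i) \<le> (\<Sum>i. hausdorff_content k d (A i))"
proof (rule ennreal_le_epsilon)
  let ?H = "hausdorff_content k d :: 'a set \<Rightarrow> ennreal"
  fix e :: real assume e: "0 < e" and fin: "(\<Sum>i. ?H (A i)) < top"
  have "\<exists>C. A n \<subseteq> (\<Union>i. C i) \<and> (\<forall>i. ediam (C i) \<le> ennreal d) \<and>
      (\<Sum>i. hausdorff_size k (C i)) \<le> ?H (A n) + ennreal (e * (1/2) ^ Suc n)" for n
  proof -
    have "?H (A n) < top"
      using fin by (metis ennreal_suminf_lessD)
    then have "?H (A n) < ?H (A n) + ennreal (e * (1/2) ^ Suc n)"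
      using e by (simp add: ennreal_add_left_cancel_less[where b=0, simplified])
    then show ?thesis
      unfolding hausdorff_content_def INF_less_iff by (auto intro: less_imp_le)
  qed
  then obtain C where C: "\<And>n. A n \<subseteq> (\<Union>i. C n i)" "\<And>n i. ediam (C n i) \<le> ennreal d"
    "\<And>n. (\<Sum>i. hausdorff_size k (C n i)) \<le> ?H (A n) + ennreal (e * (1/2) ^ Suc n)"
    by metis
  define D where "D = case_prod C \<circ> prod_decode"
  have "(\<Union>i. A i) \<subseteq> (\<Union>i. D i)"
  proof
    fix x assume "x \<in> (\<Union>i. A i)"
    then obtain n i where "x \<in> C n i" using C(1) by blast
    then have "x \<in> D (prod_encode (n, i))" by (simp add: D_def)
    then show "x \<in> (\<Union>i. D i)" by blast
  qed
  moreover have "ediam (D i) \<le> ennreal d" for i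
    by (cases "prod_decode i") (simp add: D_def C(2))
  ultimately have "?H (\<Union>i. A i) \<le> (\<Sum>i. hausdorff_size k (D i))"
    unfolding hausdorff_content_def by (intro INF_lower) auto
  also have "\<dots> = (\<Sum>i. (\<lambda>(m, n). hausdorff_size k (C m n)) (prod_decode i))"
    by (simp add: D_def split_beta)
  also have "\<dots> = (\<Sum>n. \<Sum>i. hausdorff_size k (C n i))"
    by (rule suminf_ennreal_2dimen) simp
  also have "\<dots> \<le> (\<Sum>n. ?H (A n) + ennreal (e * (1/2) ^ Suc n))"
    by (intro suminf_le C(3)) auto
  also have "\<dots> = (\<Sum>n. ?H (A n)) + (\<Sum>n. ennreal (e * (1/2) ^ Suc n))"
    by (simp add: suminf_add)
  also have "(\<Sum>n. ennreal (e * (1/2) ^ Suc n)) = ennreal e"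
    using e sums_mult[OF power_half_series, of e] by (intro suminf_ennreal_eq) auto
  finally show "?H (\<Union>i. A i) \<le> (\<Sum>i. ?H (A i)) + ennreal e" .
qed

lemma hausdorff_outer_empty [simp]: "hausdorff_outer k {} = 0"
  by (auto simp: hausdorff_outer_def)

lemma hausdorff_outer_mono: "A \<subseteq> B \<Longrightarrow> hausdorff_outer k A \<le> hausdorff_outer k B"
  unfolding hausdorff_outer_def by (intro SUP_mono) (auto intro: hausdorff_content_mono)

lemma hausdorff_outer_UN_le: "hausdorff_outer k (\<Union>i. A i) \<le> (\<Sum>i. hausdorff_outer k (A i))"
proof -
  have "hausdorff_content k d (\<Union>i. A i) \<le> (\<Sum>i. hausdorff_outer k (A i))" if "0 < d" for d
    using hausdorff_content_UN_le
  proof (rule order_trans)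
    show "(\<Sum>i. hausdorff_content k d (A i)) \<le> (\<Sum>i. hausdorff_outer k (A i))"
      using that by (intro suminf_le) (auto simp: hausdorff_outer_def intro: SUP_upper)
  qed
  then show ?thesis
    by (subst hausdorff_outer_def) (auto intro!: SUP_least)
qed

lemma hausdorff_outer_Un_le: "hausdorff_outer k (A \<union> B) \<le> hausdorff_outer k A + hausdorff_outer k B"
proof -
  have "hausdorff_outer k (\<Union>i. binaryset A B i) \<le> (\<Sum>i. hausdorff_outer k (binaryset A B i))"
    by (rule hausdorff_outer_UN_le)
  then show ?thesis
    by (simp add: UN_binaryset_eq suminf_binaryset_eq)
qed

lemma hausdorff_outer_separated:
  assumes e: "0 < e" and sep: "\<And>a b. a \<in> A \<Longrightarrow> b \<in> B \<Longrightarrow> e \<le> dist a b"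
  shows "hausdorff_outer k A + hausdorff_outer k B \<le> hausdorff_outer k (A \<union> B)"
proof -
  have *: "hausdorff_content k d A + hausdorff_content k d B \<le> hausdorff_outer k (A \<union> B)"
    if d: "0 < d" "d < e" for d
  proof -
    have "hausdorff_content k d A + hausdorff_content k d B \<le> hausdorff_content k d (A \<union> B)"
      unfolding hausdorff_content_def[of k d "A \<union> B"]
    proof (rule INF_greatest, clarify)
      fix C :: "nat \<Rightarrow> 'a set"
      assume C: "A \<union> B \<subseteq> \<Union> (range C)" "\<forall>i. ediam (C i) \<le> ennreal d"
      have meet: "C i \<inter> A = {} \<or> C i \<inter> B = {}" for i
      proof (rule ccontr)
        assume "\<not> ?thesis"
        then obtain a b where ab: "a \<in> C i" "a \<in> A" "b \<in> C i" "b \<in> B" by auto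
        then have "ennreal (dist a b) \<le> ennreal d"
          using C(2) dist_le_ediam order_trans by blast
        then show False
          using sep[OF ab(2,4)] d by (simp add: ennreal_le_iff)
      qed
      have cov: "hausdorff_content k d X \<le> (\<Sum>i. hausdorff_size k (C i \<inter> X))"
        if "X \<subseteq> A \<union> B" for X
        unfolding hausdorff_content_def
      proof (rule INF_lower)
        show "(\<lambda>i. C i \<inter> X) \<in> {C. X \<subseteq> (\<Union>i. C i) \<and> (\<forall>i. ediam (C i) \<le> ennreal d)}"
          using C that by (auto intro: order_trans[OF ediam_mono[of "C _ \<inter> X" "C _"]])
      qed
      have "hausdorff_content k d A + hausdorff_content k d B
          \<le> (\<Sum>i. hausdorff_size k (C i \<inter> A)) + (\<Sum>i. hausdorff_size k (C i \<inter> B))"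
        by (intro add_mono cov) auto
      also have "\<dots> = (\<Sum>i. hausdorff_size k (C i \<inter> A) + hausdorff_size k (C i \<inter> B))"
        by (simp add: suminf_add)
      also have "\<dots> \<le> (\<Sum>i. hausdorff_size k (C i))"
      proof (intro suminf_le allI)
        fix i show "hausdorff_size k (C i \<inter> A) + hausdorff_size k (C i \<inter> B) \<le> hausdorff_size k (C i)"
          using meet[of i] hausdorff_size_mono[of "C i \<inter> A" "C i"] hausdorff_size_mono[of "C i \<inter> B" "C i"]
          by (auto simp: hausdorff_size_def[of k "{}"])
      qed auto
      finally show "hausdorff_content k d A + hausdorff_content k d B
          \<le> (\<Sum>i. hausdorff_size k (C i))" .
    qed
    also have "\<dots> \<le> hausdorff_outer k (A \<union> B)"
      using d by (auto simp: hausdorff_outer_def intro: SUP_upper)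
    finally show ?thesis .
  qed
  have "hausdorff_outer k A + hausdorff_outer k B
      = (SUP d\<in>{0<..}. hausdorff_content k d A + hausdorff_content k d B)"
    unfolding hausdorff_outer_def
  proof (rule SUP_add_directed_ennreal[symmetric])
    fix i j :: real assume "i \<in> {0<..}" "j \<in> {0<..}"
    then show "\<exists>m\<in>{0<..}. hausdorff_content k i A + hausdorff_content k j B
        \<le> hausdorff_content k m A + hausdorff_content k m B"
      by (intro bexI[of _ "min i j"] add_mono hausdorff_content_antimono) auto
  qed
  also have "\<dots> \<le> hausdorff_outer k (A \<union> B)"
  proof (rule SUP_least)
    fix d :: real assume "d \<in> {0<..}"
    then have m: "0 < min d (e / 2)" "min d (e / 2) < e" using e by auto
    have "hausdorff_content k d A + hausdorff_content k d B
        \<le> hausdorff_content k (min d (e/2)) A + hausdorff_content k (min d (e/2)) B"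
      by (intro add_mono hausdorff_content_antimono) auto
    also have "\<dots> \<le> hausdorff_outer k (A \<union> B)" by (rule *[OF m])
    finally show "hausdorff_content k d A + hausdorff_content k d B \<le> hausdorff_outer k (A \<union> B)" .
  qed
  finally show ?thesis .
qed

lemma hausdorff_outer_closed_split:
  fixes F S :: "'a::metric_space set"
  assumes "closed F"
  shows "hausdorff_outer k (S \<inter> F) + hausdorff_outer k (S - F) \<le> hausdorff_outer k S"
proof (cases "F = {} \<or> hausdorff_outer k S = \<infinity>")
  case True
  then show ?thesis by auto
next
  case False
  then have ne: "F \<noteq> {}" and fin: "hausdorff_outer k S < \<infinity>"
    by (auto simp: less_top)
  let ?H = "hausdorff_outer k :: 'a set \<Rightarrow> ennreal"
  define \<rho> where "\<rho> n = 1 / (real n + 1)" for n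
  define T where "T n = {x \<in> S. \<rho> n \<le> infdist x F}" for n
  define R where "R n = T (Suc n) - T n" for n
  have rho: "0 < \<rho> n" "\<rho> (Suc n) < \<rho> n" for n
    by (auto simp: \<rho>_def field_simps)
  have rho_anti: "\<rho> n \<le> \<rho> m" if "m \<le> n" for m n
    using that by (auto simp: \<rho>_def field_simps)
  have T_sub: "T n \<subseteq> S" for n by (auto simp: T_def)
  have first: "?H (S \<inter> F) + ?H (T n) \<le> ?H S" for n
  proof -
    have "?H (S \<inter> F) + ?H (T n) \<le> ?H (S \<inter> F \<union> T n)"
    proof (rule hausdorff_outer_separated[OF rho(1)[of n]])
      fix a b assume "a \<in> S \<inter> F" "b \<in> T n"
      then have "\<rho> n \<le> infdist b F" "infdist b F \<le> dist b a"
        by (auto simp: T_def intro: infdist_le)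
      then show "\<rho> n \<le> dist a b" by (simp add: dist_commute)
    qed
    also have "\<dots> \<le> ?H S" using T_sub by (intro hausdorff_outer_mono) auto
    finally show ?thesis .
  qed
  have alternate: "(\<Sum>i<n. ?H (R (2 * i + c))) \<le> ?H (\<Union>i<n. R (2 * i + c))" for n c
  proof (induction n)
    case (Suc n)
    have "(\<Sum>i<Suc n. ?H (R (2 * i + c))) \<le> ?H (\<Union>i<n. R (2 * i + c)) + ?H (R (2 * n + c))"
      using Suc by (simp add: add_mono)
    also have "\<dots> \<le> ?H ((\<Union>i<n. R (2 * i + c)) \<union> R (2 * n + c))"
    proof (rule hausdorff_outer_separated)
      show "0 < (if n = 0 then 1 else \<rho> (2 * n + c - 1) - \<rho> (2 * n + c))"
        using rho(2)[of "2 * n + c - 1"] by (cases n) auto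
      fix a b assume "a \<in> (\<Union>i<n. R (2 * i + c))" and b: "b \<in> R (2 * n + c)"
      then obtain i where i: "i < n" "a \<in> R (2 * i + c)" by auto
      have "\<rho> (2 * n + c - 1) \<le> \<rho> (Suc (2 * i + c))"
        using i by (intro rho_anti) auto
      also have "\<dots> \<le> infdist a F" using i by (auto simp: R_def T_def)
      also have "\<dots> \<le> infdist b F + dist a b" by (rule infdist_triangle)
      finally have "\<rho> (2 * n + c - 1) \<le> infdist b F + dist a b" .
      moreover have "infdist b F < \<rho> (2 * n + c)" using b by (auto simp: R_def T_def)
      ultimately show "(if n = 0 then 1 else \<rho> (2 * n + c - 1) - \<rho> (2 * n + c)) \<le> dist a b"
        using i by auto
    qed
    also have "(\<Union>i<n. R (2 * i + c)) \<union> R (2 * n + c) = (\<Union>i<Suc n. R (2 * i + c))"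
      by (auto simp: less_Suc_eq)
    finally show ?case .
  qed simp
  have half: "(\<Sum>i<n. ?H (R (2 * i + c))) \<le> ?H S" for n c
  proof -
    have "?H (\<Union>i<n. R (2 * i + c)) \<le> ?H S"
      by (intro hausdorff_outer_mono) (auto simp: R_def T_def)
    then show ?thesis using alternate[of c n] by (rule order_trans[rotated])
  qed
  have "(\<Sum>i<n. ?H (R i)) \<le> ?H S + ?H S" for n
  proof -
    have "(\<Sum>i<n. ?H (R i)) \<le> (\<Sum>i<2 * n. ?H (R i))"
      by (intro sum_mono2) auto
    also have "\<dots> = (\<Sum>i<n. ?H (R (2 * i + 0))) + (\<Sum>i<n. ?H (R (2 * i + 1)))"
      by (induction n) (auto simp: algebra_simps)
    also have "\<dots> \<le> ?H S + ?H S" by (intro add_mono half)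
    finally show ?thesis .
  qed
  then have "(\<Sum>i. ?H (R i)) \<le> ?H S + ?H S" by (intro suminf_le_const summableI)
  then have sumfin: "(\<Sum>i. ?H (R i)) < \<infinity>" using fin by (auto simp: less_top[symmetric] top_unique)
  define g where "g i = enn2real (?H (R i))" for i
  have g: "?H (R i) = ennreal (g i)" for i
    using ennreal_suminf_lessD[OF sumfin, of i] by (simp add: g_def)
  have g0: "0 \<le> g i" for i by (simp add: g_def)
  have summ: "summable g"
    using sumfin by (intro summable_suminf_not_top[OF g0]) (simp add: g)
  show ?thesis
  proof (rule ennreal_le_epsilon)
    fix e :: real assume "0 < e"
    then obtain N where N: "norm (\<Sum>i. g (i + N)) < e"
      using suminf_exist_split[OF _ summ] by blast
    have tail: "(\<Sum>i. ?H (R (i + N))) \<le> ennreal e"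
    proof -
      have "(\<Sum>i. ?H (R (i + N))) = ennreal (\<Sum>i. g (i + N))"
        using summ g0 by (simp add: g suminf_ennreal2 summable_ignore_initial_segment)
      also have "\<dots> \<le> ennreal e" using N by (intro ennreal_leI) auto
      finally show ?thesis .
    qed
    have "S - F \<subseteq> T N \<union> (\<Union>i. R (i + N))"
    proof
      fix x assume x: "x \<in> S - F"
      then have "0 < infdist x F"
        using \<open>closed F\<close> ne by (simp add: infdist_pos_not_in_closed)
      then obtain m :: nat where "inverse (real (Suc m)) < infdist x F"
        using reals_Archimedean by blast
      then have ex: "x \<in> T m" using x by (auto simp: T_def \<rho>_def inverse_eq_divide add.commute)
      show "x \<in> T N \<union> (\<Union>i. R (i + N))"
      proof (cases "x \<in> T N")
        case False
        define l where "l = (LEAST l. x \<in> T l)"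
        have l: "x \<in> T l" unfolding l_def by (rule LeastI[of _ m]) (rule ex)
        have "\<not> l \<le> N"
          using l False rho_anti[of l N] by (auto simp: T_def)
        then obtain j where j: "l = Suc (j + N)" by (metis not_le less_imp_Suc_add add.commute add_Suc_right)
        have "x \<notin> T (j + N)" using not_less_Least[of "j + N" "\<lambda>l. x \<in> T l"] j by (auto simp: l_def)
        then have "x \<in> R (j + N)" using l j by (simp add: R_def)
        then show ?thesis by blast
      qed simp
    qed
    then have "?H (S - F) \<le> ?H (T N \<union> (\<Union>i. R (i + N)))" by (rule hausdorff_outer_mono)
    also have "\<dots> \<le> ?H (T N) + ?H (\<Union>i. R (i + N))" by (rule hausdorff_outer_Un_le)
    also have "\<dots> \<le> ?H (T N) + ennreal e"
      using hausdorff_outer_UN_le[of k "\<lambda>i. R (i + N)"] tail by (intro add_left_mono) (rule order_trans)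
    finally have "?H (S \<inter> F) + ?H (S - F) \<le> (?H (S \<inter> F) + ?H (T N)) + ennreal e"
      by (simp add: add.assoc add_left_mono)
    also have "\<dots> \<le> ?H S + ennreal e" by (intro add_right_mono first)
    finally show "?H (S \<inter> F) + ?H (S - F) \<le> ?H S + ennreal e" .
  qed
qed

lemma sets_hausdorff_measure [simp]: "sets (hausdorff_measure k) = sets borel"
  unfolding hausdorff_measure_def
  by (metis sets.sigma_sets_eq sets_measure_of space_borel subset_Pow_Union sets.space_closed)

lemma space_hausdorff_measure [simp]: "space (hausdorff_measure k) = UNIV"
  by (simp add: hausdorff_measure_def space_measure_of_conv)

lemma emeasure_hausdorff_measure:
  fixes A :: "'a::metric_space set"
  assumes "A \<in> sets borel"
  shows "emeasure (hausdorff_measure k) A = hausdorff_outer k A"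
proof -
  let ?H = "hausdorff_outer k :: 'a set \<Rightarrow> ennreal"
  interpret P: sigma_algebra UNIV "Pow UNIV :: 'a set set" by (rule sigma_algebra_Pow)
  have "outer_measure_space (Pow UNIV) ?H"
    by (auto simp: outer_measure_space_def positive_def increasing_def countably_subadditive_def
        intro: hausdorff_outer_mono hausdorff_outer_UN_le)
  then have ms: "measure_space UNIV (lambda_system UNIV (Pow UNIV) ?H) ?H"
    by (rule P.caratheodory_lemma)
  interpret L: sigma_algebra UNIV "lambda_system UNIV (Pow UNIV) ?H"
    using ms by (simp add: measure_space_def)
  have "Collect closed \<subseteq> lambda_system UNIV (Pow UNIV) ?H"
  proof
    fix F :: "'a set" assume "F \<in> Collect closed"
    then have "?H (S \<inter> F) + ?H (S - F) = ?H S" for S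
      using hausdorff_outer_closed_split[of F k S] hausdorff_outer_Un_le[of k "S \<inter> F" "S - F"]
      by (auto simp: Int_Diff_Un intro: antisym)
    then show "F \<in> lambda_system UNIV (Pow UNIV) ?H" unfolding P.lambda_system_eq by auto
  qed
  then have sub: "sets borel \<subseteq> lambda_system UNIV (Pow UNIV) ?H"
    unfolding borel_eq_closed by (subst sets_measure_of, simp) (rule L.sigma_sets_subset)
  have "measure_space UNIV (sets borel) ?H"
    using ms sub sets.sigma_algebra_axioms[of "borel :: 'a measure"]
    by (auto simp: measure_space_def positive_def countably_additive_def)
  then show ?thesis
    using assms unfolding hausdorff_measure_def
    by (intro emeasure_measure_of_sigma) (auto simp: measure_space_def)
qed

section \<open>Sets of locally finite perimeter\<close>

definition C1_compact_support :: "('a::euclidean_space \<Rightarrow> 'a) \<Rightarrow> bool" where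
  "C1_compact_support T \<longleftrightarrow>
     (\<forall>x. T differentiable at x) \<and>
     (\<forall>v. continuous_on UNIV (\<lambda>x. frechet_derivative T (at x) v)) \<and>
     compact (closure {x. T x \<noteq> 0})"

definition divergence :: "('a::euclidean_space \<Rightarrow> 'a) \<Rightarrow> 'a \<Rightarrow> real" where
  "divergence T x = (\<Sum>b\<in>Basis. frechet_derivative T (at x) b \<bullet> b)"

definition locally_finite_perimeter :: "'a::euclidean_space set \<Rightarrow> bool" where
  "locally_finite_perimeter E \<longleftrightarrow>
     E \<in> sets lebesgue \<and>
     (\<forall>K. compact K \<longrightarrow>
       (\<exists>C. \<forall>T. C1_compact_support T \<and> closure {x. T x \<noteq> 0} \<subseteq> K \<and> (\<forall>x. norm (T x) \<le> 1)
          \<longrightarrow> (LINT x:E|lebesgue. divergence T x) \<le> C))"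

text \<open>The vector-valued Gauss--Green measure of \<open>E\<close> is encoded by its polar decomposition: the
  total variation \<open>\<mu>\<close> and a unit density \<open>\<sigma>\<close>. By the Riesz theorem such a pair exists iff \<open>E\<close> has
  locally finite perimeter, and then \<open>\<mu>\<close> is unique and \<open>\<sigma>\<close> is unique \<open>\<mu>\<close>-a.e. With this sign the
  density is the outer normal.\<close>

definition gauss_green_polar ::
    "'a::euclidean_space set \<Rightarrow> 'a measure \<Rightarrow> ('a \<Rightarrow> 'a) \<Rightarrow> bool" where
  "gauss_green_polar E \<mu> \<sigma> \<longleftrightarrow>
     sets \<mu> = sets borel \<and>
     (\<forall>K. compact K \<longrightarrow> emeasure \<mu> K < \<infinity>) \<and>
     \<sigma> \<in> borel_measurable borel \<and>
     (AE x in \<mu>. norm (\<sigma> x) = 1) \<and>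
     (\<forall>T. C1_compact_support T \<longrightarrow>
        (LINT x:E|lebesgue. divergence T x) = (LINT x|\<mu>. T x \<bullet> \<sigma> x))"

definition perimeter_measure :: "'a::euclidean_space set \<Rightarrow> 'a measure" where
  "perimeter_measure E = (SOME \<mu>. \<exists>\<sigma>. gauss_green_polar E \<mu> \<sigma>)"

definition gauss_green_measure :: "'a::euclidean_space set \<Rightarrow> 'a set \<Rightarrow> 'a" where
  "gauss_green_measure E A =
     (LINT x:A|perimeter_measure E. (SOME \<sigma>. gauss_green_polar E (perimeter_measure E) \<sigma>) x)"

definition measure_support :: "'a::metric_space measure \<Rightarrow> 'a set" where
  "measure_support \<mu> = {x. \<forall>r>0. emeasure \<mu> (ball x r) > 0}"

definition is_outer_normal :: "'a::euclidean_space set \<Rightarrow> 'a \<Rightarrow> 'a \<Rightarrow> bool" where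
  "is_outer_normal E x v \<longleftrightarrow>
     norm v = 1 \<and>
     ((\<lambda>r. gauss_green_measure E (ball x r) /\<^sub>R measure (perimeter_measure E) (ball x r))
        \<longlongrightarrow> v) (at_right 0)"

definition reduced_boundary :: "'a::euclidean_space set \<Rightarrow> 'a set" where
  "reduced_boundary E =
     {x \<in> measure_support (perimeter_measure E). \<exists>v. is_outer_normal E x v}"

text \<open>The value \<open>0\<close> off the reduced boundary is immaterial: by Federer's theorem the reduced
  boundary has full \<open>(n-1)\<close>-dimensional Hausdorff measure in the essential boundary.\<close>

definition outer_normal :: "'a::euclidean_space set \<Rightarrow> 'a \<Rightarrow> 'a" where
  "outer_normal E x = (if x \<in> reduced_boundary E then THE v. is_outer_normal E x v else 0)"

definition has_density :: "'a::euclidean_space set \<Rightarrow> 'a \<Rightarrow> real \<Rightarrow> bool" where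
  "has_density E x t \<longleftrightarrow>
     ((\<lambda>r. measure lebesgue (E \<inter> ball x r) / measure lebesgue (ball x r)) \<longlongrightarrow> t) (at_right 0)"

definition essential_boundary :: "'a::euclidean_space set \<Rightarrow> 'a set" where
  "essential_boundary E = {x. \<not> has_density E x 0 \<and> \<not> has_density E x 1}"

section \<open>Ahlfors regularity and mean oscillation\<close>

definition ahlfors_regular :: "nat \<Rightarrow> real \<Rightarrow> 'a::euclidean_space set \<Rightarrow> bool" where
  "ahlfors_regular k C F \<longleftrightarrow>
     closed F \<and> 0 < C \<and>
     (\<forall>x\<in>F. \<forall>r. 0 < r \<and> ennreal r < ediam F \<longrightarrow>
        ennreal (inverse C * r ^ k) \<le> emeasure (hausdorff_measure k) (F \<inter> ball x r) \<and>
        emeasure (hausdorff_measure k) (F \<inter> ball x r) \<le> ennreal (C * r ^ k))"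

definition set_average :: "'a measure \<Rightarrow> 'a set \<Rightarrow> ('a \<Rightarrow> 'b::euclidean_space) \<Rightarrow> 'b" where
  "set_average M S f = (LINT y:S|M. f y) /\<^sub>R measure M S"

definition L2_mean_osc :: "'a measure \<Rightarrow> 'a set \<Rightarrow> ('a \<Rightarrow> 'b::euclidean_space) \<Rightarrow> real" where
  "L2_mean_osc M S f = sqrt (set_average M S (\<lambda>y. (norm (f y - set_average M S f))\<^sup>2))"

definition star_norm ::
    "'a::euclidean_space set \<Rightarrow> ('a \<Rightarrow> 'a) \<Rightarrow> 'a \<Rightarrow> real \<Rightarrow> ereal" where
  "star_norm F f x r =
     (SUP s\<in>{0<..<r}. ereal (L2_mean_osc (hausdorff_measure (DIM('a) - 1)) (ball x s \<inter> F) f))"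

section \<open>Reifenberg flatness\<close>

definition hausdorff_distance_sum :: "'a::metric_space set \<Rightarrow> 'a set \<Rightarrow> real" where
  "hausdorff_distance_sum A B = (SUP a\<in>A. infdist a B) + (SUP b\<in>B. infdist b A)"

definition hyperplanes_through :: "'a::euclidean_space \<Rightarrow> 'a set set" where
  "hyperplanes_through x = {L. affine L \<and> aff_dim L = int DIM('a) - 1 \<and> x \<in> L}"

definition flatness :: "'a::euclidean_space set \<Rightarrow> 'a \<Rightarrow> real \<Rightarrow> real" where
  "flatness \<Sigma> x r =
     (INF L\<in>hyperplanes_through x.
        1 / r * hausdorff_distance_sum (\<Sigma> \<inter> cball x r) (L \<inter> cball x r))"

definition reifenberg_flat_set :: "real \<Rightarrow> 'a::euclidean_space set \<Rightarrow> bool" where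
  "reifenberg_flat_set \<delta> \<Sigma> \<longleftrightarrow>
     closed \<Sigma> \<and>
     (\<forall>K. compact K \<longrightarrow>
       (\<exists>R>0. (SUP r\<in>{0<..R}. SUP x\<in>K \<inter> \<Sigma>. ereal (flatness \<Sigma> x r)) < ereal \<delta>))"

definition two_sided :: "'a::euclidean_space set \<Rightarrow> bool" where
  "two_sided \<Omega> \<longleftrightarrow> card (components (- frontier \<Omega>)) = 2"

text \<open>The parameter \<open>\<delta>\<^sub>0\<close> is the small dimensional constant below which the notion is used.\<close>

definition reifenberg_flat_domain :: "real \<Rightarrow> real \<Rightarrow> 'a::euclidean_space set \<Rightarrow> bool" where
  "reifenberg_flat_domain \<delta>\<^sub>0 \<delta> \<Omega> \<longleftrightarrow>
     0 < \<delta> \<and> \<delta> < \<delta>\<^sub>0 \<and>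
     open \<Omega> \<and> connected \<Omega> \<and>
     reifenberg_flat_set \<delta> (frontier \<Omega>) \<and>
     (\<forall>K. compact K \<longrightarrow>
       (\<exists>R>0. \<forall>y\<in>frontier \<Omega> \<inter> K. \<forall>r. 0 < r \<and> r < R \<longrightarrow>
          (\<exists>v. norm v = 1 \<and>
             (\<forall>x\<in>ball y r.
                ((x - y) \<bullet> v > \<delta> * r \<longrightarrow> x \<notin> \<Omega>) \<and>
                ((x - y) \<bullet> v < - \<delta> * r \<longrightarrow> x \<in> \<Omega>))))) \<and>
     (\<not> bounded \<Omega> \<longrightarrow> two_sided \<Omega>)"

definition chord_arc_domain :: "real \<Rightarrow> real \<Rightarrow> 'a::euclidean_space set \<Rightarrow> bool" where
  "chord_arc_domain \<delta>\<^sub>0 \<delta> \<Omega> \<longleftrightarrow>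
     locally_finite_perimeter \<Omega> \<and>
     reifenberg_flat_domain \<delta>\<^sub>0 \<delta> \<Omega> \<and>
     (\<exists>C. ahlfors_regular (DIM('a) - 1) C (frontier \<Omega>)) \<and>
     (\<forall>K. compact K \<longrightarrow>
       (\<exists>R>0. (SUP x\<in>frontier \<Omega> \<inter> K. star_norm (frontier \<Omega>) (outer_normal \<Omega>) x R) < ereal \<delta>))"

section \<open>The threshold for small oscillation of the normal\<close>

definition admissible_eps2 :: "'a::euclidean_space itself \<Rightarrow> real \<Rightarrow> real \<Rightarrow> bool" where
  "admissible_eps2 _ C_A \<epsilon>\<^sub>2 \<longleftrightarrow>
     0 < \<epsilon>\<^sub>2 \<and>
     (\<exists>C\<^sub>2. \<forall>(E :: 'a set) r\<^sub>0. \<forall>x\<in>frontier E.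
        0 < r\<^sub>0 \<and>
        locally_finite_perimeter E \<and>
        frontier E = measure_support (perimeter_measure E) \<and>
        (\<forall>y\<in>frontier E. \<forall>r. 0 < r \<and> r < r\<^sub>0 \<longrightarrow>
           ennreal (inverse C_A * r ^ (DIM('a) - 1)) \<le> emeasure (perimeter_measure E) (ball y r) \<and>
           emeasure (perimeter_measure E) (ball y r) \<le> ennreal (C_A * r ^ (DIM('a) - 1))) \<and>
        (\<forall>r. 0 < r \<and> r < r\<^sub>0 \<longrightarrow>
           L2_mean_osc (hausdorff_measure (DIM('a) - 1)) (ball x r \<inter> reduced_boundary E)
             (outer_normal E) \<le> \<epsilon>\<^sub>2)
        \<longrightarrow> (SUP \<rho>\<in>{0<..<r\<^sub>0 / 8}. ereal (flatness (frontier E) x \<rho>))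
              \<le> ereal (C\<^sub>2 * \<epsilon>\<^sub>2 powr (1 / (real DIM('a) - 1))))"

end

theory Submission
  imports Defs
begin

text \<open>Let \<open>f\<close> be the indicator of \<open>\<Omega>\<close> mollified at a scale \<open>t\<close> comparable to \<open>\<delta> s\<close>. By the
  Gauss--Green formula the derivative of \<open>f\<close> in a direction \<open>w\<close> is minus the mollification of
  \<open>\<nu> \<bullet> w\<close> against the perimeter measure. If \<open>\<nu>\<close> oscillates little on \<open>B(x, s)\<close>, then it is close in
  \<open>L\<^sup>1\<close> to a fixed unit vector \<open>v\<close>, so \<open>f\<close> is almost nonincreasing along every displacement that does
  not go backwards with respect to \<open>v\<close>, and near each boundary point it drops by a fixed amount,
  because the perimeter measure is bounded below. As \<open>0 \<le> f \<le> 1\<close>, boundary points cannot occur at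
  many well separated heights over \<open>x\<close>; this traps the boundary in a thin slab, with \<open>\<Omega>\<close> on one side
  and its complement on the other.

  The lower bound for the perimeter measure comes from \<open>\<partial>\<^sub>*\<Omega> = \<partial>\<Omega>\<close>. Let \<open>\<theta>\<close> be the density of the
  perimeter measure with respect to \<open>\<H>\<^sup>n\<^sup>-\<^sup>1\<close> on \<open>\<partial>\<Omega>\<close>. Where \<open>\<theta>\<close> vanishes, the relative isoperimetric
  inequality forces the volume fraction of \<open>\<Omega>\<close> to tend to \<open>0\<close> or \<open>1\<close>; where \<open>\<theta>\<close> is positive, the flux
  of \<open>\<nu>\<close> bounds the volume on both sides below by a multiple of \<open>\<theta>\<close>, and the isoperimetric inequality on
  the thinner side bounds \<open>\<theta>\<close> below.

  The Gauss--Green measure itself is obtained from an \<open>L\<^sup>2\<close> duality argument, since shifting \<open>\<Omega>\<close> by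
  \<open>w\<close> changes it only in a tube around \<open>\<partial>\<Omega>\<close> whose volume is controlled by \<open>\<H>\<^sup>n\<^sup>-\<^sup>1\<close>.\<close>

section \<open>Compactly supported functions\<close>

text \<open>The oscillation hypothesis is measured by H^(n-1) on the whole boundary, whereas the
  Gauss--Green formula sees only \<open>\<theta>\<close> times H^(n-1), and
  \<open>outer_normal\<close> is 0 where no normal exists. The two can be compared only if
  \<open>\<theta>\<close> lies between positive constants that depend on n and \<open>C\<close>
  alone, because \<epsilon> is fixed before \<Omega>. This is why the density bounds carry explicit
  constants, while the radii at which they are derived may depend on the domain and on the point.

  The constants form a chain. The drop b across a boundary point depends on n and \<open>C\<close>,
  and the number J of levels is chosen with J b > 2. The mollification scale is t = \<delta> s / (4
  J). Freezing the normal at v costs an error of order \<epsilon> (s / t)^n: the L^1 error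
  \<epsilon> s^(n-1) is multiplied by a displacement of length s and divided by a bump mass of order
  t^n relative to the height of the bump. So \<epsilon> comes last, of order (\<delta> /
  J)^n.\<close>

definition C1c :: "('a::euclidean_space \<Rightarrow> real) \<Rightarrow> bool" where
  "C1c f \<longleftrightarrow> (\<forall>x. f differentiable at x) \<and>
     (\<forall>v. continuous_on UNIV (\<lambda>x. frechet_derivative f (at x) v)) \<and>
     compact (closure {x. f x \<noteq> 0})"

abbreviation pd :: "('a::euclidean_space \<Rightarrow> real) \<Rightarrow> 'a \<Rightarrow> 'a \<Rightarrow> real" where
  "pd f v x \<equiv> frechet_derivative f (at x) v"

lemma C1cI:
  assumes "\<And>x. (f has_derivative f' x) (at x)" "\<And>v. continuous_on UNIV (\<lambda>x. f' x v)"
    "bounded {x. f x \<noteq> 0}"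
  shows "C1c f"
proof -
  have "frechet_derivative f (at x) = f' x" for x
    using assms(1)[of x] frechet_derivative_at[of f "f' x" x] by simp
  then show ?thesis
    using assms by (auto simp: C1c_def differentiable_def)
qed

lemma C1c_has_derivative: "C1c f \<Longrightarrow> (f has_derivative frechet_derivative f (at x)) (at x)"
  by (simp add: C1c_def frechet_derivative_works[symmetric])

lemma C1c_linear: "C1c f \<Longrightarrow> linear (frechet_derivative f (at x))"
  by (simp add: C1c_def linear_frechet_derivative)

lemma C1c_continuous: "C1c f \<Longrightarrow> continuous_on UNIV f"
  by (meson C1c_has_derivative continuous_at_imp_continuous_on has_derivative_continuous)

lemma C1c_pd_continuous: "C1c f \<Longrightarrow> continuous_on UNIV (pd f v)"
  by (simp add: C1c_def)

lemma C1c_borel: "C1c f \<Longrightarrow> f \<in> borel_measurable borel"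
  by (simp add: C1c_continuous borel_measurable_continuous_onI)

lemma C1c_pd_borel: "C1c f \<Longrightarrow> pd f v \<in> borel_measurable borel"
  by (simp add: C1c_pd_continuous borel_measurable_continuous_onI)

lemma C1c_support:
  assumes "C1c f"
  obtains r where "0 < r" "\<And>x. r \<le> norm x \<Longrightarrow> f x = 0" "\<And>x v. r \<le> norm x \<Longrightarrow> pd f v x = 0"
proof -
  have "bounded (closure {x. f x \<noteq> 0})"
    using assms compact_imp_bounded by (auto simp: C1c_def)
  then obtain r where "\<forall>x\<in>closure {x. f x \<noteq> 0}. norm x \<le> r"
    unfolding bounded_iff by blast
  then have r: "norm x \<le> r" if "x \<in> closure {x. f x \<noteq> 0}" for x using that by blast
  show thesis
  proof (rule that[of "\<bar>r\<bar> + 1"])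
    fix x :: 'a assume x: "\<bar>r\<bar> + 1 \<le> norm x"
    then have nx: "x \<notin> closure {x. f x \<noteq> 0}" using r[of x] by force
    have sub: "{x. f x \<noteq> 0} \<subseteq> closure {x. f x \<noteq> 0}" by (rule closure_subset)
    then show "f x = 0" using nx by auto
    have z: "f y = 0" if "y \<in> - closure {x. f x \<noteq> 0}" for y
      using that sub by blast
    have "(f has_derivative (\<lambda>_. 0)) (at x)"
    proof (rule has_derivative_transform_within_open)
      show "((\<lambda>_. 0) has_derivative (\<lambda>_. 0)) (at x)" by (rule has_derivative_const)
      show "open (- closure {x. f x \<noteq> 0})" by (rule open_Compl[OF closed_closure])
      show "x \<in> - closure {x. f x \<noteq> 0}" using nx by blast
      show "0 = f y" if "y \<in> - closure {x. f x \<noteq> 0}" for y using z[OF that] by (rule sym)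
    qed
    then have "frechet_derivative f (at x) = (\<lambda>_. 0)"
      by (rule frechet_derivative_at[symmetric])
    then show "pd f v x = 0" for v by simp
  qed auto
qed

lemma bounded_cts_compact_support:
  fixes f :: "'a::euclidean_space \<Rightarrow> real"
  assumes "continuous_on UNIV f" "\<And>x. r \<le> norm x \<Longrightarrow> f x = 0"
  obtains M where "0 < M" "\<And>x. \<bar>f x\<bar> \<le> M"
proof -
  have "compact (f ` cball 0 r)"
    using assms(1) by (intro compact_continuous_image) (auto intro: continuous_on_subset)
  then obtain B where "\<forall>y\<in>f ` cball 0 r. norm y \<le> B"
    using compact_imp_bounded bounded_iff by blast
  then have B: "\<And>x. x \<in> cball 0 r \<Longrightarrow> \<bar>f x\<bar> \<le> B" by auto
  show thesis
  proof (rule that[of "\<bar>B\<bar> + 1"])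
    fix x show "\<bar>f x\<bar> \<le> \<bar>B\<bar> + 1"
      using B[of x] assms(2)[of x] by (cases "norm x \<le> r") auto
  qed auto
qed

lemma integrable_bounded_support:
  fixes f :: "'a::euclidean_space \<Rightarrow> 'b::{banach, second_countable_topology}"
  assumes "f \<in> borel_measurable M" "sets M = sets borel" "\<And>x. r \<le> norm x \<Longrightarrow> f x = 0" "\<And>x. norm (f x) \<le> B"
    "emeasure M (cball 0 r) < \<infinity>"
  shows "integrable M f"
proof (rule integrableI_bounded_set[where A="cball 0 r" and B=B])
  show "cball 0 r \<in> sets M" by (simp add: assms(2))
  show "AE x in M. x \<in> cball 0 r \<longrightarrow> norm (f x) \<le> B" using assms by auto
  show "AE x in M. x \<notin> cball 0 r \<longrightarrow> f x = 0" using assms(3) by auto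
qed (use assms in auto)

lemma integrable_cts_compact_support:
  fixes f :: "'a::euclidean_space \<Rightarrow> real"
  assumes "continuous_on UNIV f" "sets M = sets borel" "\<And>x. r \<le> norm x \<Longrightarrow> f x = 0"
    "emeasure M (cball 0 r) < \<infinity>"
  shows "integrable M f"
proof -
  obtain B where "\<And>x. \<bar>f x\<bar> \<le> B"
    using bounded_cts_compact_support[OF assms(1,3)] by metis
  moreover have "f \<in> borel_measurable M"
    using assms(1,2) borel_measurable_continuous_onI[of f] by (simp cong: measurable_cong_sets)
  ultimately show ?thesis
    using assms by (intro integrable_bounded_support[of f M r B]) auto
qed

lemma C1c_integrable:
  assumes "C1c f" "sets M = sets borel" "\<And>K. compact K \<Longrightarrow> emeasure M K < \<infinity>"
  shows "integrable M f" "integrable M (pd f v)"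
proof -
  obtain r where r: "\<And>x. r \<le> norm x \<Longrightarrow> f x = 0" "\<And>x v. r \<le> norm x \<Longrightarrow> pd f v x = 0"
    using C1c_support[OF assms(1)] by metis
  have c: "emeasure M (cball 0 r) < \<infinity>" using assms(3) by auto
  show "integrable M f"
    by (rule integrable_cts_compact_support[OF C1c_continuous[OF assms(1)] assms(2) r(1) c])
  show "integrable M (pd f v)"
    by (rule integrable_cts_compact_support[OF C1c_pd_continuous[OF assms(1)] assms(2) r(2) c])
qed

lemma C1c_integrable_lborel:
  assumes "C1c f"
  shows "integrable lborel f" "integrable lborel (pd f v)"
  using C1c_integrable[OF assms, of lborel] emeasure_compact_finite by auto

lemma C1c_add:
  assumes "C1c f" "C1c g"
  shows "C1c (\<lambda>x. f x + g x)" "pd (\<lambda>x. f x + g x) v x = pd f v x + pd g v x"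
proof -
  have d: "((\<lambda>x. f x + g x) has_derivative (\<lambda>v. pd f v x + pd g v x)) (at x)" for x
    using assms by (intro has_derivative_add C1c_has_derivative)
  show "pd (\<lambda>x. f x + g x) v x = pd f v x + pd g v x"
    by (rule fun_cong[OF frechet_derivative_at[OF d, symmetric]])
  have "bounded ({x. f x \<noteq> 0} \<union> {x. g x \<noteq> 0})" using assms by (simp add: C1c_def)
  then have b: "bounded {x. f x + g x \<noteq> 0}"
    by (rule bounded_subset) auto
  show "C1c (\<lambda>x. f x + g x)"
    by (rule C1cI[OF d _ b]) (intro continuous_on_add C1c_pd_continuous assms)
qed

lemma C1c_mult:
  assumes "C1c f" "C1c g"
  shows "C1c (\<lambda>x. f x * g x)"
proof -
  have d: "((\<lambda>x. f x * g x) has_derivative (\<lambda>v. f x * pd g v x + pd f v x * g x)) (at x)" for x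
    using assms by (intro has_derivative_mult C1c_has_derivative)
  have "bounded {x. f x \<noteq> 0}" using assms by (simp add: C1c_def)
  then have b: "bounded {x. f x * g x \<noteq> 0}"
    by (rule bounded_subset) auto
  show "C1c (\<lambda>x. f x * g x)"
    by (rule C1cI[OF d _ b])
      (intro continuous_on_add continuous_on_mult C1c_pd_continuous C1c_continuous assms)
qed

lemma C1c_cmult:
  assumes "C1c f"
  shows "C1c (\<lambda>x. c * f x)" "pd (\<lambda>x. c * f x) v x = c * pd f v x"
proof -
  have d: "((\<lambda>x. c * f x) has_derivative (\<lambda>v. c * pd f v x)) (at x)" for x
    using assms by (intro has_derivative_mult_right C1c_has_derivative)
  show "pd (\<lambda>x. c * f x) v x = c * pd f v x"
    by (rule fun_cong[OF frechet_derivative_at[OF d, symmetric]])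
  have "bounded {x. f x \<noteq> 0}" using assms by (simp add: C1c_def)
  then have b: "bounded {x. c * f x \<noteq> 0}"
    by (rule bounded_subset) auto
  show "C1c (\<lambda>x. c * f x)"
    by (rule C1cI[OF d _ b]) (intro continuous_on_mult continuous_on_const C1c_pd_continuous assms)
qed

lemma C1c_scaleR:
  fixes v :: "'a::euclidean_space"
  assumes "C1c f"
  shows "C1_compact_support (\<lambda>x. f x *\<^sub>R v)" "divergence (\<lambda>x. f x *\<^sub>R v) x = pd f v x"
proof -
  have d: "((\<lambda>x. f x *\<^sub>R v) has_derivative (\<lambda>w. pd f w x *\<^sub>R v)) (at x)" for x
    using assms by (intro has_derivative_scaleR_left C1c_has_derivative)
  have fd: "frechet_derivative (\<lambda>x. f x *\<^sub>R v) (at x) = (\<lambda>w. pd f w x *\<^sub>R v)" for x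
    by (rule frechet_derivative_at[OF d, symmetric])
  have "bounded {x. f x \<noteq> 0}" using assms by (simp add: C1c_def)
  then have "compact (closure {x. f x *\<^sub>R v \<noteq> 0})"
    by (auto intro: bounded_subset)
  then show "C1_compact_support (\<lambda>x. f x *\<^sub>R v)"
    using assms d unfolding C1_compact_support_def fd
    by (auto intro!: continuous_on_scaleR simp: C1c_pd_continuous differentiable_def)
  have "divergence (\<lambda>x. f x *\<^sub>R v) x = (\<Sum>b\<in>Basis. (v \<bullet> b) *\<^sub>R pd f b x)"
    by (simp add: divergence_def fd mult.commute)
  also have "\<dots> = pd f (\<Sum>b\<in>Basis. (v \<bullet> b) *\<^sub>R b) x"
    using C1c_linear[OF assms, of x] by (simp add: linear_sum linear_cmul)
  finally show "divergence (\<lambda>x. f x *\<^sub>R v) x = pd f v x"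
    by (simp add: euclidean_representation)
qed

lemma C1_compact_support_component:
  fixes T :: "'a::euclidean_space \<Rightarrow> 'a"
  assumes "C1_compact_support T"
  shows "C1c (\<lambda>x. T x \<bullet> b)" "pd (\<lambda>x. T x \<bullet> b) v x = frechet_derivative T (at x) v \<bullet> b"
proof -
  have d: "((\<lambda>x. T x \<bullet> b) has_derivative (\<lambda>w. frechet_derivative T (at x) w \<bullet> b)) (at x)" for x
    using assms by (intro has_derivative_inner_left)
      (simp add: C1_compact_support_def frechet_derivative_works[symmetric])
  show "pd (\<lambda>x. T x \<bullet> b) v x = frechet_derivative T (at x) v \<bullet> b"
    by (rule fun_cong[OF frechet_derivative_at[OF d, symmetric]])
  have "bounded {x. T x \<noteq> 0}" using assms by (simp add: C1_compact_support_def)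
  then have "bounded {x. T x \<bullet> b \<noteq> 0}"
    by (rule bounded_subset) auto
  then show "C1c (\<lambda>x. T x \<bullet> b)"
    using assms by (intro C1cI[OF d]) (auto intro!: continuous_on_inner simp: C1_compact_support_def)
qed

lemma divergence_eq_sum_pd:
  assumes "C1_compact_support T"
  shows "divergence T x = (\<Sum>b\<in>Basis. pd (\<lambda>x. T x \<bullet> b) b x)"
  by (simp add: divergence_def C1_compact_support_component[OF assms])

lemma C1c_bounded:
  fixes f :: "'a::euclidean_space \<Rightarrow> real"
  assumes "C1c f"
  obtains M where "0 < M" "\<And>x. \<bar>f x\<bar> \<le> M" "\<And>x. \<bar>pd f v x\<bar> \<le> M"
proof -
  obtain r where r: "\<And>x. r \<le> norm x \<Longrightarrow> f x = 0" "\<And>x v. r \<le> norm x \<Longrightarrow> pd f v x = 0"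
    using C1c_support[OF assms(1)] by metis
  obtain A B where A: "0 < A" "\<And>x. \<bar>f x\<bar> \<le> A" and B: "\<And>x. \<bar>pd f v x\<bar> \<le> B"
    using bounded_cts_compact_support[OF C1c_continuous[OF assms] r(1)]
      bounded_cts_compact_support[OF C1c_pd_continuous[OF assms, of v] r(2)] by metis
  show thesis
    using A B by (intro that[of "max A B"]) (auto simp: le_max_iff_disj)
qed

section \<open>Directional difference quotients\<close>

lemma C1c_along_line:
  assumes "C1c f"
  shows "((\<lambda>s. f (z + s *\<^sub>R v)) has_real_derivative pd f v (z + s *\<^sub>R v)) (at s within S)"
proof -
  have "((\<lambda>s. f (z + s *\<^sub>R v)) has_derivative (\<lambda>h. pd f (h *\<^sub>R v) (z + s *\<^sub>R v))) (at s)"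
    by (rule has_derivative_compose[of "\<lambda>s. z + s *\<^sub>R v" "\<lambda>h. h *\<^sub>R v", OF _ C1c_has_derivative[OF assms]])
      (auto intro!: derivative_eq_intros)
  moreover have "(\<lambda>h. pd f (h *\<^sub>R v) (z + s *\<^sub>R v)) = (*) (pd f v (z + s *\<^sub>R v))"
    using linear_cmul[OF C1c_linear[OF assms, of "z + s *\<^sub>R v"], of _ v] by (auto simp: mult.commute)
  ultimately show ?thesis
    by (simp add: has_field_derivative_def has_derivative_at_withinI)
qed

lemma C1c_diff_bound:
  assumes "C1c f" "\<And>x. \<bar>pd f v x\<bar> \<le> M"
  shows "\<bar>f (z + t *\<^sub>R v) - f z\<bar> \<le> M * \<bar>t\<bar>"
proof -
  have "norm ((\<lambda>s. f (z + s *\<^sub>R v)) t - (\<lambda>s. f (z + s *\<^sub>R v)) 0) \<le> M * norm (t - 0)"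
    by (rule field_differentiable_bound[of UNIV _ "\<lambda>s. pd f v (z + s *\<^sub>R v)"])
      (auto intro!: C1c_along_line assms)
  then show ?thesis by simp
qed

lemma C1c_diff_quotient_tendsto_at:
  fixes f :: "'a::euclidean_space \<Rightarrow> real"
  assumes "C1c f" "S \<in> sets borel"
  shows "((\<lambda>t. LINT z:S|lborel. (f (z + t *\<^sub>R v) - f z) / t) \<longlongrightarrow> (LINT z:S|lborel. pd f v z)) (at 0)"
proof -
  obtain r where r: "0 < r" "\<And>x. r \<le> norm x \<Longrightarrow> f x = 0"
    using C1c_support[OF assms(1)] by metis
  obtain M where M: "0 < M" "\<And>x. \<bar>pd f v x\<bar> \<le> M"
    using C1c_bounded[OF assms(1)] by metis
  note [measurable] = C1c_borel[OF assms(1)] C1c_pd_borel[OF assms(1)] assms(2)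
  \<comment> \<open>With |t| \<le> 1 all shifted supports lie in one ball of radius
    \<open>r + norm v\<close>, which yields a single dominating function. Since 0 is interior to
    {-1..1}, the restriction disappears in the limit.\<close>
  have "((\<lambda>t. LINT z:S|lborel. (f (z + t *\<^sub>R v) - f z) / t) \<longlongrightarrow> (LINT z:S|lborel. pd f v z)) (at 0 within {-1..1})"
    unfolding tendsto_at_iff_sequentially comp_def set_lebesgue_integral_def
  proof (intro allI impI)
    fix X :: "nat \<Rightarrow> real" assume X: "\<forall>i. X i \<in> {-1..1} - {0}" "X \<longlonglongrightarrow> 0"
    show "(\<lambda>n. LINT z|lborel. indicat_real S z *\<^sub>R ((f (z + X n *\<^sub>R v) - f z) / X n))
       \<longlonglongrightarrow> (LINT z|lborel. indicat_real S z *\<^sub>R pd f v z)"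
    proof (rule integral_dominated_convergence[where w="\<lambda>z. M * indicator (cball 0 (r + norm v)) z"])
      show "AE z in lborel. (\<lambda>n. indicat_real S z *\<^sub>R ((f (z + X n *\<^sub>R v) - f z) / X n))
          \<longlonglongrightarrow> indicat_real S z *\<^sub>R pd f v z"
      proof (rule AE_I2)
        fix z
        have "((\<lambda>s. (f (z + (0 + s) *\<^sub>R v) - f (z + 0 *\<^sub>R v)) / s) \<longlongrightarrow> pd f v (z + 0 *\<^sub>R v)) (at 0)"
          using C1c_along_line[OF assms(1), of z v 0 UNIV] by (simp only: DERIV_def)
        moreover have "filterlim X (at 0) sequentially"
          unfolding filterlim_at using X by (auto simp: eventually_sequentially)
        ultimately have "(\<lambda>n. (f (z + X n *\<^sub>R v) - f z) / X n) \<longlonglongrightarrow> pd f v z"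
          using filterlim_compose by fastforce
        then show "(\<lambda>n. indicat_real S z *\<^sub>R ((f (z + X n *\<^sub>R v) - f z) / X n))
          \<longlonglongrightarrow> indicat_real S z *\<^sub>R pd f v z"
          by (intro tendsto_intros)
      qed
      show "AE x in lborel. norm (indicat_real S x *\<^sub>R ((f (x + X n *\<^sub>R v) - f x) / X n))
                \<le> M * indicator (cball 0 (r + norm v)) x" for n
      proof (rule AE_I2)
        fix z
        let ?t = "X n"
        have t: "?t \<noteq> 0" "\<bar>?t\<bar> \<le> 1" using spec[OF X(1), of n] by auto
        have b: "\<bar>(f (z + ?t *\<^sub>R v) - f z) / ?t\<bar> \<le> M"
          unfolding abs_divide using C1c_diff_bound[OF assms(1) M(2), of z ?t] t
          by (subst pos_divide_le_eq) auto
        have z: "(f (z + ?t *\<^sub>R v) - f z) / ?t = 0" if "z \<notin> cball 0 (r + norm v)"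
        proof -
          have "norm (?t *\<^sub>R v) \<le> norm v" using t mult_left_le_one_le[of "norm v" "\<bar>?t\<bar>"] by simp
          then have "r \<le> norm (z + ?t *\<^sub>R v)" using that norm_diff_ineq[of z "?t *\<^sub>R v"] by auto
          moreover have "r \<le> norm z" using that norm_ge_zero[of v] unfolding mem_cball_0 by linarith
          ultimately show ?thesis using r(2) by simp
        qed
        show "norm (indicat_real S z *\<^sub>R ((f (z + ?t *\<^sub>R v) - f z) / ?t))
                \<le> M * indicator (cball 0 (r + norm v)) z"
        proof (cases "z \<in> cball 0 (r + norm v)")
          case True
          then show ?thesis using b M(1) by (auto simp: indicator_def)
        next
          case False
          then show ?thesis using z[OF False] by (simp only:) simp
        qed
      qed
      show "integrable lborel (\<lambda>z::'a. M * indicator (cball 0 (r + norm v)) z)"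
        using emeasure_lborel_cball_finite[of "0::'a" "r + norm v"]
        by (intro integrable_mult_right integrable_real_indicator) auto
    qed measurable
  qed
  moreover have "at (0::real) within {-1..1} = at 0"
    by (rule at_within_interior) simp
  ultimately show ?thesis by simp
qed

lemma C1c_diff_quotient_tendsto:
  fixes f :: "'a::euclidean_space \<Rightarrow> real"
  assumes "C1c f" "S \<in> sets borel"
  shows "(\<lambda>n. LINT z:S|lborel. (f (z + (1 / Suc n) *\<^sub>R v) - f z) / (1 / Suc n))
     \<longlonglongrightarrow> (LINT z:S|lborel. pd f v z)"
proof (rule filterlim_compose[OF C1c_diff_quotient_tendsto_at[OF assms]])
  show "filterlim (\<lambda>n. 1 / real (Suc n)) (at 0) sequentially"
    unfolding filterlim_at using LIMSEQ_Suc[OF lim_1_over_n[where 'a=real]] by auto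
qed

lemma C1c_translate:
  assumes "C1c f"
  shows "C1c (\<lambda>y. f (y - c))" "pd (\<lambda>y. f (y - c)) v y = pd f v (y - c)"
proof -
  have d: "((\<lambda>y. f (y - c)) has_derivative (\<lambda>v. pd f v (y - c))) (at y)" for y
    by (rule has_derivative_compose[of "\<lambda>y. y - c" "\<lambda>v. v", OF _ C1c_has_derivative[OF assms]])
      (auto intro!: derivative_eq_intros)
  show "pd (\<lambda>y. f (y - c)) v y = pd f v (y - c)"
    by (rule fun_cong[OF frechet_derivative_at[OF d, symmetric]])
  have "bounded ((+) c ` {y. f y \<noteq> 0})"
    by (rule bounded_translation) (use assms in \<open>simp add: C1c_def\<close>)
  then have b: "bounded {y. f (y - c) \<noteq> 0}"
    by (rule bounded_subset) (auto intro!: image_eqI[of _ _ "_ - c"])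
  show "C1c (\<lambda>y. f (y - c))"
    by (rule C1cI[OF d _ b])
      (intro continuous_on_compose2[OF C1c_pd_continuous[OF assms]] continuous_intros, auto)
qed

lemma lborel_integral_translate:
  fixes f :: "'a::euclidean_space \<Rightarrow> real"
  assumes "f \<in> borel_measurable borel"
  shows "(LINT z|lborel. f (z + c)) = (LINT z|lborel. f z)"
proof -
  have "(LINT z|lborel. f z) = (LINT z|distr lborel borel ((+) c). f z)"
    by (simp add: lborel_distr_plus)
  also have "\<dots> = (LINT z|lborel. f (z + c))"
    using assms by (subst integral_distr) (auto simp: add.commute)
  finally show ?thesis ..
qed

text \<open>Every difference quotient integrates to 0 by translation invariance. This later lets a
  flux be computed from either side of the boundary.\<close>

lemma C1c_integral_pd_UNIV:
  assumes "C1c f"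
  shows "(LINT z|lborel. pd f v z) = 0"
proof -
  have "(LINT z:UNIV|lborel. (f (z + (1 / Suc n) *\<^sub>R v) - f z) / (1 / Suc n)) = 0" for n
  proof -
    have "integrable lborel (\<lambda>z. f (z + (1 / Suc n) *\<^sub>R v))"
      using C1c_integrable_lborel(1)[OF assms] integrable_distr_eq[of "\<lambda>z. z + (1 / Suc n) *\<^sub>R v" lborel borel f]
        C1c_borel[OF assms] lborel_distr_plus[of "(1 / Suc n) *\<^sub>R v"] by (simp add: add.commute[of _ "_ *\<^sub>R v"])
    then show ?thesis
      unfolding set_lebesgue_integral_def
      using lborel_integral_translate[OF C1c_borel[OF assms], of "(1 / Suc n) *\<^sub>R v"] C1c_integrable_lborel(1)[OF assms]
      by simp
  qed
  then show ?thesis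
    using C1c_diff_quotient_tendsto[OF assms, of UNIV v] LIMSEQ_unique[OF _ tendsto_const]
    by (simp add: set_lebesgue_integral_def)
qed

text \<open>A C^1 mollifier with a polynomial formula: squaring the positive part removes the kink
  on the sphere of radius t. It is not normalised; its height is t^4, its gradient at most 4 t^3 and
  its mass comparable to t^(n+4). The mass is divided out in \<open>profile\<close>.\<close>

definition bump :: "real \<Rightarrow> 'a::euclidean_space \<Rightarrow> real" where
  "bump t z = (max 0 (t\<^sup>2 - (norm z)\<^sup>2))\<^sup>2"

lemma has_derivative_max_square:
  "((\<lambda>u::real. (max 0 u)\<^sup>2) has_real_derivative 2 * max 0 u) (at u)"
proof (cases u "0::real" rule: linorder_cases)
  case less
  have "((\<lambda>u::real. 0) has_real_derivative 0) (at u)" by simp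
  then have "((\<lambda>u::real. (max 0 u)\<^sup>2) has_real_derivative 0) (at u)"
    by (rule has_field_derivative_transform_within_open[where S="{..<0}"]) (use less in auto)
  then show ?thesis using less by simp
next
  case equal
  \<comment> \<open>At the kink u = 0 the Caratheodory slope function is \<open>max 0\<close>
    itself, because (max 0 z)^2 = max 0 z * z for every z.\<close>
  have "\<exists>g. (\<forall>z. (max 0 z)\<^sup>2 - (max 0 u)\<^sup>2 = g z * (z - u)) \<and> isCont g u \<and> g u = 2 * max 0 u"
    using equal by (intro exI[of _ "max 0"]) (auto simp: power2_eq_square max_def intro!: continuous_intros)
  then show ?thesis by (simp only: CARAT_DERIV)
next
  case greater
  have "((\<lambda>u::real. u\<^sup>2) has_real_derivative 2 * u) (at u)"
    by (auto intro!: derivative_eq_intros)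
  then have "((\<lambda>u::real. (max 0 u)\<^sup>2) has_real_derivative 2 * u) (at u)"
    by (rule has_field_derivative_transform_within_open[where S="{0<..}"]) (use greater in auto)
  then show ?thesis using greater by simp
qed

lemma bump_nonneg [simp]: "0 \<le> bump t z"
  by (simp add: bump_def)

lemma bump_eq_0: "0 \<le> t \<Longrightarrow> t \<le> norm z \<Longrightarrow> bump t z = 0"
  by (simp add: bump_def)

lemma bump_pos: "norm z < t \<Longrightarrow> 0 < bump t z"
  using power_strict_mono[of "norm z" t 2] unfolding bump_def by simp

lemma bump_le: "bump t z \<le> t ^ 4"
proof -
  have "(max 0 (t\<^sup>2 - (norm z)\<^sup>2))\<^sup>2 \<le> (t\<^sup>2)\<^sup>2"
    by (intro power_mono) auto
  then show ?thesis by (simp add: bump_def flip: power_mult)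
qed

lemma bump_ge:
  assumes "norm z \<le> t / 2"
  shows "t ^ 4 / 2 \<le> bump t z"
proof -
  have "(norm z)\<^sup>2 \<le> (t / 2)\<^sup>2" by (intro power_mono assms) auto
  then have "3 / 4 * t\<^sup>2 \<le> t\<^sup>2 - (norm z)\<^sup>2" by (simp add: power_divide)
  then have *: "3 / 4 * t\<^sup>2 \<le> max 0 (t\<^sup>2 - (norm z)\<^sup>2)" by (rule max.coboundedI2)
  have "(3 / 4 * t\<^sup>2)\<^sup>2 \<le> bump t z"
    unfolding bump_def by (intro power_mono *) auto
  then have "9 / 16 * t ^ 4 \<le> bump t z" by (simp add: power_mult_distrib power2_eq_square power4_eq_xxxx)
  moreover have "0 \<le> t ^ 4" by simp
  ultimately show ?thesis by linarith
qed

lemma bump_commute: "bump t (y - z) = bump t (z - y)"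
  by (simp add: bump_def norm_minus_commute)

lemma bump_borel [measurable]: "bump t \<in> borel_measurable borel"
  unfolding bump_def by measurable

lemma bump_C1c:
  shows "C1c (\<lambda>y. bump t (y - z))"
    and "pd (\<lambda>y. bump t (y - z)) v y = - 4 * max 0 (t\<^sup>2 - (norm (y - z))\<^sup>2) * ((y - z) \<bullet> v)"
proof -
  have d: "((\<lambda>y. bump t (y - z)) has_derivative
      (\<lambda>v. - 4 * max 0 (t\<^sup>2 - (norm (y - z))\<^sup>2) * ((y - z) \<bullet> v))) (at y)" for y
  proof -
    have 1: "((\<lambda>y. t\<^sup>2 - (y - z) \<bullet> (y - z)) has_derivative (\<lambda>v. - 2 * ((y - z) \<bullet> v))) (at y)"
      by (rule derivative_eq_intros refl | simp add: inner_commute)+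
    have 2: "((\<lambda>u::real. (max 0 u)\<^sup>2) has_derivative (*) (2 * max 0 u)) (at u)" for u
      using has_derivative_max_square[of u] by (simp add: has_field_derivative_def)
    show ?thesis
      using has_derivative_compose[OF 1 2]
      by (simp add: bump_def power2_norm_eq_inner mult.assoc mult.left_commute)
  qed
  have "{y. bump t (y - z) \<noteq> 0} \<subseteq> cball z \<bar>t\<bar>"
  proof
    fix y assume "y \<in> {y. bump t (y - z) \<noteq> 0}"
    then have "(norm (y - z))\<^sup>2 < t\<^sup>2" by (auto simp: bump_def max_def split: if_splits)
    then have "norm (y - z) < \<bar>t\<bar>" by (metis abs_norm_cancel not_le abs_le_square_iff)
    then show "y \<in> cball z \<bar>t\<bar>" by (simp add: dist_norm norm_minus_commute)
  qed
  then have "bounded {y. bump t (y - z) \<noteq> 0}"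
    using bounded_cball bounded_subset by blast
  then show "C1c (\<lambda>y. bump t (y - z))"
    by (intro C1cI[OF d]) (auto intro!: continuous_intros)
  show "pd (\<lambda>y. bump t (y - z)) v y = - 4 * max 0 (t\<^sup>2 - (norm (y - z))\<^sup>2) * ((y - z) \<bullet> v)"
    by (rule fun_cong[OF frechet_derivative_at[OF d, symmetric]])
qed

lemma bump_pd_bound:
  assumes "0 \<le> t"
  shows "\<bar>pd (\<lambda>y. bump t (y - z)) v y\<bar> \<le> 4 * t ^ 3 * norm v * indicator (ball z t) y"
proof (cases "y \<in> ball z t")
  case True
  then have n: "norm (y - z) \<le> t" by (simp add: dist_norm norm_minus_commute)
  have "\<bar>max 0 (t\<^sup>2 - (norm (y - z))\<^sup>2) * ((y - z) \<bullet> v)\<bar> \<le> t\<^sup>2 * (t * norm v)"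
    unfolding abs_mult
  proof (rule mult_mono)
    show "\<bar>(y - z) \<bullet> v\<bar> \<le> t * norm v"
      using Cauchy_Schwarz_ineq2[of "y - z" v] mult_right_mono[OF n norm_ge_zero[of v]] by linarith
  qed auto
  then show ?thesis
    using True by (simp add: bump_C1c(2) abs_mult power3_eq_cube power2_eq_square mult.assoc)
next
  case False
  then have "t\<^sup>2 \<le> (norm (y - z))\<^sup>2"
    using assms by (intro power_mono) (auto simp: dist_norm norm_minus_commute)
  then show ?thesis using False by (simp add: bump_C1c(2))
qed

definition bump_mass :: "'a::euclidean_space itself \<Rightarrow> real \<Rightarrow> real" where
  "bump_mass _ t = (LINT z|lborel. bump t (z::'a))"

lemma bump_integrable: "integrable lborel (\<lambda>y. bump t (y - z))" "integrable lborel (\<lambda>y. bump t (z - y))"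
  using C1c_integrable_lborel(1)[OF bump_C1c(1)[of t z]] by (simp_all add: bump_commute)

lemma bump_mass_translate:
  fixes z :: "'a::euclidean_space"
  shows "(LINT y|lborel. bump t (y - z)) = bump_mass TYPE('a) t"
  unfolding bump_mass_def using lborel_integral_translate[of "bump t" "- z"] by simp

lemma bump_mass_bounds:
  assumes "0 < t"
  shows "t ^ 4 / 2 * (unit_ball_vol (real DIM('a)) * (t / 2) ^ DIM('a)) \<le> bump_mass TYPE('a::euclidean_space) t"
    and "bump_mass TYPE('a) t \<le> t ^ 4 * (unit_ball_vol (real DIM('a)) * t ^ DIM('a))"
proof -
  have i: "integrable lborel (\<lambda>z. indicat_real (ball (0::'a) s) z)" for s
    using emeasure_lborel_ball_finite[of "0::'a" s] by (intro integrable_real_indicator) auto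
  have "(LINT z|lborel. t ^ 4 / 2 * indicator (ball (0::'a) (t/2)) z) \<le> (LINT z|lborel. bump t (z::'a))"
  proof (rule integral_mono)
    show "t ^ 4 / 2 * indicator (ball (0::'a) (t/2)) z \<le> bump t z" for z :: 'a
      using bump_ge[of z t] by (cases "z \<in> ball 0 (t/2)") auto
  qed (use bump_integrable(1)[of t "0::'a"] i in auto)
  then show "t ^ 4 / 2 * (unit_ball_vol (real DIM('a)) * (t / 2) ^ DIM('a)) \<le> bump_mass TYPE('a) t"
    using assms by (simp add: bump_mass_def content_ball)
  have "(LINT z|lborel. bump t (z::'a)) \<le> (LINT z|lborel. t ^ 4 * indicator (ball (0::'a) t) z)"
  proof (rule integral_mono)
    show "bump t z \<le> t ^ 4 * indicator (ball (0::'a) t) z" for z :: 'a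
      using bump_le[of t z] bump_eq_0[of t z] assms by (cases "z \<in> ball 0 t") auto
  qed (use bump_integrable(1)[of t "0::'a"] i in auto)
  then show "bump_mass TYPE('a) t \<le> t ^ 4 * (unit_ball_vol (real DIM('a)) * t ^ DIM('a))"
    using assms by (simp add: bump_mass_def content_ball)
qed

lemma bump_mass_pos: "0 < t \<Longrightarrow> 0 < bump_mass TYPE('a::euclidean_space) t"
proof -
  assume "0 < t"
  then have "0 < t ^ 4 / 2 * (unit_ball_vol (real DIM('a)) * (t / 2) ^ DIM('a))" by simp
  then show ?thesis using bump_mass_bounds(1)[OF \<open>0 < t\<close>, where 'a='a] by linarith
qed

section \<open>Surface measure and the volume of tubes\<close>

text \<open>A box with one side 3 t and n - 1 sides 2 e has volume 3 t 4^(n-1) (e/2)^(n-1), and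
  \<open>hausdorff_size\<close> of a set of diameter e is \<open>unit_ball_vol\<close> times
  (e/2)^(n-1).\<close>

definition tube_const :: "'a::euclidean_space itself \<Rightarrow> real" where
  "tube_const _ = 3 * 4 ^ (DIM('a) - 1) / unit_ball_vol (real (DIM('a) - 1))"

lemma tube_const_pos: "0 < tube_const TYPE('a::euclidean_space)"
  by (simp add: tube_const_def)

text \<open>Sweeping a set of diameter e \<le> t along a coordinate segment of length t lengthens
  only one side of the cube of side 2 e around one of its points. The volume is therefore linear in
  t and of order n - 1 in e, like one term of a Hausdorff covering sum.\<close>

lemma segment_sum_cbox:
  fixes C :: "'a::euclidean_space set"
  assumes b: "b \<in> Basis" and t: "0 < t" and d: "ediam C \<le> ennreal t" and n: "2 \<le> DIM('a)"
  shows "\<exists>u v. {z. \<exists>s\<in>{0..t}. z - s *\<^sub>R b \<in> C} \<subseteq> cbox u v \<and>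
     emeasure lborel (cbox u v) \<le> ennreal (tube_const TYPE('a) * t) * hausdorff_size (DIM('a) - 1) C"
proof (cases "C = {}")
  case True
  then show ?thesis by (intro exI[of _ "0::'a"]) (simp add: hausdorff_size_def)
next
  case False
  then obtain c where c: "c \<in> C" by auto
  define e where "e = enn2real (ediam C)"
  have e: "ediam C = ennreal e" "0 \<le> e" "e \<le> t"
    using d t by (auto simp: e_def ennreal_enn2real_if top_unique enn2real_leI split: if_splits)
  define u where "u = c - e *\<^sub>R One"
  define v where "v = c + e *\<^sub>R One + t *\<^sub>R b"
  have "{z. \<exists>s\<in>{0..t}. z - s *\<^sub>R b \<in> C} \<subseteq> cbox u v"
  proof (intro subsetI, unfold mem_box mem_Collect_eq, intro ballI)
    fix z i assume "\<exists>s\<in>{0..t}. z - s *\<^sub>R b \<in> C" and i: "i \<in> (Basis :: 'a set)"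
    then obtain s where s: "0 \<le> s" "s \<le> t" and z: "z - s *\<^sub>R b \<in> C" by auto
    have "ennreal (dist (z - s *\<^sub>R b) c) \<le> ennreal e"
      using dist_le_ediam[OF z c] e(1) by simp
    then have "norm (z - s *\<^sub>R b - c) \<le> e" using e(2) by (simp add: dist_norm)
    then have "\<bar>(z - s *\<^sub>R b - c) \<bullet> i\<bar> \<le> e" using Basis_le_norm[OF i, of "z - s *\<^sub>R b - c"] by linarith
    then have "\<bar>z \<bullet> i - s * (b \<bullet> i) - c \<bullet> i\<bar> \<le> e" by (simp add: inner_diff_left)
    moreover have "0 \<le> s * (b \<bullet> i)" "s * (b \<bullet> i) \<le> t * (b \<bullet> i)"
      using s b i t by (auto simp: inner_Basis)
    ultimately show "u \<bullet> i \<le> z \<bullet> i \<and> z \<bullet> i \<le> v \<bullet> i"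
      using i by (simp add: u_def v_def inner_diff_left inner_add_left) linarith
  qed
  moreover have "emeasure lborel (cbox u v) \<le> ennreal (tube_const TYPE('a) * t) * hausdorff_size (DIM('a) - 1) C"
  proof -
    let ?k = "DIM('a) - 1"
    have k: "DIM('a) = Suc ?k" using n by auto
    have "emeasure lborel (cbox u v) = ennreal (\<Prod>i\<in>Basis. (v - u) \<bullet> i)"
      using e(2) t b by (subst emeasure_lborel_cbox_eq)
        (auto simp: u_def v_def inner_diff_left inner_add_left inner_Basis)
    also have "(\<Prod>i\<in>Basis. (v - u) \<bullet> i) = (\<Prod>i\<in>Basis. 2 * e + (if i = b then t else 0))"
      by (intro prod.cong) (auto simp: u_def v_def inner_diff_left inner_add_left inner_Basis b)
    also have "\<dots> = (2 * e + t) * (\<Prod>i\<in>Basis - {b}. 2 * e)"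
      using b by (subst prod.remove[of _ b]) auto
    also have "\<dots> = (2 * e + t) * (2 * e) ^ ?k"
      using b by (simp add: card_Diff_singleton)
    also have "\<dots> \<le> (3 * t) * (2 * e) ^ ?k"
      using e by (intro mult_right_mono) auto
    also have "\<dots> = tube_const TYPE('a) * t * (unit_ball_vol (real ?k) * (e / 2) ^ ?k)"
    proof -
      have "(2 * e) ^ ?k = 4 ^ ?k * (e / 2) ^ ?k" by (subst power_mult_distrib[symmetric]) simp
      moreover have "unit_ball_vol (real ?k) \<noteq> 0"
        using unit_ball_vol_pos[OF of_nat_0_le_iff, of ?k] by (metis less_irrefl)
      ultimately show ?thesis by (simp add: tube_const_def del: of_nat_diff)
    qed
    also have "ennreal \<dots> = ennreal (tube_const TYPE('a) * t) * hausdorff_size ?k C"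
    proof -
      have "ediam C / 2 = ennreal (e / 2)"
        using divide_ennreal[OF e(2), of 2] by (simp add: e(1))
      then have "hausdorff_size ?k C = ennreal (unit_ball_vol (real ?k)) * ennreal (e / 2) ^ ?k"
        using False by (simp add: hausdorff_size_def)
      also have "\<dots> = ennreal (unit_ball_vol (real ?k) * (e / 2) ^ ?k)"
        using e(2) by (simp add: ennreal_mult ennreal_power del: of_nat_diff)
      finally show ?thesis
        using e(2) t tube_const_pos[where 'a='a] by (simp only:) (subst ennreal_mult, auto)
    qed
    finally show ?thesis by (simp add: ennreal_leI)
  qed
  ultimately show ?thesis by blast
qed

text \<open>Covering \<open>A\<close> by sets of diameter at most t and sweeping each of them bounds
  the tube by the Hausdorff content at scale t, which is below the Hausdorff measure. The tube need
  not be Borel, so the bound is carried by a Borel hull.\<close>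

lemma tube_outer_measure:
  fixes A :: "'a::euclidean_space set"
  assumes b: "b \<in> Basis" and t: "0 < t" and n: "2 \<le> DIM('a)"
  shows "\<exists>W\<in>sets borel. {z. \<exists>s\<in>{0..t}. z - s *\<^sub>R b \<in> A} \<subseteq> W \<and>
     emeasure lborel W \<le> ennreal (tube_const TYPE('a) * t) * hausdorff_outer (DIM('a) - 1) A"
proof -
  let ?S = "{z. \<exists>s\<in>{0..t}. z - s *\<^sub>R b \<in> A}" and ?c = "ennreal (tube_const TYPE('a) * t)"
  have c: "?c \<noteq> 0" "?c \<noteq> \<infinity>" using t tube_const_pos[where 'a='a] by auto
  \<comment> \<open>The content is an infimum over coverings; after division by the constant the
    claim is a lower bound that can be checked covering by covering.\<close>
  have "outer_measure_of lborel ?S / ?c \<le> hausdorff_content (DIM('a) - 1) t A"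
    unfolding hausdorff_content_def
  proof (rule INF_greatest, clarify)
    fix C :: "nat \<Rightarrow> 'a set"
    assume C: "A \<subseteq> \<Union> (range C)" "\<forall>i. ediam (C i) \<le> ennreal t"
    have "\<forall>i. \<exists>u v. {z. \<exists>s\<in>{0..t}. z - s *\<^sub>R b \<in> C i} \<subseteq> cbox u v \<and>
      emeasure lborel (cbox u v) \<le> ?c * hausdorff_size (DIM('a) - 1) (C i)"
      by (rule allI, rule segment_sum_cbox[OF b t spec[OF C(2)] n])
    then have "\<exists>u v. \<forall>i. {z. \<exists>s\<in>{0..t}. z - s *\<^sub>R b \<in> C i} \<subseteq> cbox (u i) (v i) \<and>
      emeasure lborel (cbox (u i) (v i)) \<le> ?c * hausdorff_size (DIM('a) - 1) (C i)"
      by (simp only: choice_iff)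
    then obtain u v where *: "\<forall>i. {z. \<exists>s\<in>{0..t}. z - s *\<^sub>R b \<in> C i} \<subseteq> cbox (u i) (v i) \<and>
      emeasure lborel (cbox (u i) (v i)) \<le> ?c * hausdorff_size (DIM('a) - 1) (C i)"
      by blast
    have uv: "{z. \<exists>s\<in>{0..t}. z - s *\<^sub>R b \<in> C i} \<subseteq> cbox (u i) (v i)"
      "emeasure lborel (cbox (u i) (v i)) \<le> ?c * hausdorff_size (DIM('a) - 1) (C i)" for i
      using * by simp_all
    have "?S \<subseteq> (\<Union>i. cbox (u i) (v i))" using C(1) uv(1) by blast
    then have "outer_measure_of lborel ?S \<le> emeasure lborel (\<Union>i. cbox (u i) (v i))"
      unfolding outer_measure_of_def by (intro INF_lower) auto
    also have "\<dots> \<le> (\<Sum>i. emeasure lborel (cbox (u i) (v i)))"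
      by (rule emeasure_subadditive_countably) auto
    also have "\<dots> \<le> (\<Sum>i. ?c * hausdorff_size (DIM('a) - 1) (C i))"
      by (intro suminf_le uv) auto
    finally have "outer_measure_of lborel ?S \<le> ?c * (\<Sum>i. hausdorff_size (DIM('a) - 1) (C i))"
      by simp
    then show "outer_measure_of lborel ?S / ?c \<le> (\<Sum>i. hausdorff_size (DIM('a) - 1) (C i))"
      using c by (intro divide_le_posI_ennreal) (auto simp: zero_less_iff_neq_zero)
  qed
  also have "\<dots> \<le> hausdorff_outer (DIM('a) - 1) A"
    unfolding hausdorff_outer_def using t by (intro SUP_upper) auto
  finally have "outer_measure_of lborel ?S / ?c * ?c \<le> hausdorff_outer (DIM('a) - 1) A * ?c"
    by (rule mult_right_mono) auto
  then have "outer_measure_of lborel ?S \<le> ?c * hausdorff_outer (DIM('a) - 1) A"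
    using c by (simp only: ennreal_divide_times)
      (simp add: less_top mult.commute del: ennreal_eq_0_iff)
  moreover obtain W where "W \<in> sets lborel" "?S \<subseteq> W" "outer_measure_of lborel ?S = emeasure lborel W"
    using outer_measure_of_attain[of ?S lborel] by auto
  ultimately show ?thesis by auto
qed

definition surface_measure :: "'a::euclidean_space set \<Rightarrow> 'a measure" where
  "surface_measure F = density (hausdorff_measure (DIM('a) - 1)) (indicator F)"

lemma sets_surface_measure [simp, measurable_cong]: "sets (surface_measure F) = sets borel"
  by (simp add: surface_measure_def)

lemma space_surface_measure [simp]: "space (surface_measure F) = UNIV"
  by (simp add: surface_measure_def)

lemma emeasure_surface_measure:
  fixes F :: "'a::euclidean_space set"
  assumes "closed F" "A \<in> sets borel"
  shows "emeasure (surface_measure F) A = emeasure (hausdorff_measure (DIM('a) - 1)) (F \<inter> A)"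
    and "emeasure (surface_measure F) A = hausdorff_outer (DIM('a) - 1) (F \<inter> A)"
proof -
  have "(\<integral>\<^sup>+x. indicator F x * indicator A x \<partial>hausdorff_measure (DIM('a) - 1)) =
      (\<integral>\<^sup>+x. indicator (F \<inter> A) x \<partial>hausdorff_measure (DIM('a) - 1))"
    by (intro nn_integral_cong) (simp add: indicator_def)
  then show *: "emeasure (surface_measure F) A = emeasure (hausdorff_measure (DIM('a) - 1)) (F \<inter> A)"
    unfolding surface_measure_def using assms
    by (subst emeasure_density) (auto intro!: borel_measurable_indicator)
  show "emeasure (surface_measure F) A = hausdorff_outer (DIM('a) - 1) (F \<inter> A)"
    unfolding * using assms by (intro emeasure_hausdorff_measure) auto
qed

text \<open>A set lies in its own tubes, and for finite (n-1)-measure the volume of the tube of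
  length t is at most a constant times t.\<close>

lemma lborel_null_of_locally_finite_surface:
  fixes F :: "'a::euclidean_space set"
  assumes F: "closed F" and fin: "\<And>K. compact K \<Longrightarrow> emeasure (surface_measure F) K < \<infinity>"
    and n: "2 \<le> DIM('a)"
  shows "emeasure lborel F = 0"
proof -
  have "emeasure lborel (F \<inter> cball 0 (real m)) = 0" for m
  proof -
    let ?A = "F \<inter> cball 0 (real m)"
    obtain b :: 'a where b: "b \<in> Basis" using nonempty_Basis by blast
    obtain M where M: "hausdorff_outer (DIM('a) - 1) ?A = ennreal M" "0 \<le> M"
      using fin[of "cball 0 (real m)"] emeasure_surface_measure(2)[OF F, of "cball 0 (real m)"]
      by (auto simp: less_top_ennreal)
    have "emeasure lborel ?A \<le> ennreal e" if e: "0 < e" for e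
    proof -
      define t where "t = e / (tube_const TYPE('a) * (M + 1))"
      have t: "0 < t" using e M(2) tube_const_pos[where 'a='a] by (simp add: t_def)
      obtain W where W: "W \<in> sets borel" "{z. \<exists>s\<in>{0..t}. z - s *\<^sub>R b \<in> ?A} \<subseteq> W"
        "emeasure lborel W \<le> ennreal (tube_const TYPE('a) * t) * hausdorff_outer (DIM('a) - 1) ?A"
        using tube_outer_measure[OF b t n, of ?A] by blast
      have "?A \<subseteq> {z. \<exists>s\<in>{0..t}. z - s *\<^sub>R b \<in> ?A}" using t by (force intro: bexI[of _ 0])
      then have "emeasure lborel ?A \<le> emeasure lborel W"
        using W by (intro emeasure_mono) auto
      also have "\<dots> \<le> ennreal (tube_const TYPE('a) * t * M)"
        using W(3) t M(2) tube_const_pos[where 'a='a] unfolding M(1) by (subst ennreal_mult) auto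
      also have "tube_const TYPE('a) * t * M \<le> e"
        using tube_const_pos[where 'a='a] M(2) e by (simp add: t_def divide_simps)
      finally show ?thesis by (simp add: ennreal_leI)
    qed
    then show ?thesis
      by (metis ennreal_0 ennreal_le_epsilon add_0 le_zero_eq)
  qed
  then have "emeasure lborel (\<Union>m. F \<inter> cball 0 (real m)) = 0"
    using F by (intro emeasure_UN_eq_0) auto
  moreover have "(\<Union>m. F \<inter> cball 0 (real m)) = F"
    using real_arch_simple by auto
  ultimately show ?thesis by simp
qed

text \<open>The weighted tube estimate follows by cutting \<open>F\<close> into Borel pieces of
  diameter at most t. A point over a piece is within 2 t of all of that piece, so \<open>g\<close>
  there exceeds its values on the piece by at most w. The error w is added only on the ball of
  radius r + 1, which keeps the right side finite for a locally finite surface.\<close>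

lemma nn_integral_tube_le:
  fixes F :: "'a::euclidean_space set" and g :: "'a \<Rightarrow> real"
  assumes F: "closed F" and n: "2 \<le> DIM('a)" and b: "b \<in> Basis"
    and g: "continuous_on UNIV g" "\<And>x. 0 \<le> g x" "\<And>x. r \<le> norm x \<Longrightarrow> g x = 0"
    and t: "0 < t" "2 * t \<le> 1" and w: "\<And>x y. dist x y \<le> 2 * t \<Longrightarrow> g x \<le> g y + w" "0 \<le> w"
  shows "(\<integral>\<^sup>+z. indicator {z. \<exists>s\<in>{0..t}. z - s *\<^sub>R b \<in> F} z * ennreal (g z) \<partial>lborel)
    \<le> ennreal (tube_const TYPE('a) * t) *
       (\<integral>\<^sup>+y. ennreal (g y + w * indicator (cball 0 (r + 1)) y) \<partial>surface_measure F)"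
proof -
  define G where "G y = g y + w * indicator (cball 0 (r + 1)) y" for y
  have G0: "0 \<le> G y" for y using g(2) w(2) by (simp add: G_def)
  have [measurable]: "g \<in> borel_measurable borel" using g(1) by (rule borel_measurable_continuous_onI)
  have [measurable]: "cball 0 (r + 1) \<in> sets (borel :: 'a measure)" by simp
  have [measurable]: "G \<in> borel_measurable borel" unfolding G_def by measurable
  let ?c = "ennreal (tube_const TYPE('a) * t)" and ?S = "\<lambda>A. {z. \<exists>s\<in>{0..t}. z - s *\<^sub>R b \<in> A}"
  obtain D :: "'a set" where D: "countable D" "\<And>X. open X \<Longrightarrow> X \<noteq> {} \<Longrightarrow> \<exists>d\<in>D. d \<in> X"
    using countable_dense_setE by blast
  have "D \<noteq> {}" using D(2)[of UNIV] by auto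
  define q where "q = from_nat_into D"
  have q: "range q = D" using D(1) \<open>D \<noteq> {}\<close> by (simp add: q_def range_from_nat_into)
  define A where "A i = F \<inter> disjointed (\<lambda>i. ball (q i) (t / 2)) i" for i
  have A_borel [measurable]: "A i \<in> sets borel" for i
    unfolding A_def disjointed_def using F by auto
  have A_dist: "dist x y \<le> t" if "x \<in> A i" "y \<in> A i" for x y i
  proof -
    have "dist (q i) x < t / 2" "dist (q i) y < t / 2"
      using that disjointed_subset[of "\<lambda>i. ball (q i) (t / 2)" i] by (auto simp: A_def)
    then show ?thesis using dist_triangle3[of x y "q i"] by linarith
  qed
  have A_UN: "(\<Union>i. A i) = F"
  proof -
    have "(\<Union>i. ball (q i) (t / 2)) = UNIV"
    proof -
      have "\<exists>i. x \<in> ball (q i) (t / 2)" for x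
      proof -
        have "ball x (t / 2) \<noteq> {}" using t(1) by simp
        then obtain d where "d \<in> D" "d \<in> ball x (t / 2)" using D(2)[OF open_ball] by blast
        then show ?thesis using q by (metis dist_commute mem_ball rangeE)
      qed
      then show ?thesis by auto
    qed
    then show ?thesis unfolding A_def by (simp add: UN_disjointed_eq flip: Int_UN_distrib)
  qed
  have A_disj: "disjoint_family A"
    using disjoint_family_disjointed[of "\<lambda>i. ball (q i) (t / 2)"]
    unfolding A_def disjoint_family_on_def by blast
  have "\<forall>i. \<exists>W. W \<in> sets borel \<and> ?S (A i) \<subseteq> W \<and> emeasure lborel W \<le> ?c * hausdorff_outer (DIM('a) - 1) (A i)"
    using tube_outer_measure[OF b t(1) n] by blast
  from choice[OF this] obtain W where W0: "\<forall>i. W i \<in> sets borel \<and> ?S (A i) \<subseteq> W i \<and>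
    emeasure lborel (W i) \<le> ?c * hausdorff_outer (DIM('a) - 1) (A i)" ..
  then have W: "W i \<in> sets borel" "?S (A i) \<subseteq> W i"
    "emeasure lborel (W i) \<le> ?c * hausdorff_outer (DIM('a) - 1) (A i)" for i
    by simp_all
  note [measurable] = W(1)
  \<comment> \<open>The infimum over a piece dominates \<open>g\<close> on the tube over it and is
    dominated by \<open>G\<close> on the piece, so it can be carried from the volume integral to the
    surface integral.\<close>
  define m where "m i = (INF y\<in>A i. ennreal (G y))" for i
  have gm: "ennreal (g z) \<le> m i" if z: "z \<in> ?S (A i)" for z i
    unfolding m_def
  proof (rule INF_greatest)
    fix y assume y: "y \<in> A i"
    obtain s where s: "s \<in> {0..t}" "z - s *\<^sub>R b \<in> A i" using z by auto
    have "dist z y \<le> dist z (z - s *\<^sub>R b) + dist (z - s *\<^sub>R b) y" by (rule dist_triangle)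
    also have "dist z (z - s *\<^sub>R b) \<le> t" using s b by (simp add: dist_norm)
    also have "dist (z - s *\<^sub>R b) y \<le> t" using A_dist[OF s(2) y] .
    finally have d: "dist z y \<le> 2 * t" by simp
    show "ennreal (g z) \<le> ennreal (G y)"
    proof (cases "r \<le> norm z")
      case True
      then show ?thesis using g(3) G0 by simp
    next
      case False
      have "norm y \<le> norm z + dist z y" by (metis dist_commute dist_norm norm_triangle_sub)
      then have "y \<in> cball 0 (r + 1)" using False d t(2) by simp
      then show ?thesis using w(1)[OF d] by (simp add: G_def ennreal_leI)
    qed
  qed
  have "(\<integral>\<^sup>+z. indicator (?S F) z * ennreal (g z) \<partial>lborel) \<le> (\<integral>\<^sup>+z. (\<Sum>i. m i * indicator (W i) z) \<partial>lborel)"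
  proof (rule nn_integral_mono)
    fix z
    show "indicator (?S F) z * ennreal (g z) \<le> (\<Sum>i. m i * indicator (W i) z)"
    proof (cases "z \<in> ?S F")
      case True
      then obtain i where i: "z \<in> ?S (A i)" using A_UN by blast
      have "ennreal (g z) \<le> m i * indicator (W i) z" using gm[OF i] W(2)[of i] i by (auto simp: indicator_def)
      also have "\<dots> \<le> (\<Sum>i. m i * indicator (W i) z)"
        using sum_le_suminf[of "\<lambda>i. m i * indicator (W i) z" "{i}"] by (simp del: sum_mult_indicator)
      finally show ?thesis using True by simp
    qed simp
  qed
  also have "\<dots> = (\<Sum>i. m i * emeasure lborel (W i))"
    by (subst nn_integral_suminf) (auto intro!: suminf_cong nn_integral_cmult_indicator)
  also have "\<dots> \<le> (\<Sum>i. ?c * (\<integral>\<^sup>+y. ennreal (G y) * indicator (A i) y \<partial>surface_measure F))"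
  proof (intro suminf_le allI)
    fix i
    have "m i * emeasure lborel (W i) \<le> m i * (?c * hausdorff_outer (DIM('a) - 1) (A i))"
      using W(3) by (intro mult_left_mono) auto
    also have "hausdorff_outer (DIM('a) - 1) (A i) = emeasure (surface_measure F) (A i)"
      by (subst emeasure_surface_measure(2)[OF F A_borel]) (auto simp: A_def)
    also have "m i * (?c * emeasure (surface_measure F) (A i)) = ?c * (\<integral>\<^sup>+y. m i * indicator (A i) y \<partial>surface_measure F)"
      by (subst nn_integral_cmult_indicator) (auto simp: ac_simps)
    also have "\<dots> \<le> ?c * (\<integral>\<^sup>+y. ennreal (G y) * indicator (A i) y \<partial>surface_measure F)"
      by (intro mult_left_mono nn_integral_mono) (auto simp: m_def indicator_def intro: INF_lower)
    finally show "m i * emeasure lborel (W i) \<le> ?c * (\<integral>\<^sup>+y. ennreal (G y) * indicator (A i) y \<partial>surface_measure F)" .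
  qed auto
  also have "\<dots> = ?c * (\<integral>\<^sup>+y. (\<Sum>i. ennreal (G y) * indicator (A i) y) \<partial>surface_measure F)"
    by (subst nn_integral_suminf) auto
  also have "\<dots> \<le> ?c * (\<integral>\<^sup>+y. ennreal (G y) \<partial>surface_measure F)"
  proof (intro mult_left_mono nn_integral_mono)
    fix y
    have "(\<Sum>i. ennreal (G y) * indicator (A i) y) = ennreal (G y) * indicator (\<Union>i. A i) y"
      by (simp add: suminf_indicator[OF A_disj])
    then show "(\<Sum>i. ennreal (G y) * indicator (A i) y) \<le> ennreal (G y)"
      by (simp add: indicator_def)
  qed auto
  finally show ?thesis unfolding G_def .
qed

section \<open>The distributional derivative of an indicator\<close>

lemma set_integral_shift:
  fixes f :: "'a::euclidean_space \<Rightarrow> real"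
  assumes f: "integrable lborel f" and S: "S \<in> sets borel"
  shows "integrable lborel (\<lambda>z. indicat_real S z * f (z + c))"
    and "(LINT z:S|lborel. f (z + c) - f z) = (LINT z|lborel. (indicat_real S (z - c) - indicat_real S z) * f z)"
proof -
  have [measurable]: "f \<in> borel_measurable borel" "S \<in> sets borel" using f S by auto
  have i1: "integrable lborel (\<lambda>z. indicat_real S z * f z)"
    using integrable_mult_indicator[of S lborel f] f S by simp
  have i2: "integrable lborel (\<lambda>z. indicat_real S (z - c) * f z)"
    by (rule Bochner_Integration.integrable_bound[OF f]) (auto simp: indicator_def)
  have "integrable (distr lborel borel ((+) c)) (\<lambda>z. indicat_real S (z - c) * f z)"
    using i2 by (simp add: lborel_distr_plus)
  then show i3: "integrable lborel (\<lambda>z. indicat_real S z * f (z + c))"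
    by (subst (asm) integrable_distr_eq) (auto simp: add.commute)
  have "(LINT z:S|lborel. f (z + c) - f z) = (LINT z|lborel. indicat_real S z * f (z + c) - indicat_real S z * f z)"
    by (simp add: set_lebesgue_integral_def algebra_simps)
  also have "\<dots> = (LINT z|lborel. indicat_real S z * f (z + c)) - (LINT z|lborel. indicat_real S z * f z)"
    by (rule Bochner_Integration.integral_diff[OF i3 i1])
  also have "(LINT z|lborel. indicat_real S z * f (z + c)) = (LINT z|lborel. indicat_real S (z - c) * f z)"
    using lborel_integral_translate[of "\<lambda>z. indicat_real S (z - c) * f z" c] by simp
  also have "\<dots> - (LINT z|lborel. indicat_real S z * f z) = (LINT z|lborel. (indicat_real S (z - c) - indicat_real S z) * f z)"
    using Bochner_Integration.integral_diff[OF i2 i1] by (simp add: left_diff_distrib)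
  finally show "(LINT z:S|lborel. f (z + c) - f z) = (LINT z|lborel. (indicat_real S (z - c) - indicat_real S z) * f z)" .
qed

lemma segment_meets_frontier:
  fixes z b :: "'a::euclidean_space"
  assumes "(z - t *\<^sub>R b \<in> S) \<noteq> (z \<in> S)" "0 \<le> t"
  shows "\<exists>s\<in>{0..t}. z - s *\<^sub>R b \<in> frontier S"
proof -
  let ?I = "(\<lambda>s. z - s *\<^sub>R b) ` {0..t}"
  have "connected ?I"
    by (intro connected_continuous_image continuous_intros) auto
  moreover have "z \<in> ?I" "z - t *\<^sub>R b \<in> ?I" using assms(2) by (auto intro: image_eqI[of _ _ 0])
  ultimately have "?I \<inter> frontier S \<noteq> {}"
    using assms(1) by (intro connected_Int_frontier) auto
  then show ?thesis by auto
qed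

text \<open>Moving the difference quotient from f to the indicator of \<open>S\<close> leaves an
  integrand that lives where the segment from z - t b to z meets the frontier. This is a tube of
  length t, and the factor t in its volume cancels the denominator: the derivative of the indicator
  is dominated by the surface measure.\<close>

lemma pd_integral_bound:
  fixes f :: "'a::euclidean_space \<Rightarrow> real"
  assumes S: "open S" and n: "2 \<le> DIM('a)" and b: "b \<in> Basis" and f: "C1c f"
    and fin: "\<And>K. compact K \<Longrightarrow> emeasure (surface_measure (frontier S)) K < \<infinity>"
  shows "\<bar>LINT z:S|lborel. pd f b z\<bar> \<le> tube_const TYPE('a) * (LINT y|surface_measure (frontier S). \<bar>f y\<bar>)"
proof -
  let ?c = "tube_const TYPE('a)" and ?h = "surface_measure (frontier S)"
  obtain r where r: "0 < r" "\<And>x. r \<le> norm x \<Longrightarrow> f x = 0"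
    using C1c_support[OF f] by metis
  have gc: "continuous_on UNIV (\<lambda>z. \<bar>f z\<bar>)"
    using C1c_continuous[OF f] by (auto intro: continuous_intros)
  have g0: "\<bar>f x\<bar> = 0" if "r \<le> norm x" for x using r(2)[OF that] by simp
  have [measurable]: "f \<in> borel_measurable borel" "S \<in> sets borel" "cball 0 (r + 1) \<in> sets (borel :: 'a measure)"
    using C1c_borel[OF f] S by auto
  have fi: "integrable lborel f" by (rule C1c_integrable_lborel(1)[OF f])
  have gi: "integrable ?h (\<lambda>z. \<bar>f z\<bar>)"
    by (rule integrable_cts_compact_support[OF gc _ g0]) (use fin in auto)
  have ci: "integrable ?h (indicat_real (cball 0 (r + 1)))"
    using fin[of "cball 0 (r + 1)"] by (intro integrable_real_indicator) auto
  \<comment> \<open>Here w bounds the oscillation of |f| at small scales. It stays fixed while t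
    tends to 0 and is sent to 0 only afterwards, since the tube estimate loses w times the surface
    measure of a fixed ball.\<close>
  have main: "\<bar>LINT z:S|lborel. pd f b z\<bar> \<le> ?c * (LINT y|?h. \<bar>f y\<bar>) + ?c * measure ?h (cball 0 (r + 1)) * w"
    if w: "0 < w" for w
  proof -
    have "uniformly_continuous_on (cball 0 (r + 1)) (\<lambda>z. \<bar>f z\<bar>)"
      using gc by (intro compact_uniformly_continuous) (auto intro: continuous_on_subset)
    then obtain d where d: "0 < d" "\<And>x y. x \<in> cball 0 (r + 1) \<Longrightarrow> y \<in> cball 0 (r + 1) \<Longrightarrow> dist x y < d \<Longrightarrow> dist \<bar>f x\<bar> \<bar>f y\<bar> < w"
      using w unfolding uniformly_continuous_on_def by metis
    have close: "\<bar>f x\<bar> \<le> \<bar>f y\<bar> + w" if "dist x y < min d 1" for x y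
    proof (cases "norm x < r")
      case True
      moreover have "norm y \<le> norm x + dist x y" by (metis dist_commute dist_norm norm_triangle_sub)
      ultimately have "dist \<bar>f x\<bar> \<bar>f y\<bar> < w" using that by (intro d(2)) auto
      then show ?thesis by (auto simp: dist_real_def)
    next
      case False
      then show ?thesis using r(2)[of x] w by simp
    qed
    define t where "t n = 1 / real (Suc n)" for n
    have "(\<lambda>n. 2 * t n) \<longlonglongrightarrow> 2 * 0"
      unfolding t_def by (intro tendsto_intros LIMSEQ_Suc lim_1_over_n)
    then have ev: "\<forall>\<^sub>F n in sequentially. 2 * t n < min d 1"
      using d(1) by (intro order_tendstoD(2)[of _ 0]) auto
    have bound: "\<bar>LINT z:S|lborel. (f (z + t n *\<^sub>R b) - f z) / t n\<bar>
        \<le> ?c * (LINT y|?h. \<bar>f y\<bar>) + ?c * measure ?h (cball 0 (r + 1)) * w"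
      if n: "2 * t n < min d 1" for n
    proof -
      let ?t = "t n" and ?T = "{z. \<exists>s\<in>{0..t n}. z - s *\<^sub>R b \<in> frontier S}"
      have t: "0 < ?t" by (simp add: t_def)
      have Gi: "integrable ?h (\<lambda>y. \<bar>f y\<bar> + w * indicat_real (cball 0 (r + 1)) y)"
        using gi ci by auto
      have "\<bar>LINT z:S|lborel. f (z + ?t *\<^sub>R b) - f z\<bar>
          = \<bar>LINT z|lborel. (indicat_real S (z - ?t *\<^sub>R b) - indicat_real S z) * f z\<bar>"
        by (subst set_integral_shift(2)[OF fi]) auto
      also have "\<dots> \<le> (LINT z|lborel. \<bar>(indicat_real S (z - ?t *\<^sub>R b) - indicat_real S z) * f z\<bar>)"
        by (rule integral_abs_bound)
      finally have "ennreal \<bar>LINT z:S|lborel. f (z + ?t *\<^sub>R b) - f z\<bar>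
         \<le> ennreal (LINT z|lborel. \<bar>(indicat_real S (z - ?t *\<^sub>R b) - indicat_real S z) * f z\<bar>)"
        by (rule ennreal_leI)
      also have "\<dots> = (\<integral>\<^sup>+z. ennreal \<bar>(indicat_real S (z - ?t *\<^sub>R b) - indicat_real S z) * f z\<bar> \<partial>lborel)"
        by (rule nn_integral_eq_integral[symmetric],
            rule Bochner_Integration.integrable_bound[OF fi])
          (auto simp: indicator_def)
      also have "\<dots> \<le> (\<integral>\<^sup>+z. indicator ?T z * ennreal \<bar>f z\<bar> \<partial>lborel)"
      proof (rule nn_integral_mono)
        fix z
        show "ennreal \<bar>(indicat_real S (z - ?t *\<^sub>R b) - indicat_real S z) * f z\<bar> \<le> indicator ?T z * ennreal \<bar>f z\<bar>"
        proof (cases "(z - ?t *\<^sub>R b \<in> S) = (z \<in> S)")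
          case True
          then show ?thesis by (simp add: indicator_def)
        next
          case False
          then have "z \<in> ?T" using segment_meets_frontier[OF False less_imp_le[OF t]] by simp
          then show ?thesis by (auto simp: indicator_def abs_mult)
        qed
      qed
      also have "\<dots> \<le> ennreal (?c * ?t) * (\<integral>\<^sup>+y. ennreal (\<bar>f y\<bar> + w * indicator (cball 0 (r + 1)) y) \<partial>?h)"
        using n t w close by (intro nn_integral_tube_le[OF frontier_closed assms(2) b gc]) (auto simp: r(2))
      also have "(\<integral>\<^sup>+y. ennreal (\<bar>f y\<bar> + w * indicator (cball 0 (r + 1)) y) \<partial>?h)
          = ennreal (LINT y|?h. \<bar>f y\<bar> + w * indicator (cball 0 (r + 1)) y)"
        using w by (intro nn_integral_eq_integral[OF Gi]) auto
      also have "(LINT y|?h. \<bar>f y\<bar> + w * indicator (cball 0 (r + 1)) y)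
          = (LINT y|?h. \<bar>f y\<bar>) + w * measure ?h (cball 0 (r + 1))"
        using gi ci by simp
      also have "ennreal (?c * ?t) * ennreal ((LINT y|?h. \<bar>f y\<bar>) + w * measure ?h (cball 0 (r + 1)))
        = ennreal (?c * ?t * ((LINT y|?h. \<bar>f y\<bar>) + w * measure ?h (cball 0 (r + 1))))"
        using tube_const_pos[where 'a='a] t w by (intro ennreal_mult[symmetric]) auto
      finally have "\<bar>LINT z:S|lborel. f (z + ?t *\<^sub>R b) - f z\<bar>
          \<le> ?c * ?t * ((LINT y|?h. \<bar>f y\<bar>) + w * measure ?h (cball 0 (r + 1)))"
        using tube_const_pos[where 'a='a] t w by (subst (asm) ennreal_le_iff) auto
      moreover have "(LINT z:S|lborel. (f (z + ?t *\<^sub>R b) - f z) / ?t) = (LINT z:S|lborel. f (z + ?t *\<^sub>R b) - f z) / ?t"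
        by simp
      ultimately show ?thesis
        using t by (simp add: abs_divide pos_divide_le_eq algebra_simps)
    qed
    have "(\<lambda>n. \<bar>LINT z:S|lborel. (f (z + t n *\<^sub>R b) - f z) / t n\<bar>) \<longlonglongrightarrow> \<bar>LINT z:S|lborel. pd f b z\<bar>"
      unfolding t_def using S by (intro tendsto_rabs C1c_diff_quotient_tendsto f) auto
    then show ?thesis
      by (rule tendsto_upperbound) (use ev bound in \<open>auto elim: eventually_mono\<close>)
  qed
  let ?M = "?c * measure ?h (cball 0 (r + 1))"
  have M: "0 \<le> ?M" using tube_const_pos[where 'a='a] by simp
  show ?thesis
  proof (rule field_le_epsilon)
    fix e :: real assume e: "0 < e"
    have "?M * (e / (?M + 1)) \<le> e" using M e by (simp add: divide_simps)
    moreover have "0 < e / (?M + 1)" using M e by simp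
    ultimately show "\<bar>LINT z:S|lborel. pd f b z\<bar> \<le> ?c * (LINT y|?h. \<bar>f y\<bar>) + e"
      using main[of "e / (?M + 1)"] by linarith
  qed
qed

section \<open>Divergence tests and locally finite perimeter\<close>

lemma lebesgue_set_integral_eq_lborel:
  fixes f :: "'a::euclidean_space \<Rightarrow> 'b::{banach, second_countable_topology}"
  assumes "f \<in> borel_measurable borel" "S \<in> sets borel"
  shows "(LINT x:S|lebesgue. f x) = (LINT x:S|lborel. f x)"
proof -
  have [measurable]: "f \<in> borel_measurable lborel" "S \<in> sets lborel" using assms by simp_all
  show ?thesis unfolding set_lebesgue_integral_def by (intro integral_completion) measurable
qed

lemma divergence_integral:
  fixes T :: "'a::euclidean_space \<Rightarrow> 'a"
  assumes "C1_compact_support T" "S \<in> sets borel"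
  shows "(LINT x:S|lebesgue. divergence T x) = (\<Sum>b\<in>Basis. LINT x:S|lborel. pd (\<lambda>x. T x \<bullet> b) b x)"
proof -
  note c = C1_compact_support_component(1)[OF assms(1)]
  have [measurable]: "S \<in> sets lborel" using assms(2) by simp
  have "(LINT x:S|lebesgue. divergence T x) = (LINT x:S|lborel. (\<Sum>b\<in>Basis. pd (\<lambda>x. T x \<bullet> b) b x))"
    unfolding divergence_eq_sum_pd[OF assms(1)]
    using C1c_pd_borel[OF c] assms(2) by (intro lebesgue_set_integral_eq_lborel) auto
  also have "\<dots> = (\<Sum>b\<in>Basis. LINT x:S|lborel. pd (\<lambda>x. T x \<bullet> b) b x)"
    unfolding set_lebesgue_integral_def scaleR_sum_right
    using assms(2)
    by (intro Bochner_Integration.integral_sum integrable_mult_indicator C1c_integrable_lborel(2)[OF c]) auto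
  finally show ?thesis .
qed

lemma divergence_integral_scaleR:
  fixes v :: "'a::euclidean_space"
  assumes "C1c f" "S \<in> sets borel"
  shows "(LINT x:S|lebesgue. divergence (\<lambda>x. f x *\<^sub>R v) x) = (LINT x:S|lborel. pd f v x)"
  unfolding C1c_scaleR(2)[OF assms(1)]
  using C1c_pd_borel[OF assms(1)] assms(2) by (rule lebesgue_set_integral_eq_lborel)

lemma locally_finite_perimeterI:
  fixes S :: "'a::euclidean_space set"
  assumes S: "open S" and n: "2 \<le> DIM('a)"
    and fin: "\<And>K. compact K \<Longrightarrow> emeasure (surface_measure (frontier S)) K < \<infinity>"
  shows "locally_finite_perimeter S"
  unfolding locally_finite_perimeter_def
proof (intro conjI allI impI)
  show "S \<in> sets lebesgue" using S by simp
  fix K :: "'a set" assume K: "compact K"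
  let ?h = "surface_measure (frontier S)"
  let ?C = "\<Sum>b\<in>(Basis::'a set). tube_const TYPE('a) * measure ?h K"
  show "\<exists>C. \<forall>T. C1_compact_support T \<and> closure {x. T x \<noteq> 0} \<subseteq> K \<and> (\<forall>x. norm (T x) \<le> 1) \<longrightarrow>
          (LINT x:S|lebesgue. divergence T x) \<le> C"
  proof (intro exI[of _ ?C] allI impI, elim conjE)
    fix T assume T: "C1_compact_support T" "closure {x. T x \<noteq> 0} \<subseteq> K" "\<forall>x. norm (T x) \<le> 1"
    note c = C1_compact_support_component(1)[OF T(1)]
    have "(LINT x:S|lebesgue. divergence T x) = (\<Sum>b\<in>Basis. LINT x:S|lborel. pd (\<lambda>x. T x \<bullet> b) b x)"
      using S by (intro divergence_integral T) auto
    also have "\<dots> \<le> ?C"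
    proof (rule sum_mono)
      fix b :: 'a assume b: "b \<in> Basis"
      have "(LINT x:S|lborel. pd (\<lambda>x. T x \<bullet> b) b x) \<le> tube_const TYPE('a) * (LINT y|?h. \<bar>T y \<bullet> b\<bar>)"
        using pd_integral_bound[OF S n b c[of b] fin] by linarith
      also have "(LINT y|?h. \<bar>T y \<bullet> b\<bar>) \<le> (LINT y|?h. indicat_real K y)"
      proof (rule integral_mono)
        show "integrable ?h (\<lambda>y. \<bar>T y \<bullet> b\<bar>)" using C1c_integrable(1)[OF c _ fin] by auto
        show "integrable ?h (indicat_real K)"
          using K fin[OF K] by (intro integrable_real_indicator) (auto simp: compact_imp_closed borel_closed)
        fix y
        show "\<bar>T y \<bullet> b\<bar> \<le> indicat_real K y"
        proof (cases "T y = 0")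
          case False
          then have "y \<in> K" using order_trans[OF closure_subset T(2)] by blast
          moreover have "\<bar>T y \<bullet> b\<bar> \<le> 1"
            using Basis_le_norm[OF b, of "T y"] spec[OF T(3), of y] by linarith
          ultimately show ?thesis by simp
        qed simp
      qed
      also have "(LINT y|?h. indicat_real K y) = measure ?h K" by simp
      finally show "(LINT x:S|lborel. pd (\<lambda>x. T x \<bullet> b) b x) \<le> tube_const TYPE('a) * measure ?h K"
        using tube_const_pos[where 'a='a] by simp
    qed
    finally show "(LINT x:S|lebesgue. divergence T x) \<le> ?C" .
  qed
qed

section \<open>The Gauss--Green measure\<close>

text \<open>The Riesz representation on a space \<open>V\<close> that is not assumed closed. By
  \<open>bd\<close> the functional J f = |f|^2 - 2 l f is bounded below. A minimising sequence is
  Cauchy by the parallelogram identity; its limit may lie outside \<open>V\<close>, and it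
  represents l because the first variation of J tends to 0 along the sequence.\<close>

lemma L2_representation:
  fixes M :: "'a measure" and l :: "('a \<Rightarrow> real) \<Rightarrow> real"
  assumes sq: "\<And>f. f \<in> V \<Longrightarrow> integrable M (\<lambda>x. (f x)\<^sup>2)"
    and meas: "\<And>f. f \<in> V \<Longrightarrow> f \<in> borel_measurable M"
    and add: "\<And>f g. f \<in> V \<Longrightarrow> g \<in> V \<Longrightarrow> (\<lambda>x. f x + g x) \<in> V"
      "\<And>f g. f \<in> V \<Longrightarrow> g \<in> V \<Longrightarrow> l (\<lambda>x. f x + g x) = l f + l g"
    and scale: "\<And>f c. f \<in> V \<Longrightarrow> (\<lambda>x. c * f x) \<in> V" "\<And>f c. f \<in> V \<Longrightarrow> l (\<lambda>x. c * f x) = c * l f"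
    and ne: "V \<noteq> {}"
    and bd: "\<And>f. f \<in> V \<Longrightarrow> 2 * l f \<le> B + (LINT x|M. (f x)\<^sup>2)"
  shows "\<exists>g\<in>borel_measurable M. \<forall>f\<in>V. integrable M (\<lambda>x. g x * f x) \<and> l f = (LINT x|M. g x * f x)"
proof -
  define ip where "ip f g = (LINT x|M. f x * g x)" for f g :: "'a \<Rightarrow> real"
  define J where "J f = ip f f - 2 * l f" for f
  have ii: "integrable M (\<lambda>x. f x * g x)" if f: "f \<in> V" and g: "g \<in> V" for f g
  proof (rule Bochner_Integration.integrable_bound)
    show "integrable M (\<lambda>x. (f x)\<^sup>2 + (g x)\<^sup>2)" using sq f g by auto
    show "(\<lambda>x. f x * g x) \<in> borel_measurable M" using meas f g by auto
    have "\<bar>a * b\<bar> \<le> a\<^sup>2 + b\<^sup>2" for a b :: real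
    proof -
      have "2 * (\<bar>a\<bar> * \<bar>b\<bar>) \<le> a\<^sup>2 + b\<^sup>2"
        using sum_squares_bound[of "\<bar>a\<bar>" "\<bar>b\<bar>"] by (simp add: mult.assoc)
      moreover have "0 \<le> \<bar>a\<bar> * \<bar>b\<bar>" by simp
      ultimately show ?thesis unfolding abs_mult by linarith
    qed
    then show "AE x in M. norm (f x * g x) \<le> norm ((f x)\<^sup>2 + (g x)\<^sup>2)" by simp
  qed
  have ipc: "ip f g = ip g f" for f g by (simp add: ip_def mult.commute)
  have lin: "ip (\<lambda>x. f x + c * g x) h = ip f h + c * ip g h" "(\<lambda>x. f x + c * g x) \<in> V"
    "l (\<lambda>x. f x + c * g x) = l f + c * l g"
    if "f \<in> V" "g \<in> V" "h \<in> V" for f g h c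
  proof -
    have "ip (\<lambda>x. f x + c * g x) h = (LINT x|M. f x * h x + c * (g x * h x))"
      unfolding ip_def by (simp add: algebra_simps)
    also have "\<dots> = ip f h + c * ip g h"
      unfolding ip_def using ii that by (subst Bochner_Integration.integral_add) auto
    finally show "ip (\<lambda>x. f x + c * g x) h = ip f h + c * ip g h" .
    show "(\<lambda>x. f x + c * g x) \<in> V" "l (\<lambda>x. f x + c * g x) = l f + c * l g"
      using that add scale by auto
  qed
  have Jexp: "J (\<lambda>x. f x + c * g x) = J f + 2 * c * (ip f g - l g) + c\<^sup>2 * ip g g"
    if "f \<in> V" "g \<in> V" for f g c
  proof -
    have "ip (\<lambda>x. f x + c * g x) (\<lambda>x. f x + c * g x) = ip f f + 2 * c * ip f g + c\<^sup>2 * ip g g"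
      using lin(1)[OF that lin(2)[OF that that(1), of c], of c] lin(1)[OF that that(1), of c] lin(1)[OF that that(2), of c]
        ipc[of f "\<lambda>x. f x + c * g x"] ipc[of g "\<lambda>x. f x + c * g x"] ipc[of g f]
      by (simp add: algebra_simps power2_eq_square)
    then show ?thesis using lin(3)[OF that that(1), of c] by (simp add: J_def algebra_simps)
  qed
  have Jlow: "- B \<le> J f" if "f \<in> V" for f
    using bd[OF that] by (simp add: J_def ip_def power2_eq_square)
  define m where "m = Inf (J ` V)"
  have bdd: "bdd_below (J ` V)" using Jlow by (auto intro!: bdd_belowI)
  have mle: "m \<le> J f" if "f \<in> V" for f unfolding m_def using that bdd by (intro cInf_lower) auto
  \<comment> \<open>The rate 4^(-n) for the values of J becomes 2^(-n) for the norms of the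
    increments, which are therefore summable.\<close>
  have "\<forall>n. \<exists>f. f \<in> V \<and> J f < m + (1/4) ^ n"
  proof
    fix n :: nat
    have "Inf (J ` V) < m + (1/4) ^ n" by (simp add: m_def)
    then show "\<exists>f. f \<in> V \<and> J f < m + (1/4) ^ n"
      using ne bdd by (subst (asm) cInf_less_iff) auto
  qed
  from choice[OF this] obtain u where u0: "\<forall>n. u n \<in> V \<and> J (u n) < m + (1/4) ^ n" ..
  then have u: "u n \<in> V" "J (u n) < m + (1/4) ^ n" for n by simp_all
  define D where "D n x = u (Suc n) x - u n x" for n x
  have Deq: "D n = (\<lambda>x. u (Suc n) x + (-1) * u n x)" for n by (simp add: D_def fun_eq_iff)
  have DV: "D n \<in> V" for n unfolding Deq using lin(2) u(1) by blast
  have Dn: "ip (D n) (D n) \<le> 4 * (1/4) ^ n" for n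
  proof -
    have eq: "u (Suc n) = (\<lambda>x. u n x + 1 * D n x)" by (simp add: D_def fun_eq_iff)
    have "J (u (Suc n)) = J (u n) + 2 * (ip (u n) (D n) - l (D n)) + ip (D n) (D n)"
      by (subst eq, subst Jexp[OF u(1) DV]) simp
    \<comment> \<open>Minimality is tested at the midpoint of u n and u (Suc n); together with the
      expansion at the endpoint this is the parallelogram identity.\<close>
    moreover have "m \<le> J (u n) + (ip (u n) (D n) - l (D n)) + ip (D n) (D n) / 4"
      using mle[OF lin(2)[OF u(1)[of n] DV[of n] u(1)[of n], of "1/2"]]
      by (subst (asm) Jexp[OF u(1) DV]) (simp add: power2_eq_square)
    ultimately have "ip (D n) (D n) / 2 \<le> J (u (Suc n)) + J (u n) - 2 * m"
      by argo
    also have "\<dots> \<le> (1/4) ^ Suc n + (1/4) ^ n" using u(2)[of n] u(2)[of "Suc n"] by linarith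
    also have "\<dots> \<le> 2 * (1/4) ^ n" by simp
    finally show ?thesis by simp
  qed
  have near: "\<bar>ip (u n) f - l f\<bar> \<le> (1/2) ^ n * ((1 + ip f f) / 2)" if f: "f \<in> V" for n f
  proof -
    \<comment> \<open>At an almost minimiser a step c along f gains at most 4^(-n). The steps 2^(-n)
      and - 2^(-n) used below balance this gain against the quadratic term.\<close>
    have *: "- ((1/4) ^ n) \<le> 2 * c * (ip (u n) f - l f) + c\<^sup>2 * ip f f" for c
      using mle[OF lin(2)[OF u(1)[of n] f f, of c]] u(2)[of n]
      by (subst (asm) Jexp[OF u(1) f]) linarith
    have p: "((1/2::real) ^ n)\<^sup>2 = (1/4) ^ n" "(1/4::real) ^ n = (1/2) ^ n * (1/2) ^ n"
      by (simp_all add: power2_eq_square flip: power_mult_distrib)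
    have h: "0 < (1/2::real) ^ n" by simp
    have "(1/2) ^ n * (- ((1/2) ^ n)) \<le> (1/2) ^ n * (2 * (ip (u n) f - l f) + (1/2) ^ n * ip f f)"
      using *[of "(1/2) ^ n"] unfolding p(1) unfolding p(2) by (simp add: algebra_simps)
    then have 1: "- ((1/2) ^ n) \<le> 2 * (ip (u n) f - l f) + (1/2) ^ n * ip f f"
      using h by (rule mult_left_le_imp_le)
    have "(1/2) ^ n * (- ((1/2) ^ n)) \<le> (1/2) ^ n * (- 2 * (ip (u n) f - l f) + (1/2) ^ n * ip f f)"
      using *[of "- ((1/2) ^ n)"] unfolding power2_minus p(1) unfolding p(2) by (simp add: algebra_simps)
    then have 2: "- ((1/2) ^ n) \<le> - 2 * (ip (u n) f - l f) + (1/2) ^ n * ip f f"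
      using h by (rule mult_left_le_imp_le)
    have "(1/2) ^ n * ((1 + ip f f) / 2) = (1/2) ^ n / 2 + (1/2) ^ n * ip f f / 2"
      by (simp add: algebra_simps)
    then show ?thesis using 1 2 by (intro abs_leI) argo+
  qed
  define g where "g x = u 0 x + (\<Sum>n. D n x)" for x
  have [measurable]: "u n \<in> borel_measurable M" "D n \<in> borel_measurable M" for n
    using meas u(1) DV by auto
  have gm: "g \<in> borel_measurable M" unfolding g_def by measurable
  have "integrable M (\<lambda>x. g x * f x) \<and> l f = (LINT x|M. g x * f x)" if f: "f \<in> V" for f
  proof -
    have [measurable]: "f \<in> borel_measurable M" using meas f by auto
    have Di: "integrable M (\<lambda>x. D n x * f x)" for n using ii DV f by auto
    have absb: "(LINT x|M. \<bar>D n x * f x\<bar>) \<le> (1/2) ^ n * (2 + ip f f / 2)" for n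
    proof -
      have h: "0 < (2::real) ^ n" by simp
      have pw: "(1/2::real) ^ n = 1 / 2 ^ n" by (simp add: power_one_over)
      \<comment> \<open>The inequality of the means with weight 2^n makes both terms of order 2^(-n)
        after integration.\<close>
      have "\<bar>D n x * f x\<bar> \<le> (2 ^ n / 2) * (D n x * D n x) + ((1/2) ^ n / 2) * (f x * f x)" for x
      proof -
        have "0 \<le> (2 ^ n * \<bar>D n x\<bar> - \<bar>f x\<bar>)\<^sup>2" by simp
        then have "2 * 2 ^ n * (\<bar>D n x\<bar> * \<bar>f x\<bar>) \<le> 2 ^ n * (2 ^ n * (\<bar>D n x\<bar> * \<bar>D n x\<bar>)) + \<bar>f x\<bar> * \<bar>f x\<bar>"
          by (simp add: power2_eq_square algebra_simps)
        then show ?thesis using h by (simp add: pw abs_mult field_simps)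
      qed
      then have "(LINT x|M. \<bar>D n x * f x\<bar>) \<le> (LINT x|M. (2 ^ n / 2) * (D n x * D n x) + ((1/2) ^ n / 2) * (f x * f x))"
        using ii DV f by (intro integral_mono) auto
      also have "\<dots> = (2 ^ n / 2) * ip (D n) (D n) + ((1/2) ^ n / 2) * ip f f"
        unfolding ip_def using ii DV f by (subst Bochner_Integration.integral_add) auto
      also have "\<dots> \<le> (2 ^ n / 2) * (4 * (1/4) ^ n) + ((1/2) ^ n / 2) * ip f f"
        using Dn[of n] by (intro add_right_mono mult_left_mono) auto
      also have "(2 ^ n / 2) * (4 * (1/4) ^ n) = 2 * (1/2::real) ^ n"
        by (simp flip: power_mult_distrib)
      finally show ?thesis by (simp add: algebra_simps)
    qed
    have sm: "summable (\<lambda>n. LINT x|M. norm (D n x * f x))"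
    proof (rule summable_comparison_test)
      show "\<exists>N. \<forall>n\<ge>N. norm (LINT x|M. norm (D n x * f x)) \<le> (1/2) ^ n * (2 + ip f f / 2)"
        using absb by auto
      show "summable (\<lambda>n. (1/2) ^ n * (2 + ip f f / 2))"
        by (intro summable_mult2 summable_geometric) simp
    qed
    have ae: "AE x in M. summable (\<lambda>n. norm (D n x * f x))"
    proof -
      have "(\<integral>\<^sup>+x. (\<Sum>n. ennreal (norm (D n x * f x))) \<partial>M) = (\<Sum>n. ennreal (LINT x|M. norm (D n x * f x)))"
        using Di by (subst nn_integral_suminf) (auto intro!: suminf_cong nn_integral_eq_integral)
      also have "\<dots> = ennreal (\<Sum>n. LINT x|M. norm (D n x * f x))"
        using sm by (intro suminf_ennreal2) auto
      finally have "(\<integral>\<^sup>+x. (\<Sum>n. ennreal (norm (D n x * f x))) \<partial>M) \<noteq> \<infinity>" by simp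
      then have "AE x in M. (\<Sum>n. ennreal (norm (D n x * f x))) \<noteq> \<infinity>"
        by (intro nn_integral_PInf_AE) auto
      then show ?thesis
        by (rule AE_mp) (auto intro!: AE_I2 summable_suminf_not_top)
    qed
    have tel: "(\<Sum>i<n. LINT x|M. D i x * f x) = ip (u n) f - ip (u 0) f" for n
    proof (induction n)
      case (Suc n)
      have "(LINT x|M. D n x * f x) = ip (u (Suc n)) f - ip (u n) f"
        unfolding ip_def D_def left_diff_distrib using ii u(1) f by (subst Bochner_Integration.integral_diff) auto
      then show ?case using Suc by simp
    qed simp
    have "(\<lambda>n. ip (u n) f) \<longlonglongrightarrow> l f"
    proof (rule Lim_transform_eventually)
      have "(\<lambda>n. ip (u n) f - l f) \<longlonglongrightarrow> 0"
      proof (rule Lim_null_comparison)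
        show "\<forall>\<^sub>F n in sequentially. norm (ip (u n) f - l f) \<le> (1/2) ^ n * ((1 + ip f f) / 2)"
          using near[OF f] by auto
        show "(\<lambda>n. (1/2) ^ n * ((1 + ip f f) / 2)) \<longlonglongrightarrow> 0"
          by (intro tendsto_mult_left_zero LIMSEQ_power_zero) simp
      qed
      then have "(\<lambda>n. (ip (u n) f - l f) + l f) \<longlonglongrightarrow> 0 + l f" by (intro tendsto_intros)
      then show "(\<lambda>n. (ip (u n) f - l f) + l f) \<longlonglongrightarrow> l f" by simp
    qed auto
    then have "(\<lambda>n. \<Sum>i<n. LINT x|M. D i x * f x) \<longlonglongrightarrow> l f - ip (u 0) f"
      unfolding tel by (intro tendsto_intros)
    then have s1: "(\<lambda>i. LINT x|M. D i x * f x) sums (l f - ip (u 0) f)" by (simp add: sums_def)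
    have s2: "(\<lambda>i. LINT x|M. D i x * f x) sums (LINT x|M. (\<Sum>i. D i x * f x))"
      by (rule sums_integral[OF Di ae sm])
    have si: "integrable M (\<lambda>x. \<Sum>i. D i x * f x)" by (rule integrable_suminf[OF Di ae sm])
    \<comment> \<open>Convergence almost everywhere is known only for the products with f. Where f
      is nonzero it can be divided out; where f is 0, the value of g, possibly that of a divergent
      series, is multiplied by 0.\<close>
    have gf: "g x * f x = u 0 x * f x + (\<Sum>i. D i x * f x)" if "summable (\<lambda>n. norm (D n x * f x))" for x
    proof (cases "f x = 0")
      case False
      have "summable (\<lambda>n. D n x * f x)" using that by (rule summable_norm_cancel)
      then have "summable (\<lambda>n. D n x * f x * inverse (f x))" by (rule summable_mult2)
      moreover have "D n x * f x * inverse (f x) = D n x" for n using False by (simp add: mult.assoc)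
      ultimately have "summable (\<lambda>n. D n x)" by (simp only:)
      from suminf_mult2[OF this] show ?thesis by (simp only: g_def distrib_right)
    qed simp
    have i1: "integrable M (\<lambda>x. u 0 x * f x + (\<Sum>i. D i x * f x))" using ii[OF u(1)[of 0] f] si by auto
    have ae2: "AE x in M. u 0 x * f x + (\<Sum>i. D i x * f x) = g x * f x"
      using ae by (rule AE_mp) (auto intro!: AE_I2 simp: gf)
    have "(\<lambda>x. g x * f x) \<in> borel_measurable M" using gm by measurable
    then have "integrable M (\<lambda>x. g x * f x)"
      using i1 integrable_cong_AE[OF _ _ ae2] by auto
    moreover have "(LINT x|M. g x * f x) = (LINT x|M. u 0 x * f x + (\<Sum>i. D i x * f x))"
      using gm ae2 by (intro integral_cong_AE) (auto elim: AE_mp)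
    moreover have "\<dots> = ip (u 0) f + (LINT x|M. (\<Sum>i. D i x * f x))"
      unfolding ip_def using ii[OF u(1)[of 0] f] si by (rule Bochner_Integration.integral_add)
    moreover have "(LINT x|M. (\<Sum>i. D i x * f x)) = l f - ip (u 0) f" using s1 s2 sums_unique2 by blast
    ultimately show ?thesis by simp
  qed
  then show ?thesis using gm by blast
qed

text \<open>On the shell j - 1 < |x| \<le> j the weight is 2^(-j) divided by 1 plus the mass of the
  ball of radius j, so its integral is dominated by a geometric series. On a bounded set it takes
  finitely many values.\<close>

lemma exists_integrable_weight:
  fixes M :: "'a::euclidean_space measure"
  assumes M: "sets M = sets borel" and fin: "\<And>K. compact K \<Longrightarrow> emeasure M K < \<infinity>"
  obtains w :: "'a \<Rightarrow> real" where "w \<in> borel_measurable borel" "\<And>x. 0 < w x" "integrable M w"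
    "\<And>r. \<exists>c>0. \<forall>x. norm x \<le> r \<longrightarrow> c \<le> w x"
proof -
  define a where "a j = (1/2) ^ j / (1 + measure M (cball (0::'a) (real j)))" for j :: nat
  have pos: "0 < 1 + measure M (cball (0::'a) (real j))" for j
    using measure_nonneg[of M] by (intro add_pos_nonneg) auto
  have a: "0 < a j" for j using pos[of j] by (simp add: a_def)
  define w where "w x = a (nat \<lceil>norm x\<rceil>)" for x :: 'a
  have [measurable]: "w \<in> borel_measurable borel" unfolding w_def by measurable
  show thesis
  proof
    show "w \<in> borel_measurable borel" by measurable
    show "0 < w x" for x using a by (simp add: w_def)
    show "\<exists>c>0. \<forall>x. norm x \<le> r \<longrightarrow> c \<le> w x" for r
    proof (intro exI[of _ "Min (a ` {..nat \<lceil>r\<rceil>})"] conjI allI impI)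
      show "0 < Min (a ` {..nat \<lceil>r\<rceil>})" using a by (subst Min_gr_iff) auto
      fix x :: 'a assume "norm x \<le> r"
      then have "nat \<lceil>norm x\<rceil> \<le> nat \<lceil>r\<rceil>" by (intro nat_mono ceiling_mono)
      then show "Min (a ` {..nat \<lceil>r\<rceil>}) \<le> w x" unfolding w_def by (intro Min_le) auto
    qed
    show "integrable M w"
    proof (rule integrableI_nonneg)
      show "w \<in> borel_measurable M" using M by (simp cong: measurable_cong_sets)
      show "AE x in M. 0 \<le> w x" using a by (simp add: w_def less_imp_le)
      have "(\<integral>\<^sup>+x. ennreal (w x) \<partial>M) \<le> (\<integral>\<^sup>+x. (\<Sum>j. ennreal (a j) * indicator (cball 0 (real j)) x) \<partial>M)"
      proof (rule nn_integral_mono)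
        fix x
        have "ennreal (w x) = ennreal (a (nat \<lceil>norm x\<rceil>)) * indicator (cball 0 (real (nat \<lceil>norm x\<rceil>))) x"
          by (simp add: w_def indicator_def)
        also have "\<dots> \<le> (\<Sum>j. ennreal (a j) * indicator (cball 0 (real j)) x)"
          using sum_le_suminf[of "\<lambda>j. ennreal (a j) * indicator (cball 0 (real j)) x" "{nat \<lceil>norm x\<rceil>}"]
          by (simp del: sum_mult_indicator)
        finally show "ennreal (w x) \<le> (\<Sum>j. ennreal (a j) * indicator (cball 0 (real j)) x)" .
      qed
      also have "\<dots> = (\<Sum>j. ennreal (a j) * emeasure M (cball 0 (real j)))"
      proof -
        have cb: "cball (0::'a) (real j) \<in> sets M" for j using M by simp
        then have [measurable]: "(\<lambda>x. ennreal (a j) * indicator (cball 0 (real j)) x) \<in> borel_measurable M" for j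
          by measurable
        show ?thesis
          by (subst nn_integral_suminf, measurable) (simp only: nn_integral_cmult_indicator[OF cb])
      qed
      also have "\<dots> \<le> (\<Sum>j. ennreal ((1/2) ^ j))"
      proof (intro suminf_le allI)
        fix j
        have "emeasure M (cball 0 (real j)) = ennreal (measure M (cball 0 (real j)))"
          using fin[of "cball 0 (real j)"] by (intro emeasure_eq_ennreal_measure) auto
        then have "ennreal (a j) * emeasure M (cball 0 (real j)) = ennreal (a j * measure M (cball 0 (real j)))"
          using a[of j] by (simp add: ennreal_mult less_imp_le)
        also have "a j * measure M (cball (0::'a) (real j)) \<le> (1/2) ^ j"
        proof -
          have "a j * (1 + measure M (cball (0::'a) (real j))) = (1/2) ^ j"
            using pos[of j] by (simp add: a_def)
          then show ?thesis using a[of j] by (simp add: distrib_left)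
        qed
        finally show "ennreal (a j) * emeasure M (cball 0 (real j)) \<le> ennreal ((1/2) ^ j)"
          by (simp add: ennreal_leI)
      qed auto
      also have "\<dots> = ennreal (\<Sum>j. (1/2) ^ j)" by (intro suminf_ennreal2 summable_geometric) auto
      also have "\<dots> < \<infinity>" by simp
      finally show "(\<integral>\<^sup>+x. ennreal (w x) \<partial>M) < \<infinity>" .
    qed
  qed
qed

text \<open>The functional is bounded by an L^1 norm for a surface measure that may be infinite,
  while \<open>L2_representation\<close> asks for an L^2 bound. Dividing the measure by an
  integrable weight w supplies it: 2 c |f| \<le> c^2 w + f^2 / w, and w has finite integral.\<close>

lemma exists_density_component:
  fixes S :: "'a::euclidean_space set"
  assumes S: "open S" and n: "2 \<le> DIM('a)" and b: "b \<in> Basis"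
    and fin: "\<And>K. compact K \<Longrightarrow> emeasure (surface_measure (frontier S)) K < \<infinity>"
  shows "\<exists>G\<in>borel_measurable borel. \<forall>f. C1c f \<longrightarrow> integrable (surface_measure (frontier S)) (\<lambda>x. G x * f x) \<and>
      (LINT z:S|lborel. pd f b z) = (LINT x|surface_measure (frontier S). G x * f x)"
proof -
  let ?h = "surface_measure (frontier S)" and ?c = "tube_const TYPE('a)"
  obtain w :: "'a \<Rightarrow> real" where w: "w \<in> borel_measurable borel" "\<And>x. 0 < w x" "integrable ?h w"
    "\<And>r. \<exists>c>0. \<forall>x. norm x \<le> r \<longrightarrow> c \<le> w x"
    using exists_integrable_weight[OF sets_surface_measure fin] by blast
  note [measurable] = w(1)
  have w0: "0 \<le> w x" "w x \<noteq> 0" for x using w(2)[of x] by auto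
  define M where "M = density ?h (\<lambda>x. ennreal (1 / w x))"
  have iM: "integrable M f \<longleftrightarrow> integrable ?h (\<lambda>x. f x / w x)" "(LINT x|M. f x) = (LINT x|?h. f x / w x)"
    if "f \<in> borel_measurable borel" for f :: "'a \<Rightarrow> real"
  proof -
    have [measurable]: "f \<in> borel_measurable borel" by (rule that)
    have p: "AE x in ?h. 0 \<le> 1 / w x" using w0(1) by simp
    show "integrable M f \<longleftrightarrow> integrable ?h (\<lambda>x. f x / w x)"
      unfolding M_def by (subst integrable_density[OF _ _ p]) auto
    show "(LINT x|M. f x) = (LINT x|?h. f x / w x)"
      unfolding M_def by (subst integral_density[OF _ _ p]) auto
  qed
  define l where "l f = (LINT z:S|lborel. pd f b z)" for f
  have Sb: "S \<in> sets lborel" using S by simp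
  have si: "set_integrable lborel S (pd f b)" if "C1c f" for f
    unfolding set_integrable_def by (intro integrable_mult_indicator C1c_integrable_lborel(2) that Sb)
  have sq: "integrable ?h (\<lambda>x. (f x)\<^sup>2 / w x)" if f: "C1c f" for f
  proof -
    obtain r where r: "0 < r" "\<And>x. r \<le> norm x \<Longrightarrow> f x = 0" using C1c_support[OF f] by metis
    obtain B where B: "\<And>x. \<bar>f x\<bar> \<le> B" using C1c_bounded[OF f] by metis
    obtain c where c: "0 < c" "\<And>x. norm x \<le> r \<Longrightarrow> c \<le> w x" using w(4) by metis
    have [measurable]: "f \<in> borel_measurable borel" by (rule C1c_borel[OF f])
    show ?thesis
    proof (rule integrable_bounded_support)
      show "(\<lambda>x. (f x)\<^sup>2 / w x) \<in> borel_measurable ?h" by measurable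
      show "(f x)\<^sup>2 / w x = 0" if "r \<le> norm x" for x using r(2)[OF that] by simp
      show "norm ((f x)\<^sup>2 / w x) \<le> B\<^sup>2 / c" for x
      proof (cases "norm x \<le> r")
        case True
        have "(f x)\<^sup>2 \<le> B\<^sup>2" using power_mono[OF B[of x], of 2] by simp
        then show ?thesis using c(1) c(2)[OF True] w(2)[of x] by (simp add: frac_le)
      next
        case False
        then show ?thesis using r(2)[of x] c(1) by simp
      qed
      show "emeasure ?h (cball 0 r) < \<infinity>" using fin by simp
    qed simp
  qed
  have "\<exists>g\<in>borel_measurable M. \<forall>f\<in>Collect C1c. integrable M (\<lambda>x. g x * f x) \<and> l f = (LINT x|M. g x * f x)"
  proof (rule L2_representation[where B="?c\<^sup>2 * (LINT x|?h. w x)"])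
    fix f g :: "'a \<Rightarrow> real" and c :: real
    assume "f \<in> Collect C1c"
    then have f: "C1c f" by simp
    have [measurable]: "f \<in> borel_measurable borel" by (rule C1c_borel[OF f])
    show "integrable M (\<lambda>x. (f x)\<^sup>2)" using sq[OF f] by (subst iM) auto
    show "f \<in> borel_measurable M" by (simp add: M_def)
    show "(\<lambda>x. c * f x) \<in> Collect C1c" by (simp add: C1c_cmult f)
    show "l (\<lambda>x. c * f x) = c * l f" by (simp add: l_def C1c_cmult(2)[OF f])
    show "2 * l f \<le> ?c\<^sup>2 * (LINT x|?h. w x) + (LINT x|M. (f x)\<^sup>2)"
    proof -
      have fi: "integrable ?h (\<lambda>x. \<bar>f x\<bar>)" using C1c_integrable(1)[OF f _ fin] by auto
      have "2 * l f \<le> (LINT x|?h. 2 * ?c * \<bar>f x\<bar>)"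
        using pd_integral_bound[OF S n b f fin] by (simp add: l_def)
      also have "\<dots> \<le> (LINT x|?h. ?c\<^sup>2 * w x + (f x)\<^sup>2 / w x)"
      proof (rule integral_mono)
        show "integrable ?h (\<lambda>x. 2 * ?c * \<bar>f x\<bar>)" using fi by simp
        show "integrable ?h (\<lambda>x. ?c\<^sup>2 * w x + (f x)\<^sup>2 / w x)" using w(3) sq[OF f] by auto
        fix x
        have "0 \<le> (?c * w x - \<bar>f x\<bar>)\<^sup>2 / w x" using w0 by simp
        also have "\<dots> = ?c\<^sup>2 * w x - 2 * ?c * \<bar>f x\<bar> + (f x)\<^sup>2 / w x"
          using w0(2)[of x] by (simp add: power2_diff power_mult_distrib diff_divide_distrib add_divide_distrib)
            (simp add: power2_eq_square)
        finally show "2 * ?c * \<bar>f x\<bar> \<le> ?c\<^sup>2 * w x + (f x)\<^sup>2 / w x" by simp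
      qed
      also have "\<dots> = ?c\<^sup>2 * (LINT x|?h. w x) + (LINT x|M. (f x)\<^sup>2)"
        using w(3) sq[OF f] by (subst iM(2)) auto
      finally show ?thesis .
    qed
    assume "g \<in> Collect C1c"
    then have g: "C1c g" by simp
    show "(\<lambda>x. f x + g x) \<in> Collect C1c" by (simp add: C1c_add f g)
    show "l (\<lambda>x. f x + g x) = l f + l g"
      unfolding l_def C1c_add(2)[OF f g] by (rule set_integral_add(2)[OF si[OF f] si[OF g]])
  next
    show "Collect C1c \<noteq> ({} :: ('a \<Rightarrow> real) set)" using bump_C1c(1) by blast
  qed
  then obtain g where g0: "g \<in> borel_measurable M"
    and g: "\<And>f. C1c f \<Longrightarrow> integrable M (\<lambda>x. g x * f x) \<and> l f = (LINT x|M. g x * f x)" by auto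
  have gb [measurable]: "g \<in> borel_measurable borel"
    using g0 by (simp add: M_def)
  show ?thesis
  proof (intro bexI[of _ "\<lambda>x. g x / w x"] allI impI)
    fix f :: "'a \<Rightarrow> real" assume f: "C1c f"
    have [measurable]: "f \<in> borel_measurable borel" by (rule C1c_borel[OF f])
    show "integrable ?h (\<lambda>x. g x / w x * f x) \<and> (LINT z:S|lborel. pd f b z) = (LINT x|?h. g x / w x * f x)"
      using g[OF f] by (simp add: iM l_def)
  qed measurable
qed

lemma exists_gauss_green_polar:
  fixes S :: "'a::euclidean_space set"
  assumes S: "open S" and n: "2 \<le> DIM('a)"
    and fin: "\<And>K. compact K \<Longrightarrow> emeasure (surface_measure (frontier S)) K < \<infinity>"
  shows "\<exists>\<theta> \<sigma>. \<theta> \<in> borel_measurable borel \<and> (\<forall>x. 0 \<le> \<theta> x) \<and>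
    gauss_green_polar S (density (surface_measure (frontier S)) (\<lambda>x. ennreal (\<theta> x))) \<sigma>"
proof -
  let ?h = "surface_measure (frontier S)"
  have "\<forall>b\<in>Basis. \<exists>G. G \<in> borel_measurable borel \<and> (\<forall>f. C1c f \<longrightarrow> integrable ?h (\<lambda>x. G x * f x) \<and>
      (LINT z:S|lborel. pd f b z) = (LINT x|?h. G x * f x))"
    using exists_density_component[OF S n _ fin] by (simp only: Bex_def) blast
  from bchoice[OF this] obtain g where g0: "\<forall>b\<in>Basis. g b \<in> borel_measurable borel \<and> (\<forall>f. C1c f \<longrightarrow> integrable ?h (\<lambda>x. g b x * f x) \<and>
      (LINT z:S|lborel. pd f b z) = (LINT x|?h. g b x * f x))" ..
  then have gb [measurable]: "g b \<in> borel_measurable borel"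
    and gi: "C1c f \<Longrightarrow> integrable ?h (\<lambda>x. g b x * f x)"
    and gl: "C1c f \<Longrightarrow> (LINT z:S|lborel. pd f b z) = (LINT x|?h. g b x * f x)" if "b \<in> Basis" for b f
    using that by simp_all
  define G where "G x = (\<Sum>b\<in>Basis. g b x *\<^sub>R b)" for x
  have [measurable]: "G \<in> borel_measurable borel" unfolding G_def by measurable
  have Gb: "G x \<bullet> b = g b x" if "b \<in> Basis" for x b
    using that by (simp add: G_def inner_sum_left inner_Basis if_distrib sum.delta cong: if_cong)
  define \<theta> where "\<theta> x = norm (G x)" for x
  define \<sigma> where "\<sigma> x = sgn (G x)" for x
  have [measurable]: "\<theta> \<in> borel_measurable borel" unfolding \<theta>_def by measurable
  have [measurable]: "\<sigma> \<in> borel_measurable borel" unfolding \<sigma>_def sgn_div_norm by measurable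
  have GT: "T x \<bullet> G x = (\<Sum>b\<in>Basis. g b x * (T x \<bullet> b))" for T :: "'a \<Rightarrow> 'a" and x
    by (simp add: G_def inner_sum_right)
  let ?P = "density ?h (\<lambda>x. ennreal (\<theta> x))"
  have "gauss_green_polar S ?P \<sigma>"
    unfolding gauss_green_polar_def
  proof (intro conjI allI impI)
    show "sets ?P = sets borel" by simp
    show "\<sigma> \<in> borel_measurable borel" by measurable
    \<comment> \<open>\<open>sgn\<close> is 0 where \<open>G\<close> vanishes, but there the density
      \<open>\<theta>\<close> vanishes too.\<close>
    show "AE x in ?P. norm (\<sigma> x) = 1"
      by (subst AE_density) (auto simp: \<sigma>_def \<theta>_def norm_sgn)
    fix K :: "'a set" assume K: "compact K"
    then obtain r where r: "0 < r" "\<And>x. x \<in> K \<Longrightarrow> norm x \<le> r"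
      using compact_imp_bounded by (metis bounded_pos)
    \<comment> \<open>\<open>K\<close> lies in the ball of radius t / 2, where the bump is at least
      t^4 / 2. This turns integrability against one test function into local finiteness.\<close>
    define t where "t = 2 * r"
    let ?f = "\<lambda>x::'a. bump t (x - 0)"
    have f: "C1c ?f" by (rule bump_C1c(1))
    have i: "integrable ?h (\<lambda>x. \<bar>g b x * ?f x\<bar>)" if "b \<in> Basis" for b using gi[OF that f] by (rule integrable_abs)
    have "emeasure ?P K = (\<integral>\<^sup>+x. ennreal (\<theta> x) * indicator K x \<partial>?h)"
      using K by (subst emeasure_density) (auto simp: compact_imp_closed borel_closed)
    also have "\<dots> \<le> (\<integral>\<^sup>+x. ennreal ((2 / t ^ 4) * (\<Sum>b\<in>Basis. \<bar>g b x * ?f x\<bar>)) \<partial>?h)"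
    proof (rule nn_integral_mono)
      fix x
      show "ennreal (\<theta> x) * indicator K x \<le> ennreal ((2 / t ^ 4) * (\<Sum>b\<in>Basis. \<bar>g b x * ?f x\<bar>))"
      proof (cases "x \<in> K")
        case True
        have "t ^ 4 / 2 \<le> ?f x" using bump_ge[of x t] r(2)[OF True] by (simp add: t_def)
        then have c: "1 \<le> (2 / t ^ 4) * ?f x" using r(1) by (simp add: t_def field_simps)
        have "\<theta> x \<le> (\<Sum>b\<in>Basis. \<bar>g b x\<bar>)"
          unfolding \<theta>_def using norm_le_l1[of "G x"] by (simp add: Gb)
        also have "\<dots> \<le> (\<Sum>b\<in>Basis. \<bar>g b x\<bar> * ((2 / t ^ 4) * ?f x))"
          by (intro sum_mono mult_right_le_one_le[THEN order_trans, rotated -1]) (use c mult_left_mono[OF c, of "\<bar>g _ x\<bar>"] in auto)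
        also have "\<dots> = (2 / t ^ 4) * (\<Sum>b\<in>Basis. \<bar>g b x * ?f x\<bar>)"
          by (simp add: sum_distrib_left abs_mult mult_ac)
        finally show ?thesis using True by (simp add: ennreal_leI)
      qed simp
    qed
    also have "\<dots> < \<infinity>"
    proof -
      have "integrable ?h (\<lambda>x. (2 / t ^ 4) * (\<Sum>b\<in>Basis. \<bar>g b x * ?f x\<bar>))"
        by (intro integrable_mult_right Bochner_Integration.integrable_sum i)
      moreover have "0 \<le> (2 / t ^ 4) * (\<Sum>b\<in>Basis. \<bar>g b x * ?f x\<bar>)" for x
        using r(1) by (intro mult_nonneg_nonneg sum_nonneg) (auto simp: t_def)
      ultimately show ?thesis by (subst nn_integral_eq_integral) auto
    qed
    finally show "emeasure ?P K < \<infinity>" .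
  next
    fix T :: "'a \<Rightarrow> 'a" assume T: "C1_compact_support T"
    note c = C1_compact_support_component(1)[OF T]
    have "(LINT x:S|lebesgue. divergence T x) = (\<Sum>b\<in>Basis. LINT x:S|lborel. pd (\<lambda>x. T x \<bullet> b) b x)"
      using S by (intro divergence_integral T) auto
    also have "\<dots> = (\<Sum>b\<in>Basis. LINT x|?h. g b x * (T x \<bullet> b))"
      by (intro sum.cong refl gl c)
    also have "\<dots> = (LINT x|?h. T x \<bullet> G x)"
      unfolding GT by (rule Bochner_Integration.integral_sum[symmetric]) (intro gi c)
    also have "\<dots> = (LINT x|?h. \<theta> x *\<^sub>R (T x \<bullet> \<sigma> x))"
    proof (intro Bochner_Integration.integral_cong refl)
      fix x
      show "T x \<bullet> G x = \<theta> x *\<^sub>R (T x \<bullet> \<sigma> x)"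
        by (cases "G x = 0") (simp_all add: \<theta>_def \<sigma>_def sgn_div_norm)
    qed
    also have "\<dots> = (LINT x|?P. T x \<bullet> \<sigma> x)"
    proof (rule integral_density[symmetric])
      have "T x = (\<Sum>b\<in>Basis. (T x \<bullet> b) *\<^sub>R b)" for x by (simp add: euclidean_representation)
      then have "T = (\<lambda>x. \<Sum>b\<in>Basis. (T x \<bullet> b) *\<^sub>R b)" by (simp only:)
      moreover have "(\<lambda>x. \<Sum>b\<in>Basis. (T x \<bullet> b) *\<^sub>R b) \<in> borel_measurable borel"
        using C1c_borel[OF c] by measurable
      ultimately have [measurable]: "T \<in> borel_measurable borel" by (simp only:)
      show "(\<lambda>x. T x \<bullet> \<sigma> x) \<in> borel_measurable ?h" by measurable
    qed (auto simp: \<theta>_def)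
    finally show "(LINT x:S|lebesgue. divergence T x) = (LINT x|?P. T x \<bullet> \<sigma> x)" .
  qed
  moreover have "\<theta> \<in> borel_measurable borel" "\<forall>x. 0 \<le> \<theta> x" by (auto simp: \<theta>_def)
  ultimately show ?thesis by blast
qed

section \<open>Uniqueness of the polar decomposition\<close>

lemma exists_C1c_approx_support:
  assumes p: "C1c p"
  shows "\<exists>f :: nat \<Rightarrow> 'a::euclidean_space \<Rightarrow> real. (\<forall>k. C1c (f k)) \<and> (\<forall>k x. 0 \<le> f k x \<and> f k x \<le> indicator {x. p x \<noteq> 0} x) \<and>
    (\<forall>x. (\<lambda>k. f k x) \<longlonglongrightarrow> indicator {x. p x \<noteq> 0} x)"
proof -
  obtain M where M: "0 < M" "\<And>x. \<bar>p x\<bar> \<le> M" using C1c_bounded[OF p] by metis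
  define q where "q x = (1 / M\<^sup>2) * (p x * p x)" for x
  have qC: "C1c q" unfolding q_def by (intro C1c_cmult C1c_mult p)
  have q: "0 \<le> q x" "q x \<le> 1" "q x = 0 \<longleftrightarrow> p x = 0" for x
  proof -
    have "\<bar>p x\<bar> * \<bar>p x\<bar> \<le> M * M" using M(2)[of x] M(1) by (intro mult_mono) auto
    then show "q x \<le> 1" using M(1) by (simp add: q_def power2_eq_square)
  qed (use M(1) in \<open>auto simp: q_def\<close>)
  \<comment> \<open>These functions increase to 1 where q > 0 and are 0 elsewhere. They stay
    compactly supported because f (Suc k) = f k + q - q f k.\<close>
  define f where "f k x = 1 - (1 - q x) ^ k" for k x
  have "C1c (f k)" for k
  proof (induction k)
    case 0
    show ?case using C1c_cmult(1)[OF p, of 0] by (simp add: f_def)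
  next
    case (Suc k)
    have "f (Suc k) = (\<lambda>x. (f k x + q x) + (-1) * (q x * f k x))"
      by (auto simp: f_def algebra_simps)
    then show ?case using Suc qC by (simp only:) (intro C1c_add(1) C1c_cmult(1) C1c_mult)
  qed
  moreover have "0 \<le> f k x \<and> f k x \<le> indicator {x. p x \<noteq> 0} x" for k x
    using q[of x] by (auto simp: f_def indicator_def power_le_one)
  moreover have "(\<lambda>k. f k x) \<longlonglongrightarrow> indicator {x. p x \<noteq> 0} x" for x
  proof (cases "p x = 0")
    case True
    then show ?thesis using q(3)[of x] by (simp add: f_def)
  next
    case False
    then have "0 < q x" using q(1,3)[of x] by force
    then have "\<bar>1 - q x\<bar> < 1" using q(2)[of x] by auto
    then have "(\<lambda>k. 1 - (1 - q x) ^ k) \<longlonglongrightarrow> 1 - 0"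
      by (intro tendsto_intros LIMSEQ_power_zero) simp
    then show ?thesis using False by (simp add: f_def)
  qed
  ultimately show ?thesis by blast
qed

lemma borel_eq_sigma_C1c_supports:
  "sets (borel :: 'a::euclidean_space measure) = sigma_sets UNIV {U. \<exists>p. C1c p \<and> U = {x. p x \<noteq> 0}}"
    (is "_ = sigma_sets UNIV ?E")
proof
  have ball: "ball x e \<in> ?E" for x :: 'a and e
  proof (cases "0 < e")
    case True
    have "ball x e = {y. bump e (y - x) \<noteq> 0}"
    proof (intro set_eqI)
      fix y
      show "y \<in> ball x e \<longleftrightarrow> y \<in> {y. bump e (y - x) \<noteq> 0}"
        using bump_pos[of "y - x" e] bump_eq_0[of e "y - x"] True
        by (cases "norm (y - x) < e") (auto simp: dist_norm norm_minus_commute)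
    qed
    then show ?thesis using bump_C1c(1)[of e x] by blast
  next
    case False
    then have "ball x e = {y. (0::real) * bump 1 (y - x) \<noteq> 0}" by simp
    then show ?thesis using C1c_cmult(1)[OF bump_C1c(1)[of 1 x], of 0] by blast
  qed
  have op: "open U" if "U \<in> ?E" for U
    using that C1c_continuous open_Collect_neq[of _ "\<lambda>_. 0"] by fastforce
  show "sigma_sets UNIV ?E \<subseteq> sets (borel :: 'a measure)"
    using sets.sigma_sets_subset[of ?E "borel :: 'a measure"] op borel_open by (simp only: space_borel) blast
  have "U \<in> sigma_sets UNIV ?E" if U: "open U" for U :: "'a set"
  proof -
    let ?F = "{B. \<exists>x e. B = ball x e \<and> B \<subseteq> U}"
    have "\<Union>?F = U" using U by (auto simp: open_contains_ball) (metis centre_in_ball)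
    moreover obtain F' where F': "F' \<subseteq> ?F" "countable F'" "\<Union>F' = \<Union>?F"
      by (rule Lindelof[of ?F]) auto
    moreover have "\<Union>F' \<in> sigma_sets UNIV ?E"
    proof (rule sigma_sets_UNION[OF F'(2)])
      fix B assume "B \<in> F'"
      then show "B \<in> sigma_sets UNIV ?E" using F'(1) ball by (intro sigma_sets.Basic) blast
    qed
    ultimately show ?thesis by simp
  qed
  then have "sigma_sets UNIV (Collect open) \<subseteq> sigma_sets UNIV ?E"
    by (intro sigma_sets_mono) auto
  moreover have "sets (borel :: 'a measure) = sigma_sets UNIV (Collect open)"
    by (simp add: borel_def)
  ultimately show "sets (borel :: 'a measure) \<subseteq> sigma_sets UNIV ?E" by simp
qed

lemma gauss_green_polar_pd:
  fixes v :: "'a::euclidean_space"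
  assumes "gauss_green_polar E P \<sigma>" "C1c f" "E \<in> sets borel"
  shows "(LINT x:E|lborel. pd f v x) = (LINT x|P. f x * (v \<bullet> \<sigma> x))"
  using assms(1) C1c_scaleR(1)[OF assms(2), of v] divergence_integral_scaleR[OF assms(2,3), of v]
  unfolding gauss_green_polar_def by auto

lemma gauss_green_polar_integrable:
  assumes R: "gauss_green_polar E R \<rho>" and B: "B \<in> sets borel" "B \<subseteq> ball 0 r"
  shows "integrable R (\<lambda>x. indicator B x * (v \<bullet> \<rho> x))"
proof (rule Bochner_Integration.integrable_bound[where f="\<lambda>x. norm v * indicator (cball 0 r) x"])
  have g [measurable]: "sets R = sets borel" "\<rho> \<in> borel_measurable borel" "AE x in R. norm (\<rho> x) = 1"
    using R by (auto simp: gauss_green_polar_def)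
  note [measurable_cong] = g(1) and [measurable] = B(1)
  have "integrable R (indicat_real (cball 0 r))"
    using g(1) R by (intro integrable_real_indicator) (auto simp: gauss_green_polar_def)
  then show "integrable R (\<lambda>x. norm v * indicator (cball 0 r) x)" by simp
  show "(\<lambda>x. indicator B x * (v \<bullet> \<rho> x)) \<in> borel_measurable R" by measurable
  show "AE x in R. norm (indicat_real B x * (v \<bullet> \<rho> x)) \<le> norm (norm v * indicat_real (cball 0 r) x)"
    using g(3)
  proof eventually_elim
    case (elim x)
    have "\<bar>v \<bullet> \<rho> x\<bar> \<le> norm v" using Cauchy_Schwarz_ineq2[of v "\<rho> x"] elim by simp
    then show ?case using B(2) by (auto simp: indicator_def)
  qed
qed

text \<open>Polar decompositions are compared on supports of \<open>C\<^sup>1\<close> functions, which form a \<open>\<pi>\<close>-system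
  because they are closed under products.\<close>

lemma polar_set_integral_eq:
  fixes P Q :: "'a::euclidean_space measure"
  assumes E: "E \<in> sets borel" and pol: "gauss_green_polar E P \<sigma>" "gauss_green_polar E Q \<tau>" and A: "A \<in> sets borel"
  shows "(LINT x|P. indicator (A \<inter> ball 0 r) x * (v \<bullet> \<sigma> x)) = (LINT x|Q. indicator (A \<inter> ball 0 r) x * (v \<bullet> \<tau> x))"
proof -
  let ?E = "{U. \<exists>p. C1c p \<and> U = {x::'a. p x \<noteq> 0}}"
  have Es: "U \<in> sets borel" if "U \<in> ?E" for U
    using that borel_eq_sigma_C1c_supports[where 'a='a] sigma_sets.Basic by blast
  have base: "(LINT x|P. indicator U x * (v \<bullet> \<sigma> x)) = (LINT x|Q. indicator U x * (v \<bullet> \<tau> x))" if "U \<in> ?E" for U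
  proof -
    obtain p where p: "C1c p" "U = {x. p x \<noteq> 0}" using \<open>U \<in> ?E\<close> by blast
    obtain f :: "nat \<Rightarrow> 'a \<Rightarrow> real" where f0: "(\<forall>k. C1c (f k)) \<and> (\<forall>k x. 0 \<le> f k x \<and> f k x \<le> indicator U x) \<and>
       (\<forall>x. (\<lambda>k. f k x) \<longlonglongrightarrow> indicator U x)"
      using exists_C1c_approx_support[OF p(1)] unfolding p(2)[symmetric] by blast
    then have f: "C1c (f k)" "0 \<le> f k x" "f k x \<le> indicator U x" "(\<lambda>k. f k x) \<longlonglongrightarrow> indicator U x" for k x
      by simp_all
    have lim: "(\<lambda>k. LINT x:E|lborel. pd (f k) v x) \<longlonglongrightarrow> (LINT x|P. indicator U x * (v \<bullet> \<sigma> x))"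
      if "gauss_green_polar E P \<sigma>" for P \<sigma>
      unfolding gauss_green_polar_pd[OF that f(1) E]
    proof (rule integral_dominated_convergence[where w="\<lambda>x. norm v * indicator U x"])
      have g [measurable]: "sets P = sets borel" "\<sigma> \<in> borel_measurable borel" "AE x in P. norm (\<sigma> x) = 1"
        using that by (auto simp: gauss_green_polar_def)
      have [measurable]: "f k \<in> borel_measurable borel" for k by (rule C1c_borel[OF f(1)])
      note [measurable_cong] = g(1)
      have [measurable]: "U \<in> sets borel" using Es \<open>U \<in> ?E\<close> by blast
      show "(\<lambda>x. indicator U x * (v \<bullet> \<sigma> x)) \<in> borel_measurable P" by measurable
      show "(\<lambda>x. f k x * (v \<bullet> \<sigma> x)) \<in> borel_measurable P" for k by measurable
      have "U \<subseteq> closure U" by (rule closure_subset)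
      moreover have "compact (closure U)" using p by (simp add: C1c_def)
      ultimately have "emeasure P U < \<infinity>"
        using that emeasure_mono[of U "closure U" P] g(1) by (auto simp: gauss_green_polar_def intro: le_less_trans)
      then have "integrable P (indicat_real U)" using g(1) by (intro integrable_real_indicator) auto
      then show "integrable P (\<lambda>x. norm v * indicator U x)" by simp
      show "AE x in P. (\<lambda>k. f k x * (v \<bullet> \<sigma> x)) \<longlonglongrightarrow> indicator U x * (v \<bullet> \<sigma> x)"
        by (intro AE_I2 tendsto_mult f(4) tendsto_const)
      show "AE x in P. norm (f k x * (v \<bullet> \<sigma> x)) \<le> norm v * indicator U x" for k
        using g(3)
      proof eventually_elim
        case (elim x)
        have "\<bar>v \<bullet> \<sigma> x\<bar> \<le> norm v" using Cauchy_Schwarz_ineq2[of v "\<sigma> x"] elim by simp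
        then have "\<bar>f k x\<bar> * \<bar>v \<bullet> \<sigma> x\<bar> \<le> indicator U x * norm v"
          using f(2,3)[of k x] by (intro mult_mono) auto
        then show ?case by (simp add: abs_mult mult.commute)
      qed
    qed
    show ?thesis using lim[OF pol(1)] lim[OF pol(2)] by (rule LIMSEQ_unique)
  qed
  have EInt: "U \<inter> W \<in> ?E" if U: "U \<in> ?E" and W: "W \<in> ?E" for U W
  proof -
    obtain p q where "C1c p" "U = {x. p x \<noteq> 0}" "C1c q" "W = {x. q x \<noteq> 0}" using U W by blast
    then have "C1c (\<lambda>x. p x * q x)" "U \<inter> W = {x. p x * q x \<noteq> 0}" by (auto intro: C1c_mult)
    then show ?thesis by blast
  qed
  have ball0: "ball 0 r \<in> ?E"
  proof (cases "0 < r")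
    case True
    have "ball 0 r = {x::'a. bump r (x - 0) \<noteq> 0}"
      using bump_pos[of _ r] bump_eq_0[of r] True by (force simp: not_less)
    then show ?thesis using bump_C1c(1) by blast
  next
    case False
    then have "ball 0 r = {x::'a. 0 * bump 1 (x - 0) \<noteq> 0}" by simp
    then show ?thesis using C1c_cmult(1)[OF bump_C1c(1)[of 1 0], of 0] by blast
  qed
  define I where "I R \<rho> A = (LINT x|R. indicator (A \<inter> ball 0 r) x * (v \<bullet> \<rho> x))"
    for R :: "'a measure" and \<rho> A
  have Ic: "I R \<rho> (UNIV - A) = I R \<rho> UNIV - I R \<rho> A"
    if "gauss_green_polar E R \<rho>" "A \<in> sets borel" for R \<rho> A
  proof -
    have "I R \<rho> (UNIV - A) = (LINT x|R. indicator (UNIV \<inter> ball 0 r) x * (v \<bullet> \<rho> x) - indicator (A \<inter> ball 0 r) x * (v \<bullet> \<rho> x))"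
      unfolding I_def by (intro Bochner_Integration.integral_cong refl) (auto simp: indicator_def)
    also have "\<dots> = I R \<rho> UNIV - I R \<rho> A"
      unfolding I_def using that(2)
      by (intro Bochner_Integration.integral_diff gauss_green_polar_integrable[OF that(1), where r=r]) auto
    finally show ?thesis .
  qed
  have Iu: "I R \<rho> (\<Union>i. A i) = (\<Sum>i. I R \<rho> (A i))"
    if R: "gauss_green_polar E R \<rho>" and A: "\<And>i. A i \<in> sets borel" "disjoint_family A" for R \<rho> and A :: "nat \<Rightarrow> 'a set"
  proof -
    have g: "sets R = sets borel" using R by (auto simp: gauss_green_polar_def)
    have "(LINT x:(\<Union>i. A i \<inter> ball 0 r)|R. v \<bullet> \<rho> x) = (\<Sum>i. LINT x:(A i \<inter> ball 0 r)|R. v \<bullet> \<rho> x)"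
    proof (rule lebesgue_integral_countable_add)
      show "A i \<inter> ball 0 r \<in> sets R" for i using A(1) g by auto
      show "i \<noteq> j \<Longrightarrow> A i \<inter> ball 0 r \<inter> (A j \<inter> ball 0 r) = {}" for i j
        using A(2) by (auto simp: disjoint_family_on_def)
      show "set_integrable R (\<Union>i. A i \<inter> ball 0 r) (\<lambda>x. v \<bullet> \<rho> x)"
        unfolding set_integrable_def using gauss_green_polar_integrable[OF R, of "\<Union>i. A i \<inter> ball 0 r" r] A(1) by auto
    qed
    then show ?thesis by (simp add: I_def set_lebesgue_integral_def)
  qed
  have "Int_stable ?E"
    by (rule Int_stableI) (rule EInt)
  moreover have "?E \<subseteq> Pow UNIV" by simp
  moreover have "A \<in> sigma_sets UNIV ?E" using A borel_eq_sigma_C1c_supports[where 'a='a] by blast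
  ultimately have "I P \<sigma> A = I Q \<tau> A"
  proof (induct rule: sigma_sets_induct_disjoint)
    case (basic U)
    show ?case unfolding I_def by (rule base[OF EInt[OF basic ball0]])
  next
    case empty
    show ?case by (simp add: I_def)
  next
    case (compl B)
    then have "B \<in> sets borel" using borel_eq_sigma_C1c_supports[where 'a='a] by blast
    moreover have "I P \<sigma> UNIV = I Q \<tau> UNIV" unfolding I_def Int_UNIV_left by (rule base[OF ball0])
    ultimately show ?case using compl Ic[OF pol(1)] Ic[OF pol(2)] by simp
  next
    case (union B)
    then have "B i \<in> sets borel" for i using borel_eq_sigma_C1c_supports[where 'a='a] by blast
    then show ?case using union Iu[OF pol(1)] Iu[OF pol(2)] by simp
  qed
  then show ?thesis by (simp add: I_def)
qed

text \<open>The total variation is the largest pairing with fields of norm at most 1. Pairing with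
  \<open>\<sigma>\<close> gives exactly the mass of \<open>P\<close>. By
  \<open>polar_set_integral_eq\<close>, extended from constant vectors on Borel sets to bounded
  fields, the same pairing can be computed with \<open>Q\<close>, where it is at most the
  mass.\<close>

lemma gauss_green_polar_measure_le:
  fixes P Q :: "'a::euclidean_space measure"
  assumes E: "E \<in> sets borel" and pol: "gauss_green_polar E P \<sigma>" "gauss_green_polar E Q \<tau>" and A: "A \<in> sets borel"
  shows "emeasure P (A \<inter> ball 0 r) \<le> emeasure Q (A \<inter> ball 0 r)"
proof -
  have P [measurable]: "sets P = sets borel" "\<sigma> \<in> borel_measurable borel" "AE x in P. norm (\<sigma> x) = 1"
    and Q [measurable]: "sets Q = sets borel" "\<tau> \<in> borel_measurable borel" "AE x in Q. norm (\<tau> x) = 1"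
    using pol by (auto simp: gauss_green_polar_def)
  have [measurable]: "ball 0 r \<in> sets (borel :: 'a measure)" by simp
  note [measurable_cong] = P(1) Q(1) and [measurable] = A
  have finR: "emeasure R (A \<inter> ball 0 r) < \<infinity>" "integrable R (indicat_real (ball 0 r))"
    if R: "gauss_green_polar E R \<rho>" for R \<rho>
  proof -
    have s: "sets R = sets borel" and f: "emeasure R (cball 0 r) < \<infinity>" using R by (auto simp: gauss_green_polar_def)
    show "emeasure R (A \<inter> ball 0 r) < \<infinity>"
      by (rule le_less_trans[OF emeasure_mono f]) (auto simp: s)
    have "emeasure R (ball 0 r) < \<infinity>"
      by (rule le_less_trans[OF emeasure_mono f]) (auto simp: s)
    then show "integrable R (indicat_real (ball 0 r))"
      by (intro integrable_real_indicator) (auto simp: s)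
  qed
  \<comment> \<open>\<open>\<sigma>\<close> is a unit vector only almost everywhere. The modified
    field is bounded everywhere, so simple functions of norm at most 2 converge to it.\<close>
  define \<rho> where "\<rho> x = (if norm (\<sigma> x) = 1 then \<sigma> x else 0)" for x
  have [measurable]: "\<rho> \<in> borel_measurable borel" unfolding \<rho>_def by measurable
  have \<rho>1: "norm (\<rho> x) \<le> 1" for x by (simp add: \<rho>_def)
  obtain F where F0: "(\<forall>i. simple_function borel (F i)) \<and> (\<forall>x\<in>space borel. (\<lambda>i. F i x) \<longlonglongrightarrow> \<rho> x) \<and>
      (\<forall>i. \<forall>x\<in>space borel. dist (F i x) 0 \<le> 2 * dist (\<rho> x) 0)"
    using borel_measurable_implies_sequence_metric[of \<rho> borel 0] by auto
  then have F: "simple_function borel (F i)" "(\<lambda>i. F i x) \<longlonglongrightarrow> \<rho> x" "norm (F i x) \<le> 2" for i x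
    using \<rho>1[of x] by (auto intro: order_trans[of "norm (F i x)" "2 * norm (\<rho> x)"])
  have [measurable]: "F i \<in> borel_measurable borel" for i using F(1) by (rule borel_measurable_simple_function)
  let ?B = "A \<inter> ball 0 r"
  have step: "(LINT x|R. indicator ?B x * (F i x \<bullet> \<kappa> x))
      = (\<Sum>y\<in>range (F i). LINT x|R. indicator ((A \<inter> F i -` {y}) \<inter> ball 0 r) x * (y \<bullet> \<kappa> x))"
    if R: "gauss_green_polar E R \<kappa>" for R \<kappa> i
  proof -
    have fin: "finite (range (F i))" using simple_functionD(1)[OF F(1)] by simp
    have "indicator ?B x * (F i x \<bullet> \<kappa> x) = (\<Sum>y\<in>range (F i). indicator ((A \<inter> F i -` {y}) \<inter> ball 0 r) x * (y \<bullet> \<kappa> x))" for x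
    proof -
      have "(\<Sum>y\<in>range (F i). indicator ((A \<inter> F i -` {y}) \<inter> ball 0 r) x * (y \<bullet> \<kappa> x))
          = (\<Sum>y\<in>range (F i). if y = F i x then indicator ?B x * (F i x \<bullet> \<kappa> x) else 0)"
        by (intro sum.cong refl) (auto simp: indicator_def)
      then show ?thesis using fin by (simp add: sum.delta)
    qed
    then have "(LINT x|R. indicator ?B x * (F i x \<bullet> \<kappa> x))
        = (LINT x|R. (\<Sum>y\<in>range (F i). indicator ((A \<inter> F i -` {y}) \<inter> ball 0 r) x * (y \<bullet> \<kappa> x)))"
      by (simp only:)
    also have "\<dots> = (\<Sum>y\<in>range (F i). LINT x|R. indicator ((A \<inter> F i -` {y}) \<inter> ball 0 r) x * (y \<bullet> \<kappa> x))"
    proof (intro Bochner_Integration.integral_sum gauss_green_polar_integrable[OF R])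
      fix y show "A \<inter> F i -` {y} \<inter> ball 0 r \<in> sets borel"
        using simple_functionD(2)[OF F(1), of i "{y}"] A by auto
    qed auto
    finally show ?thesis .
  qed
  have eq: "(LINT x|P. indicator ?B x * (F i x \<bullet> \<sigma> x)) = (LINT x|Q. indicator ?B x * (F i x \<bullet> \<tau> x))" for i
    unfolding step[OF pol(1)] step[OF pol(2)]
  proof (intro sum.cong refl polar_set_integral_eq[OF E pol])
    fix y show "A \<inter> F i -` {y} \<in> sets borel"
      using simple_functionD(2)[OF F(1), of i "{y}"] A by auto
  qed
  have lim: "(\<lambda>i. LINT x|R. indicator ?B x * (F i x \<bullet> \<kappa> x)) \<longlonglongrightarrow> (LINT x|R. indicator ?B x * (\<rho> x \<bullet> \<kappa> x))"
    if R: "gauss_green_polar E R \<kappa>" for R \<kappa>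
  proof (rule integral_dominated_convergence[where w="\<lambda>x. 2 * indicat_real (ball 0 r) x"])
    have g [measurable]: "sets R = sets borel" "\<kappa> \<in> borel_measurable borel" "AE x in R. norm (\<kappa> x) = 1"
      using R by (auto simp: gauss_green_polar_def)
    note [measurable_cong] = g(1)
    show "(\<lambda>x. indicator ?B x * (\<rho> x \<bullet> \<kappa> x)) \<in> borel_measurable R" by measurable
    show "(\<lambda>x. indicator ?B x * (F i x \<bullet> \<kappa> x)) \<in> borel_measurable R" for i by measurable
    show "integrable R (\<lambda>x. 2 * indicat_real (ball 0 r) x)" using finR(2)[OF R] by simp
    show "AE x in R. (\<lambda>i. indicator ?B x * (F i x \<bullet> \<kappa> x)) \<longlonglongrightarrow> indicator ?B x * (\<rho> x \<bullet> \<kappa> x)"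
      by (intro AE_I2 tendsto_mult tendsto_inner F(2) tendsto_const)
    show "AE x in R. norm (indicator ?B x * (F i x \<bullet> \<kappa> x)) \<le> 2 * indicator (ball 0 r) x" for i
      using g(3)
    proof eventually_elim
      case (elim x)
      have "\<bar>F i x \<bullet> \<kappa> x\<bar> \<le> 2" using Cauchy_Schwarz_ineq2[of "F i x" "\<kappa> x"] elim F(3)[of i x] by simp
      then show ?case by (auto simp: indicator_def)
    qed
  qed
  have fP: "emeasure P ?B = ennreal (measure P ?B)" and fQ: "emeasure Q ?B = ennreal (measure Q ?B)"
    using finR(1)[OF pol(1)] finR(1)[OF pol(2)] by (simp_all add: emeasure_eq_ennreal_measure)
  have "measure P ?B = (LINT x|P. indicator ?B x * (\<rho> x \<bullet> \<sigma> x))"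
  proof -
    have "(LINT x|P. indicator ?B x * (\<rho> x \<bullet> \<sigma> x)) = (LINT x|P. indicator ?B x)"
      using P(3) by (intro integral_cong_AE) (auto elim!: eventually_mono simp: \<rho>_def simp flip: power2_norm_eq_inner)
    then show ?thesis by simp
  qed
  also have "\<dots> = (LINT x|Q. indicator ?B x * (\<rho> x \<bullet> \<tau> x))"
    using lim[OF pol(1)] lim[OF pol(2)] unfolding eq by (rule LIMSEQ_unique)
  also have "\<dots> \<le> (LINT x|Q. indicator ?B x)"
  proof (rule integral_mono_AE)
    have iB: "integrable Q (indicat_real ?B)"
      using finR(1)[OF pol(2)] Q(1) A by (intro integrable_real_indicator) auto
    then show "integrable Q (indicat_real ?B)" .
    have b: "AE x in Q. \<bar>indicator ?B x * (\<rho> x \<bullet> \<tau> x)\<bar> \<le> indicat_real ?B x"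
      using Q(3)
    proof eventually_elim
      case (elim x)
      have "\<bar>\<rho> x \<bullet> \<tau> x\<bar> \<le> 1" using Cauchy_Schwarz_ineq2[of "\<rho> x" "\<tau> x"] elim \<rho>1[of x] by simp
      then show ?case by (auto simp: indicator_def)
    qed
    show "integrable Q (\<lambda>x. indicator ?B x * (\<rho> x \<bullet> \<tau> x))"
      by (rule Bochner_Integration.integrable_bound[OF iB]) (use b in \<open>auto elim!: eventually_mono\<close>)
    show "AE x in Q. indicator ?B x * (\<rho> x \<bullet> \<tau> x) \<le> indicat_real ?B x"
      using b by (auto elim!: eventually_mono)
  qed
  finally show ?thesis unfolding fP fQ by (simp add: ennreal_leI)
qed

lemma gauss_green_polar_unique:
  assumes E: "E \<in> sets borel" and pol: "gauss_green_polar E P \<sigma>" "gauss_green_polar E Q \<tau>"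
  shows "P = Q"
proof (rule measure_eqI)
  have s: "sets P = sets borel" "sets Q = sets borel" using pol by (auto simp: gauss_green_polar_def)
  then show "sets P = sets Q" by simp
  fix A assume "A \<in> sets P"
  then have A: "A \<in> sets borel" using s by simp
  have *: "emeasure R A = (SUP n. emeasure R (A \<inter> ball 0 (real n)))" if "sets R = sets borel" for R
  proof -
    have "(SUP n. emeasure R (A \<inter> ball 0 (real n))) = emeasure R (\<Union>n. A \<inter> ball 0 (real n))"
    proof (rule SUP_emeasure_incseq)
      show "range (\<lambda>n. A \<inter> ball 0 (real n)) \<subseteq> sets R"
      proof
        fix X assume "X \<in> range (\<lambda>n. A \<inter> ball 0 (real n))"
        then obtain n where "X = A \<inter> ball 0 (real n)" by (rule imageE)
        then have "X \<in> sets borel" using A by simp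
        then show "X \<in> sets R" by (simp only: that)
      qed
      show "incseq (\<lambda>n. A \<inter> ball 0 (real n))"
        by (intro monoI Int_mono subset_ball) auto
    qed
    also have "(\<Union>n. A \<inter> ball 0 (real n)) = A"
    proof -
      have "\<exists>n. x \<in> ball 0 (real n)" for x :: 'a using reals_Archimedean2[of "norm x"] by simp
      then show ?thesis by blast
    qed
    finally show ?thesis ..
  qed
  show "emeasure P A = emeasure Q A"
    unfolding *[OF s(1)] *[OF s(2)]
    by (intro SUP_cong refl antisym gauss_green_polar_measure_le[OF E pol A]
        gauss_green_polar_measure_le[OF E pol(2,1) A])
qed

text \<open>\<open>perimeter_measure\<close> is an arbitrary choice among polar decompositions;
  uniqueness identifies it with the constructed measure, which has a density with respect to the
  surface measure.\<close>

lemma perimeter_measure_polar: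
  fixes S :: "'a::euclidean_space set"
  assumes S: "open S" and n: "2 \<le> DIM('a)"
    and fin: "\<And>K. compact K \<Longrightarrow> emeasure (surface_measure (frontier S)) K < \<infinity>"
  obtains \<theta> where "\<theta> \<in> borel_measurable borel" "\<And>x. 0 \<le> \<theta> x"
    "perimeter_measure S = density (surface_measure (frontier S)) (\<lambda>x. ennreal (\<theta> x))"
    "gauss_green_polar S (perimeter_measure S) (SOME \<sigma>. gauss_green_polar S (perimeter_measure S) \<sigma>)"
proof -
  obtain \<theta> \<sigma> where t: "\<theta> \<in> borel_measurable borel" "\<And>x. 0 \<le> \<theta> x"
    "gauss_green_polar S (density (surface_measure (frontier S)) (\<lambda>x. ennreal (\<theta> x))) \<sigma>"
    using exists_gauss_green_polar[OF S n fin] by blast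
  have "\<exists>\<sigma>. gauss_green_polar S (perimeter_measure S) \<sigma>"
    unfolding perimeter_measure_def using t(3) by (intro someI_ex[of "\<lambda>\<mu>. \<exists>\<sigma>. gauss_green_polar S \<mu> \<sigma>"]) blast
  from someI_ex[OF this] have p: "gauss_green_polar S (perimeter_measure S) (SOME \<sigma>. gauss_green_polar S (perimeter_measure S) \<sigma>)" .
  have "S \<in> sets borel" using S by simp
  from gauss_green_polar_unique[OF this p t(3)] show thesis
    using that t(1,2) p by blast
qed

section \<open>Lebesgue points of Ahlfors regular measures\<close>

locale ahlfors_measure =
  fixes M :: "'a::euclidean_space measure" and F :: "'a set" and k :: nat and C d :: real
  assumes sets_M [measurable_cong]: "sets M = sets borel"
    and closed_F: "closed F" and null_off_F: "emeasure M (- F) = 0"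
    and C_pos: "0 < C" and d_pos: "0 < d"
    and lower: "\<And>x r. x \<in> F \<Longrightarrow> 0 < r \<Longrightarrow> r < d \<Longrightarrow> ennreal (inverse C * r ^ k) \<le> emeasure M (ball x r)"
    and upper: "\<And>x r. x \<in> F \<Longrightarrow> 0 < r \<Longrightarrow> r < d \<Longrightarrow> emeasure M (ball x r) \<le> ennreal (C * r ^ k)"
begin

lemma AE_in_F: "AE x in M. x \<in> F"
proof (rule AE_I')
  show "- F \<in> null_sets M" using null_off_F closed_F by (auto simp: null_sets_def sets_M)
  show "{x \<in> space M. x \<notin> F} \<subseteq> - F" by auto
qed

lemma finite_on_compact:
  assumes K: "compact K"
  shows "emeasure M K < \<infinity>"
proof -
  have c: "compact (K \<inter> F)" using K closed_F by (rule compact_Int_closed)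
  have "K \<inter> F \<subseteq> (\<Union>x\<in>K \<inter> F. ball x (d / 2))" using d_pos by auto
  then obtain T where T: "T \<subseteq> K \<inter> F" "finite T" "K \<inter> F \<subseteq> (\<Union>x\<in>T. ball x (d / 2))"
    by (rule compactE_image[OF c, rotated]) auto
  have Fb: "- F \<in> sets borel" using closed_F by (intro borel_open open_Compl)
  have "emeasure M K \<le> emeasure M ((\<Union>x\<in>T. ball x (d / 2)) \<union> (- F))"
  proof (rule emeasure_mono)
    show "(\<Union>x\<in>T. ball x (d / 2)) \<union> - F \<in> sets M"
      unfolding sets_M by (intro sets.Un Fb borel_open) auto
  qed (use T(3) in auto)
  also have "\<dots> \<le> emeasure M (\<Union>x\<in>T. ball x (d / 2)) + emeasure M (- F)"
    using closed_F T(2) by (intro emeasure_subadditive) (auto simp: sets_M)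
  also have "\<dots> = emeasure M (\<Union>x\<in>T. ball x (d / 2))" by (simp add: null_off_F)
  also have "\<dots> \<le> (\<Sum>x\<in>T. emeasure M (ball x (d / 2)))"
    using T(2) by (intro emeasure_subadditive_finite) (auto simp: sets_M)
  also have "\<dots> < \<infinity>"
  proof -
    have "emeasure M (ball x (d / 2)) < \<infinity>" if "x \<in> T" for x
      using le_less_trans[OF upper[of x "d / 2"]] that T(1) d_pos by (simp add: subset_iff)
    then show ?thesis using T(2) by (simp add: ennreal_sum_less_top infinity_ennreal_def)
  qed
  finally show ?thesis .
qed

text \<open>The measure with density u gives \<open>A\<close> mass 0, so \<open>A\<close> has an
  open neighbourhood of small mass. Each point of \<open>Z\<close> centres a ball inside it with
  mass at least e r^k. A disjoint subfamily has small total mass, and its fivefold enlargements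
  cover \<open>Z\<close> with \<open>M\<close>-mass larger by at most a constant factor.\<close>

lemma Vitali_null_sequence:
  fixes u :: "'a \<Rightarrow> real"
  assumes u [measurable]: "u \<in> borel_measurable borel"
    and loc: "\<And>K. compact K \<Longrightarrow> (\<integral>\<^sup>+y\<in>K. ennreal (u y) \<partial>M) < \<infinity>"
    and A: "A \<in> sets borel" "A \<subseteq> F \<inter> ball 0 n" "\<And>x. x \<in> A \<Longrightarrow> u x = 0"
    and e: "0 < e" and s: "0 < s"
    and Z: "Z \<subseteq> A" "\<And>x r0. x \<in> Z \<Longrightarrow> 0 < r0 \<Longrightarrow> \<exists>r. 0 < r \<and> r < r0 \<and> ennreal (e * r ^ k) \<le> (\<integral>\<^sup>+y\<in>ball x r. ennreal (u y) \<partial>M)"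
  shows "\<exists>W\<in>sets borel. Z \<subseteq> W \<and> emeasure M W \<le> ennreal s"
proof -
  define \<mu> where "\<mu> = density M (\<lambda>y. ennreal (u y) * indicator (ball 0 (n + 1)) y)"
  \<comment> \<open>The enlarged ball has \<open>M\<close>-mass at most C (5 r)^k = c e r^k.\<close>
  define c where "c = C * 5 ^ k / e"
  have c: "0 < c" using C_pos e by (simp add: c_def)
  have [measurable]: "ball 0 (n + 1) \<in> sets (borel :: 'a measure)" by simp
  have em: "emeasure \<mu> X = (\<integral>\<^sup>+y. ennreal (u y) * indicator (ball 0 (n + 1)) y * indicator X y \<partial>M)" if "X \<in> sets borel" for X
    unfolding \<mu>_def using that by (subst emeasure_density) (auto simp: sets_M)
  have sm: "sets \<mu> = sets borel" by (simp add: \<mu>_def sets_M)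
  have "emeasure \<mu> (space \<mu>) \<noteq> \<infinity>"
  proof -
    have "emeasure \<mu> (space \<mu>) = emeasure \<mu> UNIV" using sets_eq_imp_space_eq[OF sm] by simp
    also have "\<dots> \<le> (\<integral>\<^sup>+y\<in>cball 0 (n + 1). ennreal (u y) \<partial>M)"
      by (subst em, simp, intro nn_integral_mono) (auto simp: indicator_def)
    also have "\<dots> < \<infinity>" by (rule loc) simp
    finally show ?thesis by simp
  qed
  from outer_regular[OF sm this A(1)]
  have "emeasure \<mu> A = (INF U \<in> {U. A \<subseteq> U \<and> open U}. emeasure \<mu> U)" .
  moreover have "emeasure \<mu> A = 0"
  proof -
    have "ennreal (u y) * indicator (ball 0 (n + 1)) y * indicator A y = 0" for y
      using A(3)[of y] by (cases "y \<in> A") auto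
    then show ?thesis unfolding em[OF A(1)] by (simp only: nn_integral_const mult_zero_left)
  qed
  ultimately have "(INF U \<in> {U. A \<subseteq> U \<and> open U}. emeasure \<mu> U) < ennreal (s / c)"
    using s c by simp
  then obtain U where U: "A \<subseteq> U" "open U" "emeasure \<mu> U < ennreal (s / c)"
    unfolding INF_less_iff by auto
  have "\<exists>r. 0 < r \<and> r < min 1 (d / 5) \<and> ball x r \<subseteq> U \<and> ennreal (e * r ^ k) \<le> (\<integral>\<^sup>+y\<in>ball x r. ennreal (u y) \<partial>M)"
    if x: "x \<in> Z" for x
  proof -
    have "x \<in> U" using x Z(1) U(1) by blast
    then obtain t where t: "0 < t" "ball x t \<subseteq> U" using U(2) open_contains_ball by blast
    \<comment> \<open>The bound d / 5 permits the upper regularity estimate at the enlarged radius;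
      the bound 1 keeps the balls in the region to which the measure with density u was cut
      off.\<close>
    have "0 < min t (min 1 (d / 5))" using t d_pos by simp
    from Z(2)[OF x this] obtain r where r: "0 < r" "r < min t (min 1 (d / 5))"
      "ennreal (e * r ^ k) \<le> (\<integral>\<^sup>+y\<in>ball x r. ennreal (u y) \<partial>M)" by blast
    moreover have "ball x r \<subseteq> ball x t" using r(2) by (intro subset_ball) simp
    ultimately show ?thesis using t(2) by (intro exI[of _ r]) auto
  qed
  then have "\<forall>x\<in>Z. \<exists>r. 0 < r \<and> r < min 1 (d / 5) \<and> ball x r \<subseteq> U \<and> ennreal (e * r ^ k) \<le> (\<integral>\<^sup>+y\<in>ball x r. ennreal (u y) \<partial>M)"
    by blast
  from bchoice[OF this] obtain \<rho> where \<rho>0: "\<forall>x\<in>Z. 0 < \<rho> x \<and> \<rho> x < min 1 (d / 5) \<and> ball x (\<rho> x) \<subseteq> U \<and> ennreal (e * \<rho> x ^ k) \<le> (\<integral>\<^sup>+y\<in>ball x (\<rho> x). ennreal (u y) \<partial>M)" ..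
  then have \<rho>: "0 < \<rho> x" "\<rho> x < 1" "\<rho> x < d / 5" "ball x (\<rho> x) \<subseteq> U"
    "ennreal (e * \<rho> x ^ k) \<le> (\<integral>\<^sup>+y\<in>ball x (\<rho> x). ennreal (u y) \<partial>M)" if "x \<in> Z" for x
    using that by auto
  obtain T where T: "countable T" "T \<subseteq> Z" "pairwise (\<lambda>i j. disjnt (ball i (\<rho> i)) (ball j (\<rho> j))) T"
    "Z \<subseteq> (\<Union>i\<in>T. ball i (5 * \<rho> i))"
  proof (rule Vitali_covering_lemma_balls[where S=Z and K=Z and a="\<lambda>x. x" and r=\<rho> and B=1])
    show "Z \<subseteq> (\<Union>i\<in>Z. ball i (\<rho> i))" using \<rho>(1) by auto
    show "\<And>i. i \<in> Z \<Longrightarrow> 0 < \<rho> i \<and> \<rho> i \<le> 1" using \<rho>(1,2) by (simp add: less_imp_le)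
  qed
  \<comment> \<open>The countable disjoint family is reindexed by all natural numbers, with empty
    sets at the remaining indices.\<close>
  define B where "B m = (if m \<in> to_nat_on T ` T then ball (from_nat_into T m) (\<rho> (from_nat_into T m)) else {})" for m
  define W where "W m = (if m \<in> to_nat_on T ` T then ball (from_nat_into T m) (5 * \<rho> (from_nat_into T m)) else {})" for m
  have fT: "from_nat_into T m \<in> T" if "m \<in> to_nat_on T ` T" for m
    using that T(1) by auto
  have WB: "emeasure M (W m) \<le> ennreal c * emeasure \<mu> (B m)" for m
  proof (cases "m \<in> to_nat_on T ` T")
    case True
    let ?x = "from_nat_into T m"
    have x: "?x \<in> Z" using fT[OF True] T(2) by blast
    then have xA: "?x \<in> F" "?x \<in> ball 0 n" using Z(1) A(2) by auto
    have "emeasure M (W m) \<le> ennreal (C * (5 * \<rho> ?x) ^ k)"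
      using True upper[OF xA(1), of "5 * \<rho> ?x"] \<rho>(1,3)[OF x] by (simp add: W_def)
    also have "C * (5 * \<rho> ?x) ^ k = c * (e * \<rho> ?x ^ k)" using e by (simp add: c_def power_mult_distrib)
    also have "ennreal (c * (e * \<rho> ?x ^ k)) = ennreal c * ennreal (e * \<rho> ?x ^ k)"
      using c e \<rho>(1)[OF x] by (intro ennreal_mult) auto
    also have "\<dots> \<le> ennreal c * (\<integral>\<^sup>+y\<in>ball ?x (\<rho> ?x). ennreal (u y) \<partial>M)"
      by (intro mult_left_mono \<rho>(5)[OF x]) simp
    also have "(\<integral>\<^sup>+y\<in>ball ?x (\<rho> ?x). ennreal (u y) \<partial>M) \<le> emeasure \<mu> (B m)"
    proof -
      have "ball ?x (\<rho> ?x) \<subseteq> ball 0 (n + 1)"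
      proof
        fix y assume "y \<in> ball ?x (\<rho> ?x)"
        then have "dist 0 y < n + 1" using xA(2) \<rho>(2)[OF x] dist_triangle[of 0 y ?x] by simp
        then show "y \<in> ball 0 (n + 1)" by simp
      qed
      then show ?thesis
        using True by (subst em) (auto simp: B_def indicator_def intro!: nn_integral_mono)
    qed
    finally show ?thesis by (simp add: mult_left_mono)
  next
    case False
    then show ?thesis by (simp add: W_def)
  qed
  have [measurable]: "W m \<in> sets borel" "B m \<in> sets borel" for m by (auto simp: W_def B_def)
  have "Z \<subseteq> (\<Union>m. W m)"
  proof
    fix x assume "x \<in> Z"
    then obtain i where i: "i \<in> T" "x \<in> ball i (5 * \<rho> i)" using T(4) by blast
    then have "x \<in> W (to_nat_on T i)" using T(1) by (auto simp: W_def)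
    then show "x \<in> (\<Union>m. W m)" by blast
  qed
  moreover have "emeasure M (\<Union>m. W m) \<le> ennreal s"
  proof -
    have "emeasure M (\<Union>m. W m) \<le> (\<Sum>m. emeasure M (W m))"
      by (rule emeasure_subadditive_countably) (auto simp: sets_M)
    also have "\<dots> \<le> (\<Sum>m. ennreal c * emeasure \<mu> (B m))" by (intro suminf_le WB) auto
    also have "\<dots> = ennreal c * (\<Sum>m. emeasure \<mu> (B m))" by simp
    also have "(\<Sum>m. emeasure \<mu> (B m)) = emeasure \<mu> (\<Union>m. B m)"
    proof (rule suminf_emeasure)
      show "range B \<subseteq> sets \<mu>" by (auto simp: sm)
      show "disjoint_family B"
      proof (unfold disjoint_family_on_def, intro ballI impI)
        fix m m' :: nat assume ne: "m \<noteq> m'"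
        show "B m \<inter> B m' = {}"
        proof (cases "m \<in> to_nat_on T ` T \<and> m' \<in> to_nat_on T ` T")
          case True
          then have "from_nat_into T m \<noteq> from_nat_into T m'" using ne T(1) by auto
          then show ?thesis using T(3) fT True by (auto simp: pairwise_def disjnt_def B_def)
        qed (auto simp: B_def)
      qed
    qed
    also have "emeasure \<mu> (\<Union>m. B m) \<le> emeasure \<mu> U"
    proof (rule emeasure_mono)
      have "B m \<subseteq> U" for m using fT[of m] T(2) \<rho>(4)[of "from_nat_into T m"] by (auto simp: B_def split: if_splits)
      then show "(\<Union>m. B m) \<subseteq> U" by blast
      show "U \<in> sets \<mu>" using U(2) by (simp add: sm)
    qed
    also have "\<dots> \<le> ennreal (s / c)" using U(3) by (rule less_imp_le)
    also have "ennreal c * ennreal (s / c) = ennreal s" using c s by (simp flip: ennreal_mult)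
    finally show ?thesis by (simp add: mult_left_mono)
  qed
  ultimately show ?thesis by (intro bexI[of _ "\<Union>m. W m"]) auto
qed

text \<open>The exceptional points in a bounded region can be covered by Borel sets of mass 1 / (m +
  1) for every m. Their own set need not be measurable, so the intersection of the covers serves as
  a null superset.\<close>

lemma AE_average_vanishes:
  fixes u :: "'a \<Rightarrow> real"
  assumes u: "u \<in> borel_measurable borel"
    and loc: "\<And>K. compact K \<Longrightarrow> (\<integral>\<^sup>+y\<in>K. ennreal (u y) \<partial>M) < \<infinity>"
    and A: "A \<in> sets borel" "\<And>x. x \<in> A \<Longrightarrow> u x = 0" and e: "0 < e"
  shows "AE x in M. x \<in> A \<longrightarrow> (\<exists>r0>0. \<forall>r. 0 < r \<and> r < r0 \<longrightarrow> (\<integral>\<^sup>+y\<in>ball x r. ennreal (u y) \<partial>M) \<le> ennreal (e * r ^ k))"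
proof -
  define Z where "Z n = {x \<in> A \<inter> F \<inter> ball 0 (real n). \<forall>r0>0. \<exists>r. 0 < r \<and> r < r0 \<and>
      ennreal (e * r ^ k) \<le> (\<integral>\<^sup>+y\<in>ball x r. ennreal (u y) \<partial>M)}" for n :: nat
  have "\<exists>N\<in>null_sets M. Z n \<subseteq> N" for n
  proof -
    have "\<forall>m. \<exists>W. W \<in> sets borel \<and> Z n \<subseteq> W \<and> emeasure M W \<le> ennreal (1 / real (Suc m))"
    proof
      fix m
      have "\<exists>W\<in>sets borel. Z n \<subseteq> W \<and> emeasure M W \<le> ennreal (1 / real (Suc m))"
        by (rule Vitali_null_sequence[OF u loc, where A="A \<inter> F \<inter> ball 0 (real n)" and n="real n" and e=e])
          (use A e closed_F in \<open>auto simp: Z_def\<close>)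
      then show "\<exists>W. W \<in> sets borel \<and> Z n \<subseteq> W \<and> emeasure M W \<le> ennreal (1 / real (Suc m))" by blast
    qed
    from choice[OF this] obtain W where W: "\<forall>m. W m \<in> sets borel \<and> Z n \<subseteq> W m \<and> emeasure M (W m) \<le> ennreal (1 / real (Suc m))" ..
    have "emeasure M (\<Inter>m. W m) = 0"
    proof (rule ccontr)
      assume ne: "emeasure M (\<Inter>m. W m) \<noteq> 0"
      have le: "emeasure M (\<Inter>m. W m) \<le> ennreal (1 / real (Suc m))" for m
      proof -
        have "W m \<in> sets M" using W by (simp only: sets_M)
        then have "emeasure M (\<Inter>m. W m) \<le> emeasure M (W m)" by (intro emeasure_mono) blast+
        also have "\<dots> \<le> ennreal (1 / real (Suc m))" using W by blast
        finally show ?thesis .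
      qed
      have "emeasure M (\<Inter>m. W m) < top" by (rule le_less_trans[OF le[of 0] ennreal_less_top])
      then obtain t where t: "0 \<le> t" "emeasure M (\<Inter>m. W m) = ennreal t"
        unfolding less_top_ennreal by blast
      with ne have "0 < t" by (cases "t = 0") auto
      then obtain m where m: "1 / real (Suc m) < t" by (rule nat_approx_posE)
      have "1 / real (Suc m) < t \<Longrightarrow> \<not> ennreal t \<le> ennreal (1 / real (Suc m))"
        by (simp add: ennreal_le_iff del: of_nat_Suc)
      then show False using le[of m] m unfolding t(2) by blast
    qed
    then have "(\<Inter>m. W m) \<in> null_sets M" using W by (auto simp: null_sets_def sets_M)
    then show ?thesis using W by blast
  qed
  then have "\<forall>n. \<exists>N. N \<in> null_sets M \<and> Z n \<subseteq> N" by blast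
  from choice[OF this] obtain N where N: "\<forall>n. N n \<in> null_sets M \<and> Z n \<subseteq> N n" ..
  have "AE x in M. \<forall>n. x \<notin> N n" using N AE_not_in by (subst AE_all_countable) blast
  with AE_in_F show ?thesis
  proof eventually_elim
    case (elim x)
    show ?case
    proof (intro impI)
      assume xA: "x \<in> A"
      obtain n where "norm x < real n" using reals_Archimedean2 by blast
      moreover have "x \<notin> Z n" using N elim(2) by blast
      ultimately have "\<not> (\<forall>r0>0. \<exists>r. 0 < r \<and> r < r0 \<and> ennreal (e * r ^ k) \<le> (\<integral>\<^sup>+y\<in>ball x r. ennreal (u y) \<partial>M))"
        using xA elim(1) by (auto simp: Z_def)
      then show "\<exists>r0>0. \<forall>r. 0 < r \<and> r < r0 \<longrightarrow> (\<integral>\<^sup>+y\<in>ball x r. ennreal (u y) \<partial>M) \<le> ennreal (e * r ^ k)"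
        by (meson linear)
    qed
  qed
qed

text \<open>For q in a countable dense set, let u be |g - q| set to 0 where it is below \<eta>. It
  vanishes on the set where g is within \<eta> of q, so by \<open>AE_average_vanishes\<close> its
  averages are small at almost every point of that set. There g is close to q on average, hence
  close to its value at the point.\<close>

lemma AE_lebesgue_point:
  fixes g :: "'a \<Rightarrow> 'b::euclidean_space"
  assumes g [measurable]: "g \<in> borel_measurable borel"
    and loc: "\<And>K. compact K \<Longrightarrow> (\<integral>\<^sup>+y\<in>K. ennreal (norm (g y)) \<partial>M) < \<infinity>"
  shows "AE x in M. \<forall>e>0. \<exists>r0>0. \<forall>r. 0 < r \<and> r < r0 \<longrightarrow>
    (\<integral>\<^sup>+y\<in>ball x r. ennreal (norm (g y - g x)) \<partial>M) \<le> ennreal (e * r ^ k)"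
proof -
  obtain D :: "'b set" where D: "countable D" "\<And>X. open X \<Longrightarrow> X \<noteq> {} \<Longrightarrow> \<exists>d\<in>D. d \<in> X"
    using countable_dense_setE by blast
  define \<eta> where "\<eta> m = 1 / real (Suc m)" for m
  have \<eta>: "0 < \<eta> m" for m by (simp add: \<eta>_def)
  define A where "A m q = {x. norm (g x - q) < \<eta> m}" for m q
  have [measurable]: "A m q \<in> sets borel" for m q unfolding A_def by measurable
  define u where "u m q y = norm (g y - q) * indicator (- A m q) y" for m q y
  have [measurable]: "u m q \<in> borel_measurable borel" for m q unfolding u_def by measurable
  have "AE x in M. x \<in> A m q \<longrightarrow> (\<exists>r0>0. \<forall>r. 0 < r \<and> r < r0 \<longrightarrow> (\<integral>\<^sup>+y\<in>ball x r. ennreal (u m q y) \<partial>M) \<le> ennreal (\<eta> m * r ^ k))" for m q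
  proof (rule AE_average_vanishes)
    show "u m q \<in> borel_measurable borel" "A m q \<in> sets borel" by measurable
    show "x \<in> A m q \<Longrightarrow> u m q x = 0" for x by (simp add: u_def)
    show "0 < \<eta> m" by (rule \<eta>)
    fix K :: "'a set" assume K: "compact K"
    have [measurable]: "K \<in> sets borel" using K by (simp add: compact_imp_closed)
    have "(\<integral>\<^sup>+y\<in>K. ennreal (u m q y) \<partial>M) \<le> (\<integral>\<^sup>+y. ennreal (norm (g y)) * indicator K y + ennreal (norm q) * indicator K y \<partial>M)"
    proof (rule nn_integral_mono)
      fix y
      have "u m q y \<le> norm (g y) + norm q" by (auto simp: u_def indicator_def norm_triangle_ineq4)
      from ennreal_leI[OF this] have "ennreal (u m q y) \<le> ennreal (norm (g y)) + ennreal (norm q)" by simp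
      then show "ennreal (u m q y) * indicator K y \<le> ennreal (norm (g y)) * indicator K y + ennreal (norm q) * indicator K y"
        by (auto simp: indicator_def)
    qed
    also have "\<dots> = (\<integral>\<^sup>+y\<in>K. ennreal (norm (g y)) \<partial>M) + ennreal (norm q) * emeasure M K"
      by (subst nn_integral_add) (auto simp: nn_integral_cmult_indicator sets_M)
    also have "\<dots> < \<infinity>" using loc[OF K] finite_on_compact[OF K] by (simp add: ennreal_mult_less_top)
    finally show "(\<integral>\<^sup>+y\<in>K. ennreal (u m q y) \<partial>M) < \<infinity>" .
  qed
  then have "AE x in M. \<forall>m. \<forall>q\<in>D. x \<in> A m q \<longrightarrow> (\<exists>r0>0. \<forall>r. 0 < r \<and> r < r0 \<longrightarrow> (\<integral>\<^sup>+y\<in>ball x r. ennreal (u m q y) \<partial>M) \<le> ennreal (\<eta> m * r ^ k))"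
    by (simp add: AE_all_countable AE_ball_countable[OF D(1)])
  with AE_in_F show ?thesis
  proof eventually_elim
    case (elim x)
    show ?case
    proof (intro allI impI)
      fix e :: real assume e: "0 < e"
      \<comment> \<open>The constant part 2 \<eta> integrates to at most 2 \<eta> C r^k and the
        truncated part adds 2 \<eta> r^k.\<close>
      have "0 < e / (2 * (C + 1))" using e C_pos by simp
      then obtain m where m: "\<eta> m < e / (2 * (C + 1))" unfolding \<eta>_def by (rule nat_approx_posE)
      obtain q where q: "q \<in> D" "q \<in> ball (g x) (\<eta> m)" using D(2)[of "ball (g x) (\<eta> m)"] \<eta>[of m] by auto
      have xA: "x \<in> A m q" using q(2) by (simp add: A_def dist_norm)
      then obtain r0 where r0: "0 < r0" "\<And>r. 0 < r \<Longrightarrow> r < r0 \<Longrightarrow> (\<integral>\<^sup>+y\<in>ball x r. ennreal (u m q y) \<partial>M) \<le> ennreal (\<eta> m * r ^ k)"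
        using elim(2) q(1) by blast
      show "\<exists>r0>0. \<forall>r. 0 < r \<and> r < r0 \<longrightarrow> (\<integral>\<^sup>+y\<in>ball x r. ennreal (norm (g y - g x)) \<partial>M) \<le> ennreal (e * r ^ k)"
      proof (intro exI[of _ "min r0 d"] conjI allI impI)
        show "0 < min r0 d" using r0(1) d_pos by simp
        fix r assume r: "0 < r \<and> r < min r0 d"
        have [measurable]: "ball x r \<in> sets borel" by simp
        have "(\<integral>\<^sup>+y\<in>ball x r. ennreal (norm (g y - g x)) \<partial>M)
            \<le> (\<integral>\<^sup>+y. ennreal (2 * \<eta> m) * indicator (ball x r) y + ennreal 2 * (ennreal (u m q y) * indicator (ball x r) y) \<partial>M)"
        proof (rule nn_integral_mono)
          fix y
          have "norm (g y - g x) \<le> norm (g y - q) + norm (g x - q)"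
            using norm_triangle_ineq4[of "g y - q" "g x - q"] by simp
          also have "norm (g x - q) \<le> \<eta> m" using xA by (simp add: A_def)
          finally have *: "norm (g y - g x) \<le> 2 * \<eta> m + 2 * u m q y"
            using \<eta>[of m] norm_ge_zero[of "g y - q"] by (cases "y \<in> A m q") (auto simp: u_def A_def)
          have "ennreal (norm (g y - g x)) \<le> ennreal (2 * \<eta> m) + ennreal 2 * ennreal (u m q y)"
          proof -
            have "ennreal (2 * \<eta> m) + ennreal 2 * ennreal (u m q y) = ennreal (2 * \<eta> m + 2 * u m q y)"
            proof -
              have u0: "0 \<le> u m q y" by (simp add: u_def)
              then have "ennreal (2 * u m q y) = ennreal 2 * ennreal (u m q y)" by (intro ennreal_mult) auto
              then show ?thesis using \<eta>[of m] u0 by (subst ennreal_plus) auto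
            qed
            then show ?thesis using * by (simp add: ennreal_leI)
          qed
          then show "ennreal (norm (g y - g x)) * indicator (ball x r) y
            \<le> ennreal (2 * \<eta> m) * indicator (ball x r) y + ennreal 2 * (ennreal (u m q y) * indicator (ball x r) y)"
            by (auto simp: indicator_def)
        qed
        also have "\<dots> = ennreal (2 * \<eta> m) * emeasure M (ball x r) + ennreal 2 * (\<integral>\<^sup>+y\<in>ball x r. ennreal (u m q y) \<partial>M)"
          by (subst nn_integral_add) (auto simp: nn_integral_cmult_indicator nn_integral_cmult sets_M simp del: ennreal_numeral)
        also have "\<dots> \<le> ennreal (2 * \<eta> m) * ennreal (C * r ^ k) + ennreal 2 * ennreal (\<eta> m * r ^ k)"
          using r elim(1) by (intro add_mono mult_left_mono upper r0(2)) auto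
        also have "\<dots> = ennreal (2 * \<eta> m * (C * r ^ k) + 2 * (\<eta> m * r ^ k))"
          using \<eta>[of m] r C_pos by (subst ennreal_plus) (auto simp del: ennreal_numeral simp flip: ennreal_mult)
        also have "2 * \<eta> m * (C * r ^ k) + 2 * (\<eta> m * r ^ k) = \<eta> m * (2 * (C + 1)) * r ^ k" by (simp add: algebra_simps)
        also have "ennreal (\<eta> m * (2 * (C + 1)) * r ^ k) \<le> ennreal (e * r ^ k)"
          using m r C_pos by (intro ennreal_leI mult_right_mono) (auto simp: pos_less_divide_eq)
        finally show "(\<integral>\<^sup>+y\<in>ball x r. ennreal (norm (g y - g x)) \<partial>M) \<le> ennreal (e * r ^ k)" .
      qed
    qed
  qed
qed

end

section \<open>Isoperimetric inequalities and the perimeter density\<close>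

locale regular_domain =
  fixes \<Omega> :: "'a::euclidean_space set" and C d :: real
  assumes dim: "2 \<le> DIM('a)" and open_domain: "open \<Omega>"
    and essential: "essential_boundary \<Omega> = frontier \<Omega>"
    and ahlfors: "ahlfors_measure (surface_measure (frontier \<Omega>)) (frontier \<Omega>) (DIM('a) - 1) C d"

sublocale regular_domain \<subseteq> ahlfors_measure "surface_measure (frontier \<Omega>)" "frontier \<Omega>" "DIM('a) - 1" C d
  by (rule ahlfors)

context regular_domain
begin

section \<open>Perimeter density and Gauss--Green formula of a regular domain\<close>

abbreviation h :: "'a measure" where "h \<equiv> surface_measure (frontier \<Omega>)"
abbreviation P :: "'a measure" where "P \<equiv> perimeter_measure \<Omega>"

definition \<nu> :: "'a \<Rightarrow> 'a" where "\<nu> = (SOME \<sigma>. gauss_green_polar \<Omega> (perimeter_measure \<Omega>) \<sigma>)"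

definition \<theta> :: "'a \<Rightarrow> real" where
  "\<theta> = (SOME t. t \<in> borel_measurable borel \<and> (\<forall>x. 0 \<le> t x) \<and> P = density h (\<lambda>x. ennreal (t x)))"

lemma domain_borel [measurable]: "\<Omega> \<in> sets borel"
  using open_domain by simp

lemma \<theta>: "\<theta> \<in> borel_measurable borel" "0 \<le> \<theta> x" "P = density h (\<lambda>x. ennreal (\<theta> x))"
  and polar: "gauss_green_polar \<Omega> P \<nu>"
proof -
  obtain t where t: "t \<in> borel_measurable borel" "\<And>x. 0 \<le> t x" "P = density h (\<lambda>x. ennreal (t x))"
    and p: "gauss_green_polar \<Omega> P (SOME \<sigma>. gauss_green_polar \<Omega> P \<sigma>)"
    by (rule perimeter_measure_polar[OF open_domain dim], rule finite_on_compact, assumption, rule that)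
  show "gauss_green_polar \<Omega> P \<nu>" using p by (simp add: \<nu>_def)
  have "\<exists>t. t \<in> borel_measurable borel \<and> (\<forall>x. 0 \<le> t x) \<and> P = density h (\<lambda>x. ennreal (t x))"
    using t by blast
  from someI_ex[OF this] have "\<theta> \<in> borel_measurable borel \<and> (\<forall>x. 0 \<le> \<theta> x) \<and> P = density h (\<lambda>x. ennreal (\<theta> x))"
    unfolding \<theta>_def .
  then show "\<theta> \<in> borel_measurable borel" "0 \<le> \<theta> x" "P = density h (\<lambda>x. ennreal (\<theta> x))" by auto
qed

lemma sets_P [simp, measurable_cong]: "sets P = sets borel"
  and finite_P: "\<And>K. compact K \<Longrightarrow> emeasure P K < \<infinity>"
  and \<nu>_borel [measurable]: "\<nu> \<in> borel_measurable borel"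
  and AE_norm_\<nu>: "AE x in P. norm (\<nu> x) = 1"
  using polar by (auto simp: gauss_green_polar_def)

lemma space_P [simp]: "space P = UNIV"
  using sets_eq_imp_space_eq[OF sets_P] by simp

declare \<theta>(1) [measurable]

lemma finite_P_bounded: "bounded A \<Longrightarrow> emeasure P A < \<infinity>"
proof -
  assume "bounded A"
  then have "compact (closure A)" by simp
  then show ?thesis
    using finite_P[of "closure A"] emeasure_mono[of A "closure A" P] closure_subset[of A]
    by (auto intro: le_less_trans)
qed

lemma emeasure_P: "A \<in> sets borel \<Longrightarrow> emeasure P A = (\<integral>\<^sup>+y\<in>A. ennreal (\<theta> y) \<partial>h)"
  unfolding \<theta>(3) by (subst emeasure_density) auto

lemma AE_h_norm_\<nu>: "AE x in h. 0 < \<theta> x \<longrightarrow> norm (\<nu> x) = 1"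
  using AE_norm_\<nu> unfolding \<theta>(3) by (subst (asm) AE_density) auto

lemma integral_P: "f \<in> borel_measurable borel \<Longrightarrow> (LINT x|P. f x) = (LINT x|h. \<theta> x *\<^sub>R f x)"
  for f :: "'a \<Rightarrow> 'b::{banach, second_countable_topology}"
  unfolding \<theta>(3) by (subst integral_density) (auto simp: \<theta>(2))

lemma gauss_green: "C1c f \<Longrightarrow> (LINT y:\<Omega>|lborel. pd f v y) = (LINT y|P. f y * (v \<bullet> \<nu> y))"
  by (rule gauss_green_polar_pd[OF polar]) auto

lemma integrable_P_C1c: "C1c f \<Longrightarrow> integrable P f"
  by (rule C1c_integrable(1)[OF _ sets_P finite_P])

lemma integrable_P_C1c_\<nu>:
  assumes "C1c f"
  shows "integrable P (\<lambda>y. f y * (v \<bullet> \<nu> y))"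
proof (rule Bochner_Integration.integrable_bound)
  show "integrable P (\<lambda>y. norm v * f y)" using integrable_P_C1c[OF assms] by simp
  show "(\<lambda>y. f y * (v \<bullet> \<nu> y)) \<in> borel_measurable P" using C1c_borel[OF assms] by measurable
  show "AE y in P. norm (f y * (v \<bullet> \<nu> y)) \<le> norm (norm v * f y)"
    using AE_norm_\<nu>
  proof eventually_elim
    case (elim y)
    have "\<bar>v \<bullet> \<nu> y\<bar> \<le> norm v" using Cauchy_Schwarz_ineq2[of v "\<nu> y"] elim by simp
    then have "\<bar>f y\<bar> * \<bar>v \<bullet> \<nu> y\<bar> \<le> \<bar>f y\<bar> * norm v" by (intro mult_left_mono) auto
    then show ?case by (simp add: abs_mult mult.commute)
  qed
qed

lemma frontier_lborel_null: "emeasure lborel (frontier \<Omega>) = 0"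
  by (rule lborel_null_of_locally_finite_surface[OF frontier_closed finite_on_compact dim])

section \<open>Volume exchanged under translations\<close>

lemma shift_derivative:
  assumes f: "C1c f"
  shows "((\<lambda>s. LINT y:\<Omega>|lborel. f (y - s *\<^sub>R w)) has_real_derivative
    - (LINT y|P. f (y - s *\<^sub>R w) * (w \<bullet> \<nu> y))) (at s)"
proof -
  let ?g = "\<lambda>y. f (y - s *\<^sub>R w)"
  have g: "C1c ?g" by (rule C1c_translate(1)[OF f])
  have si: "set_integrable lborel \<Omega> (\<lambda>y. f (y - c))" for c
    unfolding set_integrable_def
    by (intro integrable_mult_indicator C1c_integrable_lborel(1) C1c_translate f) auto
  have "((\<lambda>t. LINT y:\<Omega>|lborel. (?g (y + t *\<^sub>R (- w)) - ?g y) / t) \<longlongrightarrow> (LINT y:\<Omega>|lborel. pd ?g (- w) y)) (at 0)"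
    by (rule C1c_diff_quotient_tendsto_at[OF g]) auto
  also have "(LINT y:\<Omega>|lborel. pd ?g (- w) y) = - (LINT y|P. f (y - s *\<^sub>R w) * (w \<bullet> \<nu> y))"
    by (simp add: gauss_green[OF g])
  also have "(\<lambda>t. LINT y:\<Omega>|lborel. (?g (y + t *\<^sub>R (- w)) - ?g y) / t)
      = (\<lambda>t. ((LINT y:\<Omega>|lborel. f (y - (s + t) *\<^sub>R w)) - (LINT y:\<Omega>|lborel. f (y - s *\<^sub>R w))) / t)"
  proof
    fix t
    have "(LINT y:\<Omega>|lborel. (?g (y + t *\<^sub>R (- w)) - ?g y) / t) = (LINT y:\<Omega>|lborel. f (y - (s + t) *\<^sub>R w) - f (y - s *\<^sub>R w)) / t"
      by (simp add: scaleR_add_left algebra_simps)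
    then show "(LINT y:\<Omega>|lborel. (?g (y + t *\<^sub>R (- w)) - ?g y) / t)
      = ((LINT y:\<Omega>|lborel. f (y - (s + t) *\<^sub>R w)) - (LINT y:\<Omega>|lborel. f (y - s *\<^sub>R w))) / t"
      using set_integral_diff(2)[OF si si] by simp
  qed
  finally show ?thesis by (simp add: DERIV_def)
qed

lemma shift_MVT:
  assumes f: "C1c f"
  obtains s where "0 < s" "s < 1" "(LINT y:\<Omega>|lborel. f (y - w)) - (LINT y:\<Omega>|lborel. f y) = - (LINT y|P. f (y - s *\<^sub>R w) * (w \<bullet> \<nu> y))"
proof -
  have "\<exists>s>0. s < 1 \<and> (LINT y:\<Omega>|lborel. f (y - 1 *\<^sub>R w)) - (LINT y:\<Omega>|lborel. f (y - 0 *\<^sub>R w))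
      = (1 - 0) * - (LINT y|P. f (y - s *\<^sub>R w) * (w \<bullet> \<nu> y))"
    by (rule MVT2) (auto intro: shift_derivative[OF f])
  then show thesis using that by auto
qed

text \<open>For a test function f supported in \<open>U\<close>, shifting by w changes its integral
  over the domain by c times the integral of f. By \<open>shift_MVT\<close> this change is at most
  |w| times the perimeter near \<open>U\<close>. Letting f increase to the indicator of its support,
  and the supports to \<open>U\<close>, gives the volume.\<close>

lemma transition_set_bound:
  fixes c :: real
  assumes U: "open U" "U \<subseteq> ball x r" and c: "\<bar>c\<bar> = 1"
    and z: "\<And>z. z \<in> U \<Longrightarrow> indicator \<Omega> (z + w) - indicator \<Omega> z = c"
  shows "emeasure lborel U \<le> ennreal (norm w) * emeasure P (ball x (r + norm w))"
proof -
  let ?E = "ball x (r + norm w)"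
  have bound: "emeasure lborel {y. p y \<noteq> 0} \<le> ennreal (norm w) * emeasure P ?E"
    if p: "C1c p" and pU: "{y. p y \<noteq> 0} \<subseteq> U" for p
  proof -
    let ?V = "{y. p y \<noteq> 0}"
    have [measurable]: "p \<in> borel_measurable borel" by (rule C1c_borel[OF p])
    obtain f where f0: "(\<forall>k. C1c (f k)) \<and> (\<forall>k x. 0 \<le> f k x \<and> f k x \<le> indicator ?V x) \<and>
       (\<forall>x. (\<lambda>k. f k x) \<longlonglongrightarrow> indicator ?V x)"
      using exists_C1c_approx_support[OF p] by blast
    then have f: "C1c (f k)" "0 \<le> f k x" "f k x \<le> indicator ?V x" "(\<lambda>k. f k x) \<longlonglongrightarrow> indicator ?V x" for k x
      by simp_all
    have fl: "LINT y|lborel. f k y \<le> norm w * measure P ?E" for k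
    proof -
      have [measurable]: "f k \<in> borel_measurable borel" by (rule C1c_borel[OF f(1)])
      have fU: "f k y = 0" if "y \<notin> U" for y
      proof -
        have "p y = 0" using pU that by blast
        then show ?thesis using f(2,3)[of k y] by (simp add: indicator_def)
      qed
      obtain s where s: "0 < s" "s < 1" "(LINT y:\<Omega>|lborel. f k (y - w)) - (LINT y:\<Omega>|lborel. f k y)
          = - (LINT y|P. f k (y - s *\<^sub>R w) * (w \<bullet> \<nu> y))"
        by (rule shift_MVT[OF f(1)])
      have fi: "integrable lborel (f k)" by (rule C1c_integrable_lborel(1)[OF f(1)])
      have si: "set_integrable lborel \<Omega> (\<lambda>y. f k (y - c))" for c
        unfolding set_integrable_def
        by (intro integrable_mult_indicator C1c_integrable_lborel(1) C1c_translate f) auto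
      have "(LINT y:\<Omega>|lborel. f k (y - w)) - (LINT y:\<Omega>|lborel. f k y) = (LINT y:\<Omega>|lborel. f k (y + (- w)) - f k y)"
        using set_integral_diff(2)[OF si[of w] si[of 0]] by simp
      also have "\<dots> = (LINT y|lborel. (indicat_real \<Omega> (y - (- w)) - indicat_real \<Omega> y) * f k y)"
        by (rule set_integral_shift(2)[OF fi]) auto
      also have "\<dots> = (LINT y|lborel. c * f k y)"
        by (intro Bochner_Integration.integral_cong refl) (use z fU in fastforce)
      finally have "c * (LINT y|lborel. f k y) = - (LINT y|P. f k (y - s *\<^sub>R w) * (w \<bullet> \<nu> y))" using s(3) by simp
      then have "\<bar>c\<bar> * \<bar>LINT y|lborel. f k y\<bar> = \<bar>LINT y|P. f k (y - s *\<^sub>R w) * (w \<bullet> \<nu> y)\<bar>"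
        by (metis abs_minus_cancel abs_mult)
      then have "(LINT y|lborel. f k y) \<le> \<bar>LINT y|P. f k (y - s *\<^sub>R w) * (w \<bullet> \<nu> y)\<bar>" using c by simp
      also have "\<dots> \<le> (LINT y|P. \<bar>f k (y - s *\<^sub>R w) * (w \<bullet> \<nu> y)\<bar>)" by (rule integral_abs_bound)
      also have "\<dots> \<le> (LINT y|P. norm w * indicator ?E y)"
      proof (rule integral_mono_AE)
        show "integrable P (\<lambda>y. \<bar>f k (y - s *\<^sub>R w) * (w \<bullet> \<nu> y)\<bar>)"
          by (intro integrable_abs integrable_P_C1c_\<nu> C1c_translate f)
        have "integrable P (indicat_real ?E)" using finite_P_bounded[of ?E] by (intro integrable_real_indicator) auto
        then show "integrable P (\<lambda>y. norm w * indicator ?E y)" by simp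
        show "AE y in P. \<bar>f k (y - s *\<^sub>R w) * (w \<bullet> \<nu> y)\<bar> \<le> norm w * indicator ?E y"
          using AE_norm_\<nu>
        proof eventually_elim
          case (elim y)
          have 1: "\<bar>w \<bullet> \<nu> y\<bar> \<le> norm w" using Cauchy_Schwarz_ineq2[of w "\<nu> y"] elim by simp
          show ?case
          proof (cases "y - s *\<^sub>R w \<in> U")
            case True
            then have "dist x (y - s *\<^sub>R w) < r" using U(2) by auto
            moreover have "dist (y - s *\<^sub>R w) y \<le> norm w" using s mult_left_le_one_le[of "norm w" s] by (simp add: dist_norm)
            ultimately have "y \<in> ?E" using dist_triangle[of x y "y - s *\<^sub>R w"] by simp
            moreover have "\<bar>f k (y - s *\<^sub>R w)\<bar> \<le> 1" using f(2)[of k "y - s *\<^sub>R w"] order_trans[OF f(3)[of k "y - s *\<^sub>R w"] indicator_le_1] by simp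
            ultimately show ?thesis using mult_mono[of "\<bar>f k (y - s *\<^sub>R w)\<bar>" 1 "\<bar>w \<bullet> \<nu> y\<bar>" "norm w"] 1 by (simp add: abs_mult)
          next
            case False
            then show ?thesis using fU by simp
          qed
        qed
      qed
      also have "\<dots> = norm w * measure P ?E" by simp
      finally show ?thesis .
    qed
    have "(\<lambda>k. LINT y|lborel. f k y) \<longlonglongrightarrow> (LINT y|lborel. indicator ?V y)"
    proof (rule integral_dominated_convergence[where w="indicat_real ?V"])
      have "emeasure lborel ?V \<le> emeasure lborel (ball x r)"
        using pU U(2) by (intro emeasure_mono) auto
      also have "\<dots> < \<infinity>" by (rule emeasure_lborel_ball_finite)
      finally show "integrable lborel (indicat_real ?V)" by (intro integrable_real_indicator) auto
      show "f k \<in> borel_measurable lborel" for k using C1c_borel[OF f(1)] by simp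
      show "AE x in lborel. norm (f k x) \<le> indicator ?V x" for k using f(2,3) by simp
    qed (use f(4) in auto)
    then have "(LINT y|lborel. indicator ?V y) \<le> norm w * measure P ?E"
      by (rule Lim_bounded) (use fl in auto)
    then have le: "measure lborel ?V \<le> norm w * measure P ?E" by simp
    have "emeasure lborel ?V \<le> emeasure lborel (ball x r)"
      using pU U(2) by (intro emeasure_mono) auto
    also have "\<dots> < \<infinity>" by (rule emeasure_lborel_ball_finite)
    finally have "emeasure lborel ?V = ennreal (measure lborel ?V)" by (intro emeasure_eq_ennreal_measure) auto
    also have "\<dots> \<le> ennreal (norm w * measure P ?E)" using le by (rule ennreal_leI)
    also have "\<dots> = ennreal (norm w) * emeasure P ?E"
      using finite_P_bounded[of ?E] by (simp add: ennreal_mult emeasure_eq_ennreal_measure)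
    finally show ?thesis .
  qed
  let ?F = "{B. \<exists>a e. B = ball a e \<and> 0 < e \<and> B \<subseteq> U}"
  have UF: "\<Union>?F = U"
  proof
    show "U \<subseteq> \<Union>?F"
    proof
      fix a assume "a \<in> U"
      then obtain e where "0 < e" "ball a e \<subseteq> U" using U(1) open_contains_ball by blast
      then show "a \<in> \<Union>?F" using centre_in_ball by blast
    qed
  qed blast
  obtain F' where F': "F' \<subseteq> ?F" "countable F'" "\<Union>F' = \<Union>?F"
    by (rule Lindelof[of ?F]) auto
  show ?thesis
  proof (cases "F' = {}")
    case True
    then show ?thesis using F'(3) UF by simp
  next
    case False
    define B where "B = from_nat_into F'"
    have rB: "range B = F'" using F'(2) False by (simp add: B_def range_from_nat_into)
    have "\<forall>n. \<exists>a e. B n = ball a e \<and> 0 < e \<and> B n \<subseteq> U" using rB F'(1) by blast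
    then obtain a e where ae: "\<And>n. B n = ball (a n) (e n)" "\<And>n. 0 < e n" "\<And>n. B n \<subseteq> U" by metis
    \<comment> \<open>A finite sum of bumps is nonzero exactly on the union of the balls, so finite
      unions of balls are supports of C^1 functions; they exhaust \<open>U\<close>.\<close>
    define p where "p n y = (\<Sum>i<n. bump (e i) (y - a i))" for n y
    have pC: "C1c (p n)" for n
    proof (induction n)
      case 0
      show ?case using C1c_cmult(1)[OF bump_C1c(1)[of 1 0], of 0] by (simp add: p_def)
    next
      case (Suc n)
      have "p (Suc n) = (\<lambda>y. p n y + bump (e n) (y - a n))" by (simp add: p_def fun_eq_iff)
      then show ?case using C1c_add(1)[OF Suc bump_C1c(1)] by simp
    qed
    have ps: "{y. p n y \<noteq> 0} = (\<Union>i<n. B i)" for n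
    proof -
      have "p n y = 0 \<longleftrightarrow> (\<forall>i<n. y \<notin> B i)" for y
      proof -
        have "bump (e i) (y - a i) = 0 \<longleftrightarrow> y \<notin> B i" for i
          using bump_pos[of "y - a i" "e i"] bump_eq_0[of "e i" "y - a i"] ae(2)[of i]
          by (cases "norm (y - a i) < e i") (auto simp: ae(1) dist_norm norm_minus_commute)
        then show ?thesis unfolding p_def by (subst sum_nonneg_eq_0_iff) auto
      qed
      then show ?thesis by auto
    qed
    have "emeasure lborel U = emeasure lborel (\<Union>n. \<Union>i<n. B i)"
    proof -
      have "(\<Union>n. \<Union>i<n. B i) = (\<Union>i. B i)" by blast
      then have "(\<Union>n. \<Union>i<n. B i) = \<Union>F'" using rB by simp
      then show ?thesis using F'(3) UF by simp
    qed
    also have "\<dots> = (SUP n. emeasure lborel (\<Union>i<n. B i))"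
    proof (rule SUP_emeasure_incseq[symmetric])
      show "range (\<lambda>n. \<Union>i<n. B i) \<subseteq> sets lborel" by (auto simp: ae(1))
      show "incseq (\<lambda>n. \<Union>i<n. B i)" by (intro monoI UN_mono) auto
    qed
    also have "\<dots> \<le> ennreal (norm w) * emeasure P ?E"
    proof (rule SUP_least)
      fix n
      show "emeasure lborel (\<Union>i<n. B i) \<le> ennreal (norm w) * emeasure P ?E"
        using bound[OF pC[of n]] ae(3) unfolding ps by blast
    qed
    finally show ?thesis .
  qed
qed

lemma translate_null:
  assumes "A \<in> sets borel" "emeasure lborel A = 0"
  shows "emeasure lborel {z. z + w \<in> A} = 0"
proof -
  have "emeasure lborel A = emeasure (distr lborel borel ((+) w)) A" by (simp add: lborel_distr_plus)
  also have "\<dots> = emeasure lborel ((+) w -` A)" using assms(1) by (subst emeasure_distr) auto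
  also have "(+) w -` A = {z. z + w \<in> A}" by (auto simp: add.commute)
  finally show ?thesis using assms(2) by simp
qed

text \<open>Replacing the complement by the exterior makes the transition set open. What is lost
  lies in the frontier or in a translate of it, and both are Lebesgue null.\<close>

lemma shift_out_bound:
  assumes E: "E = \<Omega> \<or> E = - \<Omega>"
  shows "emeasure lborel {z \<in> ball x r. z \<in> E \<and> z + w \<notin> E} \<le> ennreal (norm w) * emeasure P (ball x (r + norm w))"
proof -
  have Fb: "frontier \<Omega> \<in> sets borel" by (simp add: borel_closed)
  have [measurable]: "closure \<Omega> \<in> sets borel" "ball x r \<in> sets borel" by auto
  have cl: "closure \<Omega> = \<Omega> \<union> frontier \<Omega>"
    using open_domain by (simp add: closure_Un_frontier)
  have shift_open: "open {z. z + w \<in> X}" if "open X" for X :: "'a set"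
  proof -
    have "open ((\<lambda>z. z + w) -` X)" using that by (intro open_vimage continuous_intros)
    then show ?thesis by (simp add: vimage_def)
  qed
  have nF: "emeasure lborel {z. z + w \<in> frontier \<Omega>} = 0"
    by (rule translate_null[OF Fb frontier_lborel_null])
  have sF: "{z. z + w \<in> frontier \<Omega>} \<in> sets borel"
    using Fb by measurable
  show ?thesis
    using E
  proof
    assume E: "E = \<Omega>"
    let ?U = "ball x r \<inter> \<Omega> \<inter> {z. z + w \<in> - closure \<Omega>}"
    have U: "open ?U" using open_domain shift_open[of "- closure \<Omega>"] by auto
    have "emeasure lborel {z \<in> ball x r. z \<in> E \<and> z + w \<notin> E} \<le> emeasure lborel (?U \<union> {z. z + w \<in> frontier \<Omega>})"
      using U sF by (intro emeasure_mono) (auto simp: E cl)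
    also have "\<dots> \<le> emeasure lborel ?U + emeasure lborel {z. z + w \<in> frontier \<Omega>}"
      using U sF by (intro emeasure_subadditive) auto
    also have "\<dots> = emeasure lborel ?U" by (simp only: nF add_0_right)
    also have "\<dots> \<le> ennreal (norm w) * emeasure P (ball x (r + norm w))"
      by (rule transition_set_bound[OF U, where c="-1"]) (auto simp: cl)
    finally show ?thesis .
  next
    assume E: "E = - \<Omega>"
    let ?U = "ball x r \<inter> (- closure \<Omega>) \<inter> {z. z + w \<in> \<Omega>}"
    have U: "open ?U" using open_domain shift_open[of "\<Omega>"] by auto
    have "emeasure lborel {z \<in> ball x r. z \<in> E \<and> z + w \<notin> E} \<le> emeasure lborel (?U \<union> frontier \<Omega>)"
      using U Fb by (intro emeasure_mono) (auto simp: E cl)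
    also have "\<dots> \<le> emeasure lborel ?U + emeasure lborel (frontier \<Omega>)"
      using U Fb by (intro emeasure_subadditive) auto
    also have "\<dots> = emeasure lborel ?U" by (simp only: frontier_lborel_null add_0_right)
    also have "\<dots> \<le> ennreal (norm w) * emeasure P (ball x (r + norm w))"
      by (rule transition_set_bound[OF U, where c="1"]) (auto simp: cl)
    finally show ?thesis .
  qed
qed

text \<open>Fubini for the pairs (z, w) with z in \<open>E\<close>, |w| < R and z + w outside
  \<open>E\<close>: for fixed w, \<open>shift_out_bound\<close> controls the measure of the
  admissible z.\<close>

lemma isoperimetric_integral:
  assumes E: "E = \<Omega> \<or> E = - \<Omega>" and R: "0 < R"
  shows "(\<integral>\<^sup>+z. indicator (E \<inter> ball x r) z * emeasure lborel (ball z R - E) \<partial>lborel)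
    \<le> ennreal R * emeasure lborel (ball (0::'a) R) * emeasure P (ball x (r + R))"
proof -
  have [measurable]: "E \<in> sets borel" "ball x r \<in> sets borel" "ball (0::'a) R \<in> sets borel" using E by auto
  have 1: "emeasure lborel (ball z R - E) = (\<integral>\<^sup>+w. indicator (ball 0 R) w * indicator (- E) (z + w) \<partial>lborel)" for z
  proof -
    have "emeasure lborel (ball z R - E) = emeasure (distr lborel borel ((+) z)) (ball z R - E)" by (simp add: lborel_distr_plus)
    also have "\<dots> = emeasure lborel ((+) z -` (ball z R - E))" by (subst emeasure_distr) auto
    also have "\<dots> = (\<integral>\<^sup>+w. indicator ((+) z -` (ball z R - E)) w \<partial>lborel)"
    proof (rule nn_integral_indicator[symmetric])
      have "(+) z \<in> borel \<rightarrow>\<^sub>M (borel :: 'a measure)" by measurable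
      from measurable_sets[OF this, of "ball z R - E"] show "(+) z -` (ball z R - E) \<in> sets lborel" by simp
    qed
    also have "\<dots> = (\<integral>\<^sup>+w. indicator (ball 0 R) w * indicator (- E) (z + w) \<partial>lborel)"
      by (intro nn_integral_cong) (auto simp: indicator_def dist_norm)
    finally show ?thesis .
  qed
  have "(\<integral>\<^sup>+z. indicator (E \<inter> ball x r) z * emeasure lborel (ball z R - E) \<partial>lborel)
      = (\<integral>\<^sup>+z. (\<integral>\<^sup>+w. indicator (E \<inter> ball x r) z * (indicator (ball 0 R) w * indicator (- E) (z + w)) \<partial>lborel) \<partial>lborel)"
    unfolding 1 by (intro nn_integral_cong, subst nn_integral_cmult) measurable
  also have "\<dots> = (\<integral>\<^sup>+w. (\<integral>\<^sup>+z. indicator (E \<inter> ball x r) z * (indicator (ball 0 R) w * indicator (- E) (z + w)) \<partial>lborel) \<partial>lborel)"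
    by (rule lborel_pair.Fubini'[symmetric]) measurable
  also have "\<dots> \<le> (\<integral>\<^sup>+w. ennreal R * emeasure P (ball x (r + R)) * indicator (ball (0::'a) R) w \<partial>lborel)"
  proof (rule nn_integral_mono)
    fix w :: 'a
    show "(\<integral>\<^sup>+z. indicator (E \<inter> ball x r) z * (indicator (ball 0 R) w * indicator (- E) (z + w)) \<partial>lborel)
      \<le> ennreal R * emeasure P (ball x (r + R)) * indicator (ball 0 R) w"
    proof (cases "w \<in> ball 0 R")
      case True
      have m: "{z \<in> ball x r. z \<in> E \<and> z + w \<notin> E} \<in> sets lborel" by measurable
      have "(\<integral>\<^sup>+z. indicator (E \<inter> ball x r) z * (indicator (ball 0 R) w * indicator (- E) (z + w)) \<partial>lborel)
          = (\<integral>\<^sup>+z. indicator {z \<in> ball x r. z \<in> E \<and> z + w \<notin> E} z \<partial>lborel)"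
        using True by (intro nn_integral_cong) (auto simp: indicator_def)
      also have "\<dots> = emeasure lborel {z \<in> ball x r. z \<in> E \<and> z + w \<notin> E}"
        by (rule nn_integral_indicator[OF m])
      also have "\<dots> \<le> ennreal (norm w) * emeasure P (ball x (r + norm w))" by (rule shift_out_bound[OF E])
      also have "\<dots> \<le> ennreal R * emeasure P (ball x (r + R))"
        using True by (intro mult_mono ennreal_leI emeasure_mono subset_ball) auto
      finally show ?thesis using True by simp
    next
      case False
      then show ?thesis by simp
    qed
  qed
  also have "\<dots> = ennreal R * emeasure lborel (ball (0::'a) R) * emeasure P (ball x (r + R))"
    by (subst nn_integral_cmult_indicator) (auto simp: mult_ac)
  finally show ?thesis .
qed

end

section \<open>Volume fractions in small balls\<close>

lemma tendsto_0_or_1: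
  fixes D :: "real \<Rightarrow> real"
  assumes cont: "continuous_on {0<..} D" and D: "\<And>r. 0 < r \<Longrightarrow> 0 \<le> D r \<and> D r \<le> 1"
    and lim: "((\<lambda>r. D r * (1 - D r)) \<longlongrightarrow> 0) (at_right 0)"
  shows "(D \<longlongrightarrow> 0) (at_right 0) \<or> (D \<longlongrightarrow> 1) (at_right 0)"
proof -
  have "\<forall>\<^sub>F r in at_right 0. D r * (1 - D r) < 1/8"
    using order_tendstoD(2)[OF lim, of "1/8"] by simp
  then obtain r1 where r1: "0 < r1" "\<And>r. 0 < r \<Longrightarrow> r < r1 \<Longrightarrow> D r * (1 - D r) < 1/8"
    unfolding eventually_at_right_field by blast
  \<comment> \<open>At 1/2 the product is 1/4, above the bound 1/8; by connectedness D then stays on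
    one side of 1/2 near 0.\<close>
  have half: "D r \<noteq> 1/2" if "0 < r" "r < r1" for r
  proof
    assume h: "D r = 1/2"
    show False using r1(2)[OF that] unfolding h by simp
  qed
  have conn: "connected (D ` {0<..<r1})"
    by (intro connected_continuous_image continuous_on_subset[OF cont]) auto
  have "(\<forall>r\<in>{0<..<r1}. D r < 1/2) \<or> (\<forall>r\<in>{0<..<r1}. 1/2 < D r)"
  proof (rule ccontr)
    assume "\<not> ?thesis"
    then obtain r s where rs: "r \<in> {0<..<r1}" "s \<in> {0<..<r1}" "1/2 \<le> D r" "D s \<le> 1/2" by (auto simp: not_less)
    then have "1/2 \<in> D ` {0<..<r1}" using connectedD_interval[OF conn, of "D s" "D r" "1/2"] by blast
    then show False using half by auto
  qed
  then show ?thesis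
  proof
    assume s: "\<forall>r\<in>{0<..<r1}. D r < 1/2"
    have "(D \<longlongrightarrow> 0) (at_right 0)"
    proof (rule tendsto_sandwich[of "\<lambda>_. 0" D _ "\<lambda>r. 2 * (D r * (1 - D r))"])
      show "\<forall>\<^sub>F r in at_right 0. 0 \<le> D r"
        using D by (auto simp: eventually_at_right_field intro: exI[of _ 1])
      have "D r \<le> 2 * (D r * (1 - D r))" if r: "0 < r" "r < r1" for r
      proof -
        have "D r < 1/2" using s r by simp
        then have "D r * 1 \<le> D r * (2 * (1 - D r))"
          using D[OF r(1)] by (intro mult_left_mono) auto
        then show ?thesis by (simp add: algebra_simps)
      qed
      then show "\<forall>\<^sub>F r in at_right 0. D r \<le> 2 * (D r * (1 - D r))"
        unfolding eventually_at_right_field using r1(1) by blast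
      show "((\<lambda>r. 2 * (D r * (1 - D r))) \<longlongrightarrow> 0) (at_right 0)"
        using tendsto_mult_left[OF lim, of 2] by simp
    qed simp
    then show ?thesis ..
  next
    assume s: "\<forall>r\<in>{0<..<r1}. 1/2 < D r"
    have "((\<lambda>r. 1 - D r) \<longlongrightarrow> 0) (at_right 0)"
    proof (rule tendsto_sandwich[of "\<lambda>_. 0" "\<lambda>r. 1 - D r" _ "\<lambda>r. 2 * (D r * (1 - D r))"])
      show "\<forall>\<^sub>F r in at_right 0. 0 \<le> 1 - D r"
        using D by (auto simp: eventually_at_right_field intro: exI[of _ 1])
      have "1 - D r \<le> 2 * (D r * (1 - D r))" if r: "0 < r" "r < r1" for r
      proof -
        have "1/2 < D r" using s r by simp
        then have "1 * (1 - D r) \<le> (2 * D r) * (1 - D r)"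
          using D[OF r(1)] by (intro mult_right_mono) auto
        then show ?thesis by (simp add: algebra_simps)
      qed
      then show "\<forall>\<^sub>F r in at_right 0. 1 - D r \<le> 2 * (D r * (1 - D r))"
        unfolding eventually_at_right_field using r1(1) by blast
      show "((\<lambda>r. 2 * (D r * (1 - D r))) \<longlongrightarrow> 0) (at_right 0)"
        using tendsto_mult_left[OF lim, of 2] by simp
    qed simp
    then have "((\<lambda>r. 1 - (1 - D r)) \<longlongrightarrow> 1 - 0) (at_right 0)" by (intro tendsto_intros)
    then show ?thesis by simp
  qed
qed

text \<open>The volume of \<open>E\<close> in a shell is at most that of the shell, so the volume
  fraction is continuous in the radius and cannot oscillate between 0 and 1.\<close>

lemma has_density_dichotomy:
  fixes E :: "'a::euclidean_space set"
  assumes E: "E \<in> sets borel"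
    and lim: "((\<lambda>r. measure lborel (E \<inter> ball x r) * measure lborel (ball x r - E) / (measure lborel (ball x r))\<^sup>2) \<longlongrightarrow> 0) (at_right 0)"
  shows "has_density E x 0 \<or> has_density E x 1"
proof -
  let ?W = "\<lambda>r. measure lborel (ball x r)"
  let ?V = "\<lambda>r. measure lborel (E \<inter> ball x r)"
  have W: "?W r = unit_ball_vol (real DIM('a)) * r ^ DIM('a)" if "0 < r" for r
    using that by (simp add: content_ball)
  have Wpos: "0 < ?W r" if "0 < r" for r using W[OF that] that by simp
  have fm: "A \<inter> ball x r \<in> fmeasurable lborel" if "A \<in> sets borel" for A r
    by (rule fmeasurable_Int_fmeasurable[of "ball x r" lborel A, simplified Int_commute])
      (use that in \<open>auto simp: fmeasurable_def emeasure_lborel_ball_finite[simplified]\<close>)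
  have split: "?V r + measure lborel (ball x r - E) = ?W r" for r
  proof -
    have "measure lborel ((E \<inter> ball x r) \<union> (ball x r - E)) = ?V r + measure lborel (ball x r - E)"
      using fm[OF E] fm[of "- E" r] E by (intro measure_Un_AE) (auto simp: Diff_eq Int_commute)
    moreover have "(E \<inter> ball x r) \<union> (ball x r - E) = ball x r" by auto
    ultimately show ?thesis by simp
  qed
  define D where "D r = ?V r / ?W r" for r
  have "continuous_on {0<..} D"
    unfolding D_def
  proof (rule continuous_on_divide)
    show Wc: "continuous_on {0<..} ?W"
      by (rule continuous_on_eq[of _ "\<lambda>r. unit_ball_vol (real DIM('a)) * r ^ DIM('a)"])
        (auto intro!: continuous_intros simp: W)
    have shell: "?V r - ?V s \<le> ?W r - ?W s" "?V s \<le> ?V r" if "s \<le> r" for r s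
    proof -
      have "ball x s \<subseteq> ball x r" using that by (rule subset_ball)
      then have "?V r \<le> measure lborel ((E \<inter> ball x s) \<union> (ball x r - ball x s))"
        using fm[OF E] fm[of "- ball x s" r] fm[OF E, of s] E
        by (intro measure_mono_fmeasurable fmeasurable.Un) (auto simp: Diff_eq Int_commute)
      also have "\<dots> \<le> ?V s + measure lborel (ball x r - ball x s)"
        using E by (intro measure_Un_le) auto
      also have "measure lborel (ball x r - ball x s) = ?W r - ?W s"
        using fm[of UNIV] \<open>ball x s \<subseteq> ball x r\<close> by (intro measurable_measure_Diff) auto
      finally show "?V r - ?V s \<le> ?W r - ?W s" by simp
      show "?V s \<le> ?V r"
        using fm[OF E, of r] \<open>ball x s \<subseteq> ball x r\<close> E by (intro measure_mono_fmeasurable) auto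
    qed
    have "\<bar>?V r - ?V s\<bar> \<le> \<bar>?W r - ?W s\<bar>" for r s
      using shell[of s r] shell[of r s] by (cases "s \<le> r") auto
    then have "dist (?V r) (?V s) \<le> dist (?W r) (?W s)" for r s by (simp add: dist_real_def)
    then show "continuous_on {0<..} ?V"
      using Wc unfolding continuous_on_iff by (meson le_less_trans)
    show "\<forall>r\<in>{0<..}. ?W r \<noteq> 0" using Wpos by fastforce
  qed
  moreover have D01: "0 \<le> D r \<and> D r \<le> 1" "D r * (1 - D r) = ?V r * measure lborel (ball x r - E) / (?W r)\<^sup>2" if "0 < r" for r
  proof -
    have "1 - D r = measure lborel (ball x r - E) / ?W r"
      using split[of r] Wpos[OF that] by (simp add: D_def field_simps)
    then show "D r * (1 - D r) = ?V r * measure lborel (ball x r - E) / (?W r)\<^sup>2"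
      by (simp add: D_def power2_eq_square)
    have "?V r \<le> ?W r" using split[of r] measure_nonneg[of lborel "ball x r - E"] by linarith
    then show "0 \<le> D r \<and> D r \<le> 1" using Wpos[OF that] by (simp add: D_def)
  qed
  moreover have "((\<lambda>r. D r * (1 - D r)) \<longlongrightarrow> 0) (at_right 0)"
    by (rule Lim_transform_eventually[OF lim]) (auto simp: eventually_at_right_field D01(2) intro!: exI[of _ 1])
  ultimately have "(D \<longlongrightarrow> 0) (at_right 0) \<or> (D \<longlongrightarrow> 1) (at_right 0)"
    by (intro tendsto_0_or_1) auto
  moreover have "D = (\<lambda>r. measure lebesgue (E \<inter> ball x r) / measure lebesgue (ball x r))"
    using E by (auto simp: D_def measure_completion)
  ultimately show ?thesis by (simp add: has_density_def)
qed

lemma C1c_pd_sum: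
  fixes v :: "'a::euclidean_space"
  assumes "C1c f"
  shows "pd f v x = (\<Sum>b\<in>Basis. (v \<bullet> b) * pd f b x)"
proof -
  have "pd f v x = pd f (\<Sum>b\<in>Basis. (v \<bullet> b) *\<^sub>R b) x" by (simp add: euclidean_representation)
  also have "\<dots> = (\<Sum>b\<in>Basis. (v \<bullet> b) * pd f b x)"
    using C1c_linear[OF assms, of x] by (simp add: linear_sum linear_cmul)
  finally show ?thesis .
qed

lemma measure_lborel_ball:
  "0 \<le> r \<Longrightarrow> measure lborel (ball (x::'a::euclidean_space) r) = unit_ball_vol (real DIM('a)) * r ^ DIM('a)"
  by (simp add: content_ball)

lemma fmeasurable_lborel_Int_ball:
  "A \<in> sets borel \<Longrightarrow> A \<inter> ball (x::'a::euclidean_space) r \<in> fmeasurable lborel"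
  by (rule fmeasurable_Int_fmeasurable[of "ball x r" lborel A, simplified Int_commute])
    (auto simp: fmeasurable_def emeasure_lborel_ball_finite[simplified])

text \<open>If the perimeter density is below \<open>density_lower\<close>, then \<open>density_scale\<close> bounds the thickness, relative
  to the radius, of the thinner of the domain and its complement.\<close>

definition density_scale :: "'a::euclidean_space itself \<Rightarrow> real \<Rightarrow> real" where
  "density_scale _ C = min 1 (1 / (128 * C\<^sup>2 * 4 ^ (DIM('a) - 1)))"

definition density_lower :: "'a::euclidean_space itself \<Rightarrow> real \<Rightarrow> real" where
  "density_lower _ C = unit_ball_vol (real DIM('a)) * density_scale TYPE('a) C ^ DIM('a)
     / (32 * 4 ^ DIM('a) * 6 ^ (DIM('a) - 1) * C)"

text \<open>The bound of \<open>pd_integral_bound\<close> summed over the n coordinate directions,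
  plus 1 for the averaging error at a Lebesgue point.\<close>

definition density_upper :: "'a::euclidean_space itself \<Rightarrow> real" where
  "density_upper _ = real DIM('a) * tube_const TYPE('a) + 1"

context regular_domain
begin

section \<open>Isoperimetric inequalities\<close>

definition vol :: "'a set \<Rightarrow> 'a \<Rightarrow> real \<Rightarrow> real" where
  "vol E x r = measure lborel (E \<inter> ball x r)"

lemma emeasure_P_ball: "emeasure P (ball x r) = ennreal (measure P (ball x r))"
  using finite_P_bounded[of "ball x r"] by (intro emeasure_eq_ennreal_measure) auto

lemma emeasure_h_ball: "emeasure h (ball x r) = ennreal (measure h (ball x r))"
proof -
  have "emeasure h (ball x r) \<le> emeasure h (cball x r)" by (intro emeasure_mono) auto
  also have "\<dots> < \<infinity>" by (rule finite_on_compact) simp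
  finally show ?thesis by (intro emeasure_eq_ennreal_measure) auto
qed

lemma measure_h_ball:
  assumes "x \<in> frontier \<Omega>" "0 < r" "r < d"
  shows "inverse C * r ^ (DIM('a) - 1) \<le> measure h (ball x r)" "measure h (ball x r) \<le> C * r ^ (DIM('a) - 1)"
  using lower[OF assms] upper[OF assms] C_pos assms(2) unfolding emeasure_h_ball
  by (simp_all add: ennreal_le_iff)

lemma vol_add: "0 \<le> r \<Longrightarrow> vol \<Omega> x r + vol (- \<Omega>) x r = unit_ball_vol (real DIM('a)) * r ^ DIM('a)"
proof -
  assume r: "0 \<le> r"
  have "measure lborel ((\<Omega> \<inter> ball x r) \<union> (- \<Omega> \<inter> ball x r)) = vol \<Omega> x r + vol (- \<Omega>) x r"
    unfolding vol_def using fmeasurable_lborel_Int_ball[of \<Omega>] fmeasurable_lborel_Int_ball[of "- \<Omega>"]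
    by (intro measure_Un_AE) auto
  moreover have "(\<Omega> \<inter> ball x r) \<union> (- \<Omega> \<inter> ball x r) = ball x r" by auto
  ultimately show ?thesis using r by (simp add: measure_lborel_ball)
qed

text \<open>Each point of \<open>E\<close> in the ball sees volume at least a of the complement
  within distance \<open>R\<close>, so the left side is below the double integral of
  \<open>isoperimetric_integral\<close>. The free scale \<open>R\<close> is what later measures the
  thickness of the thinner side.\<close>

lemma isoperimetric:
  assumes E: "E = \<Omega> \<or> E = - \<Omega>" and r: "0 < r" "0 < R" and a: "0 \<le> a"
    "\<And>z. z \<in> E \<inter> ball x r \<Longrightarrow> a \<le> vol (- E) z R"
  shows "a * vol E x r \<le> R * (unit_ball_vol (real DIM('a)) * R ^ DIM('a)) * measure P (ball x (r + R))"
proof -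
  have Eb: "E \<in> sets borel" "- E \<in> sets borel" using E by auto
  have fE: "emeasure lborel (E \<inter> ball x r) = ennreal (vol E x r)" if "E \<in> sets borel" for E x r
    using fmeasurable_lborel_Int_ball[OF that, of x r] unfolding vol_def
    by (simp add: emeasure_eq_measure2)
  have "ennreal (a * vol E x r) = ennreal a * emeasure lborel (E \<inter> ball x r)"
    using a(1) by (simp add: fE[OF Eb(1)] ennreal_mult vol_def)
  also have "\<dots> = (\<integral>\<^sup>+z. ennreal a * indicator (E \<inter> ball x r) z \<partial>lborel)"
    using Eb by (subst nn_integral_cmult_indicator) auto
  also have "\<dots> \<le> (\<integral>\<^sup>+z. indicator (E \<inter> ball x r) z * emeasure lborel (ball z R - E) \<partial>lborel)"
  proof (rule nn_integral_mono)
    fix z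
    have "ball z R - E = - E \<inter> ball z R" by auto
    then show "ennreal a * indicator (E \<inter> ball x r) z \<le> indicator (E \<inter> ball x r) z * emeasure lborel (ball z R - E)"
      using a(2)[of z] fE[OF Eb(2), of z R] by (auto simp: indicator_def intro: ennreal_leI)
  qed
  also have "\<dots> \<le> ennreal R * emeasure lborel (ball (0::'a) R) * emeasure P (ball x (r + R))"
    by (rule isoperimetric_integral[OF E r(2)])
  also have "emeasure lborel (ball (0::'a) R) = ennreal (unit_ball_vol (real DIM('a)) * R ^ DIM('a))"
    using r(2) by (simp add: emeasure_ball)
  also have "ennreal R * ennreal (unit_ball_vol (real DIM('a)) * R ^ DIM('a)) * emeasure P (ball x (r + R)) = ennreal (R * (unit_ball_vol (real DIM('a)) * R ^ DIM('a)) * measure P (ball x (r + R)))"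
    using r(2) by (simp add: emeasure_P_ball ennreal_mult mult.assoc)
  finally show ?thesis
    using r(2) by (subst (asm) ennreal_le_iff) auto
qed

text \<open>With R = 2 r every point of the ball sees the whole ball.\<close>

lemma relative_isoperimetric:
  assumes r: "0 < r"
  shows "vol \<Omega> x r * vol (- \<Omega>) x r \<le> 2 * r * (unit_ball_vol (real DIM('a)) * (2 * r) ^ DIM('a)) * measure P (ball x (3 * r))"
proof -
  have "vol (- \<Omega>) x r * vol \<Omega> x r \<le> (2 * r) * (unit_ball_vol (real DIM('a)) * (2 * r) ^ DIM('a)) * measure P (ball x (r + 2 * r))"
  proof (rule isoperimetric)
    fix z assume z: "z \<in> \<Omega> \<inter> ball x r"
    have "ball x r \<subseteq> ball z (2 * r)"
    proof
      fix y assume "y \<in> ball x r"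
      then show "y \<in> ball z (2 * r)" using z dist_triangle[of z y x] by (simp add: dist_commute)
    qed
    then show "vol (- \<Omega>) x r \<le> vol (- \<Omega>) z (2 * r)"
      unfolding vol_def by (intro measure_mono_fmeasurable fmeasurable_lborel_Int_ball) auto
  qed (use r in \<open>auto simp: vol_def\<close>)
  moreover have "r + 2 * r = 3 * r" by simp
  ultimately show ?thesis by (simp only: mult.commute[of "vol (- \<Omega>) x r"])
qed

section \<open>Lebesgue points of the perimeter density\<close>

definition lebesgue_point :: "'a \<Rightarrow> bool" where
  "lebesgue_point x \<longleftrightarrow> x \<in> frontier \<Omega> \<and> (0 < \<theta> x \<longrightarrow> norm (\<nu> x) = 1) \<and>
     (\<forall>e>0. \<exists>r0>0. \<forall>r. 0 < r \<and> r < r0 \<longrightarrow> (\<integral>\<^sup>+y\<in>ball x r. ennreal (norm (\<theta> y - \<theta> x)) \<partial>h) \<le> ennreal (e * r ^ (DIM('a) - 1))) \<and>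
     (\<forall>e>0. \<exists>r0>0. \<forall>r. 0 < r \<and> r < r0 \<longrightarrow> (\<integral>\<^sup>+y\<in>ball x r. ennreal (norm (\<theta> y *\<^sub>R \<nu> y - \<theta> x *\<^sub>R \<nu> x)) \<partial>h) \<le> ennreal (e * r ^ (DIM('a) - 1)))"

lemma AE_domain_lebesgue_point: "AE x in h. lebesgue_point x"
proof -
  have loc: "(\<integral>\<^sup>+y\<in>K. ennreal (norm (\<theta> y)) \<partial>h) < \<infinity>" if K: "compact K" for K
    using finite_P[OF K] K by (simp add: emeasure_P[symmetric] \<theta>(2) compact_imp_closed borel_closed)
  have loc2: "(\<integral>\<^sup>+y\<in>K. ennreal (norm (\<theta> y *\<^sub>R \<nu> y)) \<partial>h) < \<infinity>" if K: "compact K" for K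
  proof -
    have "(\<integral>\<^sup>+y\<in>K. ennreal (norm (\<theta> y *\<^sub>R \<nu> y)) \<partial>h) \<le> (\<integral>\<^sup>+y\<in>K. ennreal (norm (\<theta> y)) \<partial>h)"
    proof (rule nn_integral_mono_AE)
      show "AE y in h. ennreal (norm (\<theta> y *\<^sub>R \<nu> y)) * indicator K y \<le> ennreal (norm (\<theta> y)) * indicator K y"
        using AE_h_norm_\<nu>
      proof eventually_elim
        case (elim y)
        then show ?case using \<theta>(2)[of y] by (cases "\<theta> y = 0") (auto simp: indicator_def)
      qed
    qed
    then show ?thesis using loc[OF K] by (rule le_less_trans)
  qed
  have G: "(\<lambda>y. \<theta> y *\<^sub>R \<nu> y) \<in> borel_measurable borel" by measurable
  have 1: "AE x in h. \<forall>e>0. \<exists>r0>0. \<forall>r. 0 < r \<and> r < r0 \<longrightarrow>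
      (\<integral>\<^sup>+y\<in>ball x r. ennreal (norm (\<theta> y - \<theta> x)) \<partial>h) \<le> ennreal (e * r ^ (DIM('a) - 1))"
    by (rule AE_lebesgue_point[OF \<theta>(1)]) (rule loc)
  have 2: "AE x in h. \<forall>e>0. \<exists>r0>0. \<forall>r. 0 < r \<and> r < r0 \<longrightarrow>
      (\<integral>\<^sup>+y\<in>ball x r. ennreal (norm (\<theta> y *\<^sub>R \<nu> y - \<theta> x *\<^sub>R \<nu> x)) \<partial>h) \<le> ennreal (e * r ^ (DIM('a) - 1))"
    by (rule AE_lebesgue_point[OF G]) (rule loc2)
  show ?thesis
    using AE_in_F AE_h_norm_\<nu> 1 2
  proof eventually_elim
    case (elim x)
    show ?case unfolding lebesgue_point_def by (intro conjI elim)
  qed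
qed

lemma lebesgue_pointD:
  assumes x: "lebesgue_point x" and e: "0 < e"
  obtains r0 where "0 < r0" "\<And>r. 0 < r \<Longrightarrow> r < r0 \<Longrightarrow> (\<integral>\<^sup>+y\<in>ball x r. ennreal (norm (\<theta> y - \<theta> x)) \<partial>h) \<le> ennreal (e * r ^ (DIM('a) - 1))"
    "\<And>r. 0 < r \<Longrightarrow> r < r0 \<Longrightarrow> (\<integral>\<^sup>+y\<in>ball x r. ennreal (norm (\<theta> y *\<^sub>R \<nu> y - \<theta> x *\<^sub>R \<nu> x)) \<partial>h) \<le> ennreal (e * r ^ (DIM('a) - 1))"
proof -
  note * = x[unfolded lebesgue_point_def]
  obtain r1 where r1: "0 < r1" "\<forall>r. 0 < r \<and> r < r1 \<longrightarrow> (\<integral>\<^sup>+y\<in>ball x r. ennreal (norm (\<theta> y - \<theta> x)) \<partial>h) \<le> ennreal (e * r ^ (DIM('a) - 1))"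
    using mp[OF spec[OF conjunct1[OF conjunct2[OF conjunct2[OF *]]]] e] by (elim exE conjE)
  obtain r2 where r2: "0 < r2" "\<forall>r. 0 < r \<and> r < r2 \<longrightarrow> (\<integral>\<^sup>+y\<in>ball x r. ennreal (norm (\<theta> y *\<^sub>R \<nu> y - \<theta> x *\<^sub>R \<nu> x)) \<partial>h) \<le> ennreal (e * r ^ (DIM('a) - 1))"
    using mp[OF spec[OF conjunct2[OF conjunct2[OF conjunct2[OF *]]]] e] by (elim exE conjE)
  show thesis
    by (rule that[of "min r1 r2"]) (use r1 r2 in simp_all)
qed

lemma lebesgue_point_frontier: "lebesgue_point x \<Longrightarrow> x \<in> frontier \<Omega>"
  and lebesgue_point_norm: "lebesgue_point x \<Longrightarrow> 0 < \<theta> x \<Longrightarrow> norm (\<nu> x) = 1"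
  unfolding lebesgue_point_def by simp_all

lemma lebesgue_point_perimeter_le:
  assumes x: "lebesgue_point x" and e: "0 < e"
  shows "\<exists>r0>0. \<forall>r. 0 < r \<and> r < r0 \<longrightarrow> measure P (ball x r) \<le> (\<theta> x * C + e) * r ^ (DIM('a) - 1)"
proof -
  obtain r0 where r0: "0 < r0" "\<And>r. 0 < r \<Longrightarrow> r < r0 \<Longrightarrow> (\<integral>\<^sup>+y\<in>ball x r. ennreal (norm (\<theta> y - \<theta> x)) \<partial>h) \<le> ennreal (e * r ^ (DIM('a) - 1))"
    by (rule lebesgue_pointD[OF x e]) (rule that)
  have xF: "x \<in> frontier \<Omega>" by (rule lebesgue_point_frontier[OF x])
  show ?thesis
  proof (intro exI[of _ "min r0 d"] conjI allI impI)
    show "0 < min r0 d" using r0(1) d_pos by simp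
    fix r assume r: "0 < r \<and> r < min r0 d"
    have [measurable]: "ball x r \<in> sets borel" by simp
    have "emeasure P (ball x r) = (\<integral>\<^sup>+y\<in>ball x r. ennreal (\<theta> y) \<partial>h)" by (rule emeasure_P) simp
    also have "\<dots> \<le> (\<integral>\<^sup>+y. ennreal (\<theta> x) * indicator (ball x r) y + ennreal (norm (\<theta> y - \<theta> x)) * indicator (ball x r) y \<partial>h)"
    proof (rule nn_integral_mono)
      fix y
      have "\<theta> y \<le> \<theta> x + norm (\<theta> y - \<theta> x)" by simp
      from ennreal_leI[OF this] have "ennreal (\<theta> y) \<le> ennreal (\<theta> x) + ennreal (norm (\<theta> y - \<theta> x))" using \<theta>(2) by simp
      then show "ennreal (\<theta> y) * indicator (ball x r) y \<le> ennreal (\<theta> x) * indicator (ball x r) y + ennreal (norm (\<theta> y - \<theta> x)) * indicator (ball x r) y"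
        by (auto simp: indicator_def)
    qed
    also have "\<dots> = ennreal (\<theta> x) * emeasure h (ball x r) + (\<integral>\<^sup>+y\<in>ball x r. ennreal (norm (\<theta> y - \<theta> x)) \<partial>h)"
      by (subst nn_integral_add) (auto simp: nn_integral_cmult_indicator)
    also have "\<dots> \<le> ennreal (\<theta> x) * ennreal (C * r ^ (DIM('a) - 1)) + ennreal (e * r ^ (DIM('a) - 1))"
      using r by (intro add_mono mult_left_mono upper[OF xF] r0(2)) auto
    also have "\<dots> = ennreal ((\<theta> x * C + e) * r ^ (DIM('a) - 1))"
      using r e C_pos \<theta>(2)[of x] by (subst ennreal_mult[symmetric], simp, simp, subst ennreal_plus[symmetric]) (auto simp: algebra_simps)
    finally show "measure P (ball x r) \<le> (\<theta> x * C + e) * r ^ (DIM('a) - 1)"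
      using r e C_pos \<theta>(2)[of x] unfolding emeasure_P_ball by (subst (asm) ennreal_le_iff) auto
  qed
qed

section \<open>Flux of the normal and bounds for the density\<close>

lemma bump_h_integral:
  assumes "x \<in> frontier \<Omega>" "0 < r" "r < d"
  shows "r ^ 4 * r ^ (DIM('a) - 1) * inverse C / (2 * 2 ^ (DIM('a) - 1)) \<le> (LINT y|h. bump r (y - x))"
proof -
  have bi: "integrable h (\<lambda>y. bump r (y - x))"
    by (rule C1c_integrable(1)[OF bump_C1c(1)]) (auto intro: finite_on_compact[simplified])
  have "emeasure h (ball x (r / 2)) < \<infinity>" by (simp add: emeasure_h_ball)
  then have ii: "integrable h (\<lambda>y. r ^ 4 / 2 * indicator (ball x (r / 2)) y)"
    by (intro integrable_mult_right integrable_real_indicator) auto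
  have "r ^ 4 * r ^ (DIM('a) - 1) * inverse C / (2 * 2 ^ (DIM('a) - 1)) = r ^ 4 / 2 * (inverse C * (r / 2) ^ (DIM('a) - 1))"
    by (simp add: power_divide)
  also have "\<dots> \<le> r ^ 4 / 2 * measure h (ball x (r / 2))"
    using measure_h_ball(1)[OF assms(1), of "r / 2"] assms(2,3) by (intro mult_left_mono) auto
  also have "\<dots> = (LINT y|h. r ^ 4 / 2 * indicator (ball x (r / 2)) y)" by simp
  also have "\<dots> \<le> (LINT y|h. bump r (y - x))"
  proof (rule integral_mono[OF ii bi])
    fix y
    show "r ^ 4 / 2 * indicator (ball x (r / 2)) y \<le> bump r (y - x)"
      using bump_ge[of "y - x" r] by (cases "y \<in> ball x (r / 2)") (auto simp: dist_norm norm_minus_commute)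
  qed
  finally show ?thesis .
qed

text \<open>At a Lebesgue point the field \<open>\<theta>\<close> times \<open>\<nu>\<close> may be
  frozen inside the bump average, and its pairing with the unit vector \<open>\<nu> x\<close> is
  \<open>\<theta> x\<close>. The flux thus shows no cancellation beyond a small error.\<close>

lemma lebesgue_point_bump:
  assumes x: "lebesgue_point x" and t: "0 < \<theta> x" and e: "0 < e"
  shows "\<exists>r0>0. \<forall>r. 0 < r \<and> r < r0 \<longrightarrow>
     \<theta> x * (LINT y|h. bump r (y - x)) \<le> (LINT y|P. bump r (y - x) * (\<nu> x \<bullet> \<nu> y)) + e * r ^ 4 * r ^ (DIM('a) - 1)"
proof -
  define G where "G y = \<theta> y *\<^sub>R \<nu> y" for y
  have [measurable]: "G \<in> borel_measurable borel" unfolding G_def by measurable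
  have n1: "norm (\<nu> x) = 1" by (rule lebesgue_point_norm[OF x t])
  obtain r0 where r0: "0 < r0" "\<And>r. 0 < r \<Longrightarrow> r < r0 \<Longrightarrow> (\<integral>\<^sup>+y\<in>ball x r. ennreal (norm (G y - G x)) \<partial>h) \<le> ennreal (e * r ^ (DIM('a) - 1))"
    by (rule lebesgue_pointD[OF x e]) (rule that[unfolded G_def])
  show ?thesis
  proof (intro exI[of _ r0] conjI allI impI r0(1))
    fix r assume r: "0 < r \<and> r < r0"
    have [measurable]: "ball x r \<in> sets borel" by simp
    let ?f = "\<lambda>y. bump r (y - x)"
    have bi: "integrable h ?f"
      by (rule C1c_integrable(1)[OF bump_C1c(1)]) (auto intro: finite_on_compact[simplified])
    have Gi: "integrable h (\<lambda>y. ?f y * (\<nu> x \<bullet> G y))"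
    proof -
      have "integrable P (\<lambda>y. ?f y * (\<nu> x \<bullet> \<nu> y))" by (rule integrable_P_C1c_\<nu>[OF bump_C1c(1)])
      then have "integrable h (\<lambda>y. \<theta> y *\<^sub>R (?f y * (\<nu> x \<bullet> \<nu> y)))"
        unfolding \<theta>(3) by (subst (asm) integrable_density) (auto simp: \<theta>(2))
      then show ?thesis by (simp add: G_def mult.left_commute)
    qed
    have "(LINT y|P. ?f y * (\<nu> x \<bullet> \<nu> y)) = (LINT y|h. ?f y * (\<nu> x \<bullet> G y))"
      by (subst integral_P) (auto simp: G_def mult.left_commute)
    moreover have "\<theta> x * (LINT y|h. ?f y) = (LINT y|h. ?f y * (\<nu> x \<bullet> G x))"
      using n1 by (simp add: G_def power2_norm_eq_inner[symmetric] mult.commute)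
    ultimately have "\<theta> x * (LINT y|h. ?f y) - (LINT y|P. ?f y * (\<nu> x \<bullet> \<nu> y)) = (LINT y|h. ?f y * (\<nu> x \<bullet> G x) - ?f y * (\<nu> x \<bullet> G y))"
      using bi Gi by (subst Bochner_Integration.integral_diff) auto
    also have "\<dots> \<le> e * r ^ 4 * r ^ (DIM('a) - 1)"
    proof -
      have "ennreal (LINT y|h. ?f y * (\<nu> x \<bullet> G x) - ?f y * (\<nu> x \<bullet> G y)) \<le> (\<integral>\<^sup>+y. ennreal (norm (?f y * (\<nu> x \<bullet> G x) - ?f y * (\<nu> x \<bullet> G y))) \<partial>h)"
      proof -
        have i: "integrable h (\<lambda>y. ?f y * (\<nu> x \<bullet> G x) - ?f y * (\<nu> x \<bullet> G y))" using bi Gi by simp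
        have "ennreal (LINT y|h. ?f y * (\<nu> x \<bullet> G x) - ?f y * (\<nu> x \<bullet> G y)) \<le> ennreal (norm (LINT y|h. ?f y * (\<nu> x \<bullet> G x) - ?f y * (\<nu> x \<bullet> G y)))"
          by (intro ennreal_leI) simp
        also have "\<dots> \<le> (\<integral>\<^sup>+y. ennreal (norm (?f y * (\<nu> x \<bullet> G x) - ?f y * (\<nu> x \<bullet> G y))) \<partial>h)"
          by (rule integral_norm_bound_ennreal[OF i])
        finally show ?thesis .
      qed
      also have "\<dots> \<le> (\<integral>\<^sup>+y. ennreal (r ^ 4) * (ennreal (norm (G y - G x)) * indicator (ball x r) y) \<partial>h)"
      proof (rule nn_integral_mono)
        fix y
        show "ennreal (norm (?f y * (\<nu> x \<bullet> G x) - ?f y * (\<nu> x \<bullet> G y))) \<le> ennreal (r ^ 4) * (ennreal (norm (G y - G x)) * indicator (ball x r) y)"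
        proof (cases "y \<in> ball x r")
          case True
          have "norm (?f y * (\<nu> x \<bullet> G x) - ?f y * (\<nu> x \<bullet> G y)) = ?f y * \<bar>\<nu> x \<bullet> (G y - G x)\<bar>"
            by (simp add: inner_diff_right abs_mult abs_minus_commute flip: right_diff_distrib)
          also have "\<dots> \<le> r ^ 4 * norm (G y - G x)"
            using Cauchy_Schwarz_ineq2[of "\<nu> x" "G y - G x"] n1 bump_le[of r "y - x"] by (intro mult_mono) auto
          finally show ?thesis using True r by (simp add: ennreal_leI flip: ennreal_mult)
        next
          case False
          then have "?f y = 0" using r by (intro bump_eq_0) (auto simp: dist_norm norm_minus_commute)
          then show ?thesis by simp
        qed
      qed
      also have "\<dots> = ennreal (r ^ 4) * (\<integral>\<^sup>+y\<in>ball x r. ennreal (norm (G y - G x)) \<partial>h)"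
        by (rule nn_integral_cmult) measurable
      also have "\<dots> \<le> ennreal (r ^ 4) * ennreal (e * r ^ (DIM('a) - 1))" using r r0(2) by (intro mult_left_mono) auto
      also have "\<dots> = ennreal (e * r ^ 4 * r ^ (DIM('a) - 1))" using r e by (simp add: mult_ac flip: ennreal_mult)
      finally show ?thesis using r e by (subst (asm) ennreal_le_iff) auto
    qed
    finally show "\<theta> x * (LINT y|h. bump r (y - x)) \<le> (LINT y|P. bump r (y - x) * (\<nu> x \<bullet> \<nu> y)) + e * r ^ 4 * r ^ (DIM('a) - 1)"
      by simp
  qed
qed

text \<open>By Gauss--Green the flux is the integral of the derivative of the bump over the domain
  and, as that derivative has total integral 0, up to sign also over the complement. One flux
  therefore bounds the volume of both sides.\<close>

lemma bump_flux_le_volume: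
  assumes E: "E = \<Omega> \<or> E = - \<Omega>" and r: "0 < r" and v: "norm v \<le> 1"
  shows "\<bar>LINT y|P. bump r (y - x) * (v \<bullet> \<nu> y)\<bar> \<le> 4 * r ^ 3 * vol E x r"
proof -
  let ?f = "\<lambda>y. bump r (y - x)"
  have f: "C1c ?f" by (rule bump_C1c(1))
  have Eb: "E \<in> sets borel" using E by auto
  have si: "set_integrable lborel A (pd ?f v)" if "A \<in> sets borel" for A
    unfolding set_integrable_def using that by (intro integrable_mult_indicator C1c_integrable_lborel(2)[OF f]) auto
  have "(LINT y:\<Omega>|lborel. pd ?f v y) + (LINT y:-\<Omega>|lborel. pd ?f v y) = (LINT y:\<Omega> \<union> -\<Omega>|lborel. pd ?f v y)"
    by (rule set_integral_Un[symmetric]) (auto intro: si)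
  also have "\<dots> = 0" using C1c_integral_pd_UNIV[OF f, of v] by (simp add: set_lebesgue_integral_def)
  finally have "\<bar>LINT y:\<Omega>|lborel. pd ?f v y\<bar> = \<bar>LINT y:E|lborel. pd ?f v y\<bar>" using E by auto
  also have "\<dots> \<le> (LINT y|lborel. \<bar>indicat_real E y *\<^sub>R pd ?f v y\<bar>)"
    unfolding set_lebesgue_integral_def by (rule integral_abs_bound)
  also have "\<dots> \<le> (LINT y|lborel. 4 * r ^ 3 * indicator (E \<inter> ball x r) y)"
  proof (rule integral_mono)
    show "integrable lborel (\<lambda>y. \<bar>indicat_real E y *\<^sub>R pd ?f v y\<bar>)"
      using si[OF Eb] unfolding set_integrable_def by (rule integrable_abs)
    show "integrable lborel (\<lambda>y. 4 * r ^ 3 * indicat_real (E \<inter> ball x r) y)"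
      using fmeasurable_lborel_Int_ball[OF Eb, of x r]
      by (intro integrable_mult_right integrable_real_indicator) (auto simp: fmeasurable_def)
    fix y
    have "\<bar>pd ?f v y\<bar> \<le> 4 * r ^ 3 * norm v * indicator (ball x r) y" using r by (intro bump_pd_bound) simp
    also have "\<dots> \<le> 4 * r ^ 3 * 1 * indicator (ball x r) y"
      using v r by (intro mult_right_mono mult_left_mono) auto
    finally show "\<bar>indicat_real E y *\<^sub>R pd ?f v y\<bar> \<le> 4 * r ^ 3 * indicat_real (E \<inter> ball x r) y"
      by (auto simp: indicator_def)
  qed
  also have "\<dots> = 4 * r ^ 3 * vol E x r" by (simp add: vol_def)
  finally show ?thesis by (simp add: gauss_green[OF f])
qed

lemma bump_flux_le_surface:
  assumes v: "norm v \<le> 1"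
  shows "\<bar>LINT y|P. bump r (y - x) * (v \<bullet> \<nu> y)\<bar> \<le> real DIM('a) * tube_const TYPE('a) * (LINT y|h. bump r (y - x))"
proof -
  let ?f = "\<lambda>y. bump r (y - x)"
  have f: "C1c ?f" by (rule bump_C1c(1))
  have "(LINT y:\<Omega>|lborel. pd ?f v y) = (\<Sum>b\<in>Basis. (v \<bullet> b) * (LINT y:\<Omega>|lborel. pd ?f b y))"
  proof -
    have "(LINT y:\<Omega>|lborel. pd ?f v y) = (LINT y|lborel. (\<Sum>b\<in>Basis. (v \<bullet> b) * (indicat_real \<Omega> y *\<^sub>R pd ?f b y)))"
      unfolding set_lebesgue_integral_def
    proof (intro Bochner_Integration.integral_cong refl)
      fix y
      have "indicat_real \<Omega> y * (\<Sum>b\<in>Basis. (v \<bullet> b) * pd ?f b y) = (\<Sum>b\<in>Basis. (v \<bullet> b) * (indicat_real \<Omega> y * pd ?f b y))"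
        unfolding sum_distrib_left by (rule sum.cong[OF refl mult.left_commute])
      then show "indicat_real \<Omega> y *\<^sub>R pd ?f v y = (\<Sum>b\<in>Basis. (v \<bullet> b) * (indicat_real \<Omega> y *\<^sub>R pd ?f b y))"
        unfolding C1c_pd_sum[OF f, where v=v] real_scaleR_def .
    qed
    also have "\<dots> = (\<Sum>b\<in>Basis. LINT y|lborel. (v \<bullet> b) * (indicat_real \<Omega> y *\<^sub>R pd ?f b y))"
      by (intro Bochner_Integration.integral_sum integrable_mult_right integrable_mult_indicator C1c_integrable_lborel(2)[OF f]) simp
    finally show ?thesis by (simp add: set_lebesgue_integral_def)
  qed
  also have "\<bar>\<dots>\<bar> \<le> (\<Sum>b\<in>(Basis::'a set). tube_const TYPE('a) * (LINT y|h. ?f y))"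
  proof (rule order_trans[OF sum_abs], rule sum_mono)
    fix b :: 'a assume b: "b \<in> Basis"
    have "\<bar>LINT y:\<Omega>|lborel. pd ?f b y\<bar> \<le> tube_const TYPE('a) * (LINT y|h. \<bar>?f y\<bar>)"
      by (rule pd_integral_bound[OF open_domain dim b f]) (rule finite_on_compact)
    moreover have "\<bar>v \<bullet> b\<bar> \<le> 1" using Basis_le_norm[OF b, of v] v by linarith
    ultimately have "\<bar>v \<bullet> b\<bar> * \<bar>LINT y:\<Omega>|lborel. pd ?f b y\<bar> \<le> 1 * (tube_const TYPE('a) * (LINT y|h. ?f y))"
      by (intro mult_mono) auto
    then show "\<bar>(v \<bullet> b) * (LINT y:\<Omega>|lborel. pd ?f b y)\<bar> \<le> tube_const TYPE('a) * (LINT y|h. ?f y)"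
      by (simp add: abs_mult)
  qed
  finally show ?thesis by (simp add: gauss_green[OF f])
qed

lemma \<theta>_upper_bound:
  assumes x: "lebesgue_point x"
  shows "\<theta> x \<le> density_upper TYPE('a)"
proof (cases "0 < \<theta> x")
  case True
  \<comment> \<open>This is the constant of \<open>bump_h_integral\<close>, so the averaging error
    is at most one further copy of the surface integral.\<close>
  define e where "e = inverse C / (2 * 2 ^ (DIM('a) - 1))"
  have e: "0 < e" using C_pos by (simp add: e_def)
  obtain r0 where r0: "0 < r0" "\<And>r. 0 < r \<and> r < r0 \<Longrightarrow>
     \<theta> x * (LINT y|h. bump r (y - x)) \<le> (LINT y|P. bump r (y - x) * (\<nu> x \<bullet> \<nu> y)) + e * r ^ 4 * r ^ (DIM('a) - 1)"
    using lebesgue_point_bump[OF x True e] by blast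
  define r where "r = min r0 d / 2"
  have r: "0 < r" "r < r0" "r < d" using r0(1) d_pos by (auto simp: r_def)
  let ?I = "LINT y|h. bump r (y - x)"
  have I: "r ^ 4 * r ^ (DIM('a) - 1) * inverse C / (2 * 2 ^ (DIM('a) - 1)) \<le> ?I"
    by (rule bump_h_integral[OF lebesgue_point_frontier[OF x] r(1,3)])
  then have I': "e * r ^ 4 * r ^ (DIM('a) - 1) \<le> ?I" by (simp add: e_def mult_ac)
  have "0 < e * r ^ 4 * r ^ (DIM('a) - 1)" using e r by simp
  then have Ipos: "0 < ?I" using I' by linarith
  have "\<theta> x * ?I \<le> real DIM('a) * tube_const TYPE('a) * ?I + ?I"
    using r0(2)[of r] r I' bump_flux_le_surface[of "\<nu> x" r x] lebesgue_point_norm[OF x True] by simp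
  then have "\<theta> x * ?I \<le> density_upper TYPE('a) * ?I" by (simp add: density_upper_def distrib_right)
  then show ?thesis using Ipos by simp
next
  case False
  moreover have "0 \<le> density_upper TYPE('a)"
    using tube_const_pos[where 'a='a] by (simp add: density_upper_def)
  ultimately show ?thesis by linarith
qed

text \<open>The flux through the bump is at least \<open>\<theta> x\<close> times the surface
  integral, up to an error chosen as half of the main term, and at most 4 r^3 times the volume of
  either side. That the bound is proportional to \<open>\<theta> x\<close> lets the density cancel
  in \<open>\<theta>_lower_bound\<close>.\<close>

lemma volume_lower:
  assumes x: "lebesgue_point x" and t: "0 < \<theta> x"
  shows "\<exists>r0>0. \<forall>r E. 0 < r \<and> r < r0 \<and> (E = \<Omega> \<or> E = - \<Omega>) \<longrightarrow>
    \<theta> x * r ^ DIM('a) / (16 * C * 2 ^ (DIM('a) - 1)) \<le> vol E x r"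
proof -
  let ?k = "DIM('a) - 1"
  define e where "e = \<theta> x * inverse C / (4 * 2 ^ ?k)"
  have e: "0 < e" using C_pos t by (simp add: e_def)
  obtain r0 where r0: "0 < r0" "\<And>r. 0 < r \<and> r < r0 \<Longrightarrow>
     \<theta> x * (LINT y|h. bump r (y - x)) \<le> (LINT y|P. bump r (y - x) * (\<nu> x \<bullet> \<nu> y)) + e * r ^ 4 * r ^ ?k"
    using lebesgue_point_bump[OF x t e] by blast
  show ?thesis
  proof (intro exI[of _ "min r0 d"] conjI allI impI)
    show "0 < min r0 d" using r0(1) d_pos by simp
    fix r E assume "0 < r \<and> r < min r0 d \<and> (E = \<Omega> \<or> E = - \<Omega>)"
    then have r: "0 < r" "r < r0" "r < d" and E: "E = \<Omega> \<or> E = - \<Omega>" by auto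
    have "\<theta> x * (r ^ 4 * r ^ ?k * inverse C / (2 * 2 ^ ?k)) \<le> \<theta> x * (LINT y|h. bump r (y - x))"
      using bump_h_integral[OF lebesgue_point_frontier[OF x] r(1,3)] t by (intro mult_left_mono) auto
    also have "\<dots> \<le> (LINT y|P. bump r (y - x) * (\<nu> x \<bullet> \<nu> y)) + e * r ^ 4 * r ^ ?k" using r0(2) r by simp
    also have "\<dots> \<le> 4 * r ^ 3 * vol E x r + e * r ^ 4 * r ^ ?k"
      using bump_flux_le_volume[OF E r(1), of "\<nu> x" x] lebesgue_point_norm[OF x t] by simp
    also have "e * r ^ 4 * r ^ ?k = \<theta> x * (r ^ 4 * r ^ ?k * inverse C / (2 * 2 ^ ?k)) / 2" by (simp add: e_def)
    finally have "\<theta> x * (r ^ 4 * r ^ ?k * inverse C / (2 * 2 ^ ?k)) / 2 \<le> 4 * r ^ 3 * vol E x r" by simp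
    moreover have "\<theta> x * (r ^ 4 * r ^ ?k * inverse C / (2 * 2 ^ ?k)) / 2 = 4 * r ^ 3 * (\<theta> x * (r * r ^ ?k) / (16 * C * 2 ^ ?k))"
    proof -
      have gen: "a * (R * r * s * inverse C / (2 * K)) / 2 = 4 * R * (a * (r * s) / (16 * C * K))"
        if "K \<noteq> 0" for a R s K :: real
        using that C_pos by (simp add: field_simps)
      have "r ^ 4 = r ^ 3 * r" by (simp add: power3_eq_cube power4_eq_xxxx)
      then show ?thesis by (simp only:) (rule gen, simp)
    qed
    ultimately have "4 * r ^ 3 * (\<theta> x * (r * r ^ ?k) / (16 * C * 2 ^ ?k)) \<le> 4 * r ^ 3 * vol E x r" by linarith
    then have "\<theta> x * (r * r ^ ?k) / (16 * C * 2 ^ ?k) \<le> vol E x r"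
      using r(1) by (subst (asm) mult_le_cancel_left_pos) auto
    moreover have "r * r ^ ?k = r ^ DIM('a)" using dim by (simp flip: power_Suc)
    ultimately show "\<theta> x * r ^ DIM('a) / (16 * C * 2 ^ ?k) \<le> vol E x r" by simp
  qed
qed

text \<open>A point of vanishing density would, by the relative isoperimetric inequality and the continuity
  of the volume fraction in the radius, be a point of density \<open>0\<close> or \<open>1\<close> of the domain.\<close>

lemma \<theta>_positive:
  assumes x: "lebesgue_point x"
  shows "0 < \<theta> x"
proof (rule ccontr)
  assume "\<not> 0 < \<theta> x"
  then have t0: "\<theta> x = 0" using \<theta>(2)[of x] by simp
  let ?k = "DIM('a) - 1" and ?w = "unit_ball_vol (real DIM('a))"
  have w: "0 < ?w" by simp
  let ?q = "\<lambda>r. measure lborel (\<Omega> \<inter> ball x r) * measure lborel (ball x r - \<Omega>) / (measure lborel (ball x r))\<^sup>2"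
  \<comment> \<open>What remains of the right side of \<open>relative_isoperimetric\<close>, with (3
    r)^(n-1) as the perimeter, after division by the squared ball volume; all powers of r
    cancel.\<close>
  define A where "A = 2 * 2 ^ DIM('a) * 3 ^ ?k / ?w"
  have A: "0 < A" using w by (simp add: A_def)
  have "(?q \<longlongrightarrow> 0) (at_right 0)"
  proof (rule tendstoI)
    fix \<epsilon> :: real assume eps: "0 < \<epsilon>"
    define e where "e = \<epsilon> / (2 * A)"
    have e: "0 < e" "A * e < \<epsilon>" using eps A by (auto simp: e_def)
    obtain r0 where r0: "0 < r0" "\<And>r. 0 < r \<and> r < r0 \<Longrightarrow> measure P (ball x r) \<le> (\<theta> x * C + e) * r ^ ?k"
      using lebesgue_point_perimeter_le[OF x e(1)] by blast
    have "dist (?q r) 0 < \<epsilon>" if r: "0 < r" "r < r0 / 3" for r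
    proof -
      have eq: "ball x r - \<Omega> = - \<Omega> \<inter> ball x r" by auto
      have q: "?q r = vol \<Omega> x r * vol (- \<Omega>) x r / (?w * r ^ DIM('a))\<^sup>2"
        using r by (simp add: vol_def eq measure_lborel_ball)
      have "vol \<Omega> x r * vol (- \<Omega>) x r \<le> 2 * r * (?w * (2 * r) ^ DIM('a)) * measure P (ball x (3 * r))"
        by (rule relative_isoperimetric[OF r(1)])
      also have "\<dots> \<le> 2 * r * (?w * (2 * r) ^ DIM('a)) * (e * (3 * r) ^ ?k)"
        using r0(2)[of "3 * r"] r t0 w by (intro mult_left_mono) auto
      also have "\<dots> = A * e * (?w * r ^ DIM('a))\<^sup>2"
      proof -
        have "r ^ DIM('a) = r * r ^ ?k" using dim by (simp flip: power_Suc)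
        then show ?thesis using w by (simp add: A_def power_mult_distrib power2_eq_square)
      qed
      finally have "vol \<Omega> x r * vol (- \<Omega>) x r \<le> A * e * (?w * r ^ DIM('a))\<^sup>2" .
      moreover have "0 < (?w * r ^ DIM('a))\<^sup>2" using r(1) w by (intro zero_less_power mult_pos_pos)
      ultimately have "?q r \<le> A * e" unfolding q by (simp only: pos_divide_le_eq)
      moreover have "0 \<le> ?q r" by simp
      ultimately show ?thesis using e(2) unfolding dist_real_def by linarith
    qed
    then show "\<forall>\<^sub>F r in at_right 0. dist (?q r) 0 < \<epsilon>"
      unfolding eventually_at_right_field using r0(1) by (intro exI[of _ "r0 / 3"]) auto
  qed
  then have "has_density \<Omega> x 0 \<or> has_density \<Omega> x 1" by (intro has_density_dichotomy) auto
  moreover have "x \<in> essential_boundary \<Omega>" using lebesgue_point_frontier[OF x] essential by simp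
  ultimately show False by (simp add: essential_boundary_def)
qed

text \<open>If \<open>\<theta> x\<close> were small, one side \<open>E\<close> would be so thin that
  around each of its nearby points half of the ball of radius \<tau> r lies outside
  \<open>E\<close>. The isoperimetric inequality at scale \<tau> r then bounds the volume of
  \<open>E\<close> by a multiple of \<tau> \<theta> r^n, while \<open>volume_lower\<close> bounds it
  below by a multiple of \<theta> r^n. The density cancels and leaves a lower bound for \<tau> that
  its definition violates.\<close>

lemma \<theta>_lower_bound:
  assumes x: "lebesgue_point x"
  shows "density_lower TYPE('a) C < \<theta> x"
proof (rule ccontr)
  let ?k = "DIM('a) - 1" and ?w = "unit_ball_vol (real DIM('a))" and ?n = "DIM('a)"
  define \<tau> where "\<tau> = density_scale TYPE('a) C"
  assume "\<not> ?thesis"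
  then have le: "\<theta> x \<le> ?w * \<tau> ^ ?n / (32 * 4 ^ ?n * 6 ^ ?k * C)"
    by (simp add: density_lower_def \<tau>_def not_less)
  have w: "0 < ?w" by simp
  have t: "0 < \<theta> x" by (rule \<theta>_positive[OF x])
  have \<tau>: "0 < \<tau>" "\<tau> \<le> 1" "\<tau> * (64 * C\<^sup>2 * 4 ^ ?k) < 1"
  proof -
    have c: "0 < 128 * C\<^sup>2 * 4 ^ ?k" using C_pos by simp
    then show "0 < \<tau>" "\<tau> \<le> 1" by (auto simp: \<tau>_def density_scale_def)
    have "\<tau> \<le> 1 / (128 * C\<^sup>2 * 4 ^ ?k)" by (simp add: \<tau>_def density_scale_def)
    then have "\<tau> * (128 * C\<^sup>2 * 4 ^ ?k) \<le> 1" using c by (simp add: pos_le_divide_eq)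
    then show "\<tau> * (64 * C\<^sup>2 * 4 ^ ?k) < 1" by simp
  qed
  \<comment> \<open>An averaging error equal to the main term keeps the perimeter bound proportional
    to \<open>\<theta> x\<close>; this relies on \<open>\<theta>_positive\<close>.\<close>
  have e: "0 < \<theta> x * C" using t C_pos by simp
  obtain r1 where r1: "0 < r1" "\<And>r. 0 < r \<and> r < r1 \<Longrightarrow> measure P (ball x r) \<le> (\<theta> x * C + \<theta> x * C) * r ^ ?k"
    using lebesgue_point_perimeter_le[OF x e] by blast
  obtain r2 where r2: "0 < r2" "\<And>r E. 0 < r \<and> r < r2 \<and> (E = \<Omega> \<or> E = - \<Omega>) \<Longrightarrow> \<theta> x * r ^ ?n / (16 * C * 2 ^ ?k) \<le> vol E x r"
    using volume_lower[OF x t] by blast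
  define r where "r = min (r1 / 6) r2 / 2"
  have r: "0 < r" "6 * r < r1" "r < r2" using r1(1) r2(1) by (auto simp: r_def)
  have rn: "r ^ ?n = r * r ^ ?k" using dim by (simp flip: power_Suc)
  have "\<exists>E. (E = \<Omega> \<or> E = - \<Omega>) \<and> vol E x (2 * r) \<le> ?w * (\<tau> * r) ^ ?n / 2"
  proof (rule ccontr)
    assume "\<not> ?thesis"
    then have big: "?w * (\<tau> * r) ^ ?n / 2 < vol \<Omega> x (2 * r)" "?w * (\<tau> * r) ^ ?n / 2 < vol (- \<Omega>) x (2 * r)"
      by (auto simp: not_le)
    \<comment> \<open>The larger side fills half of the ball, so the bound on the product falls on
      the smaller side alone.\<close>
    have half: "?w * (2 * r) ^ ?n / 2 \<le> vol \<Omega> x (2 * r) \<or> ?w * (2 * r) ^ ?n / 2 \<le> vol (- \<Omega>) x (2 * r)"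
      using vol_add[of "2 * r" x] r(1) by auto
    have p: "0 < ?w * (\<tau> * r) ^ ?n / 2" "0 < ?w * (2 * r) ^ ?n / 2" using w \<tau> r by simp_all
    have "(?w * (\<tau> * r) ^ ?n / 2) * (?w * (2 * r) ^ ?n / 2) < vol \<Omega> x (2 * r) * vol (- \<Omega>) x (2 * r)"
      using half
    proof
      assume "?w * (2 * r) ^ ?n / 2 \<le> vol \<Omega> x (2 * r)"
      then have "(?w * (2 * r) ^ ?n / 2) * (?w * (\<tau> * r) ^ ?n / 2) < vol \<Omega> x (2 * r) * vol (- \<Omega>) x (2 * r)"
        using p big(2) by (intro mult_le_less_imp_less) auto
      then show ?thesis by (simp add: mult.commute)
    next
      assume "?w * (2 * r) ^ ?n / 2 \<le> vol (- \<Omega>) x (2 * r)"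
      then show ?thesis using p big(1) by (intro mult_less_le_imp_less) auto
    qed
    also have "\<dots> \<le> 2 * (2 * r) * (?w * (2 * (2 * r)) ^ ?n) * measure P (ball x (3 * (2 * r)))"
      using r(1) by (intro relative_isoperimetric) simp
    also have "\<dots> \<le> 2 * (2 * r) * (?w * (2 * (2 * r)) ^ ?n) * (2 * \<theta> x * C * (6 * r) ^ ?k)"
      using r1(2)[of "6 * r"] r w by (intro mult_left_mono) (auto simp: mult_ac)
    also have "\<dots> = (8 * 4 ^ ?n * 6 ^ ?k * C) * \<theta> x * (?w * (r ^ ?n * r ^ ?n))"
      by (simp add: power_mult_distrib rn)
    also have "\<dots> \<le> (8 * 4 ^ ?n * 6 ^ ?k * C) * (?w * \<tau> ^ ?n / (32 * 4 ^ ?n * 6 ^ ?k * C)) * (?w * (r ^ ?n * r ^ ?n))"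
      using le C_pos w r by (intro mult_right_mono mult_left_mono) auto
    also have "\<dots> = (?w * (\<tau> * r) ^ ?n / 2) * (?w * r ^ ?n / 2)"
      using C_pos by (simp add: power_mult_distrib)
    also have "\<dots> \<le> (?w * (\<tau> * r) ^ ?n / 2) * (?w * (2 * r) ^ ?n / 2)"
      using p w r by (intro mult_left_mono divide_right_mono power_mono) auto
    finally show False by simp
  qed
  then obtain E where E: "E = \<Omega> \<or> E = - \<Omega>" and small: "vol E x (2 * r) \<le> ?w * (\<tau> * r) ^ ?n / 2" by blast
  have Eb: "E \<in> sets borel" "- E \<in> sets borel" using E by auto
  define a where "a = ?w * (\<tau> * r) ^ ?n / 2"
  have a: "0 < a" using w \<tau> r by (simp add: a_def)
  have "a * vol E x r \<le> (\<tau> * r) * (?w * (\<tau> * r) ^ ?n) * measure P (ball x (r + \<tau> * r))"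
  proof (rule isoperimetric[OF E r(1) _ less_imp_le[OF a]])
    show "0 < \<tau> * r" using \<tau> r by simp
    fix z assume z: "z \<in> E \<inter> ball x r"
    have "\<tau> * r \<le> r" using \<tau> r by simp
    have "ball z (\<tau> * r) \<subseteq> ball x (2 * r)"
    proof
      fix y assume "y \<in> ball z (\<tau> * r)"
      then have "dist z y < r" using \<open>\<tau> * r \<le> r\<close> by simp
      then show "y \<in> ball x (2 * r)" using z dist_triangle[of x y z] by simp
    qed
    then have "vol E z (\<tau> * r) \<le> vol E x (2 * r)"
      unfolding vol_def using Eb by (intro measure_mono_fmeasurable fmeasurable_lborel_Int_ball) auto
    moreover have "vol E z (\<tau> * r) + vol (- E) z (\<tau> * r) = ?w * (\<tau> * r) ^ ?n"
      using vol_add[of "\<tau> * r" z] E \<tau> r by (auto simp: add.commute)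
    ultimately show "a \<le> vol (- E) z (\<tau> * r)" using small by (simp add: a_def)
  qed
  also have "(\<tau> * r) * (?w * (\<tau> * r) ^ ?n) * measure P (ball x (r + \<tau> * r)) = a * (2 * \<tau> * r * measure P (ball x (r + \<tau> * r)))"
    by (simp add: a_def)
  finally have "vol E x r \<le> 2 * \<tau> * r * measure P (ball x (r + \<tau> * r))"
    by (rule mult_left_le_imp_le[OF _ a])
  also have "measure P (ball x (r + \<tau> * r)) \<le> measure P (ball x (2 * r))"
  proof (rule measure_mono_fmeasurable)
    have "\<tau> * r \<le> 1 * r" using \<tau> r by (intro mult_right_mono) auto
    then show "ball x (r + \<tau> * r) \<subseteq> ball x (2 * r)" by (intro subset_ball) simp
    show "ball x (2 * r) \<in> fmeasurable P"
      using finite_P_bounded[of "ball x (2 * r)"] by (simp add: fmeasurable_def)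
  qed simp
  also have "measure P (ball x (2 * r)) \<le> 2 * \<theta> x * C * (2 * r) ^ ?k"
    using r1(2)[of "2 * r"] r by (simp add: mult_ac)
  also have "2 * \<tau> * r * (2 * \<theta> x * C * (2 * r) ^ ?k) = 4 * \<tau> * C * 2 ^ ?k * \<theta> x * r ^ ?n"
    by (simp add: power_mult_distrib rn)
  finally have up: "vol E x r \<le> 4 * \<tau> * C * 2 ^ ?k * \<theta> x * r ^ ?n" using \<tau> r by simp
  have lo: "\<theta> x * r ^ ?n / (16 * C * 2 ^ ?k) \<le> vol E x r" using r2(2) r E by blast
  have "\<theta> x * r ^ ?n / (16 * C * 2 ^ ?k) \<le> (\<theta> x * r ^ ?n) * (4 * \<tau> * C * 2 ^ ?k)"
    using order_trans[OF lo up] by (simp add: mult_ac)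
  moreover have "0 < 16 * C * 2 ^ ?k" using C_pos by simp
  ultimately have "\<theta> x * r ^ ?n \<le> (\<theta> x * r ^ ?n) * (4 * \<tau> * C * 2 ^ ?k) * (16 * C * 2 ^ ?k)"
    by (simp only: pos_divide_le_eq)
  also have "\<dots> = (\<theta> x * r ^ ?n) * (\<tau> * (64 * C\<^sup>2 * 4 ^ ?k))"
  proof -
    have "(4::real) ^ ?k = 2 ^ ?k * 2 ^ ?k" by (simp flip: power_mult_distrib)
    then show ?thesis by (simp add: power2_eq_square)
  qed
  finally have "\<theta> x * r ^ ?n * 1 \<le> (\<theta> x * r ^ ?n) * (\<tau> * (64 * C\<^sup>2 * 4 ^ ?k))" by simp
  moreover have "0 < \<theta> x * r ^ ?n" using t r by simp
  ultimately have "1 \<le> \<tau> * (64 * C\<^sup>2 * 4 ^ ?k)" by (subst (asm) mult_le_cancel_left_pos) auto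
  then show False using \<tau>(3) by simp
qed

end

section \<open>The outer normal\<close>

lemma density_lower_pos: "0 < C \<Longrightarrow> 0 < density_lower TYPE('a::euclidean_space) C"
  by (simp add: density_lower_def density_scale_def)

lemma density_upper_pos: "0 < density_upper TYPE('a::euclidean_space)"
  using tube_const_pos[where 'a='a] by (simp add: density_upper_def add_nonneg_pos)

context regular_domain
begin

lemma P_ball_lower:
  assumes "x \<in> frontier \<Omega>" "0 < r" "r < d"
  shows "density_lower TYPE('a) C * inverse C * r ^ (DIM('a) - 1) \<le> measure P (ball x r)"
proof -
  have c: "0 < density_lower TYPE('a) C" by (rule density_lower_pos[OF C_pos])
  have "ennreal (density_lower TYPE('a) C * inverse C * r ^ (DIM('a) - 1))
      = ennreal (density_lower TYPE('a) C) * ennreal (inverse C * r ^ (DIM('a) - 1))"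
    using c by (simp add: mult.assoc ennreal_mult')
  also have "\<dots> \<le> ennreal (density_lower TYPE('a) C) * emeasure h (ball x r)"
    by (intro mult_left_mono lower assms) simp
  also have "\<dots> = (\<integral>\<^sup>+y. ennreal (density_lower TYPE('a) C) * indicator (ball x r) y \<partial>h)"
    by (subst nn_integral_cmult_indicator) auto
  also have "\<dots> \<le> (\<integral>\<^sup>+y\<in>ball x r. ennreal (\<theta> y) \<partial>h)"
  proof (rule nn_integral_mono_AE)
    show "AE y in h. ennreal (density_lower TYPE('a) C) * indicator (ball x r) y \<le> ennreal (\<theta> y) * indicator (ball x r) y"
      using AE_domain_lebesgue_point
    proof eventually_elim
      case (elim y)
      show ?case using \<theta>_lower_bound[OF elim] by (intro mult_right_mono ennreal_leI) auto
    qed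
  qed
  also have "\<dots> = emeasure P (ball x r)" by (rule emeasure_P[symmetric]) simp
  also have "\<dots> = ennreal (measure P (ball x r))" by (rule emeasure_P_ball)
  finally show ?thesis by (simp add: ennreal_le_iff)
qed

lemma nn_integral_P_le:
  assumes [measurable]: "f \<in> borel_measurable borel"
  shows "(\<integral>\<^sup>+y. f y \<partial>P) \<le> ennreal (density_upper TYPE('a)) * (\<integral>\<^sup>+y. f y \<partial>h)"
proof -
  have "(\<integral>\<^sup>+y. f y \<partial>P) = (\<integral>\<^sup>+y. ennreal (\<theta> y) * f y \<partial>h)"
    unfolding \<theta>(3) by (rule nn_integral_density) measurable
  also have "\<dots> \<le> (\<integral>\<^sup>+y. ennreal (density_upper TYPE('a)) * f y \<partial>h)"
  proof (rule nn_integral_mono_AE)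
    show "AE y in h. ennreal (\<theta> y) * f y \<le> ennreal (density_upper TYPE('a)) * f y"
      using AE_domain_lebesgue_point
    proof eventually_elim
      case (elim y)
      show ?case using \<theta>_upper_bound[OF elim] by (intro mult_right_mono ennreal_leI) auto
    qed
  qed
  also have "\<dots> = ennreal (density_upper TYPE('a)) * (\<integral>\<^sup>+y. f y \<partial>h)"
    by (rule nn_integral_cmult) measurable
  finally show ?thesis .
qed

definition mean_normal :: "'a \<Rightarrow> real \<Rightarrow> 'a" where
  "mean_normal x r = gauss_green_measure \<Omega> (ball x r) /\<^sub>R measure P (ball x r)"

lemma gauss_green_measure_eq: "gauss_green_measure \<Omega> A = (LINT y:A|P. \<nu> y)"
  by (simp add: gauss_green_measure_def \<nu>_def)

lemma integrable_\<nu>_ball: "integrable P (\<lambda>y. indicat_real (ball x r) y *\<^sub>R \<nu> y)"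
proof (rule Bochner_Integration.integrable_bound)
  show "integrable P (indicat_real (ball x r))"
    using finite_P_bounded[of "ball x r"] by (intro integrable_real_indicator) auto
  have [measurable]: "ball x r \<in> sets borel" by simp
  show "(\<lambda>y. indicat_real (ball x r) y *\<^sub>R \<nu> y) \<in> borel_measurable P" by measurable
  show "AE y in P. norm (indicat_real (ball x r) y *\<^sub>R \<nu> y) \<le> norm (indicat_real (ball x r) y)"
    using AE_norm_\<nu> by eventually_elim (simp add: indicator_def)
qed

text \<open>Since the density varies, the normal is compared through \<theta> |\<nu> - \<nu> x|
  \<le> |\<theta> \<nu> - \<theta> x \<nu> x| + |\<theta> - \<theta> x|. The integrals of the right
  side are small against r^(n-1), and the perimeter of the ball is at least a multiple of
  r^(n-1).\<close>

lemma mean_normal_tendsto: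
  assumes x: "lebesgue_point x"
  shows "((\<lambda>r. mean_normal x r) \<longlongrightarrow> \<nu> x) (at_right 0)"
proof (rule tendstoI)
  fix \<epsilon> :: real assume eps: "0 < \<epsilon>"
  let ?k = "DIM('a) - 1"
  define c where "c = density_lower TYPE('a) C * inverse C"
  have c: "0 < c" using density_lower_pos[OF C_pos, where 'a='a] C_pos by (simp add: c_def)
  define e where "e = c * \<epsilon> / 4"
  have e: "0 < e" using c eps by (simp add: e_def)
  have xF: "x \<in> frontier \<Omega>" by (rule lebesgue_point_frontier[OF x])
  have n1: "norm (\<nu> x) = 1" by (rule lebesgue_point_norm[OF x \<theta>_positive[OF x]])
  obtain r0 where r0: "0 < r0" "\<And>r. 0 < r \<Longrightarrow> r < r0 \<Longrightarrow> (\<integral>\<^sup>+y\<in>ball x r. ennreal (norm (\<theta> y - \<theta> x)) \<partial>h) \<le> ennreal (e * r ^ ?k)"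
    "\<And>r. 0 < r \<Longrightarrow> r < r0 \<Longrightarrow> (\<integral>\<^sup>+y\<in>ball x r. ennreal (norm (\<theta> y *\<^sub>R \<nu> y - \<theta> x *\<^sub>R \<nu> x)) \<partial>h) \<le> ennreal (e * r ^ ?k)"
    by (rule lebesgue_pointD[OF x e]) (rule that)
  have "dist (mean_normal x r) (\<nu> x) < \<epsilon>" if r: "0 < r" "r < min r0 d" for r
  proof -
    let ?B = "ball x r"
    have [measurable]: "?B \<in> sets borel" by simp
    have Pp: "c * r ^ ?k \<le> measure P ?B" using P_ball_lower[OF xF] r by (simp add: c_def)
    then have P0: "0 < measure P ?B" using c r by (meson less_le_trans mult_pos_pos zero_less_power)
    have iB: "integrable P (indicat_real ?B)"
      using finite_P_bounded[of ?B] by (intro integrable_real_indicator) auto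
    then have iP: "integrable P (\<lambda>y. indicat_real ?B y *\<^sub>R \<nu> x)"
      by (rule integrable_scaleR_left)
    have mP: "(LINT y|P. indicat_real ?B y *\<^sub>R \<nu> x) = measure P ?B *\<^sub>R \<nu> x"
      using iB by (subst integral_scaleR_left) auto
    have "gauss_green_measure \<Omega> ?B - measure P ?B *\<^sub>R \<nu> x = (LINT y|P. indicat_real ?B y *\<^sub>R \<nu> y - indicat_real ?B y *\<^sub>R \<nu> x)"
      using integrable_\<nu>_ball iP by (simp add: gauss_green_measure_eq set_lebesgue_integral_def mP)
    also have "norm \<dots> \<le> (\<integral>\<^sup>+y. ennreal (norm (indicat_real ?B y *\<^sub>R \<nu> y - indicat_real ?B y *\<^sub>R \<nu> x)) \<partial>P)"
      by (rule integral_norm_bound_ennreal) (use integrable_\<nu>_ball iP in auto)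
    also have "\<dots> = (\<integral>\<^sup>+y. ennreal (\<theta> y) * ennreal (norm (indicat_real ?B y *\<^sub>R \<nu> y - indicat_real ?B y *\<^sub>R \<nu> x)) \<partial>h)"
      unfolding \<theta>(3) by (rule nn_integral_density) measurable
    also have "\<dots> \<le> (\<integral>\<^sup>+y. ennreal (norm (\<theta> y *\<^sub>R \<nu> y - \<theta> x *\<^sub>R \<nu> x)) * indicator ?B y + ennreal (norm (\<theta> y - \<theta> x)) * indicator ?B y \<partial>h)"
    proof (rule nn_integral_mono)
      fix y
      have "\<theta> y * norm (\<nu> y - \<nu> x) = norm (\<theta> y *\<^sub>R (\<nu> y - \<nu> x))" using \<theta>(2)[of y] by simp
      also have "\<theta> y *\<^sub>R (\<nu> y - \<nu> x) = (\<theta> y *\<^sub>R \<nu> y - \<theta> x *\<^sub>R \<nu> x) - (\<theta> y - \<theta> x) *\<^sub>R \<nu> x"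
        by (simp add: algebra_simps)
      also have "norm \<dots> \<le> norm (\<theta> y *\<^sub>R \<nu> y - \<theta> x *\<^sub>R \<nu> x) + norm (\<theta> y - \<theta> x)"
        using norm_triangle_ineq4[of "\<theta> y *\<^sub>R \<nu> y - \<theta> x *\<^sub>R \<nu> x" "(\<theta> y - \<theta> x) *\<^sub>R \<nu> x"] n1 by simp
      finally have "ennreal (\<theta> y * norm (\<nu> y - \<nu> x)) \<le> ennreal (norm (\<theta> y *\<^sub>R \<nu> y - \<theta> x *\<^sub>R \<nu> x)) + ennreal (norm (\<theta> y - \<theta> x))"
        by (metis ennreal_leI ennreal_plus norm_ge_zero)
      then show "ennreal (\<theta> y) * ennreal (norm (indicat_real ?B y *\<^sub>R \<nu> y - indicat_real ?B y *\<^sub>R \<nu> x))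
          \<le> ennreal (norm (\<theta> y *\<^sub>R \<nu> y - \<theta> x *\<^sub>R \<nu> x)) * indicator ?B y + ennreal (norm (\<theta> y - \<theta> x)) * indicator ?B y"
        using \<theta>(2)[of y] by (cases "y \<in> ?B") (simp_all add: ennreal_mult)
    qed
    also have "\<dots> = (\<integral>\<^sup>+y\<in>?B. ennreal (norm (\<theta> y *\<^sub>R \<nu> y - \<theta> x *\<^sub>R \<nu> x)) \<partial>h) + (\<integral>\<^sup>+y\<in>?B. ennreal (norm (\<theta> y - \<theta> x)) \<partial>h)"
      by (rule nn_integral_add) measurable
    also have "\<dots> \<le> ennreal (e * r ^ ?k) + ennreal (e * r ^ ?k)"
      using r by (intro add_mono r0) auto
    also have "\<dots> = ennreal (2 * (e * r ^ ?k))" using e r by (simp flip: ennreal_plus)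
    finally have N: "norm (gauss_green_measure \<Omega> ?B - measure P ?B *\<^sub>R \<nu> x) \<le> 2 * (e * r ^ ?k)"
      using e r by (subst (asm) ennreal_le_iff) auto
    have "mean_normal x r - \<nu> x = (gauss_green_measure \<Omega> ?B - measure P ?B *\<^sub>R \<nu> x) /\<^sub>R measure P ?B"
      using P0 by (simp add: mean_normal_def scaleR_diff_right)
    then have "dist (mean_normal x r) (\<nu> x) = norm (gauss_green_measure \<Omega> ?B - measure P ?B *\<^sub>R \<nu> x) / measure P ?B"
      using P0 by (simp add: dist_norm divide_inverse_commute)
    also have "\<dots> \<le> 2 * (e * r ^ ?k) / (c * r ^ ?k)"
      using N Pp c r e by (intro frac_le) auto
    also have "\<dots> = 2 * e / c" using c r by simp
    also have "\<dots> < \<epsilon>" using c eps by (simp add: e_def)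
    finally show ?thesis .
  qed
  then show "\<forall>\<^sub>F r in at_right 0. dist (mean_normal x r) (\<nu> x) < \<epsilon>"
    unfolding eventually_at_right_field using r0(1) d_pos by (intro exI[of _ "min r0 d"]) auto
qed

lemma is_outer_normal_iff:
  "is_outer_normal \<Omega> x v \<longleftrightarrow> norm v = 1 \<and> ((\<lambda>r. mean_normal x r) \<longlongrightarrow> v) (at_right 0)"
  by (simp add: is_outer_normal_def mean_normal_def)

lemma outer_normal_eqI:
  assumes "x \<in> measure_support P" "is_outer_normal \<Omega> x v"
  shows "x \<in> reduced_boundary \<Omega>" "outer_normal \<Omega> x = v"
proof -
  show r: "x \<in> reduced_boundary \<Omega>" using assms by (auto simp: reduced_boundary_def)
  have "(THE v. is_outer_normal \<Omega> x v) = v"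
  proof (rule the_equality)
    show "is_outer_normal \<Omega> x v" by (rule assms(2))
    fix u assume "is_outer_normal \<Omega> x u"
    then show "u = v" using assms(2) tendsto_unique[of "at_right (0::real)"] by (auto simp: is_outer_normal_iff)
  qed
  then show "outer_normal \<Omega> x = v" using r by (simp add: outer_normal_def)
qed

lemma norm_outer_normal_le: "norm (outer_normal \<Omega> x) \<le> 1"
proof (cases "x \<in> reduced_boundary \<Omega>")
  case True
  then obtain v where v: "x \<in> measure_support P" "is_outer_normal \<Omega> x v" by (auto simp: reduced_boundary_def)
  then show ?thesis using outer_normal_eqI(2)[OF v] by (simp add: is_outer_normal_def)
next
  case False
  then show ?thesis by (simp add: outer_normal_def)
qed

lemma frontier_subset_support: "frontier \<Omega> \<subseteq> measure_support P"
proof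
  fix x assume x: "x \<in> frontier \<Omega>"
  show "x \<in> measure_support P"
    unfolding measure_support_def
  proof (intro CollectI allI impI)
    fix r :: real assume r: "0 < r"
    define s where "s = min r (d / 2)"
    have s: "0 < s" "s < d" "s \<le> r" using r d_pos by (auto simp: s_def)
    have "0 < density_lower TYPE('a) C * inverse C * s ^ (DIM('a) - 1)"
      using density_lower_pos[OF C_pos, where 'a='a] C_pos s by simp
    then have "0 < measure P (ball x s)" using P_ball_lower[OF x s(1,2)] by linarith
    then have "0 < emeasure P (ball x s)" by (simp add: emeasure_P_ball)
    also have "\<dots> \<le> emeasure P (ball x r)" using s(3) by (intro emeasure_mono subset_ball) auto
    finally show "0 < emeasure P (ball x r)" .
  qed
qed

lemma outer_normal_lebesgue_point:
  assumes x: "lebesgue_point x"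
  shows "outer_normal \<Omega> x = \<nu> x"
proof (rule outer_normal_eqI(2))
  show "x \<in> measure_support P" using lebesgue_point_frontier[OF x] frontier_subset_support by blast
  show "is_outer_normal \<Omega> x (\<nu> x)"
    unfolding is_outer_normal_iff
    using mean_normal_tendsto[OF x] lebesgue_point_norm[OF x \<theta>_positive[OF x]] by simp
qed

lemma sigma_finite_P: "sigma_finite_measure P"
proof
  show "\<exists>A. countable A \<and> A \<subseteq> sets P \<and> \<Union> A = space P \<and> (\<forall>a\<in>A. emeasure P a \<noteq> \<infinity>)"
  proof (intro exI[of _ "range (\<lambda>n. ball 0 (real n))"] conjI)
    have "\<exists>n. x \<in> ball 0 (real n)" for x :: 'a using reals_Archimedean2[of "norm x"] by simp
    then show "\<Union> (range (\<lambda>n. ball (0::'a) (real n))) = space P" by auto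
    show "\<forall>a\<in>range (\<lambda>n. ball 0 (real n)). emeasure P a \<noteq> \<infinity>"
      using finite_P_bounded by (auto simp: less_top)
  qed auto
qed

section \<open>Borel measurability of the outer normal\<close>

lemma measure_P_ball_borel: "(\<lambda>x. measure P (ball x r)) \<in> borel_measurable borel"
  and mean_normal_borel: "(\<lambda>x. mean_normal x r) \<in> borel_measurable borel"
proof -
  interpret S: sigma_finite_measure P by (rule sigma_finite_P)
  have [measurable]: "Measurable.pred (borel \<Otimes>\<^sub>M borel) (\<lambda>(x::'a, y). y \<in> ball x r)"
    unfolding mem_ball by measurable
  have "(\<lambda>x. LINT y|P. indicat_real (ball x r) y) \<in> borel_measurable borel"
    by (rule S.borel_measurable_lebesgue_integral) (simp add: indicator_def, measurable)
  then show 1 [measurable]: "(\<lambda>x. measure P (ball x r)) \<in> borel_measurable borel" by simp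
  have [measurable]: "(\<lambda>x. LINT y|P. indicat_real (ball x r) y *\<^sub>R \<nu> y) \<in> borel_measurable borel"
    by (rule S.borel_measurable_lebesgue_integral) (simp add: indicator_def, measurable)
  show "(\<lambda>x. mean_normal x r) \<in> borel_measurable borel"
    unfolding mean_normal_def gauss_green_measure_eq set_lebesgue_integral_def by measurable
qed

text \<open>An open ball is the increasing union of smaller concentric ones, so means over balls are
  left continuous in the radius. This reduces limits over real radii to rational ones.\<close>

lemma mean_normal_left_limit:
  assumes x: "x \<in> measure_support P" and r: "0 < r" and q: "\<And>j. q j < r" "q \<longlonglongrightarrow> r"
  shows "(\<lambda>j. mean_normal x (q j)) \<longlonglongrightarrow> mean_normal x r"
proof -
  have ind: "(\<lambda>j. indicat_real (ball x (q j)) y) \<longlonglongrightarrow> indicat_real (ball x r) y" for y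
  proof (cases "dist x y < r")
    case True
    have "\<forall>\<^sub>F j in sequentially. dist x y < q j" by (rule order_tendstoD(1)[OF q(2) True])
    then have "\<forall>\<^sub>F j in sequentially. indicat_real (ball x (q j)) y = 1"
      by eventually_elim simp
    then show ?thesis using True by (simp add: tendsto_eventually)
  next
    case False
    then have "indicat_real (ball x (q j)) y = 0" for j using q(1)[of j] by auto
    then show ?thesis using False by simp
  qed
  have iB: "integrable P (indicat_real (ball x r))"
    using finite_P_bounded[of "ball x r"] by (intro integrable_real_indicator) auto
  have sub: "indicat_real (ball x (q j)) y \<le> indicat_real (ball x r) y" for j y
    using q(1)[of j] by (auto simp: indicator_def)
  have bm [measurable]: "ball x s \<in> sets borel" for s by simp
  have 1: "(\<lambda>j. LINT y|P. indicat_real (ball x (q j)) y) \<longlonglongrightarrow> (LINT y|P. indicat_real (ball x r) y)"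
  proof (rule integral_dominated_convergence[where w="indicat_real (ball x r)"])
    show "AE y in P. (\<lambda>j. indicat_real (ball x (q j)) y) \<longlonglongrightarrow> indicat_real (ball x r) y" using ind by simp
    show "AE y in P. norm (indicat_real (ball x (q j)) y) \<le> indicat_real (ball x r) y" for j using sub by simp
  qed (use iB in auto)
  have 2: "(\<lambda>j. LINT y|P. indicat_real (ball x (q j)) y *\<^sub>R \<nu> y) \<longlonglongrightarrow> (LINT y|P. indicat_real (ball x r) y *\<^sub>R \<nu> y)"
  proof (rule integral_dominated_convergence[where w="indicat_real (ball x r)"])
    show "AE y in P. (\<lambda>j. indicat_real (ball x (q j)) y *\<^sub>R \<nu> y) \<longlonglongrightarrow> indicat_real (ball x r) y *\<^sub>R \<nu> y"
      by (intro AE_I2 tendsto_scaleR ind tendsto_const)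
    show "AE y in P. norm (indicat_real (ball x (q j)) y *\<^sub>R \<nu> y) \<le> indicat_real (ball x r) y" for j
      using AE_norm_\<nu> by eventually_elim (use sub in simp)
    show "(\<lambda>y. indicat_real (ball x r) y *\<^sub>R \<nu> y) \<in> borel_measurable P" by measurable
    show "(\<lambda>y. indicat_real (ball x (q j)) y *\<^sub>R \<nu> y) \<in> borel_measurable P" for j by measurable
  qed (rule iB)
  have "0 < emeasure P (ball x r)"
    using x r unfolding measure_support_def by blast
  then have "0 < measure P (ball x r)"
    by (simp only: emeasure_P_ball ennreal_less_zero_iff)
  then have "(\<lambda>j. (LINT y|P. indicat_real (ball x (q j)) y *\<^sub>R \<nu> y) /\<^sub>R (LINT y|P. indicat_real (ball x (q j)) y))
      \<longlonglongrightarrow> (LINT y|P. indicat_real (ball x r) y *\<^sub>R \<nu> y) /\<^sub>R (LINT y|P. indicat_real (ball x r) y)"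
    by (intro tendsto_intros 1 2) simp
  then show ?thesis
    by (simp add: mean_normal_def gauss_green_measure_eq set_lebesgue_integral_def)
qed

lemma mean_normal_tendsto_rat:
  assumes x: "x \<in> measure_support P"
  shows "((\<lambda>r. mean_normal x r) \<longlongrightarrow> v) (at_right 0) \<longleftrightarrow>
    (\<forall>m. \<exists>j. \<forall>q::rat. 0 < real_of_rat q \<and> real_of_rat q < 1 / real (Suc j) \<longrightarrow> norm (mean_normal x (real_of_rat q) - v) \<le> 1 / real (Suc m))"
    (is "?L \<longleftrightarrow> (\<forall>m. \<exists>j. ?R m j)")
proof
  assume L: ?L
  show "\<forall>m. \<exists>j. ?R m j"
  proof
    fix m
    have "\<forall>\<^sub>F r in at_right 0. dist (mean_normal x r) v < 1 / real (Suc m)" by (rule tendstoD[OF L]) simp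
    then obtain b where b: "0 < b" "\<And>r. 0 < r \<Longrightarrow> r < b \<Longrightarrow> dist (mean_normal x r) v < 1 / real (Suc m)"
      unfolding eventually_at_right_field by blast
    obtain j where j: "1 / real (Suc j) < b" using b(1) by (rule nat_approx_posE)
    show "\<exists>j. ?R m j"
    proof (intro exI[of _ j] allI impI)
      fix q :: rat assume "0 < real_of_rat q \<and> real_of_rat q < 1 / real (Suc j)"
      then have "dist (mean_normal x (real_of_rat q)) v < 1 / real (Suc m)" using j by (intro b(2)) linarith+
      then show "norm (mean_normal x (real_of_rat q) - v) \<le> 1 / real (Suc m)" by (simp add: dist_norm)
    qed
  qed
next
  assume R: "\<forall>m. \<exists>j. ?R m j"
  show ?L
  proof (rule tendstoI)
    fix e :: real assume "0 < e"
    then obtain m where m: "1 / real (Suc m) < e" by (rule nat_approx_posE)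
    obtain j where j: "?R m j" using R by blast
    have "dist (mean_normal x r) v < e" if r: "0 < r" "r < 1 / real (Suc j)" for r
    proof -
      have "\<forall>i. \<exists>q::rat. max 0 (r - 1 / real (Suc i)) < real_of_rat q \<and> real_of_rat q < r"
      proof
        fix i
        have "max 0 (r - 1 / real (Suc i)) < r" using r(1) by simp
        then show "\<exists>q::rat. max 0 (r - 1 / real (Suc i)) < real_of_rat q \<and> real_of_rat q < r" by (rule of_rat_dense)
      qed
      from choice[OF this] obtain q where q: "\<forall>i. max 0 (r - 1 / real (Suc i)) < real_of_rat (q i) \<and> real_of_rat (q i) < r" ..
      have lim: "(\<lambda>i. real_of_rat (q i)) \<longlonglongrightarrow> r"
      proof (rule tendsto_sandwich[of "\<lambda>i. r - 1 / real (Suc i)" _ _ "\<lambda>_. r"])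
        have "(\<lambda>i. r - 1 / real (Suc i)) \<longlonglongrightarrow> r - 0"
          by (intro tendsto_intros LIMSEQ_Suc[OF lim_1_over_n])
        then show "(\<lambda>i. r - 1 / real (Suc i)) \<longlonglongrightarrow> r" by simp
        show "\<forall>\<^sub>F i in sequentially. r - 1 / real (Suc i) \<le> real_of_rat (q i)"
          using q by (intro always_eventually allI) (metis less_imp_le max_less_iff_conj)
        show "\<forall>\<^sub>F i in sequentially. real_of_rat (q i) \<le> r"
          using q by (intro always_eventually allI) (simp add: less_imp_le)
      qed simp
      have "(\<lambda>i. norm (mean_normal x (real_of_rat (q i)) - v)) \<longlonglongrightarrow> norm (mean_normal x r - v)"
        by (intro tendsto_intros mean_normal_left_limit[OF x r(1) _ lim]) (use q in auto)
      moreover have "norm (mean_normal x (real_of_rat (q i)) - v) \<le> 1 / real (Suc m)" for i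
      proof -
        have "0 < real_of_rat (q i)" "real_of_rat (q i) < r" using spec[OF q, of i] by simp_all
        then show ?thesis using j r(2) by force
      qed
      ultimately have "norm (mean_normal x r - v) \<le> 1 / real (Suc m)"
        by (intro LIMSEQ_le_const2) blast+
      then show ?thesis using m by (simp add: dist_norm)
    qed
    then show "\<forall>\<^sub>F r in at_right 0. dist (mean_normal x r) v < e"
      unfolding eventually_at_right_field by (intro exI[of _ "1 / real (Suc j)"]) auto
  qed
qed

text \<open>Equality with \<open>\<nu>\<close> almost everywhere does not give this, since the
  surface measure need not be complete. The limit along the radii 1 / (j + 1) is a Borel candidate,
  and whether it is the normal is decided by countably many conditions on rational radii.\<close>

lemma outer_normal_borel: "outer_normal \<Omega> \<in> borel_measurable borel"
proof -
  define L where "L x = lim (\<lambda>j. mean_normal x (1 / real (Suc j)))" for x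
  note [measurable] = mean_normal_borel measure_P_ball_borel
  have [measurable]: "L \<in> borel_measurable borel" unfolding L_def by measurable
  have supp: "measure_support P = {x. \<forall>j. 0 < measure P (ball x (1 / real (Suc j)))}"
  proof (intro set_eqI iffI)
    fix x assume "x \<in> measure_support P"
    then have "0 < emeasure P (ball x (1 / real (Suc j)))" for j by (simp add: measure_support_def)
    then show "x \<in> {x. \<forall>j. 0 < measure P (ball x (1 / real (Suc j)))}" by (simp add: emeasure_P_ball del: of_nat_Suc)
  next
    fix x assume x: "x \<in> {x. \<forall>j. 0 < measure P (ball x (1 / real (Suc j)))}"
    show "x \<in> measure_support P"
      unfolding measure_support_def
    proof (intro CollectI allI impI)
      fix r :: real assume "0 < r"
      then obtain j where j: "1 / real (Suc j) < r" by (rule nat_approx_posE)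
      have "0 < measure P (ball x (1 / real (Suc j)))" using x by blast
      then have "0 < emeasure P (ball x (1 / real (Suc j)))" by (simp only: emeasure_P_ball ennreal_less_zero_iff)
      also have "\<dots> \<le> emeasure P (ball x r)" using j by (intro emeasure_mono subset_ball) auto
      finally show "0 < emeasure P (ball x r)" .
    qed
  qed
  define A where "A = {x. (\<forall>j. 0 < measure P (ball x (1 / real (Suc j)))) \<and> norm (L x) = 1 \<and>
    (\<forall>m. \<exists>j. \<forall>q::rat. 0 < real_of_rat q \<and> real_of_rat q < 1 / real (Suc j) \<longrightarrow> norm (mean_normal x (real_of_rat q) - L x) \<le> 1 / real (Suc m))}"
  have A: "A \<in> sets borel" unfolding A_def by measurable
  have AR: "x \<in> A \<longleftrightarrow> x \<in> measure_support P \<and> is_outer_normal \<Omega> x (L x)" for x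
  proof (cases "x \<in> measure_support P")
    case True
    then show ?thesis
      unfolding is_outer_normal_iff mean_normal_tendsto_rat[OF True] A_def using supp by blast
  next
    case False
    then show ?thesis unfolding A_def using supp by blast
  qed
  have "outer_normal \<Omega> x = (if x \<in> A then L x else 0)" for x
  proof (cases "x \<in> reduced_boundary \<Omega>")
    case True
    then obtain v where v: "x \<in> measure_support P" "is_outer_normal \<Omega> x v" by (auto simp: reduced_boundary_def)
    have "filterlim (\<lambda>j. 1 / real (Suc j)) (at_right 0) sequentially"
      unfolding filterlim_at using LIMSEQ_Suc[OF lim_1_over_n[where 'a=real]] by auto
    then have "(\<lambda>j. mean_normal x (1 / real (Suc j))) \<longlonglongrightarrow> v"
      using v(2) filterlim_compose unfolding is_outer_normal_iff by blast
    then have "L x = v" unfolding L_def by (rule limI)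
    then show ?thesis using v AR[of x] outer_normal_eqI(2)[OF v] by simp
  next
    case False
    then have "x \<notin> A" using AR by (auto simp: reduced_boundary_def)
    then show ?thesis using False by (simp add: outer_normal_def)
  qed
  then have "outer_normal \<Omega> = (\<lambda>x. if x \<in> A then L x else 0)" by blast
  moreover have "(\<lambda>x. if x \<in> A then L x else 0) \<in> borel_measurable borel" using A by measurable
  ultimately show ?thesis by simp
qed

end

section \<open>From small oscillation to flatness\<close>

text \<open>The profile \<open>f\<close> is almost decreasing in the direction \<open>v\<close> and drops by about \<open>b\<close> across every
  boundary point, so at most \<open>J\<close> boundary points can be stacked at well separated heights. A gap in the
  stack is a ball centred at a point where \<open>f\<close> is \<open>0\<close> or \<open>1\<close>; in the first case no further drop is
  possible above it, in the second case none is possible below it.\<close>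

lemma slab_of_profile:
  fixes \<Omega> :: "'a::euclidean_space set" and f :: "'a \<Rightarrow> real"
  assumes x: "x \<in> frontier \<Omega>" and v: "norm v = 1" and s: "0 < s" and b: "0 < b" and \<kappa>: "0 \<le> \<kappa>" "8 * \<kappa> \<le> b"
    and A: "0 < A" "A \<le> s / 20" and J: "2 < b * real J" and t: "t = A / (4 * real J)"
    and mono: "\<And>z z'. z \<in> ball x (s / 2) \<Longrightarrow> z' \<in> ball x (s / 2) \<Longrightarrow> 0 \<le> (z' - z) \<bullet> v \<Longrightarrow> f z' \<le> f z + \<kappa>"
    and drop: "\<And>y. y \<in> frontier \<Omega> \<Longrightarrow> y \<in> ball x (s / 4) \<Longrightarrow> f (y + (t / 4) *\<^sub>R v) \<le> f (y - (t / 4) *\<^sub>R v) - b + \<kappa>"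
    and f01: "\<And>z. 0 \<le> f z" "\<And>z. f z \<le> 1"
    and f1: "\<And>z. ball z t \<subseteq> \<Omega> \<Longrightarrow> f z = 1" and f0: "\<And>z. ball z t \<inter> \<Omega> = {} \<Longrightarrow> f z = 0"
  shows "\<And>y. y \<in> frontier \<Omega> \<Longrightarrow> y \<in> ball x (s / 8) \<Longrightarrow> \<bar>(y - x) \<bullet> v\<bar> < A"
    and "\<And>z. z \<in> ball x (s / 8) \<Longrightarrow> A < (z - x) \<bullet> v \<Longrightarrow> z \<notin> \<Omega>"
    and "\<And>z. z \<in> ball x (s / 8) \<Longrightarrow> (z - x) \<bullet> v < - (A) \<Longrightarrow> z \<in> \<Omega>"
proof -
  have vv: "v \<bullet> v = 1" using v by (simp add: norm_eq_1)
  have J1: "1 \<le> real J" using J by (cases J) auto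
  have t0: "0 < t" using s A(1) J1 by (simp add: t)
  \<comment> \<open>The height A is divided into J cells of height 4 t. The ball of radius t about
    the middle of a cell leaves a margin of t above and below.\<close>
  have tJ: "4 * t * real J = A" using J1 by (simp add: t)
  have t4: "4 * t \<le> A" using tJ mult_left_mono[OF J1, of "4 * t"] t0 by simp
  have tri: "z + c *\<^sub>R v \<in> ball x (s / 2)" if "z \<in> ball x (s / 4)" "\<bar>c\<bar> \<le> s / 4" for z c
  proof -
    have "dist x (z + c *\<^sub>R v) \<le> dist x z + dist z (z + c *\<^sub>R v)" by (rule dist_triangle)
    also have "dist z (z + c *\<^sub>R v) = \<bar>c\<bar>" by (simp add: dist_norm v)
    finally show ?thesis using that by simp
  qed
  have trim: "z - c *\<^sub>R v \<in> ball x (s / 2)" if "z \<in> ball x (s / 4)" "\<bar>c\<bar> \<le> s / 4" for z c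
    using tri[OF that(1), of "- c"] that(2) by simp
  have ball84: "z \<in> ball x (s / 4)" if "z \<in> ball x (s / 8)" for z using that s by simp
  have tq: "\<bar>t / 4\<bar> \<le> s / 4" using t0 t4 A(2) s by simp
  \<comment> \<open>Below a zero of f nothing is left to lose: f is at most \<kappa> just under y,
    and the drop would make it negative above y. The next fact is the mirror image with the value
    1.\<close>
  have low: False if y: "y \<in> frontier \<Omega>" "y \<in> ball x (s / 8)" and m: "m \<in> ball x (s / 2)" "f m = 0"
    and le: "0 \<le> (y - (t / 4) *\<^sub>R v - m) \<bullet> v" for y m
    using mono[OF m(1) trim[OF ball84[OF y(2)] tq] le] drop[OF y(1) ball84[OF y(2)]]
      f01(1)[of "y + (t / 4) *\<^sub>R v"] m(2) \<kappa> b by linarith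
  have high: False if y: "y \<in> frontier \<Omega>" "y \<in> ball x (s / 8)" and m: "m \<in> ball x (s / 2)" "f m = 1"
    and le: "0 \<le> (m - (y + (t / 4) *\<^sub>R v)) \<bullet> v" for y m
    using mono[OF tri[OF ball84[OF y(2)] tq] m(1) le] drop[OF y(1) ball84[OF y(2)]]
      f01(2)[of "y - (t / 4) *\<^sub>R v"] m(2) \<kappa> b by linarith
  have free: "f m = 1 \<or> f m = 0" if "ball m t \<inter> frontier \<Omega> = {}" for m
  proof -
    have "ball m t \<inter> \<Omega> = {} \<or> ball m t - \<Omega> = {}"
      using connected_Int_frontier[OF connected_ball, of m t \<Omega>] that by blast
    then show ?thesis using f0[of m] f1[of m] by blast
  qed
  have gap: False if y1: "y1 \<in> frontier \<Omega>" "y1 \<in> ball x (s / 8)" and y2: "y2 \<in> frontier \<Omega>" "y2 \<in> ball x (s / 8)"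
    and far: "A \<le> (y2 - y1) \<bullet> v" for y1 y2
  proof -
    define z where "z j = y1 + (4 * t * real j) *\<^sub>R v" for j
    define m where "m j = y1 + (4 * t * real j + 2 * t) *\<^sub>R v" for j
    have height: "4 * t * real j + 4 * t \<le> A" if "j < J" for j
    proof -
      have "4 * t * (real j + 1) \<le> 4 * t * real J" using that t0 by (intro mult_left_mono) auto
      then show ?thesis unfolding tJ by (simp add: distrib_left)
    qed
    have zin: "z j \<in> ball x (s / 2)" if "j \<le> J" for j
    proof -
      have "4 * t * real j \<le> 4 * t * real J" using that t0 by (intro mult_left_mono) auto
      then show ?thesis unfolding z_def using tJ A(2) s t0 by (intro tri ball84 y1) auto
    qed
    have min: "m j \<in> ball x (s / 2)" if "j < J" for j
      unfolding m_def using height[OF that] A(2) s t0 by (intro tri ball84 y1) auto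
    have "\<exists>j<J. ball (m j) t \<inter> frontier \<Omega> = {}"
    proof (rule ccontr)
      assume no: "\<not> ?thesis"
      \<comment> \<open>A boundary point in each cell would cost b - 3 \<kappa> \<ge> b / 2 per
        cell, and J cells would use up more than the total range 1.\<close>
      have "f (z j) \<le> 1 - real j * (b / 2)" if "j \<le> J" for j
        using that
      proof (induction j)
        case 0
        then show ?case using f01(2) by simp
      next
        case (Suc j)
        then have j: "j < J" by simp
        obtain y where y: "y \<in> ball (m j) t" "y \<in> frontier \<Omega>" using no j by blast
        define u where "u = y - m j"
        have u: "norm u < t" using y(1) by (simp add: u_def dist_norm norm_minus_commute)
        have uv: "\<bar>u \<bullet> v\<bar> < t" using Cauchy_Schwarz_ineq2[of u v] v u by simp
        have ydef: "y = y1 + (4 * t * real j + 2 * t) *\<^sub>R v + u" by (simp add: u_def m_def)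
        have "dist x y \<le> dist x y1 + dist y1 y" by (rule dist_triangle)
        also have "dist y1 y = norm ((4 * t * real j + 2 * t) *\<^sub>R v + u)"
        proof -
          have "y - y1 = (4 * t * real j + 2 * t) *\<^sub>R v + u" by (simp add: ydef)
          then show ?thesis by (metis dist_commute dist_norm)
        qed
        also have "\<dots> \<le> (4 * t * real j + 2 * t) + t"
          using norm_triangle_ineq[of "(4 * t * real j + 2 * t) *\<^sub>R v" u] u t0 v by simp
        finally have yb: "y \<in> ball x (s / 4)" using height[OF j] A(2) s y1(2) t0 by simp
        have "0 \<le> (y - (t / 4) *\<^sub>R v - z j) \<bullet> v"
          using uv t0 by (simp add: ydef z_def inner_add_left inner_diff_left vv algebra_simps)
        from mono[OF zin trim[OF yb tq] this] have "f (y - (t / 4) *\<^sub>R v) \<le> f (z j) + \<kappa>" using j by simp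
        moreover have "0 \<le> (z (Suc j) - (y + (t / 4) *\<^sub>R v)) \<bullet> v"
          using uv t0 by (simp add: ydef z_def inner_add_left inner_diff_left vv algebra_simps)
        from mono[OF tri[OF yb tq] zin this] have "f (z (Suc j)) \<le> f (y + (t / 4) *\<^sub>R v) + \<kappa>" using j by simp
        ultimately have "f (z (Suc j)) \<le> f (z j) - b / 2" using drop[OF y(2) yb] \<kappa> b by linarith
        moreover have "f (z j) \<le> 1 - real j * (b / 2)" using Suc by simp
        moreover have "real (Suc j) * (b / 2) = real j * (b / 2) + b / 2" by (simp add: distrib_right add_divide_distrib)
        ultimately show ?case by linarith
      qed
      from this[of J] have "real J * (b / 2) \<le> 1" using f01(1)[of "z J"] by simp
      then show False using J by (simp add: mult.commute)
    qed
    then obtain j where j: "j < J" "ball (m j) t \<inter> frontier \<Omega> = {}" by blast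
    from free[OF j(2)] show False
    proof
      assume "f (m j) = 1"
      then show False
        using t0 by (intro high[OF y1 min[OF j(1)]]) (auto simp: m_def inner_add_left inner_diff_left vv)
    next
      assume "f (m j) = 0"
      then show False
        using t0 far height[OF j(1)]
        by (intro low[OF y2 min[OF j(1)]]) (auto simp: m_def inner_add_left inner_diff_left vv)
    qed
  qed
  have xb: "x \<in> ball x (s / 8)" using s by simp
  show slab: "\<bar>(y - x) \<bullet> v\<bar> < A" if y: "y \<in> frontier \<Omega>" "y \<in> ball x (s / 8)" for y
    using gap[OF x xb y] gap[OF y x xb] by (force simp: inner_diff_left)
  \<comment> \<open>The signs c = 1 and c = -1 place a ball of radius t in the cap above or below
    the slab. Each cap is connected and free of boundary points, hence inside or outside the domain,
    and the value of f at the centre of the ball decides which.\<close>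
  have side: "\<exists>m. m \<in> ball x (s / 2) \<and> ball m t \<subseteq> {z \<in> ball x (s / 8). A < c * ((z - x) \<bullet> v)} \<and> m = x + (c * (A + 2 * t)) *\<^sub>R v"
    if c: "\<bar>c\<bar> = 1" for c :: real
  proof (intro exI[of _ "x + (c * (A + 2 * t)) *\<^sub>R v"] conjI refl)
    have ac: "\<bar>c * (A + 2 * t)\<bar> = A + 2 * t" using c t0 A(1) s by (simp add: abs_mult)
    have "A + 2 * t \<le> s / 4" using A(2) t4 s by linarith
    then show "x + (c * (A + 2 * t)) *\<^sub>R v \<in> ball x (s / 2)"
      by (intro tri ball84 xb) (simp only: ac)
    show "ball (x + (c * (A + 2 * t)) *\<^sub>R v) t \<subseteq> {z \<in> ball x (s / 8). A < c * ((z - x) \<bullet> v)}"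
    proof
      fix y assume y: "y \<in> ball (x + (c * (A + 2 * t)) *\<^sub>R v) t"
      define u where "u = y - (x + (c * (A + 2 * t)) *\<^sub>R v)"
      have u: "norm u < t" using y by (simp add: u_def dist_norm norm_minus_commute)
      have uv: "\<bar>c * (u \<bullet> v)\<bar> < t" using Cauchy_Schwarz_ineq2[of u v] v u c by (simp add: abs_mult)
      have yx: "y - x = (c * (A + 2 * t)) *\<^sub>R v + u" by (simp add: u_def)
      have "norm (y - x) \<le> (A + 2 * t) + t"
        unfolding yx using norm_triangle_ineq[of "(c * (A + 2 * t)) *\<^sub>R v" u] u v ac by simp
      then have "y \<in> ball x (s / 8)" using A(2) t4 s by (simp add: dist_norm norm_minus_commute)
      moreover have "c * ((y - x) \<bullet> v) = (c * c) * (A + 2 * t) + c * (u \<bullet> v)"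
        by (simp add: yx inner_add_left vv algebra_simps)
      moreover have "c * c = 1" using c by (metis abs_mult_self_eq mult_1)
      ultimately show "y \<in> {z \<in> ball x (s / 8). A < c * ((z - x) \<bullet> v)}" using uv t0 by simp
    qed
  qed
  have cvx: "connected {z \<in> ball x (s / 8). A < c * ((z - x) \<bullet> v)}" for c :: real
  proof -
    have "{z \<in> ball x (s / 8). A < c * ((z - x) \<bullet> v)} = ball x (s / 8) \<inter> {z. (c *\<^sub>R v) \<bullet> z > A + c * (x \<bullet> v)}"
      by (auto simp: inner_diff_left inner_commute algebra_simps)
    moreover have "convex (ball x (s / 8) \<inter> {z. (c *\<^sub>R v) \<bullet> z > A + c * (x \<bullet> v)})"
      by (intro convex_Int convex_ball convex_halfspace_gt)
    ultimately show ?thesis by (simp add: convex_connected)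
  qed
  have Dfree: "{z \<in> ball x (s / 8). A < c * ((z - x) \<bullet> v)} \<inter> frontier \<Omega> = {}" if c: "\<bar>c\<bar> = 1" for c :: real
  proof -
    have "\<not> A < c * ((z - x) \<bullet> v)" if "z \<in> ball x (s / 8)" "z \<in> frontier \<Omega>" for z
    proof -
      have "\<bar>c * ((z - x) \<bullet> v)\<bar> < A" using slab[OF that(2,1)] c by (simp add: abs_mult)
      then show ?thesis by linarith
    qed
    then show ?thesis by blast
  qed
  have dich: "{z \<in> ball x (s / 8). A < c * ((z - x) \<bullet> v)} \<inter> \<Omega> = {} \<or> {z \<in> ball x (s / 8). A < c * ((z - x) \<bullet> v)} \<subseteq> \<Omega>"
    if c: "\<bar>c\<bar> = 1" for c :: real
    using connected_Int_frontier[OF cvx[of c], of \<Omega>] Dfree[OF c] by blast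
  show "z \<notin> \<Omega>" if z: "z \<in> ball x (s / 8)" "A < (z - x) \<bullet> v" for z
  proof
    assume "z \<in> \<Omega>"
    then have sub: "{z \<in> ball x (s / 8). A < 1 * ((z - x) \<bullet> v)} \<subseteq> \<Omega>" using dich[of 1] z by auto
    obtain m where m: "m \<in> ball x (s / 2)" "ball m t \<subseteq> {z \<in> ball x (s / 8). A < 1 * ((z - x) \<bullet> v)}" "m = x + (1 * (A + 2 * t)) *\<^sub>R v"
      using side[of 1] by auto
    have "f m = 1" using f1[of m] m(2) sub by blast
    then show False
      using t0 A(1) s by (intro high[OF x xb m(1)]) (auto simp: m(3) inner_add_left inner_diff_left vv)
  qed
  show "z \<in> \<Omega>" if z: "z \<in> ball x (s / 8)" "(z - x) \<bullet> v < - (A)" for z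
  proof (rule ccontr)
    assume "z \<notin> \<Omega>"
    moreover have "z \<in> {z \<in> ball x (s / 8). A < (-1) * ((z - x) \<bullet> v)}" using z by simp
    ultimately have sub: "{z \<in> ball x (s / 8). A < (-1) * ((z - x) \<bullet> v)} \<inter> \<Omega> = {}" using dich[of "-1"] by auto
    obtain m where m: "m \<in> ball x (s / 2)" "ball m t \<subseteq> {z \<in> ball x (s / 8). A < (-1) * ((z - x) \<bullet> v)}" "m = x + ((-1) * (A + 2 * t)) *\<^sub>R v"
      using side[of "-1"] by auto
    have "f m = 0" using f0[of m] m(2) sub by blast
    then show False
      using t0 A(1) s by (intro low[OF x xb m(1)]) (auto simp: m(3) inner_add_left inner_diff_left vv)
  qed
qed

section \<open>Small oscillation and the preferred direction\<close>

lemma set_average_surface_measure: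
  fixes g :: "'a::euclidean_space \<Rightarrow> 'b::euclidean_space"
  assumes F: "closed F" and B: "B \<in> sets borel" and g [measurable]: "g \<in> borel_measurable borel"
  shows "set_average (hausdorff_measure (DIM('a) - 1)) (B \<inter> F) g = set_average (surface_measure F) B g"
proof -
  let ?H = "hausdorff_measure (DIM('a) - 1) :: 'a measure"
  have [measurable]: "F \<in> sets borel" "B \<in> sets borel" using F B by (auto simp: borel_closed)
  have [measurable_cong]: "sets ?H = sets borel" by simp
  have "(LINT y:B|surface_measure F. g y) = (LINT y|density ?H (\<lambda>x. ennreal (indicator F x)). indicator B y *\<^sub>R g y)"
    by (simp add: surface_measure_def set_lebesgue_integral_def ennreal_indicator)
  also have "\<dots> = (LINT y|?H. indicator F y *\<^sub>R (indicator B y *\<^sub>R g y))"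
  proof (rule integral_density)
    show "(\<lambda>y. indicat_real B y *\<^sub>R g y) \<in> borel_measurable ?H" by measurable
    show "indicat_real F \<in> borel_measurable ?H" by measurable
  qed simp
  also have "\<dots> = (LINT y:(B \<inter> F)|?H. g y)"
    unfolding set_lebesgue_integral_def by (intro Bochner_Integration.integral_cong refl) (auto simp: indicator_def)
  finally have "(LINT y:(B \<inter> F)|?H. g y) = (LINT y:B|surface_measure F. g y)" ..
  moreover have "measure ?H (B \<inter> F) = measure (surface_measure F) B"
    using emeasure_surface_measure(1)[OF F B] by (simp add: measure_def Int_commute)
  ultimately show ?thesis by (simp add: set_average_def)
qed

lemma L2_mean_osc_surface_measure:
  fixes f :: "'a::euclidean_space \<Rightarrow> 'b::euclidean_space"
  assumes F: "closed F" and B: "B \<in> sets borel" and f [measurable]: "f \<in> borel_measurable borel"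
  shows "L2_mean_osc (hausdorff_measure (DIM('a) - 1)) (B \<inter> F) f = L2_mean_osc (surface_measure F) B f"
proof -
  have "(\<lambda>y. (norm (f y - set_average (surface_measure F) B f))\<^sup>2) \<in> borel_measurable borel" by measurable
  then show ?thesis
    unfolding L2_mean_osc_def set_average_surface_measure[OF F B f]
    by (simp only: set_average_surface_measure[OF F B])
qed

context regular_domain
begin

text \<open>The L^2 oscillation controls the mean distance to the average e by \<epsilon>. As the
  normal has length 1 almost everywhere, e has length within \<epsilon> of 1, and normalising it
  costs another \<epsilon>. The upper density bound moves the estimate to the perimeter
  measure.\<close>

lemma small_oscillation_direction:
  assumes x: "x \<in> frontier \<Omega>" and s: "0 < s" "s < d" and \<epsilon>: "0 < \<epsilon>" "\<epsilon> < 1"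
    and osc: "L2_mean_osc h (ball x s) (outer_normal \<Omega>) \<le> \<epsilon>"
  shows "\<exists>v. norm v = 1 \<and>
    (\<integral>\<^sup>+y\<in>ball x s. ennreal (norm (\<nu> y - v)) \<partial>P) \<le> ennreal (2 * density_upper TYPE('a) * C * \<epsilon> * s ^ (DIM('a) - 1))"
proof -
  let ?B = "ball x s" and ?m = "measure h (ball x s)" and ?f = "outer_normal \<Omega>"
  have [measurable]: "?f \<in> borel_measurable borel" by (rule outer_normal_borel)
  have [measurable]: "?B \<in> sets borel" by simp
  have m: "0 < ?m" "?m \<le> C * s ^ (DIM('a) - 1)"
  proof -
    have "0 < inverse C * s ^ (DIM('a) - 1)" using C_pos s by simp
    then show "0 < ?m" using measure_h_ball(1)[OF x s] by linarith
    show "?m \<le> C * s ^ (DIM('a) - 1)" by (rule measure_h_ball(2)[OF x s])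
  qed
  have iB: "integrable h (indicat_real ?B)"
    by (intro integrable_real_indicator) (auto simp: emeasure_h_ball)
  have ib: "integrable h (\<lambda>y. indicat_real ?B y * g y)" if [measurable]: "g \<in> borel_measurable borel" and b: "\<And>y. \<bar>g y\<bar> \<le> K" for g K
  proof (rule Bochner_Integration.integrable_bound)
    show "integrable h (\<lambda>y. K * indicat_real ?B y)" using iB by simp
    show "(\<lambda>y. indicat_real ?B y * g y) \<in> borel_measurable h" by measurable
    have "\<bar>g y\<bar> \<le> \<bar>K\<bar>" for y using b[of y] by linarith
    then show "AE y in h. norm (indicat_real ?B y * g y) \<le> norm (K * indicat_real ?B y)"
      by (simp add: indicator_def)
  qed
  define e where "e = set_average h ?B ?f"
  define g where "g y = norm (?f y - e)" for y
  have [measurable]: "g \<in> borel_measurable borel" unfolding g_def by measurable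
  have gb: "\<bar>g y\<bar> \<le> 1 + norm e" for y
    unfolding g_def using norm_triangle_ineq4[of "?f y" e] norm_outer_normal_le[of y] by simp
  have g2b: "\<bar>(g y)\<^sup>2\<bar> \<le> (1 + norm e)\<^sup>2" for y
    using power_mono[OF gb[of y], of 2] by simp
  have avg: "(LINT y|h. indicat_real ?B y * (g y)\<^sup>2) \<le> \<epsilon>\<^sup>2 * ?m"
  proof -
    have "sqrt ((LINT y|h. indicat_real ?B y * (g y)\<^sup>2) / ?m) \<le> \<epsilon>"
      using osc unfolding L2_mean_osc_def e_def[symmetric] g_def[symmetric]
      by (simp add: set_average_def set_lebesgue_integral_def divide_inverse mult.commute)
    then have "(LINT y|h. indicat_real ?B y * (g y)\<^sup>2) / ?m \<le> \<epsilon>\<^sup>2" by (rule real_sqrt_le_iff[THEN iffD1, OF order_trans]) (use \<epsilon> in simp)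
    then show ?thesis using m(1) by (simp add: pos_divide_le_eq)
  qed
  have I1: "(LINT y|h. indicat_real ?B y * g y) \<le> \<epsilon> * ?m"
  proof -
    \<comment> \<open>The pointwise inequality g \<le> \<epsilon> / 2 + g^2 / (2 \<epsilon>) takes
      the place of Cauchy--Schwarz.\<close>
    have "(LINT y|h. indicat_real ?B y * g y) \<le> (LINT y|h. \<epsilon> / 2 * indicat_real ?B y + 1 / (2 * \<epsilon>) * (indicat_real ?B y * (g y)\<^sup>2))"
    proof (rule integral_mono)
      show "integrable h (\<lambda>y. indicat_real ?B y * g y)" by (rule ib[OF _ gb]) measurable
      show "integrable h (\<lambda>y. \<epsilon> / 2 * indicat_real ?B y + 1 / (2 * \<epsilon>) * (indicat_real ?B y * (g y)\<^sup>2))"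
        by (intro Bochner_Integration.integrable_add integrable_mult_right iB ib[OF _ g2b]) measurable
      fix y
      have "0 \<le> (g y - \<epsilon>)\<^sup>2" by simp
      then have "2 * \<epsilon> * g y \<le> \<epsilon>\<^sup>2 + (g y)\<^sup>2" by (simp add: power2_eq_square algebra_simps)
      then have "g y \<le> \<epsilon> / 2 + 1 / (2 * \<epsilon>) * (g y)\<^sup>2" using \<epsilon>(1) by (simp add: field_simps power2_eq_square)
      then show "indicat_real ?B y * g y \<le> \<epsilon> / 2 * indicat_real ?B y + 1 / (2 * \<epsilon>) * (indicat_real ?B y * (g y)\<^sup>2)"
        by (auto simp: indicator_def)
    qed
    also have "\<dots> = \<epsilon> / 2 * ?m + 1 / (2 * \<epsilon>) * (LINT y|h. indicat_real ?B y * (g y)\<^sup>2)"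
    proof -
      have i2: "integrable h (\<lambda>y. indicat_real ?B y * (g y)\<^sup>2)" by (rule ib[OF _ g2b]) measurable
      show ?thesis using iB i2 by (subst Bochner_Integration.integral_add) auto
    qed
    also have "\<dots> \<le> \<epsilon> / 2 * ?m + 1 / (2 * \<epsilon>) * (\<epsilon>\<^sup>2 * ?m)"
      using avg \<epsilon> by (intro add_left_mono mult_left_mono) auto
    also have "\<dots> = \<epsilon> * ?m" using \<epsilon>(1) by (simp add: power2_eq_square)
    finally show ?thesis .
  qed
  have ae: "AE y in h. ?f y = \<nu> y \<and> norm (?f y) = 1"
    using AE_domain_lebesgue_point
  proof eventually_elim
    case (elim y)
    then show ?case using outer_normal_lebesgue_point[OF elim] lebesgue_point_norm[OF elim \<theta>_positive[OF elim]] by simp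
  qed
  have ne: "\<bar>norm e - 1\<bar> \<le> \<epsilon>"
  proof -
    have "\<bar>norm e - 1\<bar> * ?m = (LINT y|h. \<bar>norm e - 1\<bar> * indicat_real ?B y)" by simp
    also have "\<dots> \<le> (LINT y|h. indicat_real ?B y * g y)"
    proof (rule integral_mono_AE)
      show "integrable h (\<lambda>y. \<bar>norm e - 1\<bar> * indicat_real ?B y)" using iB by simp
      show "integrable h (\<lambda>y. indicat_real ?B y * g y)" by (rule ib[OF _ gb]) measurable
      show "AE y in h. \<bar>norm e - 1\<bar> * indicat_real ?B y \<le> indicat_real ?B y * g y"
        using ae
      proof eventually_elim
        case (elim y)
        have "\<bar>norm e - norm (?f y)\<bar> \<le> g y" unfolding g_def using norm_triangle_ineq3[of e "?f y"] by (simp add: norm_minus_commute)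
        then show ?case using elim by (auto simp: indicator_def)
      qed
    qed
    also have "\<dots> \<le> \<epsilon> * ?m" by (rule I1)
    finally show ?thesis using m(1) by (rule mult_right_le_imp_le)
  qed
  then have e0: "0 < norm e" using \<epsilon>(2) by linarith
  define v where "v = e /\<^sub>R norm e"
  have v1: "norm v = 1" using e0 by (simp add: v_def)
  have ev: "norm (e - v) \<le> \<epsilon>"
  proof -
    have "e - v = (1 - inverse (norm e)) *\<^sub>R e" by (simp add: v_def scaleR_diff_left)
    then have "norm (e - v) = \<bar>1 - inverse (norm e)\<bar> * \<bar>norm e\<bar>" by simp
    also have "\<dots> = \<bar>(1 - inverse (norm e)) * norm e\<bar>" by (rule abs_mult[symmetric])
    also have "(1 - inverse (norm e)) * norm e = norm e - 1" using e0 by (simp add: left_diff_distrib)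
    finally show ?thesis using ne by simp
  qed
  define q where "q y = norm (?f y - v)" for y
  have [measurable]: "q \<in> borel_measurable borel" unfolding q_def by measurable
  have qb: "\<bar>q y\<bar> \<le> 2" for y
    unfolding q_def using norm_triangle_ineq4[of "?f y" v] norm_outer_normal_le[of y] v1 by simp
  have iq: "integrable h (\<lambda>y. indicat_real ?B y * q y)" by (rule ib[OF _ qb]) measurable
  have "(LINT y|h. indicat_real ?B y * q y) \<le> (LINT y|h. indicat_real ?B y * g y + \<epsilon> * indicat_real ?B y)"
  proof (rule integral_mono[OF iq])
    show "integrable h (\<lambda>y. indicat_real ?B y * g y + \<epsilon> * indicat_real ?B y)"
      by (intro Bochner_Integration.integrable_add integrable_mult_right iB ib[OF _ gb]) measurable
    fix y
    have "q y \<le> g y + \<epsilon>" unfolding q_def g_def using norm_triangle_ineq[of "?f y - e" "e - v"] ev by simp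
    then show "indicat_real ?B y * q y \<le> indicat_real ?B y * g y + \<epsilon> * indicat_real ?B y"
      by (simp add: indicator_def)
  qed
  also have "\<dots> = (LINT y|h. indicat_real ?B y * g y) + \<epsilon> * ?m"
  proof -
    have "integrable h (\<lambda>y. indicat_real ?B y * g y)" by (rule ib[OF _ gb]) measurable
    then show ?thesis using iB by (subst Bochner_Integration.integral_add) auto
  qed
  also have "\<dots> \<le> 2 * \<epsilon> * ?m" using I1 by simp
  also have "\<dots> \<le> 2 * \<epsilon> * (C * s ^ (DIM('a) - 1))" using m(2) \<epsilon>(1) by (intro mult_left_mono) auto
  finally have Q: "(LINT y|h. indicat_real ?B y * q y) \<le> 2 * \<epsilon> * (C * s ^ (DIM('a) - 1))" .
  have "(\<integral>\<^sup>+y\<in>?B. ennreal (norm (\<nu> y - v)) \<partial>P) \<le> ennreal (density_upper TYPE('a)) * (\<integral>\<^sup>+y\<in>?B. ennreal (norm (\<nu> y - v)) \<partial>h)"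
    by (rule nn_integral_P_le) measurable
  also have "(\<integral>\<^sup>+y\<in>?B. ennreal (norm (\<nu> y - v)) \<partial>h) = (\<integral>\<^sup>+y. ennreal (indicat_real ?B y * q y) \<partial>h)"
  proof (rule nn_integral_cong_AE)
    show "AE y in h. ennreal (norm (\<nu> y - v)) * indicator ?B y = ennreal (indicat_real ?B y * q y)"
      using ae by eventually_elim (auto simp: q_def indicator_def)
  qed
  also have "\<dots> = ennreal (LINT y|h. indicat_real ?B y * q y)"
    by (rule nn_integral_eq_integral[OF iq]) (simp add: q_def)
  also have "\<dots> \<le> ennreal (2 * \<epsilon> * (C * s ^ (DIM('a) - 1)))" using Q by (rule ennreal_leI)
  also have "ennreal (density_upper TYPE('a)) * ennreal (2 * \<epsilon> * (C * s ^ (DIM('a) - 1))) = ennreal (2 * density_upper TYPE('a) * C * \<epsilon> * s ^ (DIM('a) - 1))"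
    using density_upper_pos[where 'a='a] \<epsilon> C_pos s by (simp add: mult_ac flip: ennreal_mult)
  finally show ?thesis using v1 by (intro exI[of _ v] conjI) (simp_all add: mult_left_mono)
qed

section \<open>The mollified indicator\<close>

definition profile :: "real \<Rightarrow> 'a \<Rightarrow> real" where
  "profile t z = (LINT y:\<Omega>|lborel. bump t (y - z)) / bump_mass TYPE('a) t"

lemma profile_bounds: "0 < t \<Longrightarrow> 0 \<le> profile t z" "0 < t \<Longrightarrow> profile t z \<le> 1"
proof -
  assume t: "0 < t"
  have N: "0 < bump_mass TYPE('a) t" by (rule bump_mass_pos[OF t])
  have i: "integrable lborel (\<lambda>y. indicat_real \<Omega> y *\<^sub>R bump t (y - z))"
    by (intro integrable_mult_indicator bump_integrable) simp
  show "0 \<le> profile t z"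
    unfolding profile_def set_lebesgue_integral_def using N by (intro divide_nonneg_pos integral_nonneg) auto
  have "(LINT y:\<Omega>|lborel. bump t (y - z)) \<le> (LINT y|lborel. bump t (y - z))"
    unfolding set_lebesgue_integral_def by (intro integral_mono i bump_integrable) (simp add: indicator_def)
  then show "profile t z \<le> 1" using N unfolding profile_def bump_mass_translate by simp
qed

lemma profile_inside:
  assumes t: "0 < t" and b: "ball z t \<subseteq> \<Omega>"
  shows "profile t z = 1"
proof -
  have "(LINT y:\<Omega>|lborel. bump t (y - z)) = (LINT y|lborel. bump t (y - z))"
    unfolding set_lebesgue_integral_def
  proof (intro Bochner_Integration.integral_cong refl)
    fix y
    have "bump t (y - z) = 0" if "y \<notin> \<Omega>"
    proof (rule bump_eq_0)
      have "y \<notin> ball z t" using b that by blast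
      then show "t \<le> norm (y - z)" by (simp add: dist_norm norm_minus_commute)
    qed (use t in simp)
    then show "indicat_real \<Omega> y *\<^sub>R bump t (y - z) = bump t (y - z)" by (cases "y \<in> \<Omega>") auto
  qed
  then show ?thesis using bump_mass_pos[OF t, where 'a='a] by (simp add: profile_def bump_mass_translate)
qed

lemma profile_outside:
  assumes t: "0 < t" and b: "ball z t \<inter> \<Omega> = {}"
  shows "profile t z = 0"
proof -
  have "(LINT y:\<Omega>|lborel. bump t (y - z)) = (LINT y::'a|lborel. 0)"
    unfolding set_lebesgue_integral_def
  proof (intro Bochner_Integration.integral_cong refl)
    fix y
    have "bump t (y - z) = 0" if "y \<in> \<Omega>"
    proof (rule bump_eq_0)
      have "y \<notin> ball z t" using b that by blast
      then show "t \<le> norm (y - z)" by (simp add: dist_norm norm_minus_commute)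
    qed (use t in simp)
    then show "indicat_real \<Omega> y *\<^sub>R bump t (y - z) = 0" by (cases "y \<in> \<Omega>") auto
  qed
  then show ?thesis by (simp add: profile_def)
qed

lemma profile_step:
  assumes v: "norm v = 1" and D: "0 \<le> D" "(\<integral>\<^sup>+y\<in>ball x s. ennreal (norm (\<nu> y - v)) \<partial>P) \<le> ennreal D" and t: "0 < t"
    and z: "\<And>\<sigma>. 0 < \<sigma> \<Longrightarrow> \<sigma> < 1 \<Longrightarrow> ball (z + \<sigma> *\<^sub>R w) t \<subseteq> ball x s"
    and L: "\<And>\<sigma>. 0 < \<sigma> \<Longrightarrow> \<sigma> < 1 \<Longrightarrow> L \<le> (LINT y|P. bump t (y - (z + \<sigma> *\<^sub>R w)) * (w \<bullet> v))"
  shows "profile t (z + w) \<le> profile t z - (L - norm w * t ^ 4 * D) / bump_mass TYPE('a) t"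
proof -
  have N: "0 < bump_mass TYPE('a) t" by (rule bump_mass_pos[OF t])
  have f: "C1c (\<lambda>y. bump t (y - z))" by (rule bump_C1c(1))
  obtain \<sigma> where \<sigma>: "0 < \<sigma>" "\<sigma> < 1" and eq: "(LINT y:\<Omega>|lborel. bump t (y - w - z)) - (LINT y:\<Omega>|lborel. bump t (y - z))
      = - (LINT y|P. bump t (y - \<sigma> *\<^sub>R w - z) * (w \<bullet> \<nu> y))"
    by (rule shift_MVT[OF f, of w])
  let ?c = "z + \<sigma> *\<^sub>R w"
  have sh: "y - \<sigma> *\<^sub>R w - z = y - ?c" "y - w - z = y - (z + w)" for y by (simp_all add: algebra_simps)
  note eq = eq[unfolded sh]
  have fc: "C1c (\<lambda>y. bump t (y - ?c))" by (rule bump_C1c(1))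
  have iv: "integrable P (\<lambda>y. bump t (y - ?c) * (w \<bullet> v))" using integrable_P_C1c[OF fc] by simp
  have in1: "integrable P (\<lambda>y. bump t (y - ?c) * (w \<bullet> \<nu> y))" by (rule integrable_P_C1c_\<nu>[OF fc])
  have [measurable]: "ball x s \<in> sets borel" by simp
  have "ennreal (norm ((LINT y|P. bump t (y - ?c) * (w \<bullet> v)) - (LINT y|P. bump t (y - ?c) * (w \<bullet> \<nu> y))))
      = ennreal (norm (LINT y|P. bump t (y - ?c) * (w \<bullet> v) - bump t (y - ?c) * (w \<bullet> \<nu> y)))"
    by (simp only: Bochner_Integration.integral_diff[OF iv in1])
  also have "\<dots> \<le> (\<integral>\<^sup>+y. ennreal (norm (bump t (y - ?c) * (w \<bullet> v) - bump t (y - ?c) * (w \<bullet> \<nu> y))) \<partial>P)"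
    by (rule integral_norm_bound_ennreal) (rule Bochner_Integration.integrable_diff[OF iv in1])
  also have "\<dots> \<le> (\<integral>\<^sup>+y. ennreal (norm w * t ^ 4) * (ennreal (norm (\<nu> y - v)) * indicator (ball x s) y) \<partial>P)"
  proof (rule nn_integral_mono)
    fix y
    show "ennreal (norm (bump t (y - ?c) * (w \<bullet> v) - bump t (y - ?c) * (w \<bullet> \<nu> y))) \<le> ennreal (norm w * t ^ 4) * (ennreal (norm (\<nu> y - v)) * indicator (ball x s) y)"
    proof (cases "y \<in> ball ?c t")
      case True
      then have yB: "y \<in> ball x s" using z[OF \<sigma>] by blast
      have "norm (bump t (y - ?c) * (w \<bullet> v) - bump t (y - ?c) * (w \<bullet> \<nu> y)) = bump t (y - ?c) * \<bar>w \<bullet> (v - \<nu> y)\<bar>"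
        by (simp add: inner_diff_right abs_mult flip: right_diff_distrib)
      also have "\<dots> \<le> t ^ 4 * (norm w * norm (\<nu> y - v))"
        using Cauchy_Schwarz_ineq2[of w "v - \<nu> y"] bump_le[of t "y - ?c"]
        by (intro mult_mono) (auto simp: norm_minus_commute)
      finally have "norm (bump t (y - ?c) * (w \<bullet> v) - bump t (y - ?c) * (w \<bullet> \<nu> y)) \<le> (norm w * t ^ 4) * norm (\<nu> y - v)"
        by (simp add: mult_ac)
      from ennreal_leI[OF this] show ?thesis using yB by (simp add: ennreal_mult')
    next
      case False
      then have "bump t (y - ?c) = 0" using t by (intro bump_eq_0) (auto simp: dist_norm norm_minus_commute)
      then show ?thesis by simp
    qed
  qed
  also have "\<dots> = ennreal (norm w * t ^ 4) * (\<integral>\<^sup>+y\<in>ball x s. ennreal (norm (\<nu> y - v)) \<partial>P)"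
    by (rule nn_integral_cmult) measurable
  also have "\<dots> \<le> ennreal (norm w * t ^ 4) * ennreal D" using D(2) by (intro mult_left_mono) auto
  also have "\<dots> = ennreal (norm w * t ^ 4 * D)" using D(1) by (simp add: ennreal_mult)
  finally have "norm ((LINT y|P. bump t (y - ?c) * (w \<bullet> v)) - (LINT y|P. bump t (y - ?c) * (w \<bullet> \<nu> y))) \<le> norm w * t ^ 4 * D"
    using D(1) by (subst (asm) ennreal_le_iff) auto
  then have "L - norm w * t ^ 4 * D \<le> (LINT y|P. bump t (y - ?c) * (w \<bullet> \<nu> y))"
    using L[OF \<sigma>] unfolding real_norm_def by linarith
  then have "(LINT y:\<Omega>|lborel. bump t (y - (z + w))) \<le> (LINT y:\<Omega>|lborel. bump t (y - z)) - (L - norm w * t ^ 4 * D)"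
    using eq by linarith
  then have "(LINT y:\<Omega>|lborel. bump t (y - (z + w))) / bump_mass TYPE('a) t \<le> ((LINT y:\<Omega>|lborel. bump t (y - z)) - (L - norm w * t ^ 4 * D)) / bump_mass TYPE('a) t"
    using N by (intro divide_right_mono) auto
  then show ?thesis by (simp add: profile_def diff_divide_distrib)
qed

end

text \<open>The product of the shift length t / 2, the bump height t^4 / 2 and the least perimeter
  of a ball of radius t / 4, divided by the upper bound of the bump mass. All powers of t
  cancel.\<close>

definition drop_const :: "'a::euclidean_space itself \<Rightarrow> real \<Rightarrow> real" where
  "drop_const _ C = density_lower TYPE('a) C * inverse C / (4 ^ DIM('a) * unit_ball_vol (real DIM('a)))"

text \<open>The error of \<open>profile_step\<close> per unit of \<epsilon> for shifts of length s,
  with the bump mass replaced by its lower bound and s / t = 4 J / \<delta>.\<close>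

definition osc_const :: "'a::euclidean_space itself \<Rightarrow> real \<Rightarrow> real \<Rightarrow> nat \<Rightarrow> real" where
  "osc_const _ C \<delta> J = 2 * 2 ^ DIM('a) * (2 * density_upper TYPE('a) * C) * (4 * real J / \<delta>) ^ DIM('a) / unit_ball_vol (real DIM('a))"

lemma drop_const_pos: "0 < C \<Longrightarrow> 0 < drop_const TYPE('a::euclidean_space) C"
  using density_lower_pos[of C, where 'a='a] by (simp add: drop_const_def)

lemma osc_const_pos: "0 < C \<Longrightarrow> 0 < \<delta> \<Longrightarrow> 0 < J \<Longrightarrow> 0 < osc_const TYPE('a::euclidean_space) C \<delta> J"
  using density_upper_pos[where 'a='a] by (simp add: osc_const_def)

context regular_domain
begin

lemma slab:
  assumes x: "x \<in> frontier \<Omega>" and s: "0 < s" "s < d" and \<epsilon>: "0 < \<epsilon>" "\<epsilon> < 1"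
    and osc: "L2_mean_osc h (ball x s) (outer_normal \<Omega>) \<le> \<epsilon>"
    and \<delta>: "0 < \<delta>" "\<delta> \<le> 1 / 20" and J: "2 < drop_const TYPE('a) C * real J"
    and small: "8 * (osc_const TYPE('a) C \<delta> J * \<epsilon>) \<le> drop_const TYPE('a) C"
  obtains v where "norm v = 1"
    "\<And>y. y \<in> frontier \<Omega> \<Longrightarrow> y \<in> ball x (s / 8) \<Longrightarrow> \<bar>(y - x) \<bullet> v\<bar> < \<delta> * s"
    "\<And>z. z \<in> ball x (s / 8) \<Longrightarrow> \<delta> * s < (z - x) \<bullet> v \<Longrightarrow> z \<notin> \<Omega>"
    "\<And>z. z \<in> ball x (s / 8) \<Longrightarrow> (z - x) \<bullet> v < - (\<delta> * s) \<Longrightarrow> z \<in> \<Omega>"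
proof -
  let ?k = "DIM('a) - 1" and ?n = "DIM('a)" and ?w = "unit_ball_vol (real DIM('a))"
  define D where "D = 2 * density_upper TYPE('a) * C * \<epsilon> * s ^ ?k"
  obtain v where v: "norm v = 1" and Dv: "(\<integral>\<^sup>+y\<in>ball x s. ennreal (norm (\<nu> y - v)) \<partial>P) \<le> ennreal D"
    using small_oscillation_direction[OF x s \<epsilon> osc] unfolding D_def by blast
  have vv: "v \<bullet> v = 1" using v by (simp add: norm_eq_1)
  have w: "0 < ?w" by simp
  then have w0: "?w \<noteq> 0" by (metis less_irrefl)
  have D0: "0 \<le> D" using density_upper_pos[where 'a='a] C_pos \<epsilon> s by (simp add: D_def)
  have b: "0 < drop_const TYPE('a) C" by (rule drop_const_pos[OF C_pos])
  have J0: "0 < J" using J by (cases J) auto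
  define \<kappa> where "\<kappa> = osc_const TYPE('a) C \<delta> J * \<epsilon>"
  have \<kappa>0: "0 \<le> \<kappa>" using osc_const_pos[OF C_pos \<delta>(1) J0, where 'a='a] \<epsilon> by (simp add: \<kappa>_def)
  define t where "t = \<delta> * s / (4 * real J)"
  have t: "0 < t" using \<delta> s J0 by (simp add: t_def)
  have A: "0 < \<delta> * s" "\<delta> * s \<le> s / 20" using \<delta> s mult_right_mono[of \<delta> "1/20" s] by simp_all
  have ts: "t \<le> s / 80"
  proof -
    have "t \<le> \<delta> * s / 4" unfolding t_def using A J0 by (intro divide_left_mono) auto
    then show ?thesis using A by simp
  qed
  let ?N = "bump_mass TYPE('a) t"
  have N: "0 < ?N" by (rule bump_mass_pos[OF t])
  have n_eq: "q ^ ?n = q * q ^ ?k" for q :: real using dim by (simp flip: power_Suc)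
  have \<kappa>: "norm u * t ^ 4 * D / ?N \<le> \<kappa>" if u: "norm u \<le> s" for u :: 'a
  proof -
    have st: "s = (4 * real J / \<delta>) * t" using \<delta> J0 by (simp add: t_def)
    have "\<kappa> * (t ^ 4 / 2 * (?w * (t / 2) ^ ?n)) \<le> \<kappa> * ?N"
      using bump_mass_bounds(1)[OF t, where 'a='a] \<kappa>0 by (rule mult_left_mono)
    also have "\<kappa> * (t ^ 4 / 2 * (?w * (t / 2) ^ ?n)) = t ^ 4 * (2 * density_upper TYPE('a) * C * \<epsilon>) * ((4 * real J / \<delta>) * t) ^ ?n"
      using w0 by (simp add: \<kappa>_def osc_const_def power_divide power_mult_distrib)
    also have "\<dots> = s * t ^ 4 * D" unfolding st[symmetric] by (simp add: D_def n_eq)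
    finally have "s * t ^ 4 * D \<le> \<kappa> * ?N" .
    moreover have "norm u * t ^ 4 * D \<le> s * t ^ 4 * D" using u t D0 by (intro mult_right_mono) auto
    ultimately show ?thesis using N by (simp add: pos_divide_le_eq)
  qed
  have sub: "ball c t \<subseteq> ball x s" if "dist x c < s / 2" for c
  proof
    fix y assume "y \<in> ball c t"
    then show "y \<in> ball x s" using that ts s dist_triangle[of x y c] by simp
  qed
  have mono: "profile t z' \<le> profile t z + \<kappa>" if z: "z \<in> ball x (s / 2)" "z' \<in> ball x (s / 2)" "0 \<le> (z' - z) \<bullet> v" for z z'
  proof -
    have "profile t (z + (z' - z)) \<le> profile t z - (0 - norm (z' - z) * t ^ 4 * D) / ?N"
    proof (rule profile_step[OF v D0 Dv t])
      fix \<sigma> :: real assume \<sigma>: "0 < \<sigma>" "\<sigma> < 1"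
      have "(1 - \<sigma>) *\<^sub>R z + \<sigma> *\<^sub>R z' \<in> ball x (s / 2)"
        using z(1,2) \<sigma> by (intro convexD[OF convex_ball]) auto
      moreover have "(1 - \<sigma>) *\<^sub>R z + \<sigma> *\<^sub>R z' = z + \<sigma> *\<^sub>R (z' - z)" by (simp add: algebra_simps)
      ultimately show "ball (z + \<sigma> *\<^sub>R (z' - z)) t \<subseteq> ball x s" by (intro sub) simp
      show "0 \<le> (LINT y|P. bump t (y - (z + \<sigma> *\<^sub>R (z' - z))) * ((z' - z) \<bullet> v))"
        using z(3) by (intro Bochner_Integration.integral_nonneg) auto
    qed
    moreover have "norm (z' - z) \<le> s"
      using z(1,2) dist_triangle3[of z' z x] by (simp add: dist_norm)
    then have "norm (z' - z) * t ^ 4 * D / ?N \<le> \<kappa>" by (rule \<kappa>)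
    ultimately show ?thesis by simp
  qed
  have drop: "profile t (y + (t / 4) *\<^sub>R v) \<le> profile t (y - (t / 4) *\<^sub>R v) - drop_const TYPE('a) C + \<kappa>"
    if y: "y \<in> frontier \<Omega>" "y \<in> ball x (s / 4)" for y
  proof -
    let ?z = "y - (t / 4) *\<^sub>R v" and ?u = "(t / 2) *\<^sub>R v"
    \<comment> \<open>All centres met during the shift stay within t / 4 of y, so each of these
      bumps is at least t^4 / 2 on the ball of radius t / 4 about y, where the perimeter is bounded
      below.\<close>
    have near: "dist y (?z + \<sigma> *\<^sub>R ?u) \<le> t / 4" if "0 < \<sigma>" "\<sigma> < 1" for \<sigma>
    proof -
      have "y - (?z + \<sigma> *\<^sub>R ?u) = (t / 4 - \<sigma> * (t / 2)) *\<^sub>R v" by (simp add: scaleR_diff_left)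
      then have "dist y (?z + \<sigma> *\<^sub>R ?u) = \<bar>t / 4 - \<sigma> * (t / 2)\<bar>" by (simp add: dist_norm v)
      also have "\<dots> \<le> t / 4"
      proof -
        have "0 \<le> \<sigma> * (t / 2)" "\<sigma> * (t / 2) \<le> t / 2" using that t mult_right_mono[of \<sigma> 1 "t / 2"] by auto
        then show ?thesis by linarith
      qed
      finally show ?thesis .
    qed
    have "profile t (?z + ?u) \<le> profile t ?z - (drop_const TYPE('a) C * ?N - norm ?u * t ^ 4 * D) / ?N"
    proof (rule profile_step[OF v D0 Dv t])
      fix \<sigma> :: real assume \<sigma>: "0 < \<sigma>" "\<sigma> < 1"
      let ?c = "?z + \<sigma> *\<^sub>R ?u"
      show "ball ?c t \<subseteq> ball x s"
        using near[OF \<sigma>] y(2) ts s dist_triangle[of x ?c y] by (intro sub) simp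
      have "drop_const TYPE('a) C * ?N \<le> drop_const TYPE('a) C * (t ^ 4 * (?w * t ^ ?n))"
        using bump_mass_bounds(2)[OF t, where 'a='a] b by (intro mult_left_mono) auto
      also have "\<dots> = t / 2 * (t ^ 4 / 2 * (density_lower TYPE('a) C * inverse C * (t / 4) ^ ?k))"
        using w0 by (simp add: drop_const_def n_eq power_divide)
      also have "\<dots> \<le> t / 2 * (t ^ 4 / 2 * measure P (ball y (t / 4)))"
        using P_ball_lower[OF y(1), of "t / 4"] t ts s by (intro mult_left_mono) auto
      also have "t ^ 4 / 2 * measure P (ball y (t / 4)) = (LINT q|P. t ^ 4 / 2 * indicator (ball y (t / 4)) q)" by simp
      also have "t / 2 * \<dots> \<le> t / 2 * (LINT q|P. bump t (q - ?c))"
      proof (intro mult_left_mono integral_mono)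
        show "integrable P (\<lambda>q. t ^ 4 / 2 * indicat_real (ball y (t / 4)) q)"
          using finite_P_bounded[of "ball y (t / 4)"] by (intro integrable_mult_right integrable_real_indicator) auto
        show "integrable P (\<lambda>q. bump t (q - ?c))" by (rule integrable_P_C1c[OF bump_C1c(1)])
        fix q
        show "t ^ 4 / 2 * indicat_real (ball y (t / 4)) q \<le> bump t (q - ?c)"
        proof (cases "q \<in> ball y (t / 4)")
          case True
          then have "dist ?c q \<le> t / 2" using near[OF \<sigma>] dist_triangle3[of ?c q y] by simp
          then show ?thesis using True bump_ge[of "q - ?c" t] by (simp add: dist_norm norm_minus_commute)
        qed simp
      qed (use t in simp)
      also have "t / 2 * (LINT q|P. bump t (q - ?c)) = (LINT q|P. bump t (q - ?c) * (?u \<bullet> v))"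
        by (simp add: vv mult.commute)
      finally show "drop_const TYPE('a) C * ?N \<le> (LINT q|P. bump t (q - ?c) * (?u \<bullet> v))" .
    qed
    also have "?z + ?u = y + (t / 4) *\<^sub>R v" by (simp add: algebra_simps flip: scaleR_add_left)
    also have "profile t ?z - (drop_const TYPE('a) C * ?N - norm ?u * t ^ 4 * D) / ?N
        = profile t ?z - drop_const TYPE('a) C + norm ?u * t ^ 4 * D / ?N"
      using N by (simp add: diff_divide_distrib)
    also have "norm ?u * t ^ 4 * D / ?N \<le> \<kappa>" using t ts s v by (intro \<kappa>) simp
    finally show ?thesis by simp
  qed
  note slab = slab_of_profile[of x \<Omega> v s "drop_const TYPE('a) C" \<kappa> "\<delta> * s" J t "profile t",
      OF x v s(1) b \<kappa>0 small[folded \<kappa>_def] A J t_def mono drop profile_bounds(1)[OF t] profile_bounds(2)[OF t]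
      profile_inside[OF t] profile_outside[OF t]]
  show thesis
    by (rule that[OF v]) (rule slab; assumption)+
qed

end

text \<open>The plane orthogonal to v serves both halves of the distance. Boundary points project to
  it at distance below a \<rho>; conversely, a segment in direction v runs from inside the domain to
  outside and must meet the boundary.\<close>

lemma flatness_le:
  fixes \<Omega> :: "'a::euclidean_space set"
  assumes x: "x \<in> frontier \<Omega>" and \<rho>: "0 < \<rho>" and v: "norm v = 1" and a: "0 \<le> a" "a \<le> 1 / 6"
    and slab: "\<And>y. y \<in> frontier \<Omega> \<Longrightarrow> y \<in> ball x (2 * \<rho>) \<Longrightarrow> \<bar>(y - x) \<bullet> v\<bar> < a * \<rho>"
    and above: "\<And>z. z \<in> ball x (2 * \<rho>) \<Longrightarrow> a * \<rho> < (z - x) \<bullet> v \<Longrightarrow> z \<notin> \<Omega>"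
    and below: "\<And>z. z \<in> ball x (2 * \<rho>) \<Longrightarrow> (z - x) \<bullet> v < - (a * \<rho>) \<Longrightarrow> z \<in> \<Omega>"
  shows "flatness (frontier \<Omega>) x \<rho> \<le> 6 * a"
proof -
  have vv: "v \<bullet> v = 1" using v by (simp add: norm_eq_1)
  define L where "L = {z. v \<bullet> z = v \<bullet> x}"
  have Liff: "z \<in> L \<longleftrightarrow> (z - x) \<bullet> v = 0" for z
    by (auto simp: L_def inner_diff_left inner_commute[of v])
  have L: "L \<in> hyperplanes_through x"
  proof -
    have "v \<noteq> 0" using v by auto
    then show ?thesis
      using aff_dim_hyperplane[of v "v \<bullet> x"] by (simp add: L_def hyperplanes_through_def affine_hyperplane)
  qed
  let ?F = "frontier \<Omega> \<inter> cball x \<rho>"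
  have ap: "0 < a" using slab[OF x] \<rho> by (simp add: zero_less_mult_iff)
  \<comment> \<open>The infimum over planes is a real one, so it lies below each term only once the
    terms are known to be bounded below.\<close>
  have nonneg: "0 \<le> 1 / \<rho> * hausdorff_distance_sum ?F (M \<inter> cball x \<rho>)" if M: "M \<in> hyperplanes_through x" for M
  proof -
    have bdd: "bdd_above ((\<lambda>p. infdist p B) ` A)" if "A \<subseteq> cball x \<rho>" "x \<in> B" for A B
    proof (rule bdd_aboveI2)
      fix p assume "p \<in> A"
      then have "dist p x \<le> \<rho>" using that(1) by (auto simp: dist_commute)
      then show "infdist p B \<le> \<rho>" using infdist_le[OF that(2), of p] by linarith
    qed
    have xM: "x \<in> M \<inter> cball x \<rho>" "x \<in> ?F" using M x \<rho> by (auto simp: hyperplanes_through_def)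
    have "0 \<le> (SUP p\<in>?F. infdist p (M \<inter> cball x \<rho>))"
      by (rule order_trans[OF infdist_nonneg cSUP_upper[OF xM(2) bdd]]) (use xM in auto)
    moreover have "0 \<le> (SUP p\<in>M \<inter> cball x \<rho>. infdist p ?F)"
      by (rule order_trans[OF infdist_nonneg cSUP_upper[OF xM(1) bdd]]) (use xM in auto)
    ultimately show ?thesis using \<rho> by (simp add: hausdorff_distance_sum_def)
  qed
  have "flatness (frontier \<Omega>) x \<rho> \<le> 1 / \<rho> * hausdorff_distance_sum ?F (L \<inter> cball x \<rho>)"
    unfolding flatness_def by (rule cINF_lower[OF bdd_belowI2 L]) (rule nonneg)
  also have "hausdorff_distance_sum ?F (L \<inter> cball x \<rho>) \<le> a * \<rho> + 5 * a * \<rho>"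
    unfolding hausdorff_distance_sum_def
  proof (rule add_mono)
    show "(SUP p\<in>?F. infdist p (L \<inter> cball x \<rho>)) \<le> a * \<rho>"
    proof (rule cSUP_least)
      show "?F \<noteq> {}" using x \<rho> by auto
      fix y assume y: "y \<in> ?F"
      define p where "p = y - ((y - x) \<bullet> v) *\<^sub>R v"
      have pv: "(p - x) \<bullet> v = 0" by (simp add: p_def inner_diff_left vv)
      have eq: "y - x = (p - x) + ((y - x) \<bullet> v) *\<^sub>R v" by (simp add: p_def)
      have "orthogonal (p - x) (((y - x) \<bullet> v) *\<^sub>R v)" using pv by (simp add: orthogonal_def)
      from norm_add_Pythagorean[OF this]
      have "(norm (y - x))\<^sup>2 = (norm (p - x))\<^sup>2 + (norm (((y - x) \<bullet> v) *\<^sub>R v))\<^sup>2"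
        unfolding eq[symmetric] .
      then have "(norm (p - x))\<^sup>2 \<le> (norm (y - x))\<^sup>2" by simp
      then have "norm (p - x) \<le> norm (y - x)" by (rule power2_le_imp_le) simp
      moreover have "norm (y - x) \<le> \<rho>" using y by (simp add: dist_norm norm_minus_commute)
      ultimately have "p \<in> L \<inter> cball x \<rho>"
        using pv by (simp add: Liff dist_norm norm_minus_commute)
      then have "infdist y (L \<inter> cball x \<rho>) \<le> dist y p" by (rule infdist_le)
      also have "\<dots> = \<bar>(y - x) \<bullet> v\<bar>" by (simp add: p_def dist_norm v)
      also have "\<dots> \<le> a * \<rho>" using y \<rho> by (intro less_imp_le slab) auto
      finally show "infdist y (L \<inter> cball x \<rho>) \<le> a * \<rho>" .
    qed
    show "(SUP p\<in>L \<inter> cball x \<rho>. infdist p ?F) \<le> 5 * a * \<rho>"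
    proof (rule cSUP_least)
      have "x \<in> L \<inter> cball x \<rho>" using \<rho> by (simp add: Liff)
      then show "L \<inter> cball x \<rho> \<noteq> {}" by blast
      fix z assume z: "z \<in> L \<inter> cball x \<rho>"
      have zv: "(z - x) \<bullet> v = 0" using z by (simp add: Liff)
      have zn: "norm (z - x) \<le> \<rho>" using z by (simp add: dist_norm norm_minus_commute)
      \<comment> \<open>Pulling the point towards x by the factor 1 - 3 a keeps the segment of half
        length 2 a \<rho> in the ball of radius \<rho>. The pull costs 3 a \<rho> and the segment 2
        a \<rho>.\<close>
      define y where "y = x + (1 - 3 * a) *\<^sub>R (z - x)"
      have yv: "(y - x) \<bullet> v = 0" by (simp add: y_def zv)
      have a3: "0 \<le> 1 - 3 * a" using a by simp
      have yn: "norm (y - x) \<le> (1 - 3 * a) * \<rho>" using zn a3 by (simp add: y_def mult_left_mono)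
      have yz: "dist z y \<le> 3 * a * \<rho>"
      proof -
        have "z - y = (3 * a) *\<^sub>R (z - x)" by (simp add: y_def algebra_simps)
        then show ?thesis using zn a by (simp add: dist_norm mult_left_mono)
      qed
      have pt: "dist x (y + c *\<^sub>R v) \<le> \<rho> - a * \<rho>" if "\<bar>c\<bar> \<le> 2 * a * \<rho>" for c
      proof -
        have "norm ((y - x) + c *\<^sub>R v) \<le> (1 - 3 * a) * \<rho> + 2 * a * \<rho>"
          using norm_triangle_ineq[of "y - x" "c *\<^sub>R v"] yn that v by simp
        moreover have "dist x (y + c *\<^sub>R v) = norm ((y - x) + c *\<^sub>R v)"
        proof -
          have "(y - x) + c *\<^sub>R v = y + c *\<^sub>R v - x" by simp
          then show ?thesis by (simp only: dist_norm norm_minus_commute)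
        qed
        ultimately show ?thesis by (simp add: algebra_simps)
      qed
      have a\<rho>: "0 < a * \<rho>" "0 < \<rho> * a" "0 \<le> \<rho> * a" using ap \<rho> by simp_all
      have inb: "y + c *\<^sub>R v \<in> ball x (2 * \<rho>)" if "\<bar>c\<bar> \<le> 2 * a * \<rho>" for c
        using pt[OF that] a\<rho> \<rho> by simp
      have h: "(y + c *\<^sub>R v - x) \<bullet> v = c" for c
        using yv by (simp add: inner_add_left inner_diff_left vv)
      let ?I = "(\<lambda>c. y + c *\<^sub>R v) ` {- (2 * a * \<rho>)..2 * a * \<rho>}"
      have "y + (2 * a * \<rho>) *\<^sub>R v \<notin> \<Omega>"
        by (rule above[OF inb]) (use a\<rho> in \<open>simp_all add: h\<close>)
      moreover have "y + (2 * a * \<rho>) *\<^sub>R v \<in> ?I"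
        by (rule imageI) (use a\<rho> in simp)
      ultimately have "?I - \<Omega> \<noteq> {}" by blast
      moreover have "y + (- (2 * a * \<rho>)) *\<^sub>R v \<in> \<Omega>"
        by (rule below[OF inb]) (use a\<rho> h[of "- (2 * a * \<rho>)"] in simp_all)
      moreover have "y + (- (2 * a * \<rho>)) *\<^sub>R v \<in> ?I"
        by (rule imageI) (use a\<rho> in simp)
      ultimately have "?I - \<Omega> \<noteq> {}" "?I \<inter> \<Omega> \<noteq> {}" by blast+
      moreover have "connected ?I"
        by (intro connected_continuous_image continuous_intros) auto
      ultimately have "?I \<inter> frontier \<Omega> \<noteq> {}" by (intro connected_Int_frontier)
      then obtain c where c0: "c \<in> {- (2 * a * \<rho>)..2 * a * \<rho>}" "y + c *\<^sub>R v \<in> frontier \<Omega>" by blast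
      have c: "\<bar>c\<bar> \<le> 2 * a * \<rho>" "y + c *\<^sub>R v \<in> frontier \<Omega>"
        using c0 unfolding atLeastAtMost_iff by linarith+
      have "y + c *\<^sub>R v \<in> ?F" using c(2) pt[OF c(1)] a\<rho> by simp
      then have "infdist z ?F \<le> dist z (y + c *\<^sub>R v)" by (rule infdist_le)
      also have "\<dots> \<le> dist z y + dist y (y + c *\<^sub>R v)" by (rule dist_triangle)
      also have "\<dots> \<le> 3 * a * \<rho> + 2 * a * \<rho>" using yz c(1) by (intro add_mono) (simp_all add: dist_norm v)
      finally show "infdist z ?F \<le> 5 * a * \<rho>" by (simp add: mult_ac)
    qed
  qed
  finally have "flatness (frontier \<Omega>) x \<rho> \<le> 1 / \<rho> * (a * \<rho> + 5 * a * \<rho>)" using \<rho> by (simp add: divide_right_mono)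
  also have "\<dots> = 6 * a" using \<rho> by (simp add: field_simps)
  finally show ?thesis .
qed

text \<open>A punctured space of dimension at least 2 is connected, so the domain or its complement
  is at most the point p and the density at p is 0 or 1. A nonempty boundary therefore has positive
  diameter; with diameter 0 the regularity condition would speak of no radius.\<close>

lemma frontier_singleton_not_essential:
  fixes \<Omega> :: "'a::euclidean_space set"
  assumes n: "2 \<le> DIM('a)" and op: "open \<Omega>" and F: "frontier \<Omega> \<subseteq> {p}"
  shows "p \<notin> essential_boundary \<Omega>"
proof -
  have ball: "measure lebesgue (ball p r) \<noteq> 0" if "0 < r" for r
    using that content_ball_pos[of r p] by simp
  have "{p} \<in> null_sets lebesgue" by (simp flip: negligible_iff_null_sets)
  then have ae: "AE x in lebesgue. x \<noteq> p" using AE_not_in[of "{p}" lebesgue] by simp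
  have "connected (- {p})"
    by (rule connected_punctured_universe[OF n])
  then have "- {p} \<inter> \<Omega> = {} \<or> - {p} \<subseteq> \<Omega>"
    using connected_Int_frontier[of "- {p}" \<Omega>] F by blast
  then have "has_density \<Omega> p 0 \<or> has_density \<Omega> p 1"
  proof
    assume "- {p} \<inter> \<Omega> = {}"
    have "measure lebesgue (\<Omega> \<inter> ball p r) = measure lebesgue ({} :: 'a set)" for r
      using ae op \<open>- {p} \<inter> \<Omega> = {}\<close> by (intro measure_eq_AE) (auto elim!: eventually_mono)
    then show ?thesis by (simp add: has_density_def)
  next
    assume sub: "- {p} \<subseteq> \<Omega>"
    have "measure lebesgue (\<Omega> \<inter> ball p r) = measure lebesgue (ball p r)" for r
      using ae op sub by (intro measure_eq_AE) (auto elim!: eventually_mono)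
    then have "\<forall>\<^sub>F r in at_right 0. 1 = measure lebesgue (\<Omega> \<inter> ball p r) / measure lebesgue (ball p r)"
      using ball by (auto simp: eventually_at_right_field intro!: exI[of _ 1])
    then have "has_density \<Omega> p 1"
      unfolding has_density_def by (rule Lim_transform_eventually[OF tendsto_const])
    then show ?thesis ..
  qed
  then show ?thesis by (auto simp: essential_boundary_def)
qed

lemma exists_regular_domain:
  fixes \<Omega> :: "'a::euclidean_space set"
  assumes n: "2 \<le> DIM('a)" and op: "open \<Omega>" and ess: "essential_boundary \<Omega> = frontier \<Omega>"
    and ahl: "ahlfors_regular (DIM('a) - 1) C (frontier \<Omega>)" and ne: "frontier \<Omega> \<noteq> {}"
  shows "\<exists>d. regular_domain \<Omega> C d"
proof -
  obtain p where p: "p \<in> frontier \<Omega>" using ne by blast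
  have "\<not> frontier \<Omega> \<subseteq> {p}" using frontier_singleton_not_essential[OF n op] p ess by blast
  then obtain q where q: "q \<in> frontier \<Omega>" "q \<noteq> p" by blast
  \<comment> \<open>Radii below the distance of two boundary points are below the diameter, whether
    or not the latter is finite.\<close>
  define d where "d = dist p q"
  have d: "0 < d" using q by (simp add: d_def)
  have ed: "ennreal r < ediam (frontier \<Omega>)" if "0 < r" "r < d" for r
  proof -
    have "ennreal r < ennreal d" using that by (intro ennreal_lessI) simp_all
    also have "\<dots> \<le> ediam (frontier \<Omega>)" unfolding d_def by (rule dist_le_ediam[OF p q(1)])
    finally show ?thesis .
  qed
  have "ahlfors_measure (surface_measure (frontier \<Omega>)) (frontier \<Omega>) (DIM('a) - 1) C d"
  proof
    show "emeasure (surface_measure (frontier \<Omega>)) (- frontier \<Omega>) = 0"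
      by (subst emeasure_surface_measure(2)) (auto simp: borel_closed)
    show "0 < C" using ahl by (simp add: ahlfors_regular_def)
    fix x r assume x: "x \<in> frontier \<Omega>" and r: "0 < r" "r < d"
    have "emeasure (surface_measure (frontier \<Omega>)) (ball x r) = emeasure (hausdorff_measure (DIM('a) - 1)) (frontier \<Omega> \<inter> ball x r)"
      by (rule emeasure_surface_measure(1)) auto
    then show "ennreal (inverse C * r ^ (DIM('a) - 1)) \<le> emeasure (surface_measure (frontier \<Omega>)) (ball x r)"
      "emeasure (surface_measure (frontier \<Omega>)) (ball x r) \<le> ennreal (C * r ^ (DIM('a) - 1))"
      using ahl x r(1) ed[OF r] unfolding ahlfors_regular_def by simp_all
  qed (use d in auto)
  then have "regular_domain \<Omega> C d" using n op ess by (simp add: regular_domain_def)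
  then show ?thesis ..
qed

lemma star_norm_less_imp_osc:
  fixes f :: "'a::euclidean_space \<Rightarrow> 'a"
  assumes "(SUP x\<in>A. star_norm F f x R) < ereal \<epsilon>" "x \<in> A" "0 < s" "s < R"
  shows "L2_mean_osc (hausdorff_measure (DIM('a) - 1)) (ball x s \<inter> F) f \<le> \<epsilon>"
proof -
  have "ereal (L2_mean_osc (hausdorff_measure (DIM('a) - 1)) (ball x s \<inter> F) f) \<le> star_norm F f x R"
    unfolding star_norm_def using assms(3,4) by (intro SUP_upper) simp
  also have "\<dots> \<le> (SUP x\<in>A. star_norm F f x R)" by (rule SUP_upper[OF assms(2)])
  also have "\<dots> < ereal \<epsilon>" by (rule assms(1))
  finally show ?thesis by simp
qed

text \<open>The threshold \<open>osc_const\<close> grows as \<open>\<delta>\<close> decreases; the factor \<open>200\<close> leaves room for the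
  passage from the slab at scale \<open>16 \<rho>\<close> to the two-sided flatness at scale \<open>\<rho>\<close>.\<close>

lemma chord_arc_of_small_oscillation:
  fixes \<Omega> :: "'a::euclidean_space set"
  assumes n: "2 \<le> DIM('a)" and op: "open \<Omega>" and con: "connected \<Omega>"
    and ess: "essential_boundary \<Omega> = frontier \<Omega>"
    and ahl: "ahlfors_regular (DIM('a) - 1) C (frontier \<Omega>)" and two: "\<not> bounded \<Omega> \<longrightarrow> two_sided \<Omega>"
    and \<delta>: "0 < \<delta>" "\<delta> \<le> 1" "\<delta> < \<delta>\<^sub>0" and J: "2 < drop_const TYPE('a) C * real J"
    and \<epsilon>: "0 < \<epsilon>" "\<epsilon> < 1" "\<epsilon> \<le> \<delta>"
    and small: "8 * (osc_const TYPE('a) C (\<delta> / 200) J * \<epsilon>) \<le> drop_const TYPE('a) C"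
    and osc: "\<And>K. compact K \<Longrightarrow> \<exists>R>0. (SUP x\<in>frontier \<Omega> \<inter> K. star_norm (frontier \<Omega>) (outer_normal \<Omega>) x R) < ereal \<epsilon>"
  shows "chord_arc_domain \<delta>\<^sub>0 \<delta> \<Omega>"
proof -
  have slab: "\<exists>R>0. \<forall>x\<in>frontier \<Omega> \<inter> K. \<forall>s. 0 < s \<and> s < R \<longrightarrow> (\<exists>v. norm v = 1 \<and>
      (\<forall>y\<in>frontier \<Omega> \<inter> ball x (s / 8). \<bar>(y - x) \<bullet> v\<bar> < \<delta> / 200 * s) \<and>
      (\<forall>z\<in>ball x (s / 8). (\<delta> / 200 * s < (z - x) \<bullet> v \<longrightarrow> z \<notin> \<Omega>) \<and> ((z - x) \<bullet> v < - (\<delta> / 200 * s) \<longrightarrow> z \<in> \<Omega>)))"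
    if K: "compact K" for K
  proof (cases "frontier \<Omega> = {}")
    case True
    then show ?thesis by (intro exI[of _ 1]) simp
  next
    case False
    obtain d where "regular_domain \<Omega> C d" using exists_regular_domain[OF n op ess ahl False] ..
    then interpret regular_domain \<Omega> C d .
    obtain R where R: "0 < R" "(SUP x\<in>frontier \<Omega> \<inter> K. star_norm (frontier \<Omega>) (outer_normal \<Omega>) x R) < ereal \<epsilon>"
      using osc[OF K] by blast
    show ?thesis
    proof (intro exI[of _ "min R d"] conjI ballI allI impI)
      show "0 < min R d" using R(1) d_pos by simp
      fix x s assume x: "x \<in> frontier \<Omega> \<inter> K" and "0 < s \<and> s < min R d"
      then have s: "0 < s" "s < R" "s < d" and xF: "x \<in> frontier \<Omega>" by auto
      have "L2_mean_osc (hausdorff_measure (DIM('a) - 1)) (ball x s \<inter> frontier \<Omega>) (outer_normal \<Omega>) \<le> \<epsilon>"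
        by (rule star_norm_less_imp_osc[OF R(2) x s(1,2)])
      then have o: "L2_mean_osc h (ball x s) (outer_normal \<Omega>) \<le> \<epsilon>"
        by (subst (asm) L2_mean_osc_surface_measure) (auto intro: outer_normal_borel)
      obtain v where v: "norm v = 1"
        "\<And>y. y \<in> frontier \<Omega> \<Longrightarrow> y \<in> ball x (s / 8) \<Longrightarrow> \<bar>(y - x) \<bullet> v\<bar> < \<delta> / 200 * s"
        "\<And>z. z \<in> ball x (s / 8) \<Longrightarrow> \<delta> / 200 * s < (z - x) \<bullet> v \<Longrightarrow> z \<notin> \<Omega>"
        "\<And>z. z \<in> ball x (s / 8) \<Longrightarrow> (z - x) \<bullet> v < - (\<delta> / 200 * s) \<Longrightarrow> z \<in> \<Omega>"
      proof (rule slab[OF xF s(1,3) \<epsilon>(1,2) o _ _ J small])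
        show "0 < \<delta> / 200" "\<delta> / 200 \<le> 1 / 20" using \<delta> by simp_all
      qed (rule that)
      then show "\<exists>v. norm v = 1 \<and>
        (\<forall>y\<in>frontier \<Omega> \<inter> ball x (s / 8). \<bar>(y - x) \<bullet> v\<bar> < \<delta> / 200 * s) \<and>
        (\<forall>z\<in>ball x (s / 8). (\<delta> / 200 * s < (z - x) \<bullet> v \<longrightarrow> z \<notin> \<Omega>) \<and> ((z - x) \<bullet> v < - (\<delta> / 200 * s) \<longrightarrow> z \<in> \<Omega>))"
        by (intro exI[of _ v] conjI ballI impI) auto
    qed
  qed
  have lfp: "locally_finite_perimeter \<Omega>"
  proof (cases "frontier \<Omega> = {}")
    case True
    have "emeasure (surface_measure (frontier \<Omega>)) K < \<infinity>" if "compact K" for K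
      using that by (subst emeasure_surface_measure(2)) (auto simp: True compact_imp_closed)
    then show ?thesis by (rule locally_finite_perimeterI[OF op n])
  next
    case False
    obtain d where "regular_domain \<Omega> C d" using exists_regular_domain[OF n op ess ahl False] ..
    then interpret regular_domain \<Omega> C d .
    show ?thesis by (rule locally_finite_perimeterI[OF op n finite_on_compact])
  qed
  have refl: "reifenberg_flat_set \<delta> (frontier \<Omega>)"
    unfolding reifenberg_flat_set_def
  proof (intro conjI allI impI)
    show "closed (frontier \<Omega>)" by simp
    fix K :: "'a set" assume K: "compact K"
    obtain R where R: "0 < R" and sl: "\<forall>x\<in>frontier \<Omega> \<inter> K. \<forall>s. 0 < s \<and> s < R \<longrightarrow> (\<exists>v. norm v = 1 \<and>
      (\<forall>y\<in>frontier \<Omega> \<inter> ball x (s / 8). \<bar>(y - x) \<bullet> v\<bar> < \<delta> / 200 * s) \<and>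
      (\<forall>z\<in>ball x (s / 8). (\<delta> / 200 * s < (z - x) \<bullet> v \<longrightarrow> z \<notin> \<Omega>) \<and> ((z - x) \<bullet> v < - (\<delta> / 200 * s) \<longrightarrow> z \<in> \<Omega>)))"
      using slab[OF K] by blast
    show "\<exists>R>0. (SUP r\<in>{0<..R}. SUP x\<in>K \<inter> frontier \<Omega>. ereal (flatness (frontier \<Omega>) x r)) < ereal \<delta>"
    \<comment> \<open>Radii r \<le> R / 17 satisfy 16 r < R strictly. At scale 16 r the slab holds
      on the ball of radius 2 r with relative width 2 \<delta> / 25, and 6 times this is at most
      \<delta> / 2, which keeps the supremum strictly below \<delta>.\<close>
    proof (intro exI[of _ "R / 17"] conjI)
      show "0 < R / 17" using R by simp
      have "(SUP r\<in>{0<..R / 17}. SUP x\<in>K \<inter> frontier \<Omega>. ereal (flatness (frontier \<Omega>) x r)) \<le> ereal (\<delta> / 2)"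
      proof (intro SUP_least)
        fix r x assume r: "r \<in> {0<..R / 17}" and x: "x \<in> K \<inter> frontier \<Omega>"
        then have r0: "0 < r" "0 < 16 * r" "16 * r < R" by auto
        have e1: "16 * r / 8 = 2 * r" "\<delta> / 200 * (16 * r) = 2 * \<delta> / 25 * r" by simp_all
        have xx: "x \<in> frontier \<Omega> \<inter> K" using x by blast
        have "\<exists>v. norm v = 1 \<and>
          (\<forall>y\<in>frontier \<Omega> \<inter> ball x (2 * r). \<bar>(y - x) \<bullet> v\<bar> < 2 * \<delta> / 25 * r) \<and>
          (\<forall>z\<in>ball x (2 * r). (2 * \<delta> / 25 * r < (z - x) \<bullet> v \<longrightarrow> z \<notin> \<Omega>) \<and> ((z - x) \<bullet> v < - (2 * \<delta> / 25 * r) \<longrightarrow> z \<in> \<Omega>))"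
          using mp[OF spec[OF bspec[OF sl xx]] conjI[OF r0(2,3)]] unfolding e1 .
        then obtain v where v: "norm v = 1"
          "\<forall>y\<in>frontier \<Omega> \<inter> ball x (2 * r). \<bar>(y - x) \<bullet> v\<bar> < 2 * \<delta> / 25 * r"
          "\<forall>z\<in>ball x (2 * r). (2 * \<delta> / 25 * r < (z - x) \<bullet> v \<longrightarrow> z \<notin> \<Omega>) \<and> ((z - x) \<bullet> v < - (2 * \<delta> / 25 * r) \<longrightarrow> z \<in> \<Omega>)"
          by blast
        have "flatness (frontier \<Omega>) x r \<le> 6 * (2 * \<delta> / 25)"
          by (rule flatness_le[OF _ r0(1) v(1)]) (use x \<delta> v(2,3) in auto)
        also have "\<dots> \<le> \<delta> / 2" using \<delta> by simp
        finally show "ereal (flatness (frontier \<Omega>) x r) \<le> ereal (\<delta> / 2)" by simp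
      qed
      also have "\<dots> < ereal \<delta>" using \<delta> by simp
      finally show "(SUP r\<in>{0<..R / 17}. SUP x\<in>K \<inter> frontier \<Omega>. ereal (flatness (frontier \<Omega>) x r)) < ereal \<delta>" .
    qed
  qed
  have sep: "\<exists>R>0. \<forall>y\<in>frontier \<Omega> \<inter> K. \<forall>r. 0 < r \<and> r < R \<longrightarrow>
      (\<exists>v. norm v = 1 \<and> (\<forall>x\<in>ball y r. ((x - y) \<bullet> v > \<delta> * r \<longrightarrow> x \<notin> \<Omega>) \<and> ((x - y) \<bullet> v < - \<delta> * r \<longrightarrow> x \<in> \<Omega>)))"
    if K: "compact K" for K
  proof -
    obtain R where R: "0 < R" and sl: "\<forall>x\<in>frontier \<Omega> \<inter> K. \<forall>s. 0 < s \<and> s < R \<longrightarrow> (\<exists>v. norm v = 1 \<and>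
      (\<forall>y\<in>frontier \<Omega> \<inter> ball x (s / 8). \<bar>(y - x) \<bullet> v\<bar> < \<delta> / 200 * s) \<and>
      (\<forall>z\<in>ball x (s / 8). (\<delta> / 200 * s < (z - x) \<bullet> v \<longrightarrow> z \<notin> \<Omega>) \<and> ((z - x) \<bullet> v < - (\<delta> / 200 * s) \<longrightarrow> z \<in> \<Omega>)))"
      using slab[OF K] by blast
    show ?thesis
    proof (intro exI[of _ "R / 8"] conjI ballI allI impI)
      show "0 < R / 8" using R by simp
      fix y r assume y: "y \<in> frontier \<Omega> \<inter> K" and "0 < r \<and> r < R / 8"
      then have r: "0 < r" "0 < 8 * r" "8 * r < R" by auto
      have e1: "8 * r / 8 = r" "\<delta> / 200 * (8 * r) = \<delta> / 25 * r" by simp_all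
      have "\<exists>v. norm v = 1 \<and>
          (\<forall>z\<in>frontier \<Omega> \<inter> ball y r. \<bar>(z - y) \<bullet> v\<bar> < \<delta> / 25 * r) \<and>
          (\<forall>z\<in>ball y r. (\<delta> / 25 * r < (z - y) \<bullet> v \<longrightarrow> z \<notin> \<Omega>) \<and> ((z - y) \<bullet> v < - (\<delta> / 25 * r) \<longrightarrow> z \<in> \<Omega>))"
        using mp[OF spec[OF bspec[OF sl y]] conjI[OF r(2,3)]] unfolding e1 .
      then obtain v where v: "norm v = 1"
        "\<forall>z\<in>ball y r. (\<delta> / 25 * r < (z - y) \<bullet> v \<longrightarrow> z \<notin> \<Omega>) \<and> ((z - y) \<bullet> v < - (\<delta> / 25 * r) \<longrightarrow> z \<in> \<Omega>)"
        by blast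
      have "0 < \<delta> * r" using \<delta> r by simp
      then have le: "\<delta> / 25 * r \<le> \<delta> * r" by simp
      show "\<exists>v. norm v = 1 \<and> (\<forall>x\<in>ball y r. ((x - y) \<bullet> v > \<delta> * r \<longrightarrow> x \<notin> \<Omega>) \<and> ((x - y) \<bullet> v < - \<delta> * r \<longrightarrow> x \<in> \<Omega>))"
      proof (intro exI[of _ v] conjI v(1) ballI impI)
        fix x assume x: "x \<in> ball y r"
        show "x \<notin> \<Omega>" if "(x - y) \<bullet> v > \<delta> * r" using bspec[OF v(2) x] that le by linarith
        show "x \<in> \<Omega>" if "(x - y) \<bullet> v < - \<delta> * r"
        proof -
          have "(x - y) \<bullet> v < - (\<delta> / 25 * r)" using that le unfolding mult_minus_left by linarith
          then show ?thesis using bspec[OF v(2) x] by blast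
        qed
      qed
    qed
  qed
  have "\<exists>R>0. (SUP x\<in>frontier \<Omega> \<inter> K. star_norm (frontier \<Omega>) (outer_normal \<Omega>) x R) < ereal \<delta>" if "compact K" for K
  proof -
    have "ereal \<epsilon> \<le> ereal \<delta>" using \<epsilon>(3) by simp
    then show ?thesis using osc[OF that] less_le_trans by blast
  qed
  then show ?thesis
    unfolding chord_arc_domain_def reifenberg_flat_domain_def
    using lfp refl sep op con two ahl \<delta> by blast
qed

theorem corollary3p12:
  fixes \<delta>\<^sub>0 :: real
  assumes "CARD('n::finite) \<ge> 3" and "0 < \<delta>\<^sub>0"
  shows "\<exists>\<delta>\<^sub>n>0. \<forall>C_A>0. \<forall>\<epsilon>\<^sub>2. admissible_eps2 TYPE(real ^ 'n) C_A \<epsilon>\<^sub>2 \<longrightarrow>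
    (\<forall>\<delta>. 0 < \<delta> \<and> \<delta> \<le> \<delta>\<^sub>n \<longrightarrow>
      (\<exists>\<epsilon>. 0 < \<epsilon> \<and> \<epsilon> < \<epsilon>\<^sub>2 \<and>
        (\<forall>\<Omega> :: (real ^ 'n) set.
           open \<Omega> \<and> connected \<Omega> \<and>
           essential_boundary \<Omega> = frontier \<Omega> \<and>
           ahlfors_regular (CARD('n) - 1) C_A (frontier \<Omega>) \<and>
           (\<not> bounded \<Omega> \<longrightarrow> two_sided \<Omega>) \<and>
           (\<forall>K. compact K \<longrightarrow>
              (\<exists>R>0. (SUP x\<in>frontier \<Omega> \<inter> K.
                 star_norm (frontier \<Omega>) (outer_normal \<Omega>) x R) < ereal \<epsilon>))
           \<longrightarrow> chord_arc_domain \<delta>\<^sub>0 \<delta> \<Omega>)))"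
proof -
  let ?T = "TYPE(real ^ 'n)"
  have dim: "2 \<le> DIM(real ^ 'n)" "DIM(real ^ 'n) = CARD('n)" using assms(1) by simp_all
  show ?thesis
  \<comment> \<open>Halving \<open>\<delta>\<^sub>0\<close> gives the strict inequality in
    \<open>reifenberg_flat_domain\<close>; the bound 1 keeps \<delta> / 200 within the range of
    \<open>slab\<close>.\<close>
  proof (rule exI[of _ "min 1 (\<delta>\<^sub>0 / 2)"], intro conjI allI impI)
    show "0 < min 1 (\<delta>\<^sub>0 / 2)" using assms(2) by simp
    fix C_A \<epsilon>\<^sub>2 \<delta> :: real
    assume C: "0 < C_A" and "admissible_eps2 ?T C_A \<epsilon>\<^sub>2" and "0 < \<delta> \<and> \<delta> \<le> min 1 (\<delta>\<^sub>0 / 2)"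
    then have \<epsilon>2: "0 < \<epsilon>\<^sub>2" and \<delta>: "0 < \<delta>" "\<delta> \<le> 1" "\<delta> < \<delta>\<^sub>0"
      using assms(2) by (auto simp: admissible_eps2_def)
    define b where "b = drop_const ?T C_A"
    have b: "0 < b" unfolding b_def by (rule drop_const_pos[OF C])
    obtain J :: nat where "2 / b < real J" using reals_Archimedean2 by blast
    then have J: "2 < b * real J" using b by (simp add: pos_divide_less_eq mult.commute)
    then have "0 < J" by (cases J) auto
    define A where "A = osc_const ?T C_A (\<delta> / 200) J"
    have A: "0 < A" unfolding A_def using C \<delta> \<open>0 < J\<close> by (intro osc_const_pos) simp_all
    \<comment> \<open>The entry 1/2 keeps the mean normal away from 0,
      \<open>\<epsilon>\<^sub>2 / 2\<close> gives the strict inequality, \<delta> hands the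
      oscillation condition on to \<open>chord_arc_domain\<close>, and b / (8 A) holds the profile
      error to an eighth of the drop. All of them are fixed before the domain.\<close>
    define \<epsilon> where "\<epsilon> = min (min (1 / 2) (\<epsilon>\<^sub>2 / 2)) (min \<delta> (b / (8 * A)))"
    have \<epsilon>: "0 < \<epsilon>" "\<epsilon> < 1" "\<epsilon> \<le> \<delta>" "\<epsilon> < \<epsilon>\<^sub>2" "\<epsilon> \<le> b / (8 * A)"
      using A b \<epsilon>2 \<delta> by (auto simp: \<epsilon>_def)
    have small: "8 * (A * \<epsilon>) \<le> b"
      using \<epsilon>(5) A by (simp add: pos_le_divide_eq mult_ac)
    show "\<exists>\<epsilon>. 0 < \<epsilon> \<and> \<epsilon> < \<epsilon>\<^sub>2 \<and>
        (\<forall>\<Omega> :: (real ^ 'n) set.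
           open \<Omega> \<and> connected \<Omega> \<and>
           essential_boundary \<Omega> = frontier \<Omega> \<and>
           ahlfors_regular (CARD('n) - 1) C_A (frontier \<Omega>) \<and>
           (\<not> bounded \<Omega> \<longrightarrow> two_sided \<Omega>) \<and>
           (\<forall>K. compact K \<longrightarrow>
              (\<exists>R>0. (SUP x\<in>frontier \<Omega> \<inter> K.
                 star_norm (frontier \<Omega>) (outer_normal \<Omega>) x R) < ereal \<epsilon>))
           \<longrightarrow> chord_arc_domain \<delta>\<^sub>0 \<delta> \<Omega>)"
    proof (rule exI[of _ \<epsilon>], intro conjI allI impI \<epsilon>(1,4), elim conjE)
      fix \<Omega> :: "(real ^ 'n) set"
      assume \<Omega>: "open \<Omega>" "connected \<Omega>" "essential_boundary \<Omega> = frontier \<Omega>"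
        and reg: "ahlfors_regular (CARD('n) - 1) C_A (frontier \<Omega>)"
        and two: "\<not> bounded \<Omega> \<longrightarrow> two_sided \<Omega>"
        and osc: "\<forall>K. compact K \<longrightarrow> (\<exists>R>0. (SUP x\<in>frontier \<Omega> \<inter> K.
                 star_norm (frontier \<Omega>) (outer_normal \<Omega>) x R) < ereal \<epsilon>)"
      show "chord_arc_domain \<delta>\<^sub>0 \<delta> \<Omega>"
        by (rule chord_arc_of_small_oscillation[OF dim(1) \<Omega> reg[folded dim(2)] two \<delta> J[unfolded b_def]
              \<epsilon>(1-3) small[unfolded A_def b_def]]) (use osc in blast)
    qed
  qed
qed

end
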